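(* Let $k\le n$ be positive integers. For each $(\alpha,\mathbf i)\in A_{n,k}$, the set $\{\overline\pi_w(\mathbf x_{\alpha,\mathbf i}): w\in\mathfrak S_n,\ \mathrm{Des}(\alpha)\subseteq\mathrm{Des}(w)\subseteq\mathrm{Des}(\alpha\cup\mathbf i)\}$ descends to a basis of $N_{\alpha,\mathbf i}$, and $\overline\pi_w(\mathbf x_{\alpha,\mathbf i})\mapsto\overline\pi_w\pi_{w_0((\alpha\cup\mathbf i)^c)}$ defines an $H_n(0)$-module isomorphism $N_{\alpha,\mathbf i}\cong P_{\alpha,\alpha\cup\mathbf i}$. Moreover $$S_{n,k}=\bigoplus_{(\alpha,\mathbf i)\in A_{n,k}}N_{\alpha,\mathbf i}\cong\bigoplus_{\beta\models n}P_\beta^{\oplus\binom{n-\ell(\beta)}{k-\ell(\beta)}}\cong\mathbb F[\mathcal{OP}_{n,k}]$$ as $H_n(0)$-modules.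
   Context: $\mathbb F$ is any field; $H_n(0)$ is the 0-Hecke algebra (generators $\pi_1,\dots,\pi_{n-1}$, relations $\pi_i^2=\pi_i$, far commutation, braid relations), $\overline\pi_i=\pi_i-1$, and $\pi_w,\overline\pi_w$ are products along a reduced word of $w$. $H_n(0)$ acts on $\mathbb F[x_1,\dots,x_n]$ by $\pi_i(f)=\frac{x_if-x_{i+1}s_i(f)}{x_i-x_{i+1}}$; the ideal $J_{n,k}$ generated by $h_k(x_1),\dots,h_k(x_1,\dots,x_n)$ (complete homogeneous symmetric) and $e_n,\dots,e_{n-k+1}$ (elementary symmetric) is stable, so $S_{n,k}=\mathbb F[x_1,\dots,x_n]/J_{n,k}$ is a graded $H_n(0)$-module. Compositions: $\mathrm{Des}(\alpha)$ = proper partial sums, $\ell(\alpha)$ = number of parts, $\alpha\preceq\beta$ iff $\mathrm{Des}(\alpha)\subseteq\mathrm{Des}(\beta)$, $\alpha^c$ has complementary descent set in $[n-1]$, $w_0(\alpha)$ is the minimal-length permutation with descent set $\mathrm{Des}(\alpha)$; $\mathrm{Des}(\mathbf i)=\{j:i_j>i_{j+1}\}$; $\alpha\cup\mathbf i$ has descent set $\mathrm{Des}(\alpha)\cup\mathrm{Des}(\mathbf i)$. $P_{\alpha,\beta}=H_n(0)\overline\pi_{w_0(\alpha)}\pi_{w_0(\beta^c)}$ for $\alpha\preceq\beta$; $P_\beta=P_{\beta,\beta}$. $\mathbf x_{\alpha,\mathbf i}=\big(\prod_{j\in\mathrm{Des}(\alpha)}x_1\cdots x_j\big)x_1^{i_1}\cdots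 x_n^{i_n}$. $A_{n,k}$ is the set of pairs $(\alpha,\mathbf i)$ with $\alpha\models n$, $\alpha_1>n-k$, and $k-\ell(\alpha)\ge i_1\ge\cdots\ge i_{n-k}\ge0=i_{n-k+1}=\cdots=i_n$; $N_{\alpha,\mathbf i}$ is the $H_n(0)$-submodule of $S_{n,k}$ generated by the image of $\overline\pi_{w_0(\alpha)}(\mathbf x_{\alpha,\mathbf i})$. $\mathbb F[\mathcal{OP}_{n,k}]$ is the span of ordered set partitions of $[n]$ into $k$ blocks with $H_n(0)$-action: $\pi_i.\sigma=0$ if $i+1$ is in a block left of $i$, $\sigma+s_i(\sigma)$ if $i+1$ is in a block right of $i$, $\sigma$ if in the same block ($s_i$ swaps letters $i,i+1$). *)

theory Defs
  imports "HOL-Library.Poly_Mapping" "HOL-Combinatorics.Permutations" "HOL-Combinatorics.Transposition"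
begin

definition smul :: "'a::semiring_0 \<Rightarrow> ('x \<Rightarrow>\<^sub>0 'a) \<Rightarrow> ('x \<Rightarrow>\<^sub>0 'a)" where
  "smul c f = Poly_Mapping.map ((*) c) f"

definition span_pm :: "('x \<Rightarrow>\<^sub>0 'a::semiring_0) set \<Rightarrow> ('x \<Rightarrow>\<^sub>0 'a) set" where
  "span_pm S = {f. \<exists>T c. finite T \<and> T \<subseteq> S \<and> f = (\<Sum>v\<in>T. smul (c v) v)}"

definition set_add :: "'v::plus set \<Rightarrow> 'v set \<Rightarrow> 'v set" where
  "set_add A B = {a + b | a b. a \<in> A \<and> b \<in> B}"

text \<open>An isomorphism of H_n(0)-modules M1/Z1 and M2/Z2, where the modules are given as
  subquotients (M a subspace, Z a subspace of M, both stable under the operators T i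
  representing the generators pi_i, i = 1..n-1). phi is an F-linear map on M1 which
  induces a bijection M1/Z1 to M2/Z2 commuting with each generator.\<close>
definition hmod_iso ::
  "nat \<Rightarrow> (nat \<Rightarrow> ('x \<Rightarrow>\<^sub>0 'a::field) \<Rightarrow> ('x \<Rightarrow>\<^sub>0 'a)) \<Rightarrow> ('x \<Rightarrow>\<^sub>0 'a) set \<Rightarrow> ('x \<Rightarrow>\<^sub>0 'a) set
   \<Rightarrow> (nat \<Rightarrow> ('y \<Rightarrow>\<^sub>0 'a) \<Rightarrow> ('y \<Rightarrow>\<^sub>0 'a)) \<Rightarrow> ('y \<Rightarrow>\<^sub>0 'a) set \<Rightarrow> ('y \<Rightarrow>\<^sub>0 'a) set
   \<Rightarrow> (('x \<Rightarrow>\<^sub>0 'a) \<Rightarrow> ('y \<Rightarrow>\<^sub>0 'a)) \<Rightarrow> bool" where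
  "hmod_iso n T1 M1 Z1 T2 M2 Z2 \<phi> \<longleftrightarrow>
     (\<forall>x\<in>M1. \<forall>y\<in>M1. \<phi> (x + y) = \<phi> x + \<phi> y) \<and>
     (\<forall>c. \<forall>x\<in>M1. \<phi> (smul c x) = smul c (\<phi> x)) \<and>
     \<phi> ` M1 \<subseteq> M2 \<and>
     (\<forall>x\<in>M1. \<phi> x \<in> Z2 \<longleftrightarrow> x \<in> Z1) \<and>
     (\<forall>y\<in>M2. \<exists>x\<in>M1. \<phi> x - y \<in> Z2) \<and>
     (\<forall>i\<in>{1..<n}. \<forall>x\<in>M1. \<phi> (T1 i x) - T2 i (\<phi> x) \<in> Z2)"

definition is_word :: "nat \<Rightarrow> nat list \<Rightarrow> bool" where
  "is_word n ws \<longleftrightarrow> set ws \<subseteq> {1..<n}"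

definition word_perm :: "nat list \<Rightarrow> nat \<Rightarrow> nat" where
  "word_perm ws = foldr (\<lambda>i f. transpose i (Suc i) \<circ> f) ws id"

definition rw :: "nat \<Rightarrow> (nat \<Rightarrow> nat) \<Rightarrow> nat list" where
  "rw n w = (SOME ws. is_word n ws \<and> word_perm ws = w \<and>
              (\<forall>ws'. is_word n ws' \<and> word_perm ws' = w \<longrightarrow> length ws \<le> length ws'))"

definition plen :: "nat \<Rightarrow> (nat \<Rightarrow> nat) \<Rightarrow> nat" where
  "plen n w = length (rw n w)"

definition pDes :: "nat \<Rightarrow> (nat \<Rightarrow> nat) \<Rightarrow> nat set" where
  "pDes n w = {i \<in> {1..<n}. w i > w (Suc i)}"

definition w0set :: "nat \<Rightarrow> nat set \<Rightarrow> nat \<Rightarrow> nat" where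
  "w0set n D = (THE w. w permutes {1..n} \<and> pDes n w = D \<and>
       (\<forall>u. u permutes {1..n} \<and> pDes n u = D \<longrightarrow> plen n w \<le> plen n u))"

definition is_comp :: "nat \<Rightarrow> nat list \<Rightarrow> bool" where
  "is_comp n \<alpha> \<longleftrightarrow> (\<forall>a\<in>set \<alpha>. 0 < a) \<and> sum_list \<alpha> = n"

definition compDes :: "nat list \<Rightarrow> nat set" where
  "compDes \<alpha> = {sum_list (take j \<alpha>) | j. 0 < j \<and> j < length \<alpha>}"

text \<open>Sequences i = (i_1,...,i_n) are lists of length n; i_j = is ! (j-1).\<close>
definition seqDes :: "nat \<Rightarrow> nat list \<Rightarrow> nat set" where
  "seqDes n is = {j \<in> {1..<n}. is ! (j - 1) > is ! j}"

type_synonym 'a mpoly = "(nat \<Rightarrow>\<^sub>0 nat) \<Rightarrow>\<^sub>0 'a"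

definition Var :: "nat \<Rightarrow> 'a::comm_ring_1 mpoly" where
  "Var j = Poly_Mapping.single (Poly_Mapping.single j 1) 1"

definition const_poly :: "'a::comm_ring_1 \<Rightarrow> 'a mpoly" where
  "const_poly c = Poly_Mapping.single 0 c"

definition polys :: "nat \<Rightarrow> 'a::comm_ring_1 mpoly set" where
  "polys n = {f. \<forall>m\<in>Poly_Mapping.keys f. Poly_Mapping.keys m \<subseteq> {1..n}}"

definition swap_var :: "nat \<Rightarrow> 'a::comm_ring_1 mpoly \<Rightarrow> 'a mpoly" where
  "swap_var i f = (\<Sum>m\<in>Poly_Mapping.keys f. const_poly (Poly_Mapping.lookup f m) *
       (\<Prod>j\<in>Poly_Mapping.keys m. Var (transpose i (Suc i) j) ^ Poly_Mapping.lookup m j))"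

text \<open>pi_i(f) = (x_i f - x_{i+1} s_i(f)) / (x_i - x_{i+1}) (exact division).\<close>
definition pi_poly :: "nat \<Rightarrow> 'a::field mpoly \<Rightarrow> 'a mpoly" where
  "pi_poly i f = (THE g. (Var i - Var (Suc i)) * g = Var i * f - Var (Suc i) * swap_var i f)"

definition pibar_poly :: "nat \<Rightarrow> 'a::field mpoly \<Rightarrow> 'a mpoly" where
  "pibar_poly i f = pi_poly i f - f"

definition word_act_poly :: "nat list \<Rightarrow> 'a::field mpoly \<Rightarrow> 'a mpoly" where
  "word_act_poly ws f = foldr pi_poly ws f"

definition pibar_w_poly :: "nat \<Rightarrow> (nat \<Rightarrow> nat) \<Rightarrow> 'a::field mpoly \<Rightarrow> 'a mpoly" where
  "pibar_w_poly n w f = foldr pibar_poly (rw n w) f"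

definition tdeg :: "(nat \<Rightarrow>\<^sub>0 nat) \<Rightarrow> nat" where
  "tdeg m = sum (Poly_Mapping.lookup m) (Poly_Mapping.keys m)"

definition h_poly :: "nat \<Rightarrow> nat \<Rightarrow> 'a::comm_ring_1 mpoly" where
  "h_poly k j = (\<Sum>m\<in>{m. Poly_Mapping.keys m \<subseteq> {1..j} \<and> tdeg m = k}. Poly_Mapping.single m 1)"

definition e_poly :: "nat \<Rightarrow> nat \<Rightarrow> 'a::comm_ring_1 mpoly" where
  "e_poly n j = (\<Sum>S\<in>{S. S \<subseteq> {1..n} \<and> card S = j}. \<Prod>s\<in>S. Var s)"

definition Jgens :: "nat \<Rightarrow> nat \<Rightarrow> 'a::comm_ring_1 mpoly set" where
  "Jgens n k = {h_poly k j | j. j \<in> {1..n}} \<union> {e_poly n j | j. j \<in> {Suc (n - k)..n}}"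

definition J :: "nat \<Rightarrow> nat \<Rightarrow> 'a::comm_ring_1 mpoly set" where
  "J n k = {f. \<exists>c. (\<forall>g\<in>Jgens n k. c g \<in> polys n) \<and> f = (\<Sum>g\<in>Jgens n k. c g * g)}"

definition x_ai :: "nat \<Rightarrow> nat list \<Rightarrow> nat list \<Rightarrow> 'a::comm_ring_1 mpoly" where
  "x_ai n \<alpha> is = (\<Prod>j\<in>compDes \<alpha>. \<Prod>t\<in>{1..j}. Var t) * (\<Prod>j\<in>{1..n}. Var j ^ (is ! (j - 1)))"

definition A :: "nat \<Rightarrow> nat \<Rightarrow> (nat list \<times> nat list) set" where
  "A n k = {(\<alpha>, is). is_comp n \<alpha> \<and> hd \<alpha> > n - k \<and> length is = n \<and> length \<alpha> \<le> k \<and>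
      (\<forall>j\<in>{1..n-k}. is ! (j - 1) \<le> k - length \<alpha>) \<and>
      (\<forall>j\<in>{1..<n-k}. is ! j \<le> is ! (j - 1)) \<and>
      (\<forall>j\<in>{n-k<..n}. is ! (j - 1) = 0)}"

text \<open>Preimage in F[x] of the submodule N_{alpha,i} of S_{n,k} = F[x]/J_{n,k}.\<close>
definition Nset :: "nat \<Rightarrow> nat \<Rightarrow> nat list \<Rightarrow> nat list \<Rightarrow> 'a::field mpoly set" where
  "Nset n k \<alpha> is = set_add
     (span_pm {word_act_poly ws (pibar_w_poly n (w0set n (compDes \<alpha>)) (x_ai n \<alpha> is)) | ws. is_word n ws})
     (J n k)"

section \<open>The 0-Hecke algebra H_n(0) as a quotient of the free algebra\<close>

type_synonym 'a fa = "nat list \<Rightarrow>\<^sub>0 'a"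

definition fa_mult :: "'a::comm_ring_1 fa \<Rightarrow> 'a fa \<Rightarrow> 'a fa" where
  "fa_mult a b = (\<Sum>u\<in>Poly_Mapping.keys a. \<Sum>v\<in>Poly_Mapping.keys b. Poly_Mapping.single (u @ v) (Poly_Mapping.lookup a u * Poly_Mapping.lookup b v))"

definition fa_word :: "nat list \<Rightarrow> 'a::comm_ring_1 fa" where
  "fa_word u = Poly_Mapping.single u 1"

definition fa_gen :: "nat \<Rightarrow> 'a::comm_ring_1 fa" where
  "fa_gen i = fa_word [i]"

definition fa_pi_w :: "nat \<Rightarrow> (nat \<Rightarrow> nat) \<Rightarrow> 'a::comm_ring_1 fa" where
  "fa_pi_w n w = foldr (\<lambda>i x. fa_mult (fa_gen i) x) (rw n w) (fa_word [])"

definition fa_pibar_w :: "nat \<Rightarrow> (nat \<Rightarrow> nat) \<Rightarrow> 'a::comm_ring_1 fa" where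
  "fa_pibar_w n w = foldr (\<lambda>i x. fa_mult (fa_gen i - fa_word []) x) (rw n w) (fa_word [])"

definition rels :: "nat \<Rightarrow> 'a::comm_ring_1 fa set" where
  "rels n = {fa_word [i, i] - fa_word [i] | i. i \<in> {1..<n}}
          \<union> {fa_word [i, j] - fa_word [j, i] | i j. i \<in> {1..<n} \<and> j \<in> {1..<n} \<and> (Suc i < j \<or> Suc j < i)}
          \<union> {fa_word [i, Suc i, i] - fa_word [Suc i, i, Suc i] | i. i \<in> {1..<n} \<and> Suc i < n}"

text \<open>Two-sided ideal of relations; H_n(0) = span of words over {1..n-1} modulo Irel.\<close>
definition Irel :: "nat \<Rightarrow> 'a::comm_ring_1 fa set" where
  "Irel n = span_pm {fa_mult (fa_mult (fa_word u) r) (fa_word v) | u v r.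
                      is_word n u \<and> is_word n v \<and> r \<in> rels n}"

definition fa_act :: "nat \<Rightarrow> 'a::comm_ring_1 fa \<Rightarrow> 'a fa" where
  "fa_act i x = fa_mult (fa_gen i) x"

text \<open>Preimage of P_{alpha,beta} = H_n(0) pibar_{w0(alpha)} pi_{w0(beta^c)}, with alpha, beta
  given through their descent sets D1 = Des(alpha), D2 = Des(beta).\<close>
definition Pset :: "nat \<Rightarrow> nat set \<Rightarrow> nat set \<Rightarrow> 'a::comm_ring_1 fa set" where
  "Pset n D1 D2 = set_add
     (span_pm {fa_mult (fa_word u) (fa_mult (fa_pibar_w n (w0set n D1)) (fa_pi_w n (w0set n ({1..<n} - D2))))
               | u. is_word n u})
     (Irel n)"

definition mult :: "nat \<Rightarrow> nat \<Rightarrow> nat list \<Rightarrow> nat" where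
  "mult n k \<beta> = (if length \<beta> \<le> k then (n - length \<beta>) choose (k - length \<beta>) else 0)"

definition embed :: "'c \<Rightarrow> 'a::comm_ring_1 fa \<Rightarrow> ('c \<times> nat list) \<Rightarrow>\<^sub>0 'a" where
  "embed c x = (\<Sum>u\<in>Poly_Mapping.keys x. Poly_Mapping.single (c, u) (Poly_Mapping.lookup x u))"

definition ds_act :: "nat \<Rightarrow> (('c \<times> nat list) \<Rightarrow>\<^sub>0 'a::comm_ring_1) \<Rightarrow> ('c \<times> nat list) \<Rightarrow>\<^sub>0 'a" where
  "ds_act i f = (\<Sum>cu\<in>Poly_Mapping.keys f. Poly_Mapping.single (fst cu, i # snd cu) (Poly_Mapping.lookup f cu))"

definition DSset :: "nat \<Rightarrow> nat \<Rightarrow> (((nat list \<times> nat) \<times> nat list) \<Rightarrow>\<^sub>0 'a::comm_ring_1) set" where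
  "DSset n k = span_pm {embed (\<beta>, j) y | \<beta> j y. is_comp n \<beta> \<and> j < mult n k \<beta> \<and>
                           y \<in> Pset n (compDes \<beta>) (compDes \<beta>)}"

definition DSzero :: "nat \<Rightarrow> nat \<Rightarrow> (((nat list \<times> nat) \<times> nat list) \<Rightarrow>\<^sub>0 'a::comm_ring_1) set" where
  "DSzero n k = span_pm {embed (\<beta>, j) y | \<beta> j y. is_comp n \<beta> \<and> j < mult n k \<beta> \<and> y \<in> Irel n}"

definition is_osp :: "nat \<Rightarrow> nat \<Rightarrow> nat set list \<Rightarrow> bool" where
  "is_osp n k \<sigma> \<longleftrightarrow> length \<sigma> = k \<and> (\<forall>B\<in>set \<sigma>. B \<noteq> {}) \<and> \<Union>(set \<sigma>) = {1..n} \<and>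
      (\<forall>a<k. \<forall>b<k. a \<noteq> b \<longrightarrow> \<sigma> ! a \<inter> \<sigma> ! b = {})"

definition blk :: "nat set list \<Rightarrow> nat \<Rightarrow> nat" where
  "blk \<sigma> x = (THE a. a < length \<sigma> \<and> x \<in> \<sigma> ! a)"

definition osp_gen :: "nat \<Rightarrow> nat set list \<Rightarrow> nat set list \<Rightarrow>\<^sub>0 'a::comm_ring_1" where
  "osp_gen i \<sigma> = (if blk \<sigma> (Suc i) < blk \<sigma> i then 0
                  else if blk \<sigma> i < blk \<sigma> (Suc i)
                  then Poly_Mapping.single \<sigma> 1 + Poly_Mapping.single (map ((`) (transpose i (Suc i))) \<sigma>) 1
                  else Poly_Mapping.single \<sigma> 1)"

definition osp_act :: "nat \<Rightarrow> (nat set list \<Rightarrow>\<^sub>0 'a::comm_ring_1) \<Rightarrow> nat set list \<Rightarrow>\<^sub>0 'a" where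
  "osp_act i f = (\<Sum>\<sigma>\<in>Poly_Mapping.keys f. smul (Poly_Mapping.lookup f \<sigma>) (osp_gen i \<sigma>))"

definition OPset :: "nat \<Rightarrow> nat \<Rightarrow> (nat set list \<Rightarrow>\<^sub>0 'a::comm_ring_1) set" where
  "OPset n k = {f. Poly_Mapping.keys f \<subseteq> {\<sigma>. is_osp n k \<sigma>}}"

end

theory Submission
  imports Defs "HOL-Computational_Algebra.Fraction_Field" "HOL-Computational_Algebra.Formal_Power_Series"
    "HOL-Computational_Algebra.Polynomial_FPS"
begin

text \<open>Spanning: every monomial modulo \<open>J\<close> is straightened to combinations of
  \<open>pibar_w(x^\<lambda>)\<close> with \<open>\<lambda>\<close> a partition, and elementary and complete symmetric polynomials
  discard all \<open>\<lambda>\<close> except the exponents of the \<open>x_ai\<close>; the induction is on the sum of squares of the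
  exponents and on the length of \<open>w\<close>. The number of pairs \<open>((\<alpha>, i), w)\<close> that remain is at most the
  number of ordered set partitions.

  Independence: label each ordered set partition by a point (after adjoining an indeterminate to the
  field) so that every generator of \<open>J\<close> is the leading form of a polynomial vanishing at all these
  points. A homogeneous relation modulo \<open>J\<close> would make fewer polynomials than there are points span
  all functions on the points.

  Module structure: replacing \<open>pibar_w\<close> by \<open>pibar_w pi_v\<close>, where \<open>v\<close> is the longest element of the
  parabolic subgroup of the ascents of \<open>w\<close>, is unitriangular for the length of \<open>w\<close>, and the elements
  obtained this way are images of bases of projective indecomposable modules. The same change of
  basis applies to the span of the ordered set partitions, and both sides are compared with the same
  direct sum.\<close>

section \<open>Linear algebra on finitely supported functions\<close>

text \<open>The dimension of the quotient is found by a squeeze. A spanning family is indexed by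
  pairs of a permutation w and a pair (\<alpha>, i) whose interval of descent sets contains Des(w).
  For a fixed w these (\<alpha>, i) are equinumerous with the (k-1)-subsets of {1..n-1} containing
  Des(w); the number of such subsets is the binomial coefficient of the theorem. On the other side
  such a subset is a set of cut positions, and a permutation with such a set of cuts encodes an
  ordered set partition injectively, so the spanning family is no larger than the point set.
  Evaluation of algebra elements at a monomial, or at a sorted ordered set partition, is a map out
  of the left ideals \<open>Pset\<close>. Every isomorphism is built from it: the left ideals are
  shown to be spanned by the expected products, and independence of these products is inherited from
  their images. The inverse map reads off coefficients. The sum of projective indecomposables is
  matched with the whole quotient at once and not with one summand N after another: a permutation w
  always contributes to the composition with descent set Des(w), so the multiplicities are counted
  by fixing w.\<close>

abbreviation lookup :: "('x \<Rightarrow>\<^sub>0 'b::zero) \<Rightarrow> 'x \<Rightarrow> 'b" where "lookup \<equiv> Poly_Mapping.lookup"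
abbreviation keys :: "('x \<Rightarrow>\<^sub>0 'b::zero) \<Rightarrow> 'x set" where "keys \<equiv> Poly_Mapping.keys"

lemma lookup_smul [simp]: "lookup (smul c f) x = c * lookup f x"
  by (simp add: smul_def Poly_Mapping.map.rep_eq when_def)

interpretation pm: vector_space "smul :: 'a::field \<Rightarrow> ('x \<Rightarrow>\<^sub>0 'a) \<Rightarrow> ('x \<Rightarrow>\<^sub>0 'a)"
  by unfold_locales (auto intro!: poly_mapping_eqI simp: lookup_add algebra_simps)

lemma span_pm_eq: "span_pm (S :: ('x \<Rightarrow>\<^sub>0 'a::field) set) = pm.span S"
  unfolding span_pm_def pm.span_explicit by blast

lemma keys_smul_subset: "keys (smul c f) \<subseteq> keys f"
  by (auto simp: in_keys_iff)

lemma smul_single [simp]: "smul c (Poly_Mapping.single x d) = Poly_Mapping.single x (c * d)"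
  by (intro poly_mapping_eqI) (auto simp: lookup_single when_def)

lemma smul_zero [simp]: "smul c 0 = 0"
  by (intro poly_mapping_eqI) simp

lemma smul_neg_1: "smul (- 1 :: 'a::ring_1) f = - f"
  by (intro poly_mapping_eqI) simp

lemma smul_add: "smul c (f + g) = smul c f + smul c g"
  by (intro poly_mapping_eqI) (simp add: lookup_add distrib_left)

lemma smul_diff: "smul (c::'a::ring) (f - g) = smul c f - smul c g"
  by (intro poly_mapping_eqI) (simp add: lookup_minus algebra_simps)

lemma smul_sum: "smul c (sum f S) = (\<Sum>x\<in>S. smul c (f x))"
  by (induction S rule: infinite_finite_induct) (auto simp: smul_add)

lemma smul_mult_left: "smul c (f * g) = smul c f * (g :: ('x::monoid_add) \<Rightarrow>\<^sub>0 'a::comm_semiring_0)"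
  unfolding smul_def mult_map_scale_conv_mult by (simp add: mult.assoc)

lemma sum_single_keys:
  assumes "finite S" "keys f \<subseteq> S"
  shows "(\<Sum>x\<in>S. Poly_Mapping.single x (lookup f x)) = f"
  by (rule poly_mapping_eqI)
     (use assms in \<open>auto simp: lookup_sum lookup_single when_def in_keys_iff\<close>)

definition lin :: "(('x \<Rightarrow>\<^sub>0 'a::field) \<Rightarrow> ('y \<Rightarrow>\<^sub>0 'a)) \<Rightarrow> bool" where
  "lin f \<longleftrightarrow> (\<forall>x y. f (x + y) = f x + f y) \<and> (\<forall>c x. f (smul c x) = smul c (f x))"

lemma linI: "(\<And>x y. f (x + y) = f x + f y) \<Longrightarrow> (\<And>c x. f (smul c x) = smul c (f x)) \<Longrightarrow> lin f"
  by (simp add: lin_def)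

lemma lin_add: "lin f \<Longrightarrow> f (x + y) = f x + f y"
  and lin_smul: "lin f \<Longrightarrow> f (smul c x) = smul c (f x)"
  by (simp_all add: lin_def)

lemma lin_zero: "lin f \<Longrightarrow> f 0 = 0"
  using lin_smul[of f 0 0] by simp

lemma lin_neg: "lin f \<Longrightarrow> f (- x) = - f x"
  using lin_smul[of f "-1" x] by (simp add: smul_neg_1)

lemma lin_diff: "lin f \<Longrightarrow> f (x - y) = f x - f y"
  using lin_add[of f x "- y"] by (simp add: lin_neg)

lemma lin_sum: "lin f \<Longrightarrow> f (sum g S) = (\<Sum>x\<in>S. f (g x))"
  by (induction S rule: infinite_finite_induct) (auto simp: lin_zero lin_add)

lemma lin_comp: "lin f \<Longrightarrow> lin g \<Longrightarrow> lin (\<lambda>x. f (g x))"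
  by (simp add: lin_def)

lemma lin_minus: "lin f \<Longrightarrow> lin g \<Longrightarrow> lin (\<lambda>x. f x - g x)"
  by (auto simp: lin_def smul_diff algebra_simps)

lemma lin_ident: "lin (\<lambda>x. x)"
  by (simp add: lin_def)

lemma lin_foldr: "(\<And>i. lin (T i)) \<Longrightarrow> lin (\<lambda>x. foldr T ws x)"
  by (induction ws) (auto simp: lin_ident[unfolded id_def[symmetric]] lin_def)

lemma lin_eqI:
  assumes "lin f" "lin g" "\<And>x. f (Poly_Mapping.single x 1) = g (Poly_Mapping.single x 1)"
  shows "f y = g y"
proof -
  have y: "y = (\<Sum>x\<in>keys y. smul (lookup y x) (Poly_Mapping.single x 1))"
    by (simp add: sum_single_keys)
  show ?thesis
    by (subst (1 2) y) (simp only: lin_sum[OF assms(1)] lin_sum[OF assms(2)]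
          lin_smul[OF assms(1)] lin_smul[OF assms(2)] assms(3))
qed

lemma lin_subspace_vimage: "lin f \<Longrightarrow> pm.subspace S \<Longrightarrow> pm.subspace {x. f x \<in> S}"
  by (auto simp: pm.subspace_def lin_zero lin_add lin_smul)

lemma lin_span_image: "lin f \<Longrightarrow> (\<And>x. x \<in> S \<Longrightarrow> f x \<in> U) \<Longrightarrow> pm.subspace U \<Longrightarrow> x \<in> pm.span S \<Longrightarrow> f x \<in> U"
  using pm.span_minimal[of S "{x. f x \<in> U}"] lin_subspace_vimage[of f U] by blast

text \<open>Linear extension of a map given on the standard basis. The product of the free algebra,
  the action of words, the truncation to one degree and the evaluation of a direct sum are
  instances, so their linearity is proved once.\<close>

definition lext :: "('x \<Rightarrow> ('y \<Rightarrow>\<^sub>0 'a)) \<Rightarrow> ('x \<Rightarrow>\<^sub>0 'a::field) \<Rightarrow> ('y \<Rightarrow>\<^sub>0 'a)" where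
  "lext g f = (\<Sum>x\<in>keys f. smul (lookup f x) (g x))"

lemma lext_superset:
  assumes "finite S" "keys f \<subseteq> S"
  shows "lext g f = (\<Sum>x\<in>S. smul (lookup f x) (g x))"
  unfolding lext_def by (rule sum.mono_neutral_left) (use assms in \<open>auto simp: in_keys_iff\<close>)

lemma lext_lin: "lin (lext g)"
proof (rule linI)
  fix x y :: "'a \<Rightarrow>\<^sub>0 'b"
  let ?S = "keys x \<union> keys y"
  have "keys (x + y) \<subseteq> ?S" by (rule Poly_Mapping.keys_add)
  then show "lext g (x + y) = lext g x + lext g y"
    by (simp add: lext_superset[of ?S] lookup_add pm.scale_left_distrib sum.distrib)
next
  fix c and x :: "'a \<Rightarrow>\<^sub>0 'b"
  show "lext g (smul c x) = smul c (lext g x)"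
    by (simp add: lext_superset[of "keys x"] keys_smul_subset smul_sum)
qed

lemma lext_single [simp]: "lext g (Poly_Mapping.single x c) = smul c (g x)"
  by (subst lext_superset[of "{x}"]) auto

lemma lin_lext_comp:
  assumes "lin h"
  shows "h (lext g f) = lext (\<lambda>x. h (g x)) f"
  unfolding lext_def by (simp add: lin_sum[OF assms] lin_smul[OF assms])

lemma lext_in_subspace:
  assumes "pm.subspace U" "\<And>x. x \<in> keys f \<Longrightarrow> g x \<in> U"
  shows "lext g f \<in> U"
  unfolding lext_def by (intro pm.subspace_sum pm.subspace_scale assms)

text \<open>Coefficients are attached to indices and not to vectors, because at this point a family
  may still repeat values; that a family is injective only comes out of the later independence
  results.\<close>

lemma span_image_family:
  assumes "finite B" "x \<in> pm.span (f ` B)"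
  obtains c where "x = (\<Sum>p\<in>B. smul (c p) (f p))"
proof -
  have "pm.span (f ` B) \<subseteq> {y. \<exists>c. y = (\<Sum>p\<in>B. smul (c p) (f p))}"
  proof (rule pm.span_minimal)
    show "f ` B \<subseteq> {y. \<exists>c. y = (\<Sum>p\<in>B. smul (c p) (f p))}"
    proof safe
      fix q assume "q \<in> B"
      then have "f q = (\<Sum>p\<in>B. smul (if p = q then 1 else 0) (f p))"
        using assms(1) by (simp add: if_distrib[of "\<lambda>c. smul c _"] cong: if_cong)
      then show "\<exists>c. f q = (\<Sum>p\<in>B. smul (c p) (f p))" by (intro exI[of _ "\<lambda>p. if p = q then 1 else 0"])
    qed
    show "pm.subspace {y. \<exists>c. y = (\<Sum>p\<in>B. smul (c p) (f p))}"
      unfolding pm.subspace_def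
    proof safe
      show "\<exists>c. 0 = (\<Sum>p\<in>B. smul (c p) (f p))" by (rule exI[of _ "\<lambda>_. 0"]) simp
    next
      fix c d
      show "\<exists>ca. (\<Sum>p\<in>B. smul (c p) (f p)) + (\<Sum>p\<in>B. smul (d p) (f p)) = (\<Sum>p\<in>B. smul (ca p) (f p))"
        by (rule exI[of _ "\<lambda>p. c p + d p"]) (simp add: pm.scale_left_distrib sum.distrib)
    next
      fix a c
      show "\<exists>ca. smul a (\<Sum>p\<in>B. smul (c p) (f p)) = (\<Sum>p\<in>B. smul (ca p) (f p))"
        by (rule exI[of _ "\<lambda>p. a * c p"]) (simp add: smul_sum)
    qed
  qed
  with assms(2) that show ?thesis by blast
qed

lemma set_add_eq: "x \<in> set_add S T \<longleftrightarrow> (\<exists>a\<in>S. \<exists>b\<in>T. x = a + b)"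
  by (auto simp: set_add_def)

lemma subspace_set_add:
  "pm.subspace S \<Longrightarrow> pm.subspace T \<Longrightarrow> pm.subspace (set_add S T)"
  unfolding set_add_def by (rule pm.subspace_sums)

lemma set_add_left: "pm.subspace T \<Longrightarrow> x \<in> S \<Longrightarrow> x \<in> set_add S T"
  unfolding set_add_eq using pm.subspace_0 by force

lemma set_add_right: "pm.subspace S \<Longrightarrow> x \<in> T \<Longrightarrow> x \<in> set_add S T"
  unfolding set_add_eq using pm.subspace_0 by force

lemma set_add_minimal:
  "pm.subspace U \<Longrightarrow> S \<subseteq> U \<Longrightarrow> T \<subseteq> U \<Longrightarrow> set_add S T \<subseteq> U"
  by (auto simp: set_add_eq intro!: pm.subspace_add)

text \<open>A nonzero coefficient would express one member through the others. Fewer than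
  \<open>card X\<close> vectors would then span \<open>card X\<close> independent unit vectors,
  against the exchange bound.\<close>

lemma spanning_family_independent:
  fixes v :: "'i \<Rightarrow> ('x \<Rightarrow>\<^sub>0 'k::field)"
  assumes fin: "finite I" "finite X" and card: "card I \<le> card X"
    and sp: "\<And>x. x \<in> X \<Longrightarrow> Poly_Mapping.single x 1 \<in> pm.span (v ` I)"
    and z: "(\<Sum>p\<in>I. smul (c p) (v p)) = 0" and q: "q \<in> I"
  shows "c q = 0"
proof (rule ccontr)
  assume nz: "c q \<noteq> 0"
  let ?e = "\<lambda>x. Poly_Mapping.single x (1::'k)"
  have ind: "pm.independent (?e ` X)"
    unfolding pm.independent_explicit_module
  proof safe
    fix t :: "('x \<Rightarrow>\<^sub>0 'k) set" and u w
    assume t: "finite t" "t \<subseteq> ?e ` X" "(\<Sum>v\<in>t. smul (u v) v) = 0" "w \<in> t"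
    obtain x where x: "w = ?e x" using t by blast
    have "lookup (\<Sum>v\<in>t. smul (u v) v) x = (\<Sum>v\<in>t. if v = w then u w else 0)"
      unfolding lookup_sum
    proof (rule sum.cong)
      fix v assume "v \<in> t"
      then obtain y where "v = ?e y" using t by blast
      moreover have "y = x" if "?e y = ?e x" using that by (metis keys_single singleton_inject zero_neq_one)
      ultimately show "lookup (smul (u v) v) x = (if v = w then u w else 0)"
        using x by (auto simp: lookup_single when_def)
    qed simp
    then show "u w = 0" using t by simp
  qed
  have vq: "v q \<in> pm.span (v ` (I - {q}))"
  proof -
    have "smul (c q) (v q) = - (\<Sum>p\<in>I-{q}. smul (c p) (v p))"
      using z fin q by (simp add: sum.remove[of I q] eq_neg_iff_add_eq_0)
    moreover have "(\<Sum>p\<in>I-{q}. smul (c p) (v p)) \<in> pm.span (v ` (I - {q}))"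
      by (intro pm.span_sum pm.span_scale pm.span_base imageI)
    ultimately have "smul (c q) (v q) \<in> pm.span (v ` (I - {q}))"
      by (simp only: pm.span_neg)
    then have "smul (inverse (c q)) (smul (c q) (v q)) \<in> pm.span (v ` (I - {q}))"
      by (rule pm.span_scale)
    then show ?thesis using nz by simp
  qed
  have "v ` I \<subseteq> pm.span (v ` (I - {q}))"
    using vq by (auto intro: pm.span_base)
  then have "pm.span (v ` I) \<subseteq> pm.span (v ` (I - {q}))"
    by (intro pm.span_minimal) auto
  then have "?e ` X \<subseteq> pm.span (v ` (I - {q}))" using sp by auto
  from pm.independent_span_bound[OF _ ind this] fin
  have "card (?e ` X) \<le> card (v ` (I - {q}))" by simp
  also have "\<dots> \<le> card (I - {q})" using fin by (intro card_image_le) simp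
  also have "\<dots> < card I" using fin q by (meson card_Diff1_less)
  finally have "card (?e ` X) < card X" using card by simp
  moreover have "inj ?e"
    by (rule injI) (metis keys_single singleton_inject zero_neq_one)
  ultimately show False by (metis card_image inj_on_subset less_irrefl subset_UNIV)
qed

text \<open>In the applications \<open>E\<close> evaluates algebra elements at generators of the
  module \<open>M1\<close>. Of \<open>b2\<close> only spanning modulo \<open>Z2\<close> is asked;
  its independence is inherited from that of its image \<open>b1\<close> modulo \<open>Z1\<close>,
  and this makes \<open>E\<close> invertible on the quotients.\<close>

lemma hmod_iso_from_basis:
  fixes E :: "('y \<Rightarrow>\<^sub>0 'a::field) \<Rightarrow> ('x \<Rightarrow>\<^sub>0 'a)"
  assumes B: "finite B"
    and sub: "pm.subspace M1" "pm.subspace Z1" "pm.subspace M2" "pm.subspace Z2" "Z1 \<subseteq> M1"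
    and E: "lin E" "E ` M2 \<subseteq> M1" "E ` Z2 \<subseteq> Z1"
    and T1: "\<And>i. lin (T1 i)" "\<And>i x. i \<in> {1..<n} \<Longrightarrow> x \<in> Z1 \<Longrightarrow> T1 i x \<in> Z1"
      "\<And>i x. i \<in> {1..<n} \<Longrightarrow> x \<in> M1 \<Longrightarrow> T1 i x \<in> M1"
    and T2: "\<And>i. lin (T2 i)" "\<And>i y. i \<in> {1..<n} \<Longrightarrow> y \<in> Z2 \<Longrightarrow> T2 i y \<in> Z2"
      "\<And>i y. i \<in> {1..<n} \<Longrightarrow> y \<in> M2 \<Longrightarrow> T2 i y \<in> M2"
    and com: "\<And>i y. i \<in> {1..<n} \<Longrightarrow> y \<in> M2 \<Longrightarrow> E (T2 i y) - T1 i (E y) \<in> Z1"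
    and b2: "\<And>p. p \<in> B \<Longrightarrow> b2 p \<in> M2" "\<And>y. y \<in> M2 \<Longrightarrow> \<exists>c. y - (\<Sum>p\<in>B. smul (c p) (b2 p)) \<in> Z2"
    and b1: "\<And>p. p \<in> B \<Longrightarrow> E (b2 p) = b1 p" "\<And>x. x \<in> M1 \<Longrightarrow> \<exists>c. x - (\<Sum>p\<in>B. smul (c p) (b1 p)) \<in> Z1"
      "\<And>c p. (\<Sum>p\<in>B. smul (c p) (b1 p)) \<in> Z1 \<Longrightarrow> p \<in> B \<Longrightarrow> c p = 0"
  shows "hmod_iso n T2 M2 Z2 T1 M1 Z1 E"
    and "\<exists>\<phi>. hmod_iso n T1 M1 Z1 T2 M2 Z2 \<phi> \<and> (\<forall>p\<in>B. \<phi> (b1 p) - b2 p \<in> Z2)"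
proof -
  define S1 where "S1 c = (\<Sum>p\<in>B. smul (c p) (b1 p))" for c
  define S2 where "S2 c = (\<Sum>p\<in>B. smul (c p) (b2 p))" for c
  have ES: "E (S2 c) = S1 c" for c
    unfolding S1_def S2_def by (simp add: lin_sum[OF E(1)] lin_smul[OF E(1)] b1(1))
  have S2M: "S2 c \<in> M2" for c
    unfolding S2_def by (intro pm.subspace_sum pm.subspace_scale sub b2)
  \<comment> \<open>Injectivity of \<open>E\<close> on the quotients: once \<open>E y\<close>
    vanishes modulo \<open>Z1\<close>, independence of \<open>b1\<close> kills all coefficients of
    \<open>y\<close>.\<close>
  have Zsub: "y \<in> Z2" if y: "y \<in> M2" "E y \<in> Z1" for y
  proof -
    obtain c where c: "y - S2 c \<in> Z2" using b2(2)[OF y(1)] unfolding S2_def by blast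
    have "E (y - S2 c) \<in> Z1" using c E by blast
    then have "E y - S1 c \<in> Z1" by (simp add: lin_diff[OF E(1)] ES)
    then have "S1 c \<in> Z1" using pm.subspace_diff[OF sub(2) y(2)] by fastforce
    then have "\<And>p. p \<in> B \<Longrightarrow> c p = 0" using b1(3) unfolding S1_def by blast
    then have "S2 c = 0" unfolding S2_def by simp
    with c show ?thesis by simp
  qed
  show "hmod_iso n T2 M2 Z2 T1 M1 Z1 E"
    unfolding hmod_iso_def
  proof (intro conjI ballI allI)
    show "E ` M2 \<subseteq> M1" by fact
    show "(E x \<in> Z1) = (x \<in> Z2)" if "x \<in> M2" for x using Zsub that E by blast
    show "\<exists>x\<in>M2. E x - y \<in> Z1" if y: "y \<in> M1" for y
    proof -
      obtain c where c: "y - S1 c \<in> Z1" using b1(2)[OF y] unfolding S1_def by blast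
      then have "- (y - S1 c) \<in> Z1" by (rule pm.subspace_neg[OF sub(2)])
      then show ?thesis using S2M[of c] ES[of c] by (intro bexI[of _ "S2 c"]) auto
    qed
  qed (use lin_add[OF E(1)] lin_smul[OF E(1)] com in auto)
  \<comment> \<open>Coefficients are unique on \<open>B\<close> (\<open>coefu\<close>), so the
    arbitrary choice still yields a map that is linear on the nose, as \<open>hmod_iso\<close>
    demands, and not merely modulo \<open>Z2\<close>.\<close>
  define coef where "coef x = (SOME c. x - S1 c \<in> Z1)" for x
  have coef: "x - S1 (coef x) \<in> Z1" if "x \<in> M1" for x
    unfolding coef_def by (rule someI_ex[of "\<lambda>c. x - S1 c \<in> Z1"]) (use b1(2)[OF that] in \<open>simp add: S1_def\<close>)
  have Sd: "S1 (\<lambda>p. c p - d p) = S1 c - S1 d" for c d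
    unfolding S1_def by (simp add: pm.scale_left_diff_distrib sum_subtractf)
  have coefu: "S2 (coef x) = S2 c" if "x \<in> M1" "x - S1 c \<in> Z1" for x c
  proof -
    have "(x - S1 c) - (x - S1 (coef x)) \<in> Z1" by (intro pm.subspace_diff sub that coef)
    then have "S1 (\<lambda>p. coef x p - c p) \<in> Z1" by (simp add: Sd)
    then have "\<And>p. p \<in> B \<Longrightarrow> coef x p - c p = 0" using b1(3)[of "\<lambda>p. coef x p - c p"] unfolding S1_def by blast
    then show ?thesis unfolding S2_def by simp
  qed
  define \<phi> where "\<phi> x = S2 (coef x)" for x
  \<comment> \<open>\<open>E\<close> undoes \<phi> modulo \<open>Z1\<close>. With
    \<open>Zsub\<close>, the remaining claims about \<phi> can be tested after applying
    \<open>E\<close>.\<close>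
  have EP: "E (\<phi> x) - x \<in> Z1" if "x \<in> M1" for x
  proof -
    have "- (x - S1 (coef x)) \<in> Z1" by (rule pm.subspace_neg[OF sub(2) coef[OF that]])
    then show ?thesis unfolding \<phi>_def ES by simp
  qed
  have "hmod_iso n T1 M1 Z1 T2 M2 Z2 \<phi>"
    unfolding hmod_iso_def
  proof (intro conjI ballI allI)
    fix x y assume x: "x \<in> M1" and y: "y \<in> M1"
    have "(x - S1 (coef x)) + (y - S1 (coef y)) \<in> Z1" by (intro pm.subspace_add sub coef x y)
    also have "(x - S1 (coef x)) + (y - S1 (coef y)) = (x + y) - S1 (\<lambda>p. coef x p + coef y p)"
      unfolding S1_def by (simp add: pm.scale_left_distrib sum.distrib)
    finally have "\<phi> (x + y) = S2 (\<lambda>p. coef x p + coef y p)"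
      unfolding \<phi>_def by (intro coefu pm.subspace_add sub x y)
    then show "\<phi> (x + y) = \<phi> x + \<phi> y"
      unfolding \<phi>_def S2_def by (simp add: pm.scale_left_distrib sum.distrib)
  next
    fix a x assume x: "x \<in> M1"
    have "smul a (x - S1 (coef x)) \<in> Z1" by (intro pm.subspace_scale sub coef x)
    also have "smul a (x - S1 (coef x)) = smul a x - S1 (\<lambda>p. a * coef x p)"
      unfolding S1_def by (simp add: smul_diff smul_sum)
    finally have "\<phi> (smul a x) = S2 (\<lambda>p. a * coef x p)"
      unfolding \<phi>_def by (intro coefu pm.subspace_scale sub x)
    then show "\<phi> (smul a x) = smul a (\<phi> x)"
      unfolding \<phi>_def S2_def by (simp add: smul_sum)
  next
    show "\<phi> ` M1 \<subseteq> M2" unfolding \<phi>_def using S2M by blast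
  next
    fix x assume x: "x \<in> M1"
    have "\<phi> x \<in> Z2 \<longleftrightarrow> E (\<phi> x) \<in> Z1" using Zsub E S2M unfolding \<phi>_def by blast
    also have "\<dots> \<longleftrightarrow> x \<in> Z1"
      using EP[OF x] pm.subspace_add[OF sub(2), of "E (\<phi> x) - x" x]
        pm.subspace_diff[OF sub(2), of "E (\<phi> x)" "E (\<phi> x) - x"] by auto
    finally show "(\<phi> x \<in> Z2) = (x \<in> Z1)" .
  next
    fix y assume y: "y \<in> M2"
    have Ey: "E y \<in> M1" using y E by blast
    have "\<phi> (E y) - y \<in> Z2"
    proof (rule Zsub)
      show "\<phi> (E y) - y \<in> M2" unfolding \<phi>_def by (intro pm.subspace_diff sub S2M y)
      show "E (\<phi> (E y) - y) \<in> Z1" using EP[OF Ey] by (simp add: lin_diff[OF E(1)])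
    qed
    then show "\<exists>x\<in>M1. \<phi> x - y \<in> Z2" using Ey by blast
  next
    fix i x assume i: "i \<in> {1..<n}" and x: "x \<in> M1"
    have px: "\<phi> x \<in> M2" for x unfolding \<phi>_def by (rule S2M)
    show "\<phi> (T1 i x) - T2 i (\<phi> x) \<in> Z2"
    proof (rule Zsub)
      show "\<phi> (T1 i x) - T2 i (\<phi> x) \<in> M2" by (intro pm.subspace_diff sub px T2 i)
      have "(E (\<phi> (T1 i x)) - T1 i x) - (E (T2 i (\<phi> x)) - T1 i (E (\<phi> x))) - T1 i (E (\<phi> x) - x) \<in> Z1"
        by (intro pm.subspace_diff sub EP T1 i x com px)
      then show "E (\<phi> (T1 i x) - T2 i (\<phi> x)) \<in> Z1"
        by (simp add: lin_diff[OF E(1)] lin_diff[OF T1(1)])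
    qed
  qed
  moreover have "\<phi> (b1 p) - b2 p \<in> Z2" if p: "p \<in> B" for p
  proof (rule Zsub)
    have b1M: "b1 p \<in> M1" using b1(1)[OF p] b2(1)[OF p] E by force
    show "\<phi> (b1 p) - b2 p \<in> M2" unfolding \<phi>_def by (intro pm.subspace_diff sub S2M b2 p)
    show "E (\<phi> (b1 p) - b2 p) \<in> Z1" using EP[OF b1M] by (simp add: lin_diff[OF E(1)] b1(1)[OF p])
  qed
  ultimately show "\<exists>\<phi>. hmod_iso n T1 M1 Z1 T2 M2 Z2 \<phi> \<and> (\<forall>p\<in>B. \<phi> (b1 p) - b2 p \<in> Z2)" by blast
qed

section \<open>Inversions, reduced words and parabolic longest elements\<close>

abbreviation sg :: "nat \<Rightarrow> nat \<Rightarrow> nat" where "sg i \<equiv> Transposition.transpose i (Suc i)"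
abbreviation (input) perm :: "nat \<Rightarrow> (nat \<Rightarrow> nat) \<Rightarrow> bool" where "perm n w \<equiv> w permutes {1..n}"

section \<open>Inversion numbers and multiplication by simple transpositions\<close>

definition ninv :: "nat \<Rightarrow> (nat \<Rightarrow> nat) \<Rightarrow> nat" where
  "ninv n w = card {(a,b). 1 \<le> a \<and> a < b \<and> b \<le> n \<and> w b < w a}"

lemma sg_perm: "i \<in> {1..<n} \<Longrightarrow> perm n (sg i)"
  by (rule permutes_swap_id) auto

lemma sg_simps [simp]: "sg i i = Suc i" "sg i (Suc i) = i"
  by (auto simp: transpose_def)

lemma sg_other: "x \<noteq> i \<Longrightarrow> x \<noteq> Suc i \<Longrightarrow> sg i x = x"
  by (auto simp: transpose_def)

lemma sg_sg [simp]: "sg i (sg i x) = x"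
  by simp

lemma perm_comp_sg: "perm n w \<Longrightarrow> i \<in> {1..<n} \<Longrightarrow> perm n (w \<circ> sg i)"
  by (intro permutes_compose sg_perm)

lemma perm_sg_comp: "perm n w \<Longrightarrow> i \<in> {1..<n} \<Longrightarrow> perm n (sg i \<circ> w)"
  by (intro permutes_compose sg_perm)

lemma perm_neq: "perm n w \<Longrightarrow> w i \<noteq> w (Suc i)"
  by (metis n_not_Suc_n permutes_def)

lemma sg_order:
  assumes "a < b" "(a, b) \<noteq> (i, Suc i)"
  shows "sg i a < sg i b"
  using assms by (auto simp: transpose_def)

lemma sg_range: "i \<in> {1..<n} \<Longrightarrow> sg i x \<in> {1..n} \<longleftrightarrow> x \<in> {1..n}"
  by (auto simp: transpose_def)

lemma finite_inv_set: "finite {(a,b). 1 \<le> a \<and> a < b \<and> b \<le> (n::nat) \<and> P a b}"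
  by (rule finite_subset[of _ "{1..n} \<times> {1..n}"]) auto

lemma ninv_right_up:
  assumes w: "perm n w" and i: "i \<in> {1..<n}" and asc: "w i < w (Suc i)"
  shows "ninv n (w \<circ> sg i) = Suc (ninv n w)"
proof -
  let ?I = "\<lambda>w. {(a,b). 1 \<le> a \<and> a < b \<and> b \<le> n \<and> w b < w a}"
  let ?f = "\<lambda>(a,b). (sg i a, sg i b)"
  have inj: "inj_on ?f S" for S by (rule inj_on_inverseI[where g = ?f]) auto
  \<comment> \<open>Relabelling both entries of an inversion by s_i preserves their order, except
    for the pair (i, i+1), which is not an inversion of \<open>w\<close> but is one of the
    product.\<close>
  have "?I (w \<circ> sg i) = insert (i, Suc i) (?f ` ?I w)"
  proof (intro equalityI subsetI)
    fix p assume p: "p \<in> ?I (w \<circ> sg i)"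
    obtain a b where ab: "p = (a,b)" by (cases p)
    show "p \<in> insert (i, Suc i) (?f ` ?I w)"
    proof (cases "(a,b) = (i, Suc i)")
      case False
      have "a \<in> {1..n}" "b \<in> {1..n}" using p ab by auto
      then have r: "sg i a \<in> {1..n}" "sg i b \<in> {1..n}" using sg_range[OF i] by blast+
      have "(sg i a, sg i b) \<in> ?I w" using p ab sg_order[of a b i] False r by auto
      then have "?f (sg i a, sg i b) \<in> ?f ` ?I w" by (rule imageI)
      then show ?thesis using ab by simp
    qed (use ab in simp)
  next
    fix p assume p: "p \<in> insert (i, Suc i) (?f ` ?I w)"
    show "p \<in> ?I (w \<circ> sg i)"
    proof (cases "p = (i, Suc i)")
      case True then show ?thesis using i asc by auto
    next
      case False
      then obtain a b where ab: "(a,b) \<in> ?I w" "p = (sg i a, sg i b)" using p by auto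
      have ne: "(a,b) \<noteq> (i, Suc i)" using ab asc by auto
      have "a \<in> {1..n}" "b \<in> {1..n}" using ab by auto
      then have r: "sg i a \<in> {1..n}" "sg i b \<in> {1..n}" using sg_range[OF i] by blast+
      show ?thesis using ab sg_order[OF _ ne] r by auto
    qed
  qed
  moreover have "(i, Suc i) \<notin> ?f ` ?I w"
  proof
    assume "(i, Suc i) \<in> ?f ` ?I w"
    then obtain a b where ab: "(a,b) \<in> ?I w" "sg i a = i" "sg i b = Suc i" by auto
    then have "a = Suc i" "b = i" by (metis sg_sg sg_simps(1), metis sg_sg sg_simps(2))
    then show False using ab by auto
  qed
  moreover have "finite (?I w)" by (rule finite_inv_set)
  ultimately show ?thesis unfolding ninv_def by (simp add: card_image[OF inj])
qed

lemma ninv_right_down: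
  assumes w: "perm n w" and i: "i \<in> {1..<n}" and desc: "w (Suc i) < w i"
  shows "ninv n w = Suc (ninv n (w \<circ> sg i))"
proof -
  have "ninv n ((w \<circ> sg i) \<circ> sg i) = Suc (ninv n (w \<circ> sg i))"
    by (rule ninv_right_up[OF perm_comp_sg[OF w i] i]) (use desc in simp)
  moreover have "(w \<circ> sg i) \<circ> sg i = w" by (simp add: fun_eq_iff)
  ultimately show ?thesis by simp
qed

lemma ninv_inv:
  assumes w: "perm n w"
  shows "ninv n (inv w) = ninv n w"
proof -
  let ?I = "\<lambda>w. {(a,b). 1 \<le> a \<and> a < b \<and> b \<le> n \<and> w b < w a}"
  have iw: "perm n (inv w)" by (rule permutes_inv[OF w])
  have r: "1 \<le> w x \<and> w x \<le> n \<longleftrightarrow> 1 \<le> x \<and> x \<le> n" "1 \<le> inv w x \<and> inv w x \<le> n \<longleftrightarrow> 1 \<le> x \<and> x \<le> n" for x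
    using permutes_in_image[OF w, of x] permutes_in_image[OF iw, of x] by simp_all
  have *: "bij_betw (\<lambda>(a,b). (w b, w a)) (?I w) (?I (inv w))"
  proof (rule bij_betw_byWitness[where f' = "\<lambda>(a,b). (inv w b, inv w a)"])
    show "(\<lambda>(a,b). (w b, w a)) ` ?I w \<subseteq> ?I (inv w)"
    proof clarsimp
      fix a b assume "Suc 0 \<le> a" "a < b" "b \<le> n" "w b < w a"
      then show "Suc 0 \<le> w b \<and> w a \<le> n \<and> inv w (w a) < inv w (w b)"
        using r(1)[of a] r(1)[of b] by (simp add: permutes_inverses[OF w])
    qed
    show "(\<lambda>(a,b). (inv w b, inv w a)) ` ?I (inv w) \<subseteq> ?I w"
    proof clarsimp
      fix a b assume "Suc 0 \<le> a" "a < b" "b \<le> n" "inv w b < inv w a"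
      then show "Suc 0 \<le> inv w b \<and> inv w a \<le> n \<and> w (inv w a) < w (inv w b)"
        using r(2)[of a] r(2)[of b] by (simp add: permutes_inverses[OF w])
    qed
  qed (simp_all add: permutes_inverses[OF w] case_prod_unfold)
  show ?thesis unfolding ninv_def using bij_betw_same_card[OF *] by simp
qed

lemma inv_sg_comp: "perm n w \<Longrightarrow> i \<in> {1..<n} \<Longrightarrow> inv (sg i \<circ> w) = inv w \<circ> sg i"
  by (metis bij_transpose inv_transpose_eq o_inv_distrib permutes_bij)

lemma ninv_left_up:
  assumes w: "perm n w" and i: "i \<in> {1..<n}" and asc: "inv w i < inv w (Suc i)"
  shows "ninv n (sg i \<circ> w) = Suc (ninv n w)"
proof -
  have "ninv n (sg i \<circ> w) = ninv n (inv w \<circ> sg i)"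
    using ninv_inv[OF perm_sg_comp[OF w i]] inv_sg_comp[OF w i] by simp
  then show ?thesis using ninv_right_up[OF permutes_inv[OF w] i asc] ninv_inv[OF w] by simp
qed

lemma ninv_left_down:
  assumes w: "perm n w" and i: "i \<in> {1..<n}" and desc: "inv w (Suc i) < inv w i"
  shows "ninv n w = Suc (ninv n (sg i \<circ> w))"
proof -
  have "ninv n (sg i \<circ> w) = ninv n (inv w \<circ> sg i)"
    using ninv_inv[OF perm_sg_comp[OF w i]] inv_sg_comp[OF w i] by simp
  then show ?thesis using ninv_right_down[OF permutes_inv[OF w] i desc] ninv_inv[OF w] by simp
qed

text \<open>Climbing from 1 gives i <= w i, and going down from n gives w i <= i.\<close>

lemma strict_mono_perm_id:
  assumes w: "perm n w" and asc: "\<And>i. i \<in> {1..<n} \<Longrightarrow> w i < w (Suc i)"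
  shows "w = id"
proof -
  have ge: "1 \<le> i \<Longrightarrow> i \<le> n \<Longrightarrow> i \<le> w i" for i
  proof (induction i)
    case (Suc i)
    show ?case
    proof (cases "i = 0")
      case True then show ?thesis using permutes_in_image[OF w, of 1] Suc by auto
    next
      case False
      then have "i \<le> w i" using Suc by auto
      also have "w i < w (Suc i)" using asc[of i] False Suc by auto
      finally show ?thesis by simp
    qed
  qed simp
  have le: "d < n \<Longrightarrow> w (n - d) \<le> n - d" for d
  proof (induction d)
    case 0
    then show ?case using permutes_in_image[OF w, of n] by auto
  next
    case (Suc d)
    have "w (n - Suc d) < w (Suc (n - Suc d))" using Suc by (intro asc) auto
    also have "Suc (n - Suc d) = n - d" using Suc by auto
    also have "w (n - d) \<le> n - d" using Suc by auto
    finally show ?case by auto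
  qed
  show ?thesis
  proof
    fix x
    show "w x = id x"
    proof (cases "x \<in> {1..n}")
      case True
      then show ?thesis using ge[of x] le[of "n - x"] by auto
    next
      case False
      then show ?thesis using w by (auto simp: permutes_def)
    qed
  qed
qed

lemma ninv_le: "ninv n w \<le> n * n"
proof -
  have "ninv n w \<le> card ({1..n} \<times> {1..n})"
    unfolding ninv_def by (rule card_mono) auto
  then show ?thesis by simp
qed

lemma ninv_id [simp]: "ninv n id = 0"
proof -
  have "{(a,b). 1 \<le> a \<and> a < b \<and> b \<le> n \<and> id b < id a} = {}" by auto
  then show ?thesis unfolding ninv_def by (simp only: card.empty)
qed

section \<open>Words, reduced words and their relations\<close>

lemma word_perm_Nil [simp]: "word_perm [] = id"
  and word_perm_Cons [simp]: "word_perm (i # ws) = sg i \<circ> word_perm ws"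
  by (simp_all add: word_perm_def)

lemma word_perm_append: "word_perm (us @ vs) = word_perm us \<circ> word_perm vs"
  by (induction us) (auto simp: comp_assoc)

lemma is_word_simps [simp]: "is_word n []" "is_word n (i # ws) \<longleftrightarrow> i \<in> {1..<n} \<and> is_word n ws"
  "is_word n (us @ vs) \<longleftrightarrow> is_word n us \<and> is_word n vs"
  by (auto simp: is_word_def)

lemma word_perm_perm: "is_word n ws \<Longrightarrow> perm n (word_perm ws)"
proof (induction ws)
  case Nil
  show ?case unfolding word_perm_Nil by (rule permutes_id)
next
  case (Cons i ws)
  then show ?case unfolding word_perm_Cons by (intro perm_sg_comp) auto
qed

lemma ninv_le_length: "is_word n ws \<Longrightarrow> ninv n (word_perm ws) \<le> length ws"
proof (induction ws)
  case (Cons i ws)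
  let ?w = "word_perm ws"
  have i: "i \<in> {1..<n}" and w: "perm n ?w" using Cons.prems word_perm_perm by auto
  have "inv ?w i \<noteq> inv ?w (Suc i)" by (rule perm_neq[OF permutes_inv[OF w]])
  then consider "inv ?w i < inv ?w (Suc i)" | "inv ?w (Suc i) < inv ?w i" by linarith
  then have "ninv n (sg i \<circ> ?w) \<le> Suc (ninv n ?w)"
    by cases (use ninv_left_up[OF w i] ninv_left_down[OF w i] in auto)
  moreover have "ninv n (word_perm (i # ws)) = ninv n (sg i \<circ> ?w)" by (rule arg_cong[OF word_perm_Cons])
  ultimately show ?case using Cons by (simp del: word_perm_Cons)
qed (simp only: word_perm_Nil ninv_id)

text \<open>Sorting by adjacent swaps: as long as there is a descent, cancelling it on the right
  lowers the inversion number by one and contributes the last letter of the word.\<close>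

lemma exists_reduced_word:
  assumes "perm n w"
  shows "\<exists>ws. is_word n ws \<and> word_perm ws = w \<and> length ws = ninv n w"
  using assms
proof (induction "ninv n w" arbitrary: w)
  case 0
  have "w = id"
  proof (rule strict_mono_perm_id[OF 0(2)])
    fix i assume i: "i \<in> {1..<n}"
    show "w i < w (Suc i)"
    proof (rule ccontr)
      assume "\<not> w i < w (Suc i)"
      then have "w (Suc i) < w i" using perm_neq[OF 0(2), of i] by linarith
      from ninv_right_down[OF 0(2) i this] 0(1) show False by simp
    qed
  qed
  then show ?case using 0(1) by (intro exI[of _ "[]"]) (simp only: word_perm_Nil is_word_simps list.size)
next
  case (Suc m)
  have "\<exists>i\<in>{1..<n}. w (Suc i) < w i"
  proof (rule ccontr)
    assume "\<not> ?thesis"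
    then have "w = id" using perm_neq[OF Suc(3)] by (intro strict_mono_perm_id[OF Suc(3)]) (meson linorder_neqE_nat)
    then show False using Suc(2) by (simp only: ninv_id)
  qed
  then obtain i where i: "i \<in> {1..<n}" "w (Suc i) < w i" by blast
  have p: "perm n (w \<circ> sg i)" by (rule perm_comp_sg[OF Suc(3) i(1)])
  have m: "m = ninv n (w \<circ> sg i)" using ninv_right_down[OF Suc(3) i] Suc(2) by simp
  from Suc(1)[OF m p] obtain ws where ws: "is_word n ws" "word_perm ws = w \<circ> sg i" "length ws = ninv n (w \<circ> sg i)"
    by blast
  have "word_perm (ws @ [i]) = w" unfolding word_perm_append ws(2) by (simp add: fun_eq_iff)
  then show ?case using ws i m Suc(2) by (intro exI[of _ "ws @ [i]"]) auto
qed

definition red :: "nat \<Rightarrow> (nat \<Rightarrow> nat) \<Rightarrow> nat list \<Rightarrow> bool" where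
  "red n w ws \<longleftrightarrow> is_word n ws \<and> word_perm ws = w \<and> length ws = ninv n w"

text \<open>The choice in \<open>rw\<close> minimizes the length among all words for
  \<open>w\<close>. Since the inversion number is a lower bound for that length and is attained, the
  chosen word has exactly this length.\<close>

lemma red_rw:
  assumes "perm n w"
  shows "red n w (rw n w)"
proof -
  obtain us where us: "is_word n us" "word_perm us = w" "length us = ninv n w"
    using exists_reduced_word[OF assms] by blast
  have "\<exists>ws. is_word n ws \<and> word_perm ws = w \<and> (\<forall>ws'. is_word n ws' \<and> word_perm ws' = w \<longrightarrow> length ws \<le> length ws')"
    using us ninv_le_length by (intro exI[of _ us]) metis
  from someI_ex[OF this] have r: "is_word n (rw n w) \<and> word_perm (rw n w) = w
      \<and> (\<forall>ws'. is_word n ws' \<and> word_perm ws' = w \<longrightarrow> length (rw n w) \<le> length ws')"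
    unfolding rw_def .
  then have "length (rw n w) \<le> ninv n w" using us by metis
  moreover have "ninv n w \<le> length (rw n w)" using ninv_le_length[of n "rw n w"] r by simp
  ultimately show ?thesis using r unfolding red_def by simp
qed

lemma plen_eq: "perm n w \<Longrightarrow> plen n w = ninv n w"
  using red_rw by (simp add: plen_def red_def)

lemma red_perm: "red n w ws \<Longrightarrow> perm n w"
  using word_perm_perm by (auto simp: red_def)

lemma red_Cons:
  assumes "red n w (i # ws)"
  shows "red n (sg i \<circ> w) ws" "i \<in> {1..<n}" "inv w (Suc i) < inv w i"
proof -
  let ?u = "word_perm ws"
  have i: "i \<in> {1..<n}" and u: "perm n ?u" and w: "w = sg i \<circ> ?u" and ws: "is_word n ws"
    using assms word_perm_perm by (auto simp: red_def)
  have l: "Suc (length ws) = ninv n (sg i \<circ> ?u)" using assms w by (simp add: red_def)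
  \<comment> \<open>Otherwise the letter i would shorten \<open>?u\<close>, and the remaining word
    would be too short for the inversion number of \<open>?u\<close>.\<close>
  have up: "inv ?u i < inv ?u (Suc i)"
  proof (rule ccontr)
    assume "\<not> ?thesis"
    then have "inv ?u (Suc i) < inv ?u i" using perm_neq[OF permutes_inv[OF u], of i] by linarith
    from ninv_left_down[OF u i this] l ninv_le_length[OF ws] show False by simp
  qed
  have "sg i \<circ> w = ?u" using w by (simp add: fun_eq_iff)
  moreover have "length ws = ninv n ?u" using ninv_left_up[OF u i up] l by simp
  ultimately show "red n (sg i \<circ> w) ws" using ws by (simp add: red_def)
  show "i \<in> {1..<n}" by fact
  show "inv w (Suc i) < inv w i" unfolding w inv_sg_comp[OF u i] using up by simp
qed

lemma red_ConsI:
  assumes "red n (sg i \<circ> w) ws" "i \<in> {1..<n}" "perm n w" "inv w (Suc i) < inv w i"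
  shows "red n w (i # ws)"
  using assms ninv_left_down[OF assms(3,2,4)] by (auto simp: red_def fun_eq_iff)

lemma red_snoc:
  assumes "red n w ws" "i \<in> {1..<n}" "w i < w (Suc i)"
  shows "red n (w \<circ> sg i) (ws @ [i])"
  using assms ninv_right_up[OF red_perm[OF assms(1)] assms(2,3)] by (auto simp: red_def word_perm_append)

text \<open>Matsumoto's theorem. Two reduced words of \<open>w\<close> starting with \<open>i\<close> and \<open>j\<close> are both linked to
  reduced words that start with the longest element of the dihedral subgroup of \<open>i\<close> and \<open>j\<close>.\<close>

lemma matsumoto:
  fixes R :: "nat list \<Rightarrow> nat list \<Rightarrow> bool"
  assumes refl: "\<And>u. R u u" and sym: "\<And>u v. R u v \<Longrightarrow> R v u" and trans: "\<And>u v w. R u v \<Longrightarrow> R v w \<Longrightarrow> R u w"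
    and cons: "\<And>i u v. i \<in> {1..<n} \<Longrightarrow> R u v \<Longrightarrow> R (i # u) (i # v)"
    and far: "\<And>i j u. i \<in> {1..<n} \<Longrightarrow> j \<in> {1..<n} \<Longrightarrow> Suc i < j \<Longrightarrow> is_word n u \<Longrightarrow> R (i # j # u) (j # i # u)"
    and braid: "\<And>i u. i \<in> {1..<n} \<Longrightarrow> Suc i < n \<Longrightarrow> is_word n u \<Longrightarrow> R (i # Suc i # i # u) (Suc i # i # Suc i # u)"
    and red: "red n w us" "red n w vs"
  shows "R us vs"
  using red
proof (induction "length us" arbitrary: us vs w rule: less_induct)
  case less
  note IH = less(1) and us = less(2) and vs = less(3)
  have w: "perm n w" by (rule red_perm[OF us])
  show ?case
  proof (cases us)
    case Nil
    then have "vs = []" using us vs by (auto simp: red_def)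
    then show ?thesis using Nil refl by simp
  next
    case (Cons i u)
    then obtain j v where vsj: "vs = j # v" using us vs by (cases vs) (auto simp: red_def)
    have i: "red n (sg i \<circ> w) u" "i \<in> {1..<n}" "inv w (Suc i) < inv w i" using red_Cons us Cons by auto
    have j: "red n (sg j \<circ> w) v" "j \<in> {1..<n}" "inv w (Suc j) < inv w j" using red_Cons vs vsj by auto
    have len: "length u < length us" "length v < length us" using us vs Cons vsj by (auto simp: red_def)
    \<comment> \<open>Two distinct left descents of \<open>w\<close>, ordered as a < b. The tails
      are exchanged by the induction hypothesis for shorter permutations, and in between one
      commutation or braid relation is applied.\<close>
    have aux: "R (a # x) (b # y)"
      if a: "red n (sg a \<circ> w) x" "a \<in> {1..<n}" "inv w (Suc a) < inv w a" "length x < length us"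
      and b: "red n (sg b \<circ> w) y" "b \<in> {1..<n}" "inv w (Suc b) < inv w b" "length y < length us"
      and ab: "a < b" for a b x y
    proof (cases "Suc a < b")
      case True
      define w' where "w' = sg b \<circ> (sg a \<circ> w)"
      have com: "sg a \<circ> sg b = sg b \<circ> sg a" using True by (auto simp: fun_eq_iff transpose_def)
      have w'2: "w' = sg a \<circ> (sg b \<circ> w)" unfolding w'_def using com by (simp add: comp_assoc[symmetric])
      have pa: "perm n (sg a \<circ> w)" and pb: "perm n (sg b \<circ> w)" using perm_sg_comp w that by auto
      have p': "perm n w'" unfolding w'_def by (rule perm_sg_comp[OF pa b(2)])
      obtain z where z: "red n w' z" using red_rw[OF p'] by blast
      have ra: "red n (sg a \<circ> w) (b # z)"
        by (rule red_ConsI) (use z pa b ab True inv_sg_comp[OF w a(2)] in \<open>auto simp: w'_def sg_other\<close>)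
      have rb: "red n (sg b \<circ> w) (a # z)"
        by (rule red_ConsI) (use z pb a ab True inv_sg_comp[OF w b(2)] in \<open>auto simp: w'2 sg_other\<close>)
      have "R (a # x) (a # b # z)" by (intro cons a IH[OF a(4) a(1) ra])
      moreover have "R (a # b # z) (b # a # z)" using z by (intro far a b True) (auto simp: red_def)
      moreover have "R (b # a # z) (b # y)" by (intro cons b sym[OF IH[OF b(4) b(1) rb]])
      ultimately show ?thesis using trans by blast
    next
      case False
      then have ba: "b = Suc a" using ab by simp
      \<comment> \<open>\<open>w\<close> with the longest element of the dihedral subgroup of s_a
        and s_b removed on the left. Three inversions disappear because a and b are both left
        descents of \<open>w\<close>.\<close>
      define w' where "w' = sg a \<circ> (sg b \<circ> (sg a \<circ> w))"
      have com: "sg a \<circ> (sg b \<circ> sg a) = sg b \<circ> (sg a \<circ> sg b)"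
        unfolding ba by (auto simp: fun_eq_iff transpose_def)
      have w'2: "w' = sg b \<circ> (sg a \<circ> (sg b \<circ> w))" unfolding w'_def using com by (simp add: comp_assoc[symmetric])
      have pa: "perm n (sg a \<circ> w)" and pb: "perm n (sg b \<circ> w)" using perm_sg_comp w that by auto
      have pba: "perm n (sg b \<circ> (sg a \<circ> w))" and pab: "perm n (sg a \<circ> (sg b \<circ> w))"
        using perm_sg_comp pa pb that by auto
      have p': "perm n w'" unfolding w'_def by (rule perm_sg_comp[OF pba a(2)])
      obtain z where z: "red n w' z" using red_rw[OF p'] by blast
      note ia = inv_sg_comp[OF w a(2)] and ib = inv_sg_comp[OF w b(2)]
      note iba = inv_sg_comp[OF pa b(2)] and iab = inv_sg_comp[OF pb a(2)]
      have ra1: "red n (sg b \<circ> (sg a \<circ> w)) (a # z)"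
        by (rule red_ConsI) (use z pba a in \<open>simp_all add: w'_def del: atLeastLessThan_iff One_nat_def\<close>, unfold iba ia, use a b ba in \<open>auto simp: sg_other\<close>)
      have ra: "red n (sg a \<circ> w) (b # a # z)"
        by (rule red_ConsI[OF ra1 b(2) pa]) (use a b ba in \<open>auto simp: ia sg_other\<close>)
      have rb1: "red n (sg a \<circ> (sg b \<circ> w)) (b # z)"
        by (rule red_ConsI) (use z pab b in \<open>simp_all add: w'2 del: atLeastLessThan_iff One_nat_def\<close>, unfold iab ib, use a b ba in \<open>auto simp: sg_other\<close>)
      have rb: "red n (sg b \<circ> w) (a # b # z)"
        by (rule red_ConsI[OF rb1 a(2) pb], unfold ib) (use a b ba in \<open>auto simp: sg_other\<close>)
      have "R (a # x) (a # b # a # z)" by (intro cons a IH[OF a(4) a(1) ra])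
      moreover have "R (a # b # a # z) (b # a # b # z)" unfolding ba using z b(2) ba by (intro braid a) (auto simp: red_def)
      moreover have "R (b # a # b # z) (b # y)" by (intro cons b sym[OF IH[OF b(4) b(1) rb]])
      ultimately show ?thesis using trans by blast
    qed
    show ?thesis
    proof (cases i j rule: linorder_cases)
      case less
      then show ?thesis using aux[OF i len(1) j len(2)] Cons vsj by simp
    next
      case equal
      then show ?thesis using cons[OF i(2) IH[OF len(1) i(1)]] j Cons vsj by simp
    next
      case greater
      then show ?thesis using sym[OF aux[OF j len(2) i len(1)]] Cons vsj by simp
    qed
  qed
qed

section \<open>Descent sets and longest elements of parabolic subgroups\<close>

lemma pDes_sub: "pDes n w \<subseteq> {1..<n}"
  by (auto simp: pDes_def)

lemma finite_perms: "finite {w. perm n w}"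
  by (rule finite_permutations) simp

text \<open>A descent at j can be lost only when the values i+1 and i stand at the positions j and
  j+1, and then i would already be a left descent.\<close>

lemma pDes_left_mono:
  assumes w: "perm n w" and i: "i \<in> {1..<n}" and asc: "inv w i < inv w (Suc i)"
  shows "pDes n w \<subseteq> pDes n (sg i \<circ> w)"
proof
  fix j assume j: "j \<in> pDes n w"
  then have d: "w (Suc j) < w j" by (simp add: pDes_def)
  have ne: "(w (Suc j), w j) \<noteq> (i, Suc i)"
  proof
    assume "(w (Suc j), w j) = (i, Suc i)"
    then have e: "i = w (Suc j)" "Suc i = w j" by simp_all
    have "inv w i = Suc j" unfolding e(1) by (rule permutes_inverses(2)[OF w])
    moreover have "inv w (Suc i) = j" unfolding e(2) by (rule permutes_inverses(2)[OF w])
    ultimately have "Suc j < j" using asc by (simp only:)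
    then show False by simp
  qed
  show "j \<in> pDes n (sg i \<circ> w)" using j sg_order[OF d ne] by (simp add: pDes_def)
qed

text \<open>Membership in one orbit of the parabolic subgroup generated by the s_i with i in D: the
  orbits are the maximal intervals all of whose inner gaps lie in D.\<close>

definition same_run :: "nat set \<Rightarrow> nat \<Rightarrow> nat \<Rightarrow> bool" where
  "same_run D a b \<longleftrightarrow> {min a b..<max a b} \<subseteq> D"

lemma same_run_refl: "same_run D a a"
  by (simp add: same_run_def)

lemma same_run_sym: "same_run D a b \<Longrightarrow> same_run D b a"
  by (simp add: same_run_def min.commute max.commute)

lemma same_run_trans: "same_run D a b \<Longrightarrow> same_run D b c \<Longrightarrow> same_run D a c"
proof -
  assume "same_run D a b" "same_run D b c"
  moreover have "{min a c..<max a c} \<subseteq> {min a b..<max a b} \<union> {min b c..<max b c}" by auto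
  ultimately show ?thesis unfolding same_run_def by blast
qed

lemma same_run_Suc: "same_run D i (Suc i) \<longleftrightarrow> i \<in> D"
  by (auto simp: same_run_def)

lemma same_run_sg: "i \<in> D \<Longrightarrow> same_run D a (sg i a)"
  by (cases "a = i"; cases "a = Suc i")
     (auto simp: same_run_refl sg_other same_run_Suc intro: same_run_sym)

lemma same_run_word: "set ws \<subseteq> D \<Longrightarrow> same_run D a (word_perm ws a)"
proof (induction ws)
  case (Cons i ws)
  then show ?case using same_run_sg[of i D "word_perm ws a"] by (auto intro: same_run_trans)
qed (simp add: same_run_refl)

lemma same_run_decreasing:
  assumes D: "D \<subseteq> pDes n w" and ab: "a < b" "same_run D a b"
  shows "w b < w a"
  using ab
proof (induction b)
  case (Suc b)
  have run: "{a..<Suc b} \<subseteq> D" using Suc.prems by (simp add: same_run_def min_def max_def)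
  moreover have "b \<in> {a..<Suc b}" using Suc.prems by simp
  ultimately have "b \<in> pDes n w" using D by blast
  then have d: "w (Suc b) < w b" by (simp add: pDes_def)
  show ?case
  proof (cases "a = b")
    case False
    then have ab: "a < b" using Suc.prems by simp
    have "{a..<b} \<subseteq> {a..<Suc b}" by auto
    then have "{a..<b} \<subseteq> D" using run by (rule subset_trans)
    then have "same_run D a b" using ab by (simp add: same_run_def)
    then have "w b < w a" by (rule Suc.IH[OF ab])
    then show ?thesis using d by simp
  qed (use d in simp)
qed simp

text \<open>A permutation whose descents include D decreases along every run of D. Hence each letter
  of a reduced word over D that is cancelled on the right lowers the length by one, and
  \<open>w\<close> factors as (w v^-1) v with lengths adding up.\<close>

lemma ninv_divide_parabolic:
  assumes w: "perm n w" and D: "D \<subseteq> pDes n w" and r: "red n v ws" and ws: "set ws \<subseteq> D"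
  shows "ninv n (w \<circ> inv v) + length ws = ninv n w"
  using r ws
proof (induction ws arbitrary: v)
  case Nil
  then have "v = id" by (simp add: red_def fun_eq_iff)
  then show ?case by (simp only: inv_id comp_id list.size add_0_right)
next
  case (Cons i ws)
  let ?u = "sg i \<circ> v"
  note u = red_Cons(1)[OF Cons(2)] and i = red_Cons(2,3)[OF Cons(2)]
  have pv: "perm n v" and pu: "perm n ?u" using red_perm[OF Cons(2)] red_perm[OF u] .
  have iu: "inv ?u = inv v \<circ> sg i" by (rule inv_sg_comp[OF pv i(1)])
  have wu: "word_perm ws = ?u" using u by (simp add: red_def)
  have iD: "i \<in> D" using Cons(3) by simp
  have run: "same_run D (inv ?u x) x" for x
  proof -
    have "same_run D (inv ?u x) (?u (inv ?u x))" unfolding wu[symmetric] by (rule same_run_word) (use Cons(3) in simp)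
    then show ?thesis by (simp only: permutes_inverses(1)[OF pu])
  qed
  have "same_run D (inv ?u i) (inv ?u (Suc i))"
    by (rule same_run_trans[OF run[of i] same_run_trans[OF _ same_run_sym[OF run]]]) (simp add: same_run_Suc iD)
  moreover have "inv ?u i < inv ?u (Suc i)" unfolding iu using i by simp
  ultimately have "w (inv ?u (Suc i)) < w (inv ?u i)" by (intro same_run_decreasing[OF D])
  then have "ninv n (w \<circ> inv ?u) = Suc (ninv n ((w \<circ> inv ?u) \<circ> sg i))"
    by (intro ninv_right_down i permutes_compose permutes_inv pu w) simp
  moreover have "(w \<circ> inv ?u) \<circ> sg i = w \<circ> inv v" unfolding iu by (simp add: fun_eq_iff)
  moreover have "ninv n (w \<circ> inv ?u) + length ws = ninv n w" by (rule Cons.IH[OF u]) (use Cons(3) in simp)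
  ultimately show ?case by (simp only: list.size)
qed

text \<open>Take a reduced word over D of maximal length, which exists because lengths are bounded.
  It cannot be prolonged on the right or on the left, so every i in D is a descent on both
  sides.\<close>

lemma parabolic_longest_exists:
  assumes D: "D \<subseteq> {1..<n}"
  obtains ws v where "red n v ws" "set ws \<subseteq> D" "pDes n v = D"
    "\<And>i. i \<in> D \<Longrightarrow> inv v (Suc i) < inv v i"
proof -
  let ?P = "\<lambda>ws. red n (word_perm ws) ws \<and> set ws \<subseteq> D"
  have P0: "?P []" by (simp add: red_def del: word_perm_Nil, simp only: word_perm_Nil ninv_id)
  have bd: "\<forall>ws. ?P ws \<longrightarrow> length ws < Suc (n * n)"
  proof (intro allI impI)
    fix us assume "?P us"
    then have "length us = ninv n (word_perm us)" by (simp only: red_def)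
    also have "\<dots> \<le> n * n" by (rule ninv_le)
    finally show "length us < Suc (n * n)" by simp
  qed
  obtain ws where ws: "?P ws" and mx: "\<And>us. ?P us \<Longrightarrow> length us \<le> length ws"
    using ex_has_greatest_nat[of ?P "[]" length "Suc (n * n)"] P0 bd by blast
  let ?v = "word_perm ws"
  have v: "perm n ?v" using ws red_perm by blast
  have right: "?v (Suc i) < ?v i" if i: "i \<in> D" for i
  proof (rule ccontr)
    assume "\<not> ?thesis"
    then have "?v i < ?v (Suc i)" using perm_neq[OF v, of i] by linarith
    then have "red n (?v \<circ> sg i) (ws @ [i])" using ws i D by (intro red_snoc) auto
    then have "?P (ws @ [i])" using ws i by (simp add: red_def)
    from mx[OF this] show False by simp
  qed
  have left: "inv ?v (Suc i) < inv ?v i" if i: "i \<in> D" for i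
  proof (rule ccontr)
    assume "\<not> ?thesis"
    then have a: "inv ?v i < inv ?v (Suc i)" using perm_neq[OF permutes_inv[OF v], of i] by linarith
    have iD: "i \<in> {1..<n}" using i D by auto
    have "ninv n (word_perm (i # ws)) = Suc (ninv n ?v)"
      unfolding arg_cong[OF word_perm_Cons, of "ninv n"] by (rule ninv_left_up[OF v iD a])
    then have "?P (i # ws)" using ws i iD by (simp add: red_def del: word_perm_Cons)
    from mx[OF this] show False by simp
  qed
  have "pDes n ?v = D"
  proof (intro equalityI subsetI)
    fix j assume j: "j \<in> pDes n ?v"
    show "j \<in> D"
    proof (rule ccontr)
      assume nj: "j \<notin> D"
      \<comment> \<open>An index j outside D separates two runs, and \<open>?v\<close> preserves
        runs: the value at j stays at most j, and the value at j+1 stays above j.\<close>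
      have "{min j (?v j)..<max j (?v j)} \<subseteq> D" "{min (Suc j) (?v (Suc j))..<max (Suc j) (?v (Suc j))} \<subseteq> D"
        using same_run_word[of ws D] ws unfolding same_run_def by blast+
      with nj have "j \<notin> {min j (?v j)..<max j (?v j)}" "j \<notin> {min (Suc j) (?v (Suc j))..<max (Suc j) (?v (Suc j))}"
        by blast+
      then have "?v j \<le> j" "Suc j \<le> ?v (Suc j)" by auto
      then show False using j by (simp add: pDes_def)
    qed
  next
    fix j assume "j \<in> D"
    then show "j \<in> pDes n ?v" using right D by (auto simp: pDes_def)
  qed
  then show ?thesis using that[of ?v ws] ws left by blast
qed

text \<open>The quotient u v^-1 has length equal to the difference of the two lengths, so equal
  lengths make it the identity. This is the uniqueness that the definite description in
  \<open>w0set\<close> relies on.\<close>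

lemma parabolic_longest_minimal:
  assumes v: "red n v ws" "set ws \<subseteq> D" and u: "perm n u" "D \<subseteq> pDes n u"
  shows "ninv n v \<le> ninv n u" "ninv n u = ninv n v \<Longrightarrow> u = v"
proof -
  have l: "ninv n (u \<circ> inv v) + length ws = ninv n u" by (rule ninv_divide_parabolic[OF u v])
  have lv: "length ws = ninv n v" using v by (simp add: red_def)
  show "ninv n v \<le> ninv n u" using l lv by simp
  have pv: "perm n v" by (rule red_perm[OF v(1)])
  assume "ninv n u = ninv n v"
  then have z: "ninv n (u \<circ> inv v) = 0" using l lv by simp
  have p: "perm n (u \<circ> inv v)" by (intro permutes_compose permutes_inv pv u)
  from exists_reduced_word[OF p] z obtain us where "word_perm us = u \<circ> inv v" "length us = 0" by auto
  then have "u \<circ> inv v = id" by simp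
  then have "u \<circ> inv v \<circ> v = v" by (simp only: id_comp)
  then show "u = v" using permutes_inv_o[OF pv] by (simp add: comp_assoc)
qed

text \<open>The minimal permutation with descent set D is identified with the longest element of the
  parabolic subgroup of D. All later arguments use this second description: a reduced word with
  letters in D, and every element of D a left descent.\<close>

lemma w0set_props:
  assumes D: "D \<subseteq> {1..<n}"
  obtains ws where "red n (w0set n D) ws" "set ws \<subseteq> D" "pDes n (w0set n D) = D"
    "\<And>i. i \<in> D \<Longrightarrow> inv (w0set n D) (Suc i) < inv (w0set n D) i"
proof -
  obtain ws v where v: "red n v ws" "set ws \<subseteq> D" "pDes n v = D"
    "\<And>i. i \<in> D \<Longrightarrow> inv v (Suc i) < inv v i" by (rule parabolic_longest_exists[OF D]) metis
  have pv: "perm n v" by (rule red_perm[OF v(1)])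
  have "w0set n D = v"
    unfolding w0set_def
  proof (rule the_equality)
    show "perm n v \<and> pDes n v = D \<and> (\<forall>u. perm n u \<and> pDes n u = D \<longrightarrow> plen n v \<le> plen n u)"
      using pv v parabolic_longest_minimal(1)[OF v(1,2)] by (auto simp: plen_eq)
  next
    fix w assume w: "perm n w \<and> pDes n w = D \<and> (\<forall>u. perm n u \<and> pDes n u = D \<longrightarrow> plen n w \<le> plen n u)"
    then have "ninv n w \<le> ninv n v" using pv v by (metis plen_eq)
    moreover have "ninv n v \<le> ninv n w" using parabolic_longest_minimal(1)[OF v(1,2), of w] w by simp
    ultimately show "w = v" using parabolic_longest_minimal(2)[OF v(1,2), of w] w by simp
  qed
  then show ?thesis using that v by blast
qed

lemma w0set_perm: "D \<subseteq> {1..<n} \<Longrightarrow> perm n (w0set n D)"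
  by (erule w0set_props) (erule red_perm)

lemma pDes_w0set: "D \<subseteq> {1..<n} \<Longrightarrow> pDes n (w0set n D) = D"
  by (erule w0set_props)

lemma ninv_divide_w0set:
  assumes w: "perm n w" and D: "D \<subseteq> pDes n w"
  shows "ninv n (w \<circ> inv (w0set n D)) + ninv n (w0set n D) = ninv n w"
proof -
  have Dn: "D \<subseteq> {1..<n}" using D pDes_sub by blast
  obtain ws where ws: "red n (w0set n D) ws" "set ws \<subseteq> D" by (rule w0set_props[OF Dn])
  have "length ws = ninv n (w0set n D)" using ws(1) unfolding red_def by blast
  with ninv_divide_parabolic[OF w D ws] show ?thesis by (simp only:)
qed

section \<open>The 0-Hecke algebra\<close>

declare One_nat_def [simp del]

lemma lext_fun_add: "lext (\<lambda>u. g u + h u) a = lext g a + lext h a"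
  by (simp add: lext_def smul_add sum.distrib)

lemma lext_fun_smul: "lext (\<lambda>u. smul c (g u)) a = smul c (lext g a)"
  by (simp add: lext_def smul_sum mult.commute)

lemma lext_ident: "lext (\<lambda>u. Poly_Mapping.single u 1) a = a"
  by (simp add: lext_def sum_single_keys)

lemma fa_mult_lext: "fa_mult a b = lext (\<lambda>u. lext (\<lambda>v. Poly_Mapping.single (u @ v) 1) b) a"
  by (simp add: fa_mult_def lext_def smul_sum)

lemma lin_fa_mult_left: "lin (\<lambda>a. fa_mult a b)"
  unfolding fa_mult_lext by (rule lext_lin)

lemma lin_fa_mult_right: "lin (fa_mult a)"
  unfolding fa_mult_lext
  by (rule linI) (simp_all add: lin_add[OF lext_lin] lin_smul[OF lext_lin] lext_fun_add lext_fun_smul)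

lemmas fa_mult_add = lin_add[OF lin_fa_mult_left] lin_add[OF lin_fa_mult_right]
lemmas fa_mult_diff = lin_diff[OF lin_fa_mult_left] lin_diff[OF lin_fa_mult_right]
lemmas fa_mult_neg = lin_neg[OF lin_fa_mult_left] lin_neg[OF lin_fa_mult_right]
lemmas fa_mult_zero = lin_zero[OF lin_fa_mult_left] lin_zero[OF lin_fa_mult_right]

lemma fa_mult_word [simp]: "fa_mult (fa_word u) (fa_word v) = (fa_word (u @ v) :: 'a::field fa)"
  by (simp add: fa_mult_lext fa_word_def)

lemma fa_mult_assoc: "fa_mult (fa_mult a b) c = (fa_mult a (fa_mult b c) :: 'a::field fa)"
proof -
  have 1: "fa_mult (fa_mult (fa_word u) (fa_word v)) c = fa_mult (fa_word u) (fa_mult (fa_word v) c)" for u v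
    by (rule lin_eqI[of "\<lambda>c. fa_mult (fa_mult (fa_word u) (fa_word v)) c"])
       (auto intro!: lin_comp[OF lin_fa_mult_right] lin_fa_mult_right simp: fa_word_def[symmetric])
  have 2: "fa_mult (fa_mult (fa_word u) b) c = fa_mult (fa_word u) (fa_mult b c)" for u
    by (rule lin_eqI[of "\<lambda>b. fa_mult (fa_mult (fa_word u) b) c"])
       (use 1 in \<open>auto intro!: lin_comp[OF lin_fa_mult_right] lin_comp[OF lin_fa_mult_left]
          lin_fa_mult_right lin_fa_mult_left simp: fa_word_def\<close>)
  show ?thesis
    by (rule lin_eqI[of "\<lambda>a. fa_mult (fa_mult a b) c"])
       (use 2 in \<open>auto intro!: lin_comp[OF lin_fa_mult_left] lin_fa_mult_left simp: fa_word_def\<close>)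
qed

lemma fa_mult_unit [simp]: "fa_mult (fa_word []) a = (a :: 'a::field fa)" "fa_mult a (fa_word []) = a"
  by (simp_all add: fa_mult_lext fa_word_def lext_ident)

text \<open>The type of the free algebra has a letter for every natural number, whereas
  \<open>Irel n\<close> is closed only under multiplication by words in the letters 1, ..., n-1.
  This subspace is the algebra that is meant.\<close>

definition fa_words :: "nat \<Rightarrow> 'a::field fa set" where
  "fa_words n = {a. \<forall>u\<in>keys a. is_word n u}"

lemma subspace_keys: "pm.subspace {f. \<forall>x\<in>keys f. P x}"
  unfolding pm.subspace_def
proof safe
  fix f g x
  assume "\<forall>x\<in>keys f. P x" "\<forall>x\<in>keys g. P x" "x \<in> keys (f + g)"
  then show "P x" using Poly_Mapping.keys_add[of f g] by blast
next
  fix f c x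
  assume "\<forall>x\<in>keys f. P x" "x \<in> keys (smul c f)"
  then show "P x" using keys_smul_subset[of c f] by blast
qed simp

lemma fa_words_subspace: "pm.subspace (fa_words n)"
  unfolding fa_words_def by (rule subspace_keys)

lemma fa_word_in_words: "is_word n u \<Longrightarrow> fa_word u \<in> fa_words n"
  by (simp add: fa_words_def fa_word_def)

lemma fa_mult_words:
  assumes "a \<in> fa_words n" "b \<in> fa_words n"
  shows "fa_mult a b \<in> fa_words n"
  unfolding fa_mult_lext
  by (intro lext_in_subspace fa_words_subspace)
     (use assms in \<open>auto simp: fa_words_def\<close>)

lemma fa_words_left_mult:
  assumes "pm.subspace U" "\<And>u. is_word n u \<Longrightarrow> fa_mult (fa_word u) b \<in> U" "a \<in> fa_words n"
  shows "fa_mult a b \<in> U"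
proof -
  have "fa_mult a b = fa_mult (lext (\<lambda>u. Poly_Mapping.single u 1) a) b" by (simp add: lext_ident)
  also have "\<dots> = lext (\<lambda>u. fa_mult (fa_word u) b) a"
    by (subst lin_lext_comp[OF lin_fa_mult_left]) (simp add: fa_word_def)
  finally show ?thesis using assms by (auto intro!: lext_in_subspace simp: fa_words_def)
qed

lemma fa_words_right_mult:
  assumes "pm.subspace U" "\<And>u. is_word n u \<Longrightarrow> fa_mult b (fa_word u) \<in> U" "a \<in> fa_words n"
  shows "fa_mult b a \<in> U"
proof -
  have "fa_mult b a = fa_mult b (lext (\<lambda>u. Poly_Mapping.single u 1) a)" by (simp add: lext_ident)
  also have "\<dots> = lext (\<lambda>u. fa_mult b (fa_word u)) a"
    by (subst lin_lext_comp[OF lin_fa_mult_right]) (simp add: fa_word_def)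
  finally show ?thesis using assms by (auto intro!: lext_in_subspace simp: fa_words_def)
qed

lemma Irel_subspace: "pm.subspace (Irel n :: 'a::field fa set)"
  unfolding Irel_def span_pm_eq by simp

lemma Irel_left:
  assumes a: "a \<in> fa_words n" and r: "r \<in> Irel n"
  shows "fa_mult a r \<in> Irel n"
proof (rule fa_words_left_mult[OF Irel_subspace _ a])
  fix w assume w: "is_word n w"
  show "fa_mult (fa_word w) r \<in> Irel n"
  proof (rule lin_span_image[OF lin_fa_mult_right _ Irel_subspace r[unfolded Irel_def span_pm_eq]])
    fix x :: "'a fa"
    assume "x \<in> {fa_mult (fa_mult (fa_word u) r) (fa_word v) | u v r. is_word n u \<and> is_word n v \<and> r \<in> rels n}"
    then obtain u v r where x: "x = fa_mult (fa_mult (fa_word u) r) (fa_word v)" "is_word n u" "is_word n v" "r \<in> rels n"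
      by blast
    then have "fa_mult (fa_word w) x = fa_mult (fa_mult (fa_word (w @ u)) r) (fa_word v)"
      by (simp add: fa_mult_assoc[symmetric])
    moreover have "is_word n (w @ u)" using w x by simp
    ultimately show "fa_mult (fa_word w) x \<in> Irel n"
      unfolding Irel_def span_pm_eq using x by (intro pm.span_base) blast
  qed
qed

lemma Irel_right:
  assumes a: "a \<in> fa_words n" and r: "r \<in> Irel n"
  shows "fa_mult r a \<in> Irel n"
proof (rule fa_words_right_mult[OF Irel_subspace _ a])
  fix w assume w: "is_word n w"
  show "fa_mult r (fa_word w) \<in> Irel n"
  proof (rule lin_span_image[OF lin_fa_mult_left _ Irel_subspace r[unfolded Irel_def span_pm_eq]])
    fix x :: "'a fa"
    assume "x \<in> {fa_mult (fa_mult (fa_word u) r) (fa_word v) | u v r. is_word n u \<and> is_word n v \<and> r \<in> rels n}"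
    then obtain u v r where x: "x = fa_mult (fa_mult (fa_word u) r) (fa_word v)" "is_word n u" "is_word n v" "r \<in> rels n"
      by blast
    then have "fa_mult x (fa_word w) = fa_mult (fa_mult (fa_word u) r) (fa_word (v @ w))"
      by (simp add: fa_mult_assoc)
    moreover have "is_word n (v @ w)" using w x by simp
    ultimately show "fa_mult x (fa_word w) \<in> Irel n"
      unfolding Irel_def span_pm_eq using x by (intro pm.span_base) blast
  qed
qed

lemma rels_Irel: "r \<in> rels n \<Longrightarrow> r \<in> (Irel n :: 'a::field fa set)"
  unfolding Irel_def span_pm_eq by (rule pm.span_base) (auto intro!: exI[of _ "[]"] exI[of _ r])

definition heq :: "nat \<Rightarrow> 'a::field fa \<Rightarrow> 'a fa \<Rightarrow> bool" where
  "heq n a b \<longleftrightarrow> a - b \<in> Irel n"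

lemma heq_refl [simp]: "heq n a a"
  by (simp add: heq_def pm.subspace_0[OF Irel_subspace])

lemma heq_sym: "heq n a b \<Longrightarrow> heq n b a"
  unfolding heq_def using pm.subspace_neg[OF Irel_subspace, of "a - b" n] by simp

lemma heq_trans [trans]: "heq n a b \<Longrightarrow> heq n b c \<Longrightarrow> heq n a c"
  unfolding heq_def using pm.subspace_add[OF Irel_subspace, of "a - b" n "b - c"] by simp

lemma heq_add: "heq n a b \<Longrightarrow> heq n c d \<Longrightarrow> heq n (a + c) (b + d)"
  unfolding heq_def using pm.subspace_add[OF Irel_subspace, of "a - b" n "c - d"] by (simp add: algebra_simps)

lemma heq_neg: "heq n a b \<Longrightarrow> heq n (- a) (- b)"
  unfolding heq_def using pm.subspace_neg[OF Irel_subspace, of "a - b" n] by (simp add: algebra_simps)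

lemma heq_left: "heq n a b \<Longrightarrow> c \<in> fa_words n \<Longrightarrow> heq n (fa_mult c a) (fa_mult c b)"
  unfolding heq_def by (simp add: fa_mult_diff[symmetric] Irel_left)

lemma heq_right: "heq n a b \<Longrightarrow> c \<in> fa_words n \<Longrightarrow> heq n (fa_mult a c) (fa_mult b c)"
  unfolding heq_def by (simp add: fa_mult_diff[symmetric] Irel_right)

section \<open>The elements pibar_i, their relations, and their products along reduced words\<close>

definition hb :: "nat \<Rightarrow> 'a::field fa" where
  "hb i = fa_gen i - fa_word []"

lemma fa_gen_eq: "fa_gen i = hb i + fa_word []"
  by (simp add: hb_def)

lemma hb_words: "i \<in> {1..<n} \<Longrightarrow> hb i \<in> fa_words n"
  unfolding hb_def fa_gen_def by (intro pm.subspace_diff fa_words_subspace fa_word_in_words) auto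

lemma gen_words: "i \<in> {1..<n} \<Longrightarrow> fa_gen i \<in> fa_words n"
  unfolding fa_gen_def by (intro fa_word_in_words) auto

lemma hb_idem: "i \<in> {1..<n} \<Longrightarrow> heq n (fa_mult (hb i) (hb i)) (- hb i)"
proof -
  assume i: "i \<in> {1..<n}"
  have "fa_mult (hb i) (hb i) - - hb i = fa_word [i, i] - (fa_word [i] :: 'a fa)"
    by (simp add: hb_def fa_gen_def fa_mult_diff)
  moreover have "fa_word [i, i] - (fa_word [i] :: 'a fa) \<in> rels n" using i unfolding rels_def by blast
  ultimately show ?thesis unfolding heq_def using rels_Irel by metis
qed

lemma hb_far:
  assumes "i \<in> {1..<n}" "j \<in> {1..<n}" "Suc i < j"
  shows "heq n (fa_mult (hb i) (hb j)) (fa_mult (hb j) (hb i))"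
proof -
  have "fa_mult (hb i) (hb j) - fa_mult (hb j) (hb i) = fa_word [i, j] - (fa_word [j, i] :: 'a fa)"
    by (simp add: hb_def fa_gen_def fa_mult_diff)
  moreover have "fa_word [i, j] - (fa_word [j, i] :: 'a fa) \<in> rels n" using assms unfolding rels_def by blast
  ultimately show ?thesis unfolding heq_def using rels_Irel by metis
qed

lemma hb_braid:
  assumes "i \<in> {1..<n}" "Suc i < n"
  shows "heq n (fa_mult (hb i) (fa_mult (hb (Suc i)) (hb i))) (fa_mult (hb (Suc i)) (fa_mult (hb i) (hb (Suc i))))"
proof -
  let ?j = "Suc i"
  \<comment> \<open>In the expansion the words with two distinct letters cancel; what remains
    besides the braid relation is a difference of two quadratic relations.\<close>
  have "fa_mult (hb i) (fa_mult (hb ?j) (hb i)) - fa_mult (hb ?j) (fa_mult (hb i) (hb ?j))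
     = (fa_word [i, ?j, i] - fa_word [?j, i, ?j]) - (fa_word [i,i] - fa_word [i])
       + (fa_word [?j,?j] - (fa_word [?j] :: 'a fa))"
    by (simp add: hb_def fa_gen_def fa_mult_diff)
  moreover have "fa_word [i, ?j, i] - (fa_word [?j, i, ?j] :: 'a fa) \<in> Irel n" "fa_word [i,i] - (fa_word [i] :: 'a fa) \<in> Irel n"
     "fa_word [?j,?j] - (fa_word [?j] :: 'a fa) \<in> Irel n"
    by (rule rels_Irel, use assms in \<open>auto simp: rels_def\<close>)+
  ultimately show ?thesis unfolding heq_def
    using pm.subspace_add[OF Irel_subspace] pm.subspace_diff[OF Irel_subspace] by metis
qed

definition bw :: "nat list \<Rightarrow> 'a::field fa" where
  "bw ws = foldr (\<lambda>i x. fa_mult (hb i) x) ws (fa_word [])"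

lemma bw_simps [simp]: "bw [] = fa_word []" "bw (i # ws) = fa_mult (hb i) (bw ws)"
  by (simp_all add: bw_def)

lemma bw_append: "bw (us @ vs) = fa_mult (bw us) (bw vs)"
  by (induction us) (simp_all add: fa_mult_assoc)

lemma bw_words: "is_word n ws \<Longrightarrow> bw ws \<in> fa_words n"
  by (induction ws) (auto intro!: fa_mult_words hb_words fa_word_in_words)

lemma fa_pibar_w_eq: "fa_pibar_w n w = bw (rw n w)"
  by (simp add: fa_pibar_w_def bw_def hb_def)

lemma fa_pi_w_eq: "fa_pi_w n w = (fa_word (rw n w) :: 'a::field fa)"
proof -
  have "foldr (\<lambda>i x. fa_mult (fa_gen i) x) ws (fa_word []) = (fa_word ws :: 'a fa)" for ws
    by (induction ws) (simp_all add: fa_gen_def)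
  then show ?thesis by (simp add: fa_pi_w_def)
qed

lemma bw_reduced:
  assumes "red n w us" "red n w vs"
  shows "heq n (bw us) (bw vs :: 'a::field fa)"
proof (rule matsumoto[of "\<lambda>u v. heq n (bw u) (bw v :: 'a fa)", OF _ _ _ _ _ _ assms])
  fix i u v assume "i \<in> {1..<n}" "heq n (bw u) (bw v :: 'a fa)"
  then show "heq n (bw (i # u)) (bw (i # v) :: 'a fa)" by (simp only: bw_simps heq_left hb_words)
next
  fix i j u assume "i \<in> {1..<n}" "j \<in> {1..<n}" "Suc i < j" "is_word n u"
  then show "heq n (bw (i # j # u)) (bw (j # i # u) :: 'a fa)"
    using heq_right[OF hb_far bw_words] by (simp add: fa_mult_assoc)
next
  fix i u assume "i \<in> {1..<n}" "Suc i < n" "is_word n u"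
  then show "heq n (bw (i # Suc i # i # u)) (bw (Suc i # i # Suc i # u) :: 'a fa)"
    using heq_right[OF hb_braid bw_words] by (simp add: fa_mult_assoc)
qed (auto intro: heq_sym heq_trans)

lemma fa_word_reduced:
  assumes "red n w us" "red n w vs"
  shows "heq n (fa_word us) (fa_word vs :: 'a::field fa)"
proof (rule matsumoto[of "\<lambda>u v. heq n (fa_word u) (fa_word v :: 'a fa)", OF _ _ _ _ _ _ assms])
  fix i u v assume "i \<in> {1..<n}" "heq n (fa_word u) (fa_word v :: 'a fa)"
  then show "heq n (fa_word (i # u)) (fa_word (i # v) :: 'a fa)"
    using heq_left[of n "fa_word u" "fa_word v" "fa_word [i]"] by (simp add: fa_word_in_words)
next
  fix i j u assume *: "i \<in> {1..<n}" "j \<in> {1..<n}" "Suc i < j" "is_word n u"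
  then have "(heq n :: 'a fa \<Rightarrow> 'a fa \<Rightarrow> bool) (fa_word [i,j]) (fa_word [j,i] :: 'a fa)"
    unfolding heq_def by (intro rels_Irel) (unfold rels_def, blast)
  from heq_right[OF this fa_word_in_words[OF *(4)]]
  show "heq n (fa_word (i # j # u)) (fa_word (j # i # u) :: 'a fa)" by simp
next
  fix i u assume *: "i \<in> {1..<n}" "Suc i < n" "is_word n u"
  then have "(heq n :: 'a fa \<Rightarrow> 'a fa \<Rightarrow> bool) (fa_word [i,Suc i,i]) (fa_word [Suc i,i,Suc i] :: 'a fa)"
    unfolding heq_def by (intro rels_Irel) (auto simp: rels_def)
  from heq_right[OF this fa_word_in_words[OF *(3)]]
  show "heq n (fa_word (i # Suc i # i # u)) (fa_word (Suc i # i # Suc i # u) :: 'a fa)" by simp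
qed (auto intro: heq_sym heq_trans)

abbreviation (input) pb :: "nat \<Rightarrow> (nat \<Rightarrow> nat) \<Rightarrow> 'a::field fa" where "pb n w \<equiv> fa_pibar_w n w"

lemma pb_red: "red n w ws \<Longrightarrow> heq n (pb n w) (bw ws)"
  unfolding fa_pibar_w_eq by (rule bw_reduced[OF red_rw[OF red_perm]])

lemma pb_words: "perm n w \<Longrightarrow> pb n w \<in> fa_words n"
  unfolding fa_pibar_w_eq using red_rw[of w n] by (intro bw_words) (simp add: red_def)

lemma pb_left_up:
  assumes w: "perm n w" and i: "i \<in> {1..<n}" and up: "inv w i < inv w (Suc i)"
  shows "heq n (fa_mult (hb i) (pb n w)) (pb n (sg i \<circ> w))"
proof -
  have "red n (sg i \<circ> w) (i # rw n w)"
    using red_rw[OF w] ninv_left_up[OF w i up] i by (simp add: red_def)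
  from heq_sym[OF pb_red[OF this]] show ?thesis by (simp add: fa_pibar_w_eq)
qed

lemma pb_left_down:
  assumes w: "perm n w" and i: "i \<in> {1..<n}" and d: "inv w (Suc i) < inv w i"
  shows "heq n (fa_mult (hb i) (pb n w)) (- pb n w :: 'a::field fa)"
proof -
  let ?z = "rw n (sg i \<circ> w)"
  have z: "red n (sg i \<circ> w) ?z" by (rule red_rw[OF perm_sg_comp[OF w i]])
  have eq: "heq n (pb n w) (bw (i # ?z) :: 'a fa)" by (rule pb_red[OF red_ConsI[OF z i w d]])
  have zw: "(bw ?z :: 'a fa) \<in> fa_words n" using z by (intro bw_words) (simp add: red_def)
  have "(heq n :: 'a fa \<Rightarrow> 'a fa \<Rightarrow> bool) (fa_mult (hb i) (pb n w)) (fa_mult (hb i) (bw (i # ?z)) :: 'a fa)" by (rule heq_left[OF eq hb_words[OF i]])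
  also have "fa_mult (hb i) (bw (i # ?z)) = fa_mult (fa_mult (hb i) (hb i)) (bw ?z)" by (simp add: fa_mult_assoc)
  also have "(heq n :: 'a fa \<Rightarrow> 'a fa \<Rightarrow> bool) \<dots> (fa_mult (- hb i) (bw ?z))" by (rule heq_right[OF hb_idem[OF i] zw])
  also have "fa_mult (- hb i) (bw ?z) = - bw (i # ?z)" by (simp add: fa_mult_neg)
  also have "(heq n :: 'a fa \<Rightarrow> 'a fa \<Rightarrow> bool) \<dots> (- pb n w)" by (rule heq_neg[OF heq_sym[OF eq]])
  finally show ?thesis .
qed

lemma pb_right_up:
  assumes w: "perm n w" and i: "i \<in> {1..<n}" and up: "i \<notin> pDes n w"
  shows "heq n (fa_mult (pb n w) (hb i)) (pb n (w \<circ> sg i))"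
proof -
  have "w i < w (Suc i)" using up i perm_neq[OF w, of i] by (simp add: pDes_def)
  from red_snoc[OF red_rw[OF w] i this] have "red n (w \<circ> sg i) (rw n w @ [i])" .
  from heq_sym[OF pb_red[OF this]] show ?thesis by (simp add: fa_pibar_w_eq bw_append)
qed

lemma pb_right_factor:
  assumes w: "perm n w" and i: "i \<in> pDes n w"
  obtains z where "is_word n z" "(heq n :: 'a::field fa \<Rightarrow> 'a fa \<Rightarrow> bool) (pb n w) (fa_mult (bw z) (hb i))"
proof -
  let ?u = "w \<circ> sg i"
  have i': "i \<in> {1..<n}" and d: "w (Suc i) < w i" using i by (auto simp: pDes_def)
  have z: "red n ?u (rw n ?u)" by (rule red_rw[OF perm_comp_sg[OF w i']])
  have ww: "?u \<circ> sg i = w" by (simp add: fun_eq_iff)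
  have "red n (?u \<circ> sg i) (rw n ?u @ [i])" by (rule red_snoc[OF z i']) (use d in simp)
  then have "red n w (rw n ?u @ [i])" unfolding ww .
  from pb_red[OF this] have "(heq n :: 'a fa \<Rightarrow> 'a fa \<Rightarrow> bool) (pb n w) (fa_mult (bw (rw n ?u)) (hb i))" by (simp add: bw_append)
  moreover have "is_word n (rw n ?u)" using z by (simp only: red_def)
  ultimately show ?thesis using that by blast
qed

lemma pb_right_down:
  assumes w: "perm n w" and i: "i \<in> pDes n w"
  shows "heq n (fa_mult (pb n w) (hb i)) (- pb n w :: 'a::field fa)"
proof -
  have i': "i \<in> {1..<n}" using i by (auto simp: pDes_def)
  obtain z where z: "is_word n z" "(heq n :: 'a fa \<Rightarrow> 'a fa \<Rightarrow> bool) (pb n w) (fa_mult (bw z) (hb i) :: 'a fa)" by (rule pb_right_factor[OF w i])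
  have "(heq n :: 'a fa \<Rightarrow> 'a fa \<Rightarrow> bool) (fa_mult (pb n w) (hb i)) (fa_mult (fa_mult (bw z) (hb i)) (hb i) :: 'a fa)"
    by (rule heq_right[OF z(2) hb_words[OF i']])
  also have "fa_mult (fa_mult (bw z) (hb i)) (hb i) = fa_mult (bw z) (fa_mult (hb i) (hb i))" by (simp add: fa_mult_assoc)
  also have "(heq n :: 'a fa \<Rightarrow> 'a fa \<Rightarrow> bool) \<dots> (fa_mult (bw z) (- hb i))" by (rule heq_left[OF hb_idem[OF i'] bw_words[OF z(1)]])
  also have "fa_mult (bw z) (- hb i) = - fa_mult (bw z) (hb i)" by (simp add: fa_mult_neg)
  also have "(heq n :: 'a fa \<Rightarrow> 'a fa \<Rightarrow> bool) \<dots> (- pb n w)" by (rule heq_neg[OF heq_sym[OF z(2)]])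
  finally show ?thesis .
qed

text \<open>pibar_w absorbs pibar_i on the right with a sign, so multiplying it by pi_i = pibar_i +
  1 gives - pibar_w + pibar_w.\<close>

lemma pb_gen_zero: "perm n w \<Longrightarrow> i \<in> pDes n w \<Longrightarrow> fa_mult (pb n w) (fa_gen i) \<in> Irel n"
  using heq_add[OF pb_right_down[of w n i], of "pb n w" "pb n w"]
  by (simp add: fa_gen_eq fa_mult_add heq_def)

lemma pb_gen_up:
  "perm n w \<Longrightarrow> i \<in> {1..<n} \<Longrightarrow> i \<notin> pDes n w \<Longrightarrow> heq n (fa_mult (pb n w) (fa_gen i)) (pb n w + pb n (w \<circ> sg i))"
  using heq_add[OF pb_right_up[of w n i], of "pb n w" "pb n w"]
  by (simp add: fa_gen_eq fa_mult_add add.commute)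

text \<open>The length filtration modulo the relations. Right multiplication by a generator either
  kills a pibar_v or adds a longer term, so the filtration is stable and congruences modulo
  \<open>longer\<close> survive it.\<close>

definition longer :: "nat \<Rightarrow> (nat \<Rightarrow> nat) \<Rightarrow> 'a::field fa set" where
  "longer n w = set_add (pm.span {pb n v | v. perm n v \<and> ninv n w < ninv n v}) (Irel n)"

lemma longer_subspace: "pm.subspace (longer n w)"
  unfolding longer_def by (intro subspace_set_add Irel_subspace pm.subspace_span)

lemma Irel_longer: "r \<in> Irel n \<Longrightarrow> r \<in> longer n w"
  unfolding longer_def by (intro set_add_right pm.subspace_span)

lemma pb_longer: "perm n v \<Longrightarrow> ninv n w < ninv n v \<Longrightarrow> pb n v \<in> longer n w"
  unfolding longer_def by (intro set_add_left Irel_subspace pm.span_base) blast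

lemma longer_heq: "heq n a b \<Longrightarrow> b \<in> longer n w \<Longrightarrow> a \<in> longer n w"
  unfolding heq_def using pm.subspace_add[OF longer_subspace Irel_longer, of "a - b" n b w] by simp

lemma longer_gen:
  assumes i: "i \<in> {1..<n}" and y: "y \<in> longer n w"
  shows "fa_mult y (fa_gen i) \<in> longer n w"
proof -
  obtain s r where s: "s \<in> pm.span {pb n v | v. perm n v \<and> ninv n w < ninv n v}" and r: "r \<in> Irel n" and y: "y = s + r"
    using y unfolding longer_def set_add_eq by blast
  have "fa_mult s (fa_gen i) \<in> longer n w"
  proof (rule lin_span_image[OF lin_fa_mult_left _ longer_subspace s])
    fix x :: "'a fa" assume "x \<in> {pb n v | v. perm n v \<and> ninv n w < ninv n v}"
    then obtain v where x: "x = pb n v" and v: "perm n v" "ninv n w < ninv n v" by blast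
    show "fa_mult x (fa_gen i) \<in> longer n w"
    proof (cases "i \<in> pDes n v")
      case True
      then show ?thesis unfolding x by (intro Irel_longer pb_gen_zero v)
    next
      case False
      then have "v i < v (Suc i)" using i perm_neq[OF v(1), of i] by (simp add: pDes_def)
      then have "ninv n w < ninv n (v \<circ> sg i)" using ninv_right_up[OF v(1) i] v by simp
      then show ?thesis unfolding x
        by (intro longer_heq[OF pb_gen_up[OF v(1) i False]] pm.subspace_add longer_subspace pb_longer v perm_comp_sg i)
    qed
  qed
  moreover have "fa_mult r (fa_gen i) \<in> longer n w" by (intro Irel_longer Irel_right gen_words i r)
  ultimately show ?thesis unfolding y by (simp add: fa_mult_add pm.subspace_add[OF longer_subspace])
qed

lemma pb_word_longer:
  assumes w: "perm n w" and us: "is_word n us" "set us \<inter> pDes n w = {}"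
  shows "fa_mult (pb n w) (fa_word us) - pb n w \<in> (longer n w :: 'a::field fa set)"
  using us
proof (induction us rule: rev_induct)
  case Nil
  show ?case by (simp add: pm.subspace_0[OF longer_subspace])
next
  case (snoc i us)
  have i: "i \<in> {1..<n}" "i \<notin> pDes n w" using snoc.prems by auto
  have IH: "fa_mult (pb n w) (fa_word us) - pb n w \<in> (longer n w :: 'a::field fa set)" using snoc by auto
  have "fa_mult (fa_mult (pb n w) (fa_word us) - pb n w) (fa_gen i) \<in> (longer n w :: 'a::field fa set)" by (rule longer_gen[OF i(1) IH])
  moreover have "fa_mult (pb n w) (fa_gen i) - pb n w \<in> (longer n w :: 'a::field fa set)"
  proof -
    have "w i < w (Suc i)" using i perm_neq[OF w, of i] by (simp add: pDes_def)
    then have "ninv n w < ninv n (w \<circ> sg i)" using ninv_right_up[OF w i(1)] by simp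
    then have "pb n (w \<circ> sg i) \<in> (longer n w :: 'a::field fa set)" by (intro pb_longer perm_comp_sg w i)
    moreover have "(heq n :: 'a fa \<Rightarrow> 'a fa \<Rightarrow> bool) (fa_mult (pb n w) (fa_gen i) - pb n w) (pb n (w \<circ> sg i))"
      using pb_gen_up[OF w i] unfolding heq_def by (simp add: algebra_simps)
    ultimately show ?thesis by (rule longer_heq[rotated])
  qed
  ultimately have "fa_mult (fa_mult (pb n w) (fa_word us) - pb n w) (fa_gen i) + (fa_mult (pb n w) (fa_gen i) - pb n w) \<in> (longer n w :: 'a::field fa set)"
    by (rule pm.subspace_add[OF longer_subspace])
  then show ?case by (simp add: fa_mult_diff fa_mult_assoc fa_gen_def)
qed

abbreviation (input) piw0 :: "nat \<Rightarrow> nat set \<Rightarrow> 'a::field fa" where "piw0 n E \<equiv> fa_pi_w n (w0set n E)"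

lemma piw0_words: "E \<subseteq> {1..<n} \<Longrightarrow> piw0 n E \<in> fa_words n"
  unfolding fa_pi_w_eq using red_rw[OF w0set_perm[of E n]] by (intro fa_word_in_words) (simp add: red_def)

text \<open>The word chosen by \<open>rw\<close> need not be the one built from letters in E, but
  two reduced words of the same permutation are congruent.\<close>

lemma piw0_word:
  assumes E: "E \<subseteq> {1..<n}"
  obtains ws where "is_word n ws" "set ws \<subseteq> E" "heq n (piw0 n E) (fa_word ws)"
proof -
  obtain ws where ws: "red n (w0set n E) ws" "set ws \<subseteq> E" by (rule w0set_props[OF E])
  have "(heq n :: 'a fa \<Rightarrow> 'a fa \<Rightarrow> bool) (piw0 n E) (fa_word ws)" unfolding fa_pi_w_eq
    by (rule fa_word_reduced[OF red_rw[OF w0set_perm[OF E]] ws(1)])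
  moreover have "is_word n ws" using ws(1) by (simp only: red_def)
  ultimately show ?thesis using that ws by blast
qed

lemma piw0_left:
  assumes E: "E \<subseteq> {1..<n}" and j: "j \<in> E"
  obtains z where "is_word n z" "(heq n :: 'a::field fa \<Rightarrow> 'a fa \<Rightarrow> bool) (piw0 n E) (fa_mult (fa_gen j) (fa_word z))"
proof -
  let ?w = "w0set n E"
  have w: "perm n ?w" by (rule w0set_perm[OF E])
  have jn: "j \<in> {1..<n}" using E j by blast
  have d: "inv ?w (Suc j) < inv ?w j" by (rule w0set_props[OF E]) (use j in blast)
  have z: "red n (sg j \<circ> ?w) (rw n (sg j \<circ> ?w))" by (rule red_rw[OF perm_sg_comp[OF w jn]])
  have "(heq n :: 'a fa \<Rightarrow> 'a fa \<Rightarrow> bool) (piw0 n E) (fa_word (j # rw n (sg j \<circ> ?w)))" unfolding fa_pi_w_eq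
    by (rule fa_word_reduced[OF red_rw[OF w] red_ConsI[OF z jn w d]])
  moreover have "is_word n (rw n (sg j \<circ> ?w))" using z by (simp only: red_def)
  ultimately show ?thesis using that by (simp add: fa_gen_def)
qed

text \<open>Every j in E is a left descent of w_0(E), so pi_{w_0(E)} can be written with pi_j in
  front, and pibar_w annihilates pi_j when j is a descent of \<open>w\<close>.\<close>

lemma pb_piw0_zero:
  assumes w: "perm n w" and E: "E \<subseteq> {1..<n}" and j: "j \<in> E" "j \<in> pDes n w"
  shows "fa_mult (pb n w) (piw0 n E) \<in> (Irel n :: 'a::field fa set)"
proof -
  obtain z where z: "is_word n z" "(heq n :: 'a fa \<Rightarrow> 'a fa \<Rightarrow> bool) (piw0 n E) (fa_mult (fa_gen j) (fa_word z) :: 'a fa)" by (rule piw0_left[OF E j(1)])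
  have "(heq n :: 'a fa \<Rightarrow> 'a fa \<Rightarrow> bool) (fa_mult (pb n w) (piw0 n E)) (fa_mult (pb n w) (fa_mult (fa_gen j) (fa_word z)))"
    by (rule heq_left[OF z(2) pb_words[OF w]])
  also have "\<dots> = fa_mult (fa_mult (pb n w) (fa_gen j)) (fa_word z)" by (simp add: fa_mult_assoc)
  also have "(heq n :: 'a fa \<Rightarrow> 'a fa \<Rightarrow> bool) \<dots> 0" unfolding heq_def diff_0_right by (intro Irel_right fa_word_in_words z pb_gen_zero w j)
  finally show ?thesis by (simp add: heq_def)
qed

text \<open>The unitriangularity behind both changes of basis: no letter of w_0(E) is a descent of
  \<open>w\<close>, so each of them reproduces pibar_w up to longer terms.\<close>

lemma pb_piw0_longer:
  assumes w: "perm n w" and E: "E \<subseteq> {1..<n}" "E \<inter> pDes n w = {}"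
  shows "fa_mult (pb n w) (piw0 n E) - pb n w \<in> (longer n w :: 'a::field fa set)"
proof -
  obtain ws where ws: "is_word n ws" "set ws \<subseteq> E" "heq n (piw0 n E) (fa_word ws :: 'a fa)" by (rule piw0_word[OF E(1)])
  have "(heq n :: 'a fa \<Rightarrow> 'a fa \<Rightarrow> bool) (fa_mult (pb n w) (piw0 n E) - pb n w) (fa_mult (pb n w) (fa_word ws) - pb n w)"
    using heq_left[OF ws(3) pb_words[OF w]] by (simp add: heq_def)
  moreover have "fa_mult (pb n w) (fa_word ws) - pb n w \<in> longer n w"
    by (rule pb_word_longer[OF w ws(1)]) (use ws E in blast)
  ultimately show ?thesis by (rule longer_heq)
qed

section \<open>The left ideals P_{alpha,beta}\<close>

lemma Pset_span:
  "Pset n D1 D2 = set_add (pm.span {fa_mult (fa_word u) (fa_mult (pb n (w0set n D1)) (piw0 n ({1..<n} - D2))) | u. is_word n u}) (Irel n)"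
  unfolding Pset_def span_pm_eq ..

lemma Pset_subspace: "pm.subspace (Pset n D1 D2 :: 'a::field fa set)"
  unfolding Pset_span by (intro subspace_set_add Irel_subspace pm.subspace_span)

lemma Irel_Pset: "r \<in> Irel n \<Longrightarrow> r \<in> (Pset n D1 D2 :: 'a::field fa set)"
  unfolding Pset_span by (intro set_add_right pm.subspace_span)

lemma fa_act_lin: "lin (fa_act i)"
  unfolding fa_act_def[abs_def] by (rule lin_fa_mult_right)

lemma fa_act_Irel: "i \<in> {1..<n} \<Longrightarrow> r \<in> Irel n \<Longrightarrow> fa_act i r \<in> (Irel n :: 'a::field fa set)"
  unfolding fa_act_def by (intro Irel_left gen_words)

lemma fa_act_Pset:
  assumes i: "i \<in> {1..<n}" and y: "y \<in> Pset n D1 D2"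
  shows "fa_act i y \<in> (Pset n D1 D2 :: 'a::field fa set)"
proof -
  let ?G = "{fa_mult (fa_word u) (fa_mult (pb n (w0set n D1)) (piw0 n ({1..<n} - D2))) | u. is_word n u}"
  obtain s r where s: "s \<in> pm.span ?G" and r: "r \<in> Irel n" and y: "y = s + r"
    using y unfolding Pset_span set_add_eq by blast
  have "fa_act i s \<in> Pset n D1 D2"
  proof (rule lin_span_image[OF fa_act_lin _ Pset_subspace s])
    fix x assume "x \<in> ?G"
    then obtain u where u: "is_word n u" "x = fa_mult (fa_word u) (fa_mult (pb n (w0set n D1)) (piw0 n ({1..<n} - D2)))" by blast
    have "fa_act i x = fa_mult (fa_word (i # u)) (fa_mult (pb n (w0set n D1)) (piw0 n ({1..<n} - D2)))"
      unfolding u(2) fa_act_def fa_gen_def by (simp add: fa_mult_assoc[symmetric])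
    moreover have "is_word n (i # u)" using i u by simp
    ultimately show "fa_act i x \<in> Pset n D1 D2" unfolding Pset_span
      by (intro set_add_left Irel_subspace pm.span_base) blast
  qed
  moreover have "fa_act i r \<in> Pset n D1 D2" by (intro Irel_Pset fa_act_Irel i r)
  ultimately show ?thesis unfolding y by (simp add: lin_add[OF fa_act_lin] pm.subspace_add[OF Pset_subspace])
qed

text \<open>Since Des(w) contains D1, \<open>w\<close> = u w_0(D1) with lengths adding up, hence
  pibar_w = pibar_u pibar_{w_0(D1)} modulo the relations.\<close>

lemma pb_in_Pset:
  assumes w: "perm n w" and D: "D1 \<subseteq> pDes n w"
  shows "fa_mult (pb n w) (piw0 n ({1..<n} - D2)) \<in> (Pset n D1 D2 :: 'a::field fa set)"
proof -
  let ?v = "w0set n D1" and ?P = "piw0 n ({1..<n} - D2) :: 'a fa"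
  have D1: "D1 \<subseteq> {1..<n}" using D pDes_sub by blast
  have v: "perm n ?v" by (rule w0set_perm[OF D1])
  have Pw: "?P \<in> fa_words n" by (rule piw0_words) auto
  define u where "u = w \<circ> inv ?v"
  have u: "perm n u" unfolding u_def by (intro permutes_compose permutes_inv w v)
  have l: "ninv n u + ninv n ?v = ninv n w" unfolding u_def by (rule ninv_divide_w0set[OF w D])
  have uv: "u \<circ> ?v = w" unfolding u_def by (simp only: comp_assoc permutes_inv_o[OF v] comp_id)
  have ru: "red n u (rw n u)" and rv: "red n ?v (rw n ?v)" using red_rw u v by auto
  have r: "red n w (rw n u @ rw n ?v)"
    using ru rv l uv unfolding red_def by (simp add: word_perm_append)
  have "(heq n :: 'a fa \<Rightarrow> 'a fa \<Rightarrow> bool) (pb n w) (fa_mult (bw (rw n u)) (pb n ?v) :: 'a fa)" using pb_red[OF r] by (simp add: bw_append fa_pibar_w_eq)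
  from heq_right[OF this Pw] have e: "fa_mult (pb n w) ?P - fa_mult (bw (rw n u)) (fa_mult (pb n ?v) ?P) \<in> Irel n"
    by (simp add: heq_def fa_mult_assoc)
  have "fa_mult (bw (rw n u)) (fa_mult (pb n ?v) ?P) \<in> Pset n D1 D2"
  proof (rule fa_words_left_mult[OF Pset_subspace])
    show "bw (rw n u) \<in> fa_words n" using ru by (intro bw_words) (simp only: red_def)
    fix z assume "is_word n z"
    then show "fa_mult (fa_word z) (fa_mult (pb n ?v) ?P) \<in> Pset n D1 D2"
      unfolding Pset_span by (intro set_add_left Irel_subspace pm.span_base) blast
  qed
  from pm.subspace_add[OF Pset_subspace Irel_Pset[OF e] this] show ?thesis by simp
qed

text \<open>Left multiplication by pibar_i turns pibar_w into pibar_{s_i w} or - pibar_w, and in the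
  first case the descent set only grows, so it keeps containing D1. As soon as a descent leaves D2,
  the factor pi_{w_0} on the right kills the product, so the span is closed.\<close>

lemma Pset_spanned:
  assumes D: "D1 \<subseteq> D2" "D2 \<subseteq> {1..<n}"
  shows "(Pset n D1 D2 :: 'a::field fa set) \<subseteq> set_add (pm.span ((\<lambda>w. fa_mult (pb n w) (piw0 n ({1..<n} - D2))) `
           {w. perm n w \<and> D1 \<subseteq> pDes n w \<and> pDes n w \<subseteq> D2})) (Irel n)"
    (is "_ \<subseteq> ?S")
proof -
  let ?P = "piw0 n ({1..<n} - D2) :: 'a fa"
  let ?W = "{w. perm n w \<and> D1 \<subseteq> pDes n w \<and> pDes n w \<subseteq> D2}"
  have S: "pm.subspace ?S" by (intro subspace_set_add Irel_subspace pm.subspace_span)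
  have IS: "r \<in> Irel n \<Longrightarrow> r \<in> ?S" for r by (intro set_add_right pm.subspace_span)
  have heqS: "heq n a b \<Longrightarrow> b \<in> ?S \<Longrightarrow> a \<in> ?S" for a b
    unfolding heq_def using pm.subspace_add[OF S IS, of "a - b" b] by simp
  have D1n: "D1 \<subseteq> {1..<n}" using D by blast
  have Pw: "?P \<in> fa_words n" by (rule piw0_words) auto
  have base: "fa_mult (pb n w) ?P \<in> ?S" if w: "perm n w" "D1 \<subseteq> pDes n w" for w
  proof (cases "pDes n w \<subseteq> D2")
    case True
    then show ?thesis using w by (intro set_add_left Irel_subspace pm.span_base imageI) blast
  next
    case False
    then obtain j where j: "j \<in> pDes n w" "j \<notin> D2" by blast
    then have "j \<in> {1..<n} - D2" using pDes_sub by blast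
    then show ?thesis using j by (intro IS pb_piw0_zero[OF w(1)]) auto
  qed
  have gen: "fa_mult (fa_gen i) y \<in> ?S" if i: "i \<in> {1..<n}" and y: "y \<in> ?S" for i y
  proof -
    obtain s r where s: "s \<in> pm.span ((\<lambda>w. fa_mult (pb n w) ?P) ` ?W)" and r: "r \<in> Irel n" and y: "y = s + r"
      using y unfolding set_add_eq by blast
    have "fa_mult (fa_gen i) s \<in> ?S"
    proof (rule lin_span_image[OF lin_fa_mult_right _ S s])
      fix x assume "x \<in> (\<lambda>w. fa_mult (pb n w) ?P) ` ?W"
      then obtain w where w: "perm n w" "D1 \<subseteq> pDes n w" and x: "x = fa_mult (pb n w) ?P" by blast
      have "fa_mult (hb i) x \<in> ?S"
      proof (cases "inv w i < inv w (Suc i)")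
        case True
        have "(heq n :: 'a fa \<Rightarrow> 'a fa \<Rightarrow> bool) (fa_mult (hb i) x) (fa_mult (pb n (sg i \<circ> w)) ?P)"
          unfolding x using heq_right[OF pb_left_up[OF w(1) i True] Pw] by (simp add: fa_mult_assoc)
        moreover have "D1 \<subseteq> pDes n (sg i \<circ> w)" using pDes_left_mono[OF w(1) i True] w by blast
        ultimately show ?thesis by (rule heqS[OF _ base[OF perm_sg_comp[OF w(1) i]]])
      next
        case False
        then have "inv w (Suc i) < inv w i" using perm_neq[OF permutes_inv[OF w(1)], of i] by linarith
        then have "(heq n :: 'a fa \<Rightarrow> 'a fa \<Rightarrow> bool) (fa_mult (hb i) x) (- x)"
          unfolding x using heq_right[OF pb_left_down[OF w(1) i] Pw] by (simp add: fa_mult_assoc fa_mult_neg)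
        then show ?thesis unfolding x by (rule heqS[OF _ pm.subspace_neg[OF S base[OF w]]])
      qed
      moreover have "x \<in> ?S" unfolding x by (rule base[OF w])
      ultimately show "fa_mult (fa_gen i) x \<in> ?S" unfolding fa_gen_eq
        by (simp add: fa_mult_add pm.subspace_add[OF S])
    qed
    moreover have "fa_mult (fa_gen i) r \<in> ?S" by (intro IS Irel_left gen_words i r)
    ultimately show ?thesis unfolding y by (simp add: fa_mult_add pm.subspace_add[OF S])
  qed
  have words: "fa_mult (fa_word u) y \<in> ?S" if "is_word n u" "y \<in> ?S" for u y
    using that
  proof (induction u)
    case (Cons i u)
    then have "fa_mult (fa_gen i) (fa_mult (fa_word u) y) \<in> ?S" by (intro gen) auto
    then show ?case by (simp add: fa_gen_def fa_mult_assoc[symmetric])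
  qed simp
  have "fa_mult (pb n (w0set n D1)) ?P \<in> ?S"
    by (intro base w0set_perm D1n) (simp add: pDes_w0set[OF D1n])
  then show ?thesis unfolding Pset_span
    by (intro set_add_minimal S pm.span_minimal) (auto intro: words IS)
qed

section \<open>Modules over the 0-Hecke algebra\<close>

text \<open>Evaluation at \<open>x\<close> as a linear map on the free algebra. It vanishes on
  \<open>Irel n\<close> when \<open>x\<close> lies in a module, and the homomorphisms out of the
  left ideals are restrictions of it.\<close>

definition act :: "(nat \<Rightarrow> ('x \<Rightarrow>\<^sub>0 'a::field) \<Rightarrow> ('x \<Rightarrow>\<^sub>0 'a)) \<Rightarrow> ('x \<Rightarrow>\<^sub>0 'a) \<Rightarrow> 'a fa \<Rightarrow> ('x \<Rightarrow>\<^sub>0 'a)" where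
  "act T x = lext (\<lambda>u. foldr T u x)"

lemma act_lin: "lin (act T x)"
  unfolding act_def by (rule lext_lin)

lemma act_word [simp]: "act T x (fa_word u) = foldr T u x"
  by (simp add: act_def fa_word_def)

lemma act_mult:
  assumes T: "\<And>i. lin (T i)"
  shows "act T x (fa_mult a b) = act T (act T x b) a"
proof -
  have f: "lin (\<lambda>y. foldr T u y)" for u by (rule lin_foldr[OF T])
  have 1: "act T x (fa_mult (fa_word u) b) = foldr T u (act T x b)" for u
  proof (rule lin_eqI[of "\<lambda>b. act T x (fa_mult (fa_word u) b)" "\<lambda>b. foldr T u (act T x b)"])
    show "lin (\<lambda>b. act T x (fa_mult (fa_word u) b))" by (rule lin_comp[OF act_lin lin_fa_mult_right])
    show "lin (\<lambda>b. foldr T u (act T x b))" by (rule lin_comp[OF f act_lin])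
  qed (simp add: fa_word_def[symmetric])
  show ?thesis
  proof (rule lin_eqI[of "\<lambda>a. act T x (fa_mult a b)" "act T (act T x b)"])
    show "lin (\<lambda>a. act T x (fa_mult a b))" by (rule lin_comp[OF act_lin lin_fa_mult_left])
    show "lin (act T (act T x b))" by (rule act_lin)
  qed (simp add: fa_word_def[symmetric] 1)
qed

text \<open>The operators are linear on the whole ambient space, but the relations are required on
  \<open>M\<close> only: arbitrary lists of sets or polynomials in further variables are thereby
  excluded without changing types.\<close>

locale hecke_module =
  fixes n :: nat and T :: "nat \<Rightarrow> ('x \<Rightarrow>\<^sub>0 'a::field) \<Rightarrow> ('x \<Rightarrow>\<^sub>0 'a)" and M :: "('x \<Rightarrow>\<^sub>0 'a) set"
  assumes lin_T: "\<And>i. lin (T i)"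
    and sub_M: "pm.subspace M"
    and stable: "\<And>i x. i \<in> {1..<n} \<Longrightarrow> x \<in> M \<Longrightarrow> T i x \<in> M"
    and idem: "\<And>i x. i \<in> {1..<n} \<Longrightarrow> x \<in> M \<Longrightarrow> T i (T i x) = T i x"
    and far: "\<And>i j x. i \<in> {1..<n} \<Longrightarrow> j \<in> {1..<n} \<Longrightarrow> Suc i < j \<Longrightarrow> x \<in> M \<Longrightarrow> T i (T j x) = T j (T i x)"
    and braid: "\<And>i x. i \<in> {1..<n} \<Longrightarrow> Suc i < n \<Longrightarrow> x \<in> M \<Longrightarrow> T i (T (Suc i) (T i x)) = T (Suc i) (T i (T (Suc i) x))"
begin

lemma foldr_M: "is_word n u \<Longrightarrow> x \<in> M \<Longrightarrow> foldr T u x \<in> M"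
  by (induction u) (auto intro: stable)

lemma act_M: "x \<in> M \<Longrightarrow> a \<in> fa_words n \<Longrightarrow> act T x a \<in> M"
  unfolding act_def by (intro lext_in_subspace sub_M) (auto simp: fa_words_def foldr_M)

lemma act_rels:
  assumes x: "x \<in> M" and r: "r \<in> rels n"
  shows "act T x r = 0"
proof -
  consider (idem) i where "i \<in> {1..<n}" "r = fa_word [i, i] - fa_word [i]"
    | (far) i j where "i \<in> {1..<n}" "j \<in> {1..<n}" "Suc i < j \<or> Suc j < i" "r = fa_word [i, j] - fa_word [j, i]"
    | (braid) i where "i \<in> {1..<n}" "Suc i < n" "r = fa_word [i, Suc i, i] - fa_word [Suc i, i, Suc i]"
    using r unfolding rels_def by blast
  then show ?thesis
  proof cases
    case idem
    then show ?thesis using hecke_module.idem[OF hecke_module_axioms] x by (simp add: lin_diff[OF act_lin])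
  next
    case far
    then show ?thesis using hecke_module.far[OF hecke_module_axioms] x by (auto simp: lin_diff[OF act_lin])
  next
    case braid
    then show ?thesis using hecke_module.braid[OF hecke_module_axioms] x by (simp add: lin_diff[OF act_lin])
  qed
qed

lemma act_Irel:
  assumes x: "x \<in> M" and r: "r \<in> Irel n"
  shows "act T x r = 0"
proof -
  have "act T x r \<in> {0}"
  proof (rule lin_span_image[OF act_lin _ pm.subspace_single_0 r[unfolded Irel_def span_pm_eq]])
    fix y :: "'a fa" assume "y \<in> {fa_mult (fa_mult (fa_word u) r) (fa_word v) | u v r. is_word n u \<and> is_word n v \<and> r \<in> rels n}"
    then obtain u v r where y: "y = fa_mult (fa_mult (fa_word u) r) (fa_word v)" "is_word n v" "r \<in> rels n" by blast
    have "act T x y = foldr T u (act T (foldr T v x) r)" unfolding y(1) by (simp add: act_mult[OF lin_T])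
    also have "act T (foldr T v x) r = 0" by (rule act_rels[OF foldr_M[OF y(2) x] y(3)])
    also have "foldr T u 0 = 0" by (rule lin_zero[OF lin_foldr[OF lin_T]])
    finally show "act T x y \<in> {0}" by simp
  qed
  then show ?thesis by simp
qed

lemma act_heq: "x \<in> M \<Longrightarrow> heq n a b \<Longrightarrow> act T x a = act T x b"
  using act_Irel[of x "a - b"] by (simp add: heq_def lin_diff[OF act_lin])

definition pbar :: "(nat \<Rightarrow> nat) \<Rightarrow> ('x \<Rightarrow>\<^sub>0 'a) \<Rightarrow> ('x \<Rightarrow>\<^sub>0 'a)" where
  "pbar w x = act T x (pb n w)"

lemma act_hb: "act T x (hb i) = T i x - x"
  by (simp add: hb_def fa_gen_def lin_diff[OF act_lin])

lemma act_bw: "act T x (bw ws) = foldr (\<lambda>i y. T i y - y) ws x"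
  by (induction ws) (simp_all add: act_mult[OF lin_T] act_hb)

lemma pbar_foldr: "pbar w x = foldr (\<lambda>i y. T i y - y) (rw n w) x"
  unfolding pbar_def fa_pibar_w_eq by (rule act_bw)

lemma lin_pbar: "lin (pbar w)"
  unfolding pbar_foldr[abs_def]
  by (rule lin_foldr) (intro lin_minus lin_T lin_ident)

lemma pbar_M: "perm n w \<Longrightarrow> x \<in> M \<Longrightarrow> pbar w x \<in> M"
  unfolding pbar_def by (intro act_M pb_words)

lemma pbar_in_stable:
  assumes "perm n w" "pm.subspace U" "\<And>i y. i \<in> {1..<n} \<Longrightarrow> y \<in> U \<Longrightarrow> T i y \<in> U" "x \<in> U"
  shows "pbar w x \<in> U"
proof -
  have "is_word n ws \<Longrightarrow> foldr (\<lambda>i y. T i y - y) ws x \<in> U" for ws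
    by (induction ws) (auto intro!: assms pm.subspace_diff)
  then show ?thesis unfolding pbar_foldr using red_rw[OF assms(1)] by (simp add: red_def)
qed

lemma pbar_left_up:
  assumes "x \<in> M" "perm n w" "i \<in> {1..<n}" "inv w i < inv w (Suc i)"
  shows "T i (pbar w x) - pbar w x = pbar (sg i \<circ> w) x"
  using act_heq[OF assms(1) pb_left_up[OF assms(2-)]] by (simp add: pbar_def act_mult[OF lin_T] act_hb)

lemma pbar_left_down:
  assumes "x \<in> M" "perm n w" "i \<in> {1..<n}" "inv w (Suc i) < inv w i"
  shows "T i (pbar w x) - pbar w x = - pbar w x"
  using act_heq[OF assms(1) pb_left_down[OF assms(2-)]]
  by (simp add: pbar_def act_mult[OF lin_T] act_hb lin_neg[OF act_lin])

lemma pbar_right_up: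
  assumes "x \<in> M" "perm n w" "i \<in> {1..<n}" "i \<notin> pDes n w"
  shows "pbar w (T i x - x) = pbar (w \<circ> sg i) x"
  using act_heq[OF assms(1) pb_right_up[OF assms(2-)]] by (simp add: pbar_def act_mult[OF lin_T] act_hb)

lemma pbar_right_down:
  assumes "x \<in> M" "perm n w" "i \<in> pDes n w"
  shows "pbar w (T i x - x) = - pbar w x"
  using act_heq[OF assms(1) pb_right_down[OF assms(2-)]]
  by (simp add: pbar_def act_mult[OF lin_T] act_hb lin_neg[OF act_lin])

text \<open>A descent i of \<open>w\<close> lets pibar_w absorb pibar_i up to sign, and pibar_i
  annihilates a vector fixed by pi_i.\<close>

lemma pbar_zero:
  assumes "x \<in> M" "perm n w" "i \<in> pDes n w" "T i x = x"
  shows "pbar w x = 0"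
proof -
  have "- pbar w x = pbar w (T i x - x)" using pbar_right_down[OF assms(1-3)] by simp
  also have "\<dots> = 0" using assms(4) lin_zero[OF lin_pbar] by simp
  finally show ?thesis by simp
qed

lemma span_pbar_stable:
  assumes X: "X \<subseteq> M" and i: "i \<in> {1..<n}" and y: "y \<in> pm.span {pbar w x | w x. perm n w \<and> x \<in> X}"
  shows "T i y \<in> pm.span {pbar w x | w x. perm n w \<and> x \<in> X}"
proof (rule lin_span_image[OF lin_T _ pm.subspace_span y])
  fix z assume "z \<in> {pbar w x | w x. perm n w \<and> x \<in> X}"
  then obtain w x where z: "z = pbar w x" and w: "perm n w" and x: "x \<in> X" by blast
  have xM: "x \<in> M" using x X by blast
  have b: "pbar v x \<in> pm.span {pbar w x | w x. perm n w \<and> x \<in> X}" if "perm n v" for v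
    using that x by (intro pm.span_base) blast
  show "T i z \<in> pm.span {pbar w x | w x. perm n w \<and> x \<in> X}"
  proof (cases "inv w i < inv w (Suc i)")
    case True
    have "T i z = pbar (sg i \<circ> w) x + pbar w x" using pbar_left_up[OF xM w i True] z by (simp add: algebra_simps)
    then show ?thesis by (simp only:) (intro pm.span_add b w perm_sg_comp i)
  next
    case False
    then have "inv w (Suc i) < inv w i" using perm_neq[OF permutes_inv[OF w], of i] by linarith
    from pbar_left_down[OF xM w i this] z have "T i z = 0" by simp
    then show ?thesis by (simp add: pm.span_zero)
  qed
qed

definition plonger :: "(nat \<Rightarrow> nat) \<Rightarrow> ('x \<Rightarrow>\<^sub>0 'a) \<Rightarrow> ('x \<Rightarrow>\<^sub>0 'a) set" where
  "plonger w x = pm.span {pbar v x | v. perm n v \<and> ninv n w < ninv n v}"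

lemma plonger_subspace: "pm.subspace (plonger w x)"
  unfolding plonger_def by simp

lemma plonger_subset:
  assumes "pm.subspace U" "\<And>v. perm n v \<Longrightarrow> ninv n w < ninv n v \<Longrightarrow> pbar v x \<in> U"
  shows "plonger w x \<subseteq> U"
  unfolding plonger_def by (rule pm.span_minimal) (use assms in auto)

lemma act_longer:
  assumes x: "x \<in> M" and y: "y \<in> longer n w"
  shows "act T x y \<in> plonger w x"
proof -
  obtain s r where s: "s \<in> pm.span {pb n v | v. perm n v \<and> ninv n w < ninv n v}" and r: "r \<in> Irel n" and y: "y = s + r"
    using y unfolding longer_def set_add_eq by blast
  have "act T x s \<in> plonger w x"
    by (rule lin_span_image[OF act_lin _ plonger_subspace s])
       (auto simp: plonger_def pbar_def intro!: pm.span_base)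
  then show ?thesis unfolding y by (simp add: lin_add[OF act_lin] act_Irel[OF x r])
qed

lemma act_pb_piw0:
  assumes x: "x \<in> M" and w: "perm n w" and E: "E \<subseteq> {1..<n}" "E \<inter> pDes n w = {}"
  shows "act T x (fa_mult (pb n w) (piw0 n E)) - pbar w x \<in> plonger w x"
  using act_longer[OF x pb_piw0_longer[OF w E]] by (simp add: pbar_def lin_diff[OF act_lin])

lemma act_piw0_fixed:
  assumes x: "x \<in> M" and E: "E \<subseteq> {1..<n}" and fixed: "\<And>j. j \<in> E \<Longrightarrow> T j x = x"
  shows "act T x (fa_mult y (piw0 n E)) = act T x y"
proof -
  obtain ws where ws: "set ws \<subseteq> E" "heq n (piw0 n E) (fa_word ws :: 'a fa)" by (rule piw0_word[OF E])
  have "foldr T ws x = x" using ws(1) by (induction ws) (simp_all add: fixed)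
  then have "act T x (piw0 n E) = x" using act_heq[OF x ws(2)] by simp
  then show ?thesis by (simp add: act_mult[OF lin_T])
qed

text \<open>Induction from long to short permutations. It is well founded because inversion numbers
  are at most n^2, and it fits the filtration: error terms are always longer.\<close>

lemma pbar_descending_induct:
  assumes U: "pm.subspace U"
    and step: "\<And>w. perm n w \<Longrightarrow> (\<And>v. perm n v \<Longrightarrow> ninv n w < ninv n v \<Longrightarrow> pbar v x \<in> U) \<Longrightarrow> pbar w x \<in> U"
    and w: "perm n w"
  shows "pbar w x \<in> U"
  using w
proof (induction "n * n - ninv n w" arbitrary: w rule: less_induct)
  case less
  show ?case
  proof (rule step[OF less.prems])
    fix v assume v: "perm n v" "ninv n w < ninv n v"
    have "n * n - ninv n v < n * n - ninv n w" using v ninv_le[of n v] by linarith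
    from less.hyps[OF this v(1)] show "pbar v x \<in> U" .
  qed
qed

end

section \<open>The 0-Hecke action on polynomials\<close>

lemma smul_const_poly: "smul c f = const_poly c * (f :: 'a::comm_ring_1 mpoly)"
  by (simp add: smul_def const_poly_def mult_map_scale_conv_mult)

abbreviation mo :: "(nat \<Rightarrow>\<^sub>0 nat) \<Rightarrow> 'a::comm_ring_1 mpoly" where "mo m \<equiv> Poly_Mapping.single m 1"

section \<open>Substitution homomorphisms\<close>

definition mono_val :: "(nat \<Rightarrow> 'r::comm_ring_1) \<Rightarrow> (nat \<Rightarrow>\<^sub>0 nat) \<Rightarrow> 'r" where
  "mono_val v m = (\<Prod>j\<in>keys m. v j ^ lookup m j)"

lemma mono_val_superset:
  "finite S \<Longrightarrow> keys m \<subseteq> S \<Longrightarrow> mono_val v m = (\<Prod>j\<in>S. v j ^ lookup m j)"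
  unfolding mono_val_def by (rule prod.mono_neutral_left) (auto simp: in_keys_iff)

lemma mono_val_add: "mono_val v (m + m') = mono_val v m * mono_val v m'"
proof -
  let ?S = "keys m \<union> keys m'"
  have "keys (m + m') \<subseteq> ?S" by (rule Poly_Mapping.keys_add)
  then show ?thesis
    by (simp add: mono_val_superset[of ?S] lookup_add power_add prod.distrib)
qed

lemma mono_val_zero [simp]: "mono_val v 0 = 1"
  by (simp add: mono_val_def)

lemma mono_val_single [simp]: "mono_val v (Poly_Mapping.single j p) = v j ^ p"
  by (subst mono_val_superset[of "{j}"]) auto

text \<open>The coefficients are moved along \<open>e\<close> while the variables are substituted.
  With \<open>const_poly\<close> this gives substitutions of variables such as s_i; with the
  embedding into rational functions it gives evaluation at points over the larger field.\<close>

locale coeff_hom =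
  fixes e :: "'a::comm_ring_1 \<Rightarrow> 'r::comm_ring_1"
  assumes e_add: "e (a + b) = e a + e b" and e_mult: "e (a * b) = e a * e b" and e_one: "e 1 = 1"
begin

lemma e_zero: "e 0 = 0"
  using e_add[of 0 0] by simp

definition hom_ext :: "(nat \<Rightarrow> 'r) \<Rightarrow> 'a mpoly \<Rightarrow> 'r" where
  "hom_ext v f = (\<Sum>m\<in>keys f. e (lookup f m) * mono_val v m)"

lemma hom_ext_add: "hom_ext v (f + g) = hom_ext v f + hom_ext v g"
  unfolding hom_ext_def
  by (rule setsum_keys_plus_distrib) (simp_all add: e_zero e_add distrib_right)

lemma hom_ext_zero [simp]: "hom_ext v 0 = 0"
  by (simp add: hom_ext_def)

lemma hom_ext_sum: "hom_ext v (sum f S) = (\<Sum>x\<in>S. hom_ext v (f x))"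
  by (induction S rule: infinite_finite_induct) (auto simp: hom_ext_add)

lemma hom_ext_single: "hom_ext v (Poly_Mapping.single m c) = e c * mono_val v m"
  by (cases "c = 0") (simp_all add: hom_ext_def e_zero)

lemma hom_ext_mult: "hom_ext v (f * g) = hom_ext v f * hom_ext v g"
proof -
  have 1: "hom_ext v (Poly_Mapping.single m c * g) = hom_ext v (Poly_Mapping.single m c) * hom_ext v g" for m c g
  proof -
    have "hom_ext v (Poly_Mapping.single m c * g)
        = hom_ext v (Poly_Mapping.single m c * (\<Sum>m'\<in>keys g. Poly_Mapping.single m' (lookup g m')))"
      by (simp add: sum_single_keys)
    also have "\<dots> = (\<Sum>m'\<in>keys g. hom_ext v (Poly_Mapping.single m c) * hom_ext v (Poly_Mapping.single m' (lookup g m')))"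
      by (simp add: sum_distrib_left hom_ext_sum mult_single hom_ext_single e_mult mono_val_add mult_ac)
    also have "\<dots> = hom_ext v (Poly_Mapping.single m c) * hom_ext v (\<Sum>m'\<in>keys g. Poly_Mapping.single m' (lookup g m'))"
      by (simp only: hom_ext_sum sum_distrib_left)
    also have "\<dots> = hom_ext v (Poly_Mapping.single m c) * hom_ext v g"
      by (simp add: sum_single_keys)
    finally show ?thesis .
  qed
  have "hom_ext v (f * g) = hom_ext v ((\<Sum>m\<in>keys f. Poly_Mapping.single m (lookup f m)) * g)"
    by (simp add: sum_single_keys)
  also have "\<dots> = (\<Sum>m\<in>keys f. hom_ext v (Poly_Mapping.single m (lookup f m)) * hom_ext v g)"
    by (simp only: sum_distrib_right hom_ext_sum 1)
  also have "\<dots> = hom_ext v (\<Sum>m\<in>keys f. Poly_Mapping.single m (lookup f m)) * hom_ext v g"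
    by (simp only: hom_ext_sum sum_distrib_right)
  finally show ?thesis by (simp add: sum_single_keys)
qed

lemma hom_ext_Var [simp]: "hom_ext v (Var j) = v j"
  by (simp add: Var_def hom_ext_single e_one)

lemma hom_ext_const: "hom_ext v (const_poly c) = e c"
  by (simp add: const_poly_def hom_ext_single)

lemma hom_ext_one [simp]: "hom_ext v 1 = 1"
  using hom_ext_const[of v 1] by (simp add: const_poly_def e_one)

lemma hom_ext_prod: "hom_ext v (prod f S) = (\<Prod>x\<in>S. hom_ext v (f x))"
  by (induction S rule: infinite_finite_induct) (auto simp: hom_ext_mult)

lemma hom_ext_uminus: "hom_ext v (- f) = - hom_ext v f"
  using hom_ext_add[of v f "- f"] by (simp add: eq_neg_iff_add_eq_0 add.commute)

lemma hom_ext_diff: "hom_ext v (f - g) = hom_ext v f - hom_ext v g"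
  using hom_ext_add[of v f "- g"] by (simp add: hom_ext_uminus)

end

interpretation cp: coeff_hom "const_poly :: 'a::comm_ring_1 \<Rightarrow> 'a mpoly"
  by unfold_locales (simp_all add: const_poly_def single_add mult_single)

lemma mono_val_Var: "mono_val Var m = (mo m :: 'a::comm_ring_1 mpoly)"
proof -
  have p: "(Var j :: 'a mpoly) ^ p = mo (Poly_Mapping.single j p)" for j p
    by (induction p) (simp_all add: Var_def mult_single single_add[symmetric] plus_1_eq_Suc)
  have "(\<Prod>j\<in>S. mo (g j)) = (mo (\<Sum>j\<in>S. g j) :: 'a mpoly)" for S and g :: "nat \<Rightarrow> nat \<Rightarrow>\<^sub>0 nat"
    by (induction S rule: infinite_finite_induct) (simp_all add: mult_single)
  then show ?thesis by (simp add: mono_val_def p sum_single_keys)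
qed

lemma hom_ext_ident: "cp.hom_ext Var f = (f :: 'a::comm_ring_1 mpoly)"
  by (simp add: cp.hom_ext_def mono_val_Var const_poly_def mult_single sum_single_keys)

lemma mpoly_induct [case_names const Var add mult]:
  fixes f :: "'a::comm_ring_1 mpoly"
  assumes "\<And>c. P (const_poly c)" "\<And>j. P (Var j)" "\<And>f g. P f \<Longrightarrow> P g \<Longrightarrow> P (f + g)"
    "\<And>f g. P f \<Longrightarrow> P g \<Longrightarrow> P (f * g)"
  shows "P f"
proof -
  have z: "P 0" "P 1" using assms(1)[of 0] assms(1)[of 1] by (simp_all add: const_poly_def)
  have pw: "P (Var j ^ p)" for j p by (induction p) (use z assms in auto)
  have pr: "P (\<Prod>j\<in>S. Var j ^ p j)" for S p
    by (induction S rule: infinite_finite_induct) (use z pw assms in auto)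
  have "P (\<Sum>m\<in>S. const_poly (c m) * mono_val Var m)" for S c
    by (induction S rule: infinite_finite_induct) (use z pr assms in \<open>auto simp: mono_val_def\<close>)
  then have "P (cp.hom_ext Var f)" unfolding cp.hom_ext_def .
  then show ?thesis by (simp only: hom_ext_ident)
qed

lemma swap_var_eq: "swap_var i f = cp.hom_ext (\<lambda>j. Var (sg i j)) f"
  by (simp add: swap_var_def cp.hom_ext_def mono_val_def)

lemma swap_add: "swap_var i (f + g) = swap_var i f + swap_var i g"
  and swap_mult: "swap_var i (f * g) = swap_var i f * swap_var i g"
  and swap_diff: "swap_var i (f - g) = swap_var i f - swap_var i g"
  and swap_Var: "swap_var i (Var j) = Var (sg i j)"
  and swap_const: "swap_var i (const_poly c) = const_poly c"
  and swap_one: "swap_var i 1 = 1"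
  and swap_sum: "swap_var i (sum h S) = (\<Sum>x\<in>S. swap_var i (h x))"
  and swap_prod: "swap_var i (prod h S) = (\<Prod>x\<in>S. swap_var i (h x))"
  by (simp_all add: swap_var_eq cp.hom_ext_add cp.hom_ext_mult cp.hom_ext_diff cp.hom_ext_const
        cp.hom_ext_sum cp.hom_ext_prod)

lemma swap_swap: "swap_var i (swap_var i f) = f"
  by (induction f rule: mpoly_induct) (simp_all add: swap_add swap_mult swap_Var swap_const)

lemma swap_far: "Suc i < j \<Longrightarrow> swap_var i (swap_var j f) = swap_var j (swap_var i f)"
  by (induction f rule: mpoly_induct)
     (auto simp: swap_add swap_mult swap_Var swap_const transpose_def intro!: arg_cong[of _ _ Var])

lemma swap_braid: "swap_var i (swap_var (Suc i) (swap_var i f)) = swap_var (Suc i) (swap_var i (swap_var (Suc i) f))"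
  by (induction f rule: mpoly_induct)
     (auto simp: swap_add swap_mult swap_Var swap_const transpose_def intro!: arg_cong[of _ _ Var])

section \<open>Divided differences and the operators pi_i\<close>

lemma Var_diff_nz: "(Var i - Var (Suc i) :: 'a::comm_ring_1 mpoly) \<noteq> 0"
proof
  assume "(Var i - Var (Suc i) :: 'a mpoly) = 0"
  then have "lookup (Var i :: 'a mpoly) (Poly_Mapping.single i 1) = lookup (Var (Suc i) :: 'a mpoly) (Poly_Mapping.single i 1)"
    by simp
  moreover have "Poly_Mapping.single (Suc i) (1::nat) \<noteq> Poly_Mapping.single i 1"
    by (metis keys_single n_not_Suc_n singleton_inject zero_neq_one)
  ultimately show False by (simp add: Var_def lookup_single when_def)
qed

text \<open>The difference f - s_i f obeys a twisted Leibniz rule, so divisibility passes from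
  constants and variables to all polynomials.\<close>

lemma divided_difference_exists: "(Var i - Var (Suc i)) dvd (f - swap_var i f)"
proof (induction f rule: mpoly_induct)
  case (Var j)
  have "(Var i - Var (Suc i) :: 'a mpoly) dvd - (Var i - Var (Suc i))" by (simp only: dvd_minus_iff dvd_refl)
  then show ?case by (cases "j = i"; cases "j = Suc i") (auto simp: swap_Var sg_other)
next
  case (add f g)
  have "f + g - swap_var i (f + g) = (f - swap_var i f) + (g - swap_var i g)" by (simp add: swap_add)
  then show ?case using dvd_add[OF add] by (simp only:)
next
  case (mult f g)
  have "f * g - swap_var i (f * g) = f * (g - swap_var i g) + (f - swap_var i f) * swap_var i g"
    by (simp add: swap_mult algebra_simps)
  then show ?case using dvd_add[OF dvd_mult[OF mult(2)] dvd_mult2[OF mult(1)]] by (simp only:)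
qed (simp add: swap_const)

lemma pi_poly_eq: "(Var i - Var (Suc i)) * pi_poly i f = Var i * f - Var (Suc i) * swap_var i (f :: 'a::field mpoly)"
proof -
  obtain g where g: "f - swap_var i f = (Var i - Var (Suc i)) * g"
    using divided_difference_exists[of i f] by (elim dvdE)
  \<comment> \<open>The candidate for pi_i f is f plus x_{i+1} times the divided difference of f;
    polynomials over a field form an integral domain, so it is the only one.\<close>
  have "(Var i - Var (Suc i)) * (f + Var (Suc i) * g) = Var i * f - Var (Suc i) * f + Var (Suc i) * ((Var i - Var (Suc i)) * g)"
    by (simp add: algebra_simps)
  also have "\<dots> = Var i * f - Var (Suc i) * swap_var i f" unfolding g[symmetric] by (simp add: algebra_simps)
  finally have ex: "(Var i - Var (Suc i)) * (f + Var (Suc i) * g) = Var i * f - Var (Suc i) * swap_var i f" .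
  have "\<exists>!g. (Var i - Var (Suc i)) * g = Var i * f - Var (Suc i) * swap_var i f"
    using ex Var_diff_nz[of i, where ?'a = 'a] by (metis mult_left_cancel)
  from theI'[OF this] show ?thesis unfolding pi_poly_def .
qed

lemma pi_polyI: "(Var i - Var (Suc i)) * g = Var i * f - Var (Suc i) * swap_var i f \<Longrightarrow> pi_poly i f = (g :: 'a::field mpoly)"
  using pi_poly_eq[of i f] Var_diff_nz[of i, where ?'a = 'a] by (metis mult_left_cancel)

lemma pibar_poly_eq: "(Var i - Var (Suc i)) * pibar_poly i f = Var (Suc i) * (f - swap_var i (f :: 'a::field mpoly))"
  unfolding pibar_poly_def right_diff_distrib[of "Var i - Var (Suc i)"] pi_poly_eq by (simp add: algebra_simps)

lemma pibar_polyI: "(Var i - Var (Suc i)) * g = Var (Suc i) * (f - swap_var i f) \<Longrightarrow> pibar_poly i f = (g :: 'a::field mpoly)"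
  using pibar_poly_eq[of i f] Var_diff_nz[of i, where ?'a = 'a] by (metis mult_left_cancel)

lemma pi_poly_lin: "lin (pi_poly i)"
proof (rule linI; rule pi_polyI)
  fix f g :: "'a mpoly" and c
  show "(Var i - Var (Suc i)) * (pi_poly i f + pi_poly i g) = Var i * (f + g) - Var (Suc i) * swap_var i (f + g)"
    by (simp add: distrib_left pi_poly_eq swap_add)
  have "(Var i - Var (Suc i)) * (const_poly c * pi_poly i f) = const_poly c * ((Var i - Var (Suc i)) * pi_poly i f)"
    by (simp only: mult_ac)
  also have "\<dots> = Var i * (const_poly c * f) - Var (Suc i) * swap_var i (const_poly c * f)"
    unfolding pi_poly_eq by (simp add: swap_mult swap_const algebra_simps)
  finally show "(Var i - Var (Suc i)) * smul c (pi_poly i f) = Var i * smul c f - Var (Suc i) * swap_var i (smul c f)"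
    by (simp add: smul_const_poly)
qed

lemma pibar_poly_lin: "lin (pibar_poly i)"
  unfolding pibar_poly_def[abs_def] by (rule lin_minus[OF pi_poly_lin lin_ident])

lemma swap_pi_poly: "swap_var i (pi_poly i f) = pi_poly i (f :: 'a::field mpoly)"
proof (rule sym, rule pi_polyI)
  have "swap_var i ((Var i - Var (Suc i)) * pi_poly i f) = swap_var i (Var i * f - Var (Suc i) * swap_var i f)"
    by (simp only: pi_poly_eq)
  then have "(Var (Suc i) - Var i) * swap_var i (pi_poly i f) = Var (Suc i) * swap_var i f - Var i * f"
    by (simp add: swap_mult swap_diff swap_Var swap_swap)
  then show "(Var i - Var (Suc i)) * swap_var i (pi_poly i f) = Var i * f - Var (Suc i) * swap_var i f"
    by (simp add: algebra_simps)
qed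

lemma pi_poly_sym: "swap_var i f = f \<Longrightarrow> pi_poly i f = (f :: 'a::field mpoly)"
  by (rule pi_polyI) (simp add: algebra_simps)

lemma pi_poly_far:
  assumes "Suc i < j"
  shows "pi_poly i (pi_poly j f) = pi_poly j (pi_poly i (f :: 'a::field mpoly))"
proof -
  define a b c d where "a = (Var i :: 'a mpoly)" and "b = (Var (Suc i) :: 'a mpoly)" and "c = (Var j :: 'a mpoly)" and "d = (Var (Suc j) :: 'a mpoly)"
  note defs = a_def b_def c_def d_def
  let ?g = "pi_poly j f" and ?h = "pi_poly i f"
  have sw: "swap_var i c = c" "swap_var i d = d" "swap_var j a = a" "swap_var j b = b"
    using assms by (auto simp: defs swap_Var sg_other)
  have 1: "(a - b) * pi_poly i ?g = a * ?g - b * swap_var i ?g" and 2: "(c - d) * ?g = c * f - d * swap_var j f"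
    and 3: "(c - d) * pi_poly j ?h = c * ?h - d * swap_var j ?h" and 4: "(a - b) * ?h = a * f - b * swap_var i f"
    unfolding defs by (rule pi_poly_eq)+
  have 5: "(c - d) * swap_var i ?g = c * swap_var i f - d * swap_var i (swap_var j f)"
    using arg_cong[OF 2, of "swap_var i"] sw by (simp add: swap_mult swap_diff)
  have 6: "(a - b) * swap_var j ?h = a * swap_var j f - b * swap_var j (swap_var i f)"
    using arg_cong[OF 4, of "swap_var j"] sw by (simp add: swap_mult swap_diff)
  have "(c - d) * ((a - b) * pi_poly i ?g) = a * ((c - d) * ?g) - b * ((c - d) * swap_var i ?g)"
    unfolding 1 by (simp add: algebra_simps)
  also have "\<dots> = c * ((a - b) * ?h) - d * ((a - b) * swap_var j ?h)"
    unfolding 2 4 5 6 swap_far[OF assms, of f] by (simp add: algebra_simps)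
  also have "\<dots> = (a - b) * ((c - d) * pi_poly j ?h)"
    unfolding 3 by (simp add: algebra_simps)
  finally have "(c - d) * (a - b) * pi_poly i ?g = (c - d) * (a - b) * pi_poly j ?h" by (simp add: mult_ac)
  moreover have "(c - d) * (a - b) \<noteq> 0" using Var_diff_nz[of i, where ?'a = 'a] Var_diff_nz[of j, where ?'a = 'a]
    unfolding defs by (rule no_zero_divisors[rotated])
  ultimately show ?thesis by (metis mult_left_cancel)
qed

lemma pi_poly_braid:
  "pi_poly i (pi_poly (Suc i) (pi_poly i f)) = pi_poly (Suc i) (pi_poly i (pi_poly (Suc i) (f :: 'a::field mpoly)))"
proof -
  define j where "j = Suc i"
  define a b c where "a = (Var i :: 'a mpoly)" and "b = (Var j :: 'a mpoly)" and "c = (Var (Suc j) :: 'a mpoly)"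
  note defs = a_def b_def c_def j_def
  define s t where "s = (swap_var i :: 'a mpoly \<Rightarrow> 'a mpoly)" and "t = (swap_var j :: 'a mpoly \<Rightarrow> 'a mpoly)"
  have P: "(a - b) * pi_poly i g = a * g - b * s g" "(b - c) * pi_poly j g = b * g - c * t g" for g
    using pi_poly_eq[of i g] pi_poly_eq[of j g] by (simp_all add: defs s_def t_def)
  have sw: "s a = b" "s b = a" "s c = c" "t a = a" "t b = c" "t c = b"
    by (auto simp: defs s_def t_def swap_Var sg_other)
  have hm: "s (g * h) = s g * s h" "s (g - h) = s g - s h" "t (g * h) = t g * t h" "t (g - h) = t g - t h" for g h
    by (simp_all add: s_def t_def swap_mult swap_diff)
  have br: "s (t (s f)) = t (s (t f))" unfolding s_def t_def j_def by (rule swap_braid)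
  have invs: "s (pi_poly i g) = pi_poly i g" "t (pi_poly j g) = pi_poly j g" for g
    unfolding s_def t_def by (rule swap_pi_poly)+
  \<comment> \<open>The antisymmetrization of x_i^2 x_{i+1} f over the permutations of the three
    variables. Both sides of the braid relation become \<open>A\<close> after multiplication by the
    Vandermonde product.\<close>
  define A where "A = a*b*(a*f - b * s f) - a*c*(a * t f - c * t (s f)) + b*c*(b * s (t f) - c * s (t (s f)))"
  have L: "(b - c) * (a - c) * (a - b) * pi_poly i (pi_poly j (pi_poly i f)) = A"
  proof -
    let ?f1 = "pi_poly i f" let ?f2 = "pi_poly j ?f1"
    have f1: "(a - b) * ?f1 = a * f - b * s f" by (rule P)
    have tf1: "(a - c) * t ?f1 = a * t f - c * t (s f)" using arg_cong[OF f1, of t] by (simp add: hm sw)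
    have stf1: "(b - c) * s (t ?f1) = b * s (t f) - c * s (t (s f))" using arg_cong[OF tf1, of s] by (simp add: hm sw)
    have f2: "(b - c) * ?f2 = b * ?f1 - c * t ?f1" by (rule P)
    have sf2: "(a - c) * s ?f2 = a * ?f1 - c * s (t ?f1)" using arg_cong[OF f2, of s] by (simp add: hm sw invs)
    have "(b - c) * (a - c) * (a - b) * pi_poly i ?f2 = (b - c) * (a - c) * ((a - b) * pi_poly i ?f2)" by (simp only: mult.assoc)
    also have "\<dots> = (a - c) * a * ((b - c) * ?f2) - (b - c) * b * ((a - c) * s ?f2)" unfolding P(1)[of ?f2] by (simp add: algebra_simps)
    also have "\<dots> = a * b * ((a - b) * ?f1) - a * c * ((a - c) * t ?f1) + b * c * ((b - c) * s (t ?f1))"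
      unfolding f2 sf2 by (simp add: algebra_simps)
    also have "\<dots> = A" unfolding f1 tf1 stf1 A_def ..
    finally show ?thesis .
  qed
  have R: "(b - c) * (a - c) * (a - b) * pi_poly j (pi_poly i (pi_poly j f)) = A"
  proof -
    let ?f1 = "pi_poly j f" let ?f2 = "pi_poly i ?f1"
    have f1: "(b - c) * ?f1 = b * f - c * t f" by (rule P)
    have sf1: "(a - c) * s ?f1 = a * s f - c * s (t f)" using arg_cong[OF f1, of s] by (simp add: hm sw)
    have tsf1: "(a - b) * t (s ?f1) = a * t (s f) - b * t (s (t f))" using arg_cong[OF sf1, of t] by (simp add: hm sw)
    have f2: "(a - b) * ?f2 = a * ?f1 - b * s ?f1" by (rule P)
    have tf2: "(a - c) * t ?f2 = a * ?f1 - c * t (s ?f1)" using arg_cong[OF f2, of t] by (simp add: hm sw invs)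
    have "(b - c) * (a - c) * (a - b) * pi_poly j ?f2 = (a - c) * (a - b) * ((b - c) * pi_poly j ?f2)" by (simp only: mult_ac)
    also have "\<dots> = (a - c) * b * ((a - b) * ?f2) - (a - b) * c * ((a - c) * t ?f2)" unfolding P(2)[of ?f2] by (simp add: algebra_simps)
    also have "\<dots> = a * a * ((b - c) * ?f1) - b * b * ((a - c) * s ?f1) + c * c * ((a - b) * t (s ?f1))"
      unfolding f2 tf2 by (simp add: algebra_simps)
    also have "\<dots> = A" unfolding f1 sf1 tsf1 A_def br by (simp add: algebra_simps)
    finally show ?thesis .
  qed
  have "a - c \<noteq> 0"
  proof
    assume "a - c = 0"
    then have "s (a - c) = s 0" by simp
    then have "b - c = 0" using lin_zero[OF lin_ident] by (simp add: hm sw) (simp add: s_def swap_var_eq)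
    then show False using Var_diff_nz[of j, where ?'a = 'a] by (simp add: defs)
  qed
  then have "(b - c) * (a - c) * (a - b) \<noteq> 0" using Var_diff_nz[where ?'a = 'a] by (simp add: defs)
  then show ?thesis using L R unfolding j_def by (metis mult_left_cancel)
qed

lemma pi_poly_symmetric_mult: "swap_var i g = g \<Longrightarrow> pi_poly i (f * g) = pi_poly i f * (g :: 'a::field mpoly)"
proof (rule pi_polyI)
  assume "swap_var i g = g"
  moreover have "(Var i - Var (Suc i)) * (pi_poly i f * g) = (Var i * f - Var (Suc i) * swap_var i f) * g"
    by (simp only: mult.assoc[symmetric] pi_poly_eq)
  ultimately show "(Var i - Var (Suc i)) * (pi_poly i f * g) = Var i * (f * g) - Var (Suc i) * swap_var i (f * g)"
    by (simp add: swap_mult algebra_simps)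
qed

subsection \<open>Monomials\<close>

definition expo :: "nat \<Rightarrow> (nat \<Rightarrow> nat) \<Rightarrow> (nat \<Rightarrow>\<^sub>0 nat)" where
  "expo n f = (\<Sum>j\<in>{1..n}. Poly_Mapping.single j (f j))"

lemma lookup_expo: "lookup (expo n f) j = (if j \<in> {1..n} then f j else 0)"
  by (simp add: expo_def lookup_sum lookup_single when_def)

lemma keys_expo: "keys (expo n f) \<subseteq> {1..n}"
  by (auto simp: in_keys_iff lookup_expo split: if_splits)

lemma expo_lookup: "keys m \<subseteq> {1..n} \<Longrightarrow> expo n (lookup m) = m"
  by (intro poly_mapping_eqI) (auto simp: lookup_expo in_keys_iff)

lemma expo_cong: "(\<And>j. j \<in> {1..n} \<Longrightarrow> f j = g j) \<Longrightarrow> expo n f = expo n g"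
  by (simp add: expo_def)

lemma mo_expo: "mo (expo n f) = (\<Prod>j\<in>{1..n}. Var j ^ f j)"
  unfolding mono_val_Var[symmetric] mono_val_superset[OF _ keys_expo, simplified]
  by (rule prod.cong) (simp_all add: lookup_expo)

lemma tdeg_sum: "keys m \<subseteq> {1..n} \<Longrightarrow> tdeg m = (\<Sum>j\<in>{1..n}. lookup m j)"
  unfolding tdeg_def by (rule sum.mono_neutral_left) (auto simp: in_keys_iff)

lemma tdeg_expo: "tdeg (expo n f) = (\<Sum>j\<in>{1..n}. f j)"
  by (simp add: tdeg_sum[OF keys_expo] lookup_expo)

text \<open>By strict convexity of squares, replacing two exponents p > q by two strictly
  intermediate ones with the same sum lowers this number, while permuting exponents keeps it. It
  serves as the order in which monomials are reduced.\<close>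

definition qn :: "nat \<Rightarrow> (nat \<Rightarrow>\<^sub>0 nat) \<Rightarrow> nat" where
  "qn n m = (\<Sum>j\<in>{1..n}. (lookup m j)\<^sup>2)"

lemma qn_expo: "qn n (expo n f) = (\<Sum>j\<in>{1..n}. (f j)\<^sup>2)"
  by (simp add: qn_def lookup_expo)

definition low :: "nat \<Rightarrow> nat \<Rightarrow> nat \<Rightarrow> 'a::field mpoly set" where
  "low n d q = pm.span {mo m | m. keys m \<subseteq> {1..n} \<and> tdeg m = d \<and> qn n m < q}"

lemma low_subspace: "pm.subspace (low n d q)"
  by (simp add: low_def)

lemma low_base: "keys m \<subseteq> {1..n} \<Longrightarrow> tdeg m = d \<Longrightarrow> qn n m < q \<Longrightarrow> mo m \<in> low n d q"
  unfolding low_def by (rule pm.span_base) blast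

lemma low_mono: "q \<le> q' \<Longrightarrow> low n d q \<subseteq> low n d q'"
  unfolding low_def by (rule pm.span_mono) auto

lemma sum_two:
  fixes h :: "nat \<Rightarrow> 'b::comm_monoid_add"
  assumes "i \<in> {1..<n}"
  shows "(\<Sum>j\<in>{1..n}. h j) = h i + (h (Suc i) + (\<Sum>j\<in>{1..n} - {i, Suc i}. h j))"
proof -
  have "{1..n} - {i} - {Suc i} = {1..n} - {i, Suc i}" by auto
  then show ?thesis using assms
    by (simp add: sum.remove[of "{1..n}" i] sum.remove[of "{1..n} - {i}" "Suc i"])
qed

lemma prod_two:
  fixes h :: "nat \<Rightarrow> 'b::comm_monoid_mult"
  assumes "i \<in> {1..<n}"
  shows "(\<Prod>j\<in>{1..n}. h j) = h i * (h (Suc i) * (\<Prod>j\<in>{1..n} - {i, Suc i}. h j))"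
proof -
  have "{1..n} - {i} - {Suc i} = {1..n} - {i, Suc i}" by auto
  then show ?thesis using assms
    by (simp add: prod.remove[of "{1..n}" i] prod.remove[of "{1..n} - {i}" "Suc i"])
qed

lemma mo_expo_two:
  assumes "i \<in> {1..<n}"
  shows "mo (expo n f) = (\<Prod>j\<in>{1..n} - {i, Suc i}. Var j ^ f j) * Var i ^ f i * Var (Suc i) ^ f (Suc i)"
  unfolding mo_expo prod_two[OF assms] by (simp add: mult_ac)

text \<open>The quotient is a geometric sum. Its term t = 0 is the monomial with larger exponent on
  the right, and in all other terms the two exponents lie strictly between q and p. The numerator
  changes sign when the two exponents are swapped, hence the second formula.\<close>

lemma pibar_two:
  fixes M X Y :: "'a::field mpoly"
  assumes M: "swap_var i M = M" and X: "X = Var i" and Y: "Y = Var (Suc i)" and pq: "q \<le> p"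
  shows "pibar_poly i (M * X ^ p * Y ^ q) = (\<Sum>t<p - q. M * X ^ (q + t) * Y ^ (p - t))"
    and "pibar_poly i (M * X ^ q * Y ^ p) = - (\<Sum>t<p - q. M * X ^ (q + t) * Y ^ (p - t))"
proof -
  have sp: "swap_var i (Z ^ r) = swap_var i Z ^ r" for Z :: "'a mpoly" and r
    by (induction r) (simp_all add: swap_one swap_mult)
  have sw: "swap_var i (M * X ^ a * Y ^ b) = M * Y ^ a * X ^ b" for a b
    by (simp add: swap_mult sp M X Y swap_Var)
  have t: "M * X ^ (q + t) * Y ^ (p - t) = M * X ^ q * Y ^ q * Y * (Y ^ (p - q - Suc t) * X ^ t)" if "t < p - q" for t
  proof -
    have "p - t = q + Suc (p - q - Suc t)" using that by simp
    then have "Y ^ (p - t) = Y ^ q * (Y * Y ^ (p - q - Suc t))" by (simp only: power_add power_Suc)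
    then show ?thesis by (simp add: power_add mult_ac)
  qed
  have "(X - Y) * (\<Sum>t<p - q. M * X ^ (q + t) * Y ^ (p - t))
      = M * X ^ q * Y ^ q * Y * ((X - Y) * (\<Sum>t<p - q. Y ^ (p - q - Suc t) * X ^ t))"
  proof -
    have "(\<Sum>t<p - q. M * X ^ (q + t) * Y ^ (p - t)) = M * X ^ q * Y ^ q * Y * (\<Sum>t<p - q. Y ^ (p - q - Suc t) * X ^ t)"
      unfolding sum_distrib_left by (intro sum.cong refl t) simp
    then show ?thesis by (simp only: mult.left_commute)
  qed
  also have "\<dots> = M * X ^ q * Y ^ q * Y * (X ^ (p - q) - Y ^ (p - q))"
    by (simp only: power_diff_sumr2)
  also have "\<dots> = Y * (M * (X ^ q * X ^ (p - q)) * Y ^ q - M * X ^ q * (Y ^ q * Y ^ (p - q)))"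
    by (simp add: algebra_simps)
  also have "\<dots> = Y * (M * X ^ p * Y ^ q - M * X ^ q * Y ^ p)"
    using pq by (simp add: power_add[symmetric])
  finally have *: "(X - Y) * (\<Sum>t<p - q. M * X ^ (q + t) * Y ^ (p - t)) = Y * (M * X ^ p * Y ^ q - M * X ^ q * Y ^ p)" .
  show "pibar_poly i (M * X ^ p * Y ^ q) = (\<Sum>t<p - q. M * X ^ (q + t) * Y ^ (p - t))"
    by (rule pibar_polyI) (use * sw in \<open>simp add: X[symmetric] Y[symmetric] mult_ac\<close>)
  have "(X - Y) * - (\<Sum>t<p - q. M * X ^ (q + t) * Y ^ (p - t)) = - (Y * (M * X ^ p * Y ^ q - M * X ^ q * Y ^ p))"
    unfolding *[symmetric] by (simp only: mult_minus_right)
  also have "\<dots> = Y * (M * X ^ q * Y ^ p - swap_var i (M * X ^ q * Y ^ p))"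
    unfolding sw by (simp add: algebra_simps)
  finally show "pibar_poly i (M * X ^ q * Y ^ p) = - (\<Sum>t<p - q. M * X ^ (q + t) * Y ^ (p - t))"
    by (intro pibar_polyI) (simp add: X[symmetric] Y[symmetric])
qed

lemma square_between:
  assumes "q < a" "a < (p::nat)" "a + b = p + q"
  shows "a\<^sup>2 + b\<^sup>2 < p\<^sup>2 + q\<^sup>2"
proof -
  obtain c where c: "a = q + c" using assms by (metis less_imp_add_positive)
  obtain d where d: "p = a + d" using assms by (metis less_imp_add_positive)
  have b: "b = q + d" using assms c d by simp
  have "0 < c" "0 < d" using assms c d by auto
  then have "0 < c * d" by simp
  then show ?thesis unfolding d b c by (simp add: power2_eq_square algebra_simps)
qed

lemma fixed_away: "swap_var i (\<Prod>j\<in>{1..n} - {i, Suc i}. Var j ^ f j) = (\<Prod>j\<in>{1..n} - {i, Suc i}. Var j ^ f j)"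
proof -
  have sp: "swap_var i (Z ^ r) = swap_var i Z ^ r" for Z :: "'a mpoly" and r
    by (induction r) (simp_all add: swap_one swap_mult)
  show ?thesis unfolding swap_prod by (rule prod.cong) (auto simp: sp swap_Var sg_other)
qed

lemma pibar_sum_low:
  fixes f :: "nat \<Rightarrow> nat"
  assumes i: "i \<in> {1..<n}" and pq: "q < p" and g: "(g i = p \<and> g (Suc i) = q) \<or> (g i = q \<and> g (Suc i) = p)"
  shows "(\<Sum>t<p - q. (\<Prod>j\<in>{1..n} - {i, Suc i}. Var j ^ g j) * Var i ^ (q + t) * Var (Suc i) ^ (p - t))
     - mo (expo n (g(i := q, Suc i := p))) \<in> (low n (tdeg (expo n g)) (qn n (expo n g)) :: 'a::field mpoly set)"
proof -
  define h where "h t = g(i := q + t, Suc i := p - t)" for t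
  have e: "(\<Prod>j\<in>{1..n} - {i, Suc i}. Var j ^ g j) * Var i ^ (q + t) * Var (Suc i) ^ (p - t) = (mo (expo n (h t)) :: 'a mpoly)" for t
    unfolding mo_expo_two[OF i] by (intro arg_cong2[of _ _ _ _ "(*)"] prod.cong) (auto simp: h_def)
  have l: "mo (expo n (h t)) \<in> low n (tdeg (expo n g)) (qn n (expo n g))" if t: "0 < t" "t < p - q" for t
  proof (rule low_base[OF keys_expo])
    have r: "(\<Sum>j\<in>{1..n} - {i, Suc i}. k (h t j)) = (\<Sum>j\<in>{1..n} - {i, Suc i}. k (g j))" for k :: "nat \<Rightarrow> nat"
      by (rule sum.cong) (auto simp: h_def)
    show "tdeg (expo n (h t)) = tdeg (expo n g)"
      unfolding tdeg_expo sum_two[OF i] using r[of "\<lambda>x. x"] t g by (auto simp: h_def)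
    have "(q + t)\<^sup>2 + (p - t)\<^sup>2 < p\<^sup>2 + q\<^sup>2" using t by (intro square_between) auto
    then show "qn n (expo n (h t)) < qn n (expo n g)"
      unfolding qn_expo sum_two[OF i] using r[of "\<lambda>x. x\<^sup>2"] g by (auto simp: h_def)
  qed
  have "{..<p - q} = insert 0 {0<..<p - q}" using pq by auto
  then have "(\<Sum>t<p - q. mo (expo n (h t)) :: 'a mpoly) = mo (expo n (h 0)) + (\<Sum>t\<in>{0<..<p - q}. mo (expo n (h t)))" by simp
  moreover have "h 0 = g(i := q, Suc i := p)" by (simp add: h_def)
  moreover have "(\<Sum>t\<in>{0<..<p - q}. mo (expo n (h t)) :: 'a mpoly) \<in> low n (tdeg (expo n g)) (qn n (expo n g))"
    by (intro pm.subspace_sum low_subspace l) auto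
  ultimately show ?thesis unfolding e by simp
qed

text \<open>Up to monomials with a smaller sum of squares, pibar_i acts on monomials as pibar_i acts
  on words: a descent is swapped, equal exponents give zero, an ascent gives the negative. The two
  following lemmas are the other two cases.\<close>

lemma pibar_expo_desc:
  assumes i: "i \<in> {1..<n}" and f: "f (Suc i) < f i"
  shows "pibar_poly i (mo (expo n f)) - mo (expo n (f \<circ> sg i)) \<in> (low n (tdeg (expo n f)) (qn n (expo n f)) :: 'a::field mpoly set)"
proof -
  have "f \<circ> sg i = f(i := f (Suc i), Suc i := f i)" by (auto simp: fun_eq_iff sg_other)
  moreover have "pibar_poly i (mo (expo n f) :: 'a mpoly)
      = (\<Sum>t<f i - f (Suc i). (\<Prod>j\<in>{1..n} - {i, Suc i}. Var j ^ f j) * Var i ^ (f (Suc i) + t) * Var (Suc i) ^ (f i - t))"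
    unfolding mo_expo_two[OF i, of f] by (rule pibar_two(1)[OF fixed_away refl refl less_imp_le[OF f]])
  moreover note pibar_sum_low[OF i f, of f, where ?'a = 'a]
  ultimately show ?thesis by simp
qed

lemma pibar_expo_eq:
  assumes i: "i \<in> {1..<n}" and f: "f (Suc i) = f i"
  shows "pibar_poly i (mo (expo n f)) = 0"
  unfolding mo_expo_two[OF i, of f] f
  using pibar_two(1)[OF fixed_away refl refl order_refl] by simp

lemma pibar_expo_asc:
  assumes i: "i \<in> {1..<n}" and f: "f i < f (Suc i)"
  shows "pibar_poly i (mo (expo n f)) + mo (expo n f) \<in> (low n (tdeg (expo n f)) (qn n (expo n f)) :: 'a::field mpoly set)"
proof -
  have u: "f(i := f i, Suc i := f (Suc i)) = f" by (auto simp: fun_eq_iff)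
  let ?S = "\<Sum>t<f (Suc i) - f i. (\<Prod>j\<in>{1..n} - {i, Suc i}. Var j ^ f j) * Var i ^ (f i + t) * (Var (Suc i) :: 'a mpoly) ^ (f (Suc i) - t)"
  have "pibar_poly i (mo (expo n f)) = - ?S" unfolding mo_expo_two[OF i, of f]
    by (rule pibar_two(2)[OF fixed_away refl refl less_imp_le[OF f]])
  moreover have "- (?S - mo (expo n f)) \<in> low n (tdeg (expo n f)) (qn n (expo n f))"
    using pm.subspace_neg[OF low_subspace pibar_sum_low[OF i f disjI2[OF conjI[OF refl refl]], where ?'a = 'a]]
    unfolding u .
  ultimately show ?thesis by simp
qed

lemma expo_sg:
  assumes i: "i \<in> {1..<n}"
  shows "tdeg (expo n (f \<circ> sg i)) = tdeg (expo n f)" "qn n (expo n (f \<circ> sg i)) = qn n (expo n f)"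
proof -
  have r: "(\<Sum>j\<in>{1..n}. k ((f \<circ> sg i) j)) = (\<Sum>j\<in>{1..n}. k (f j))" for k :: "nat \<Rightarrow> nat"
    using sum.permute[OF sg_perm[OF i], of "\<lambda>j. k (f j)"] by (simp add: comp_def)
  show "tdeg (expo n (f \<circ> sg i)) = tdeg (expo n f)" unfolding tdeg_expo using r[of "\<lambda>x. x"] by simp
  show "qn n (expo n (f \<circ> sg i)) = qn n (expo n f)" unfolding qn_expo using r[of "\<lambda>x. x\<^sup>2"] by simp
qed

lemma pibar_low:
  assumes i: "i \<in> {1..<n}" and y: "y \<in> low n d q"
  shows "pibar_poly i y \<in> low n d q"
proof (rule lin_span_image[OF pibar_poly_lin _ low_subspace y[unfolded low_def]])
  fix z :: "'a mpoly" assume "z \<in> {mo m | m. keys m \<subseteq> {1..n} \<and> tdeg m = d \<and> qn n m < q}"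
  then obtain m where m: "z = mo m" "keys m \<subseteq> {1..n}" "tdeg m = d" "qn n m < q" by blast
  define f where "f = lookup m"
  have mf: "m = expo n f" using expo_lookup[OF m(2)] by (simp add: f_def)
  have sub: "low n (tdeg (expo n f)) (qn n (expo n f)) \<subseteq> (low n d q :: 'a mpoly set)"
    using m low_mono[of "qn n m" q n d] by (simp add: mf)
  have b: "mo (expo n f) \<in> low n d q" "mo (expo n (f \<circ> sg i)) \<in> low n d q"
    using m expo_sg[OF i, of f] by (auto intro!: low_base keys_expo simp: mf)
  consider "f i < f (Suc i)" | "f (Suc i) < f i" | "f (Suc i) = f i" by linarith
  then show "pibar_poly i z \<in> low n d q"
  proof cases
    case 1
    from subsetD[OF sub pibar_expo_asc[OF i 1]] show ?thesis
      using pm.subspace_diff[OF low_subspace _ b(1), of "pibar_poly i z + mo (expo n f)"] by (simp add: m(1) mf)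
  next
    case 2
    from subsetD[OF sub pibar_expo_desc[OF i 2]] show ?thesis
      using pm.subspace_add[OF low_subspace _ b(2), of "pibar_poly i z - mo (expo n (f \<circ> sg i))"] by (simp add: m(1) mf)
  next
    case 3
    then show ?thesis using pibar_expo_eq[OF i 3, where ?'a = 'a] pm.subspace_0[OF low_subspace] by (simp add: m(1) mf)
  qed
qed

lemma pi_pibar: "pi_poly i y = pibar_poly i y + y"
  by (simp add: pibar_poly_def)

lemma pi_low: "i \<in> {1..<n} \<Longrightarrow> y \<in> low n d q \<Longrightarrow> pi_poly i y \<in> low n d q"
  unfolding pi_pibar by (intro pm.subspace_add low_subspace pibar_low)

lemma polys_subspace: "pm.subspace (polys n)"
  unfolding polys_def by (rule subspace_keys)

lemma mo_polys: "keys m \<subseteq> {1..n} \<Longrightarrow> mo m \<in> polys n"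
  by (simp add: polys_def)

lemma mpoly_eq_lext: "f = lext mo f"
  by (simp add: lext_ident)

lemma low_polys: "low n d q \<subseteq> polys n"
  unfolding low_def by (rule pm.span_minimal[OF _ polys_subspace]) (auto intro: mo_polys)

lemma pi_polys:
  assumes i: "i \<in> {1..<n}" and f: "f \<in> polys n"
  shows "pi_poly i f \<in> (polys n :: 'a::field mpoly set)"
proof -
  have "pi_poly i f = pi_poly i (lext mo f)" by (simp only: mpoly_eq_lext[symmetric])
  also have "\<dots> = lext (\<lambda>m. pi_poly i (mo m)) f" by (rule lin_lext_comp[OF pi_poly_lin])
  also have "\<dots> \<in> polys n"
  proof (rule lext_in_subspace[OF polys_subspace])
    fix m assume "m \<in> keys f"
    then have m: "keys m \<subseteq> {1..n}" using f by (auto simp: polys_def)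
    have "mo m \<in> (low n (tdeg m) (Suc (qn n m)) :: 'a mpoly set)" by (rule low_base[OF m]) auto
    then show "pi_poly i (mo m) \<in> (polys n :: 'a mpoly set)" using pi_low[OF i] low_polys by blast
  qed
  finally show ?thesis .
qed

interpretation pol: hecke_module n pi_poly "polys n :: 'a::field mpoly set" for n
proof
  show "pi_poly i (pi_poly i x) = pi_poly i x" for i and x :: "'a mpoly"
    by (rule pi_poly_sym[OF swap_pi_poly])
qed (auto intro: pi_poly_lin polys_subspace pi_polys pi_poly_far pi_poly_braid)

lemma pibar_w_poly_eq: "pibar_w_poly n w = pol.pbar n w"
  by (rule ext) (simp add: pibar_w_poly_def pol.pbar_foldr pibar_poly_def[abs_def])

subsection \<open>The ideal is stable under the 0-Hecke action\<close>

lemma polys_one: "1 \<in> polys n"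
  by (simp add: polys_def)

lemma polys_Var: "j \<in> {1..n} \<Longrightarrow> Var j \<in> polys n"
  by (simp add: polys_def Var_def)

lemma polys_const: "const_poly c \<in> polys n"
  by (simp add: polys_def const_poly_def)

lemma polys_add: "f \<in> polys n \<Longrightarrow> g \<in> polys n \<Longrightarrow> f + g \<in> (polys n :: 'a::field mpoly set)"
  by (rule pm.subspace_add[OF polys_subspace])

lemma polys_sum: "(\<And>x. x \<in> S \<Longrightarrow> f x \<in> polys n) \<Longrightarrow> sum f S \<in> (polys n :: 'a::field mpoly set)"
  by (rule pm.subspace_sum[OF polys_subspace])

lemma polys_mult: "f \<in> polys n \<Longrightarrow> g \<in> polys n \<Longrightarrow> f * g \<in> polys n"
proof -
  assume f: "f \<in> polys n" and g: "g \<in> polys n"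
  show "f * g \<in> polys n" unfolding polys_def
  proof safe
    fix m x assume m: "m \<in> keys (f * g)" and x: "x \<in> keys m"
    obtain a b where ab: "m = a + b" "a \<in> keys f" "b \<in> keys g" using keys_mult[of f g] m by blast
    have "keys m \<subseteq> keys a \<union> keys b" unfolding ab(1) by (rule Poly_Mapping.keys_add)
    then show "x \<in> {1..n}" using f g ab(2,3) x unfolding polys_def by blast
  qed
qed

lemma polys_prod: "(\<And>x. x \<in> S \<Longrightarrow> f x \<in> polys n) \<Longrightarrow> prod f S \<in> polys n"
  by (induction S rule: infinite_finite_induct) (auto intro: polys_mult polys_one)

lemma polys_power: "f \<in> polys n \<Longrightarrow> f ^ p \<in> polys n"
  by (induction p) (auto intro: polys_mult polys_one)

lemma swap_polys: "i \<in> {1..<n} \<Longrightarrow> f \<in> polys n \<Longrightarrow> swap_var i f \<in> (polys n :: 'a::field mpoly set)"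
proof -
  assume i: "i \<in> {1..<n}" and f: "f \<in> polys n"
  have "sg i x \<in> {1..n}" if "m \<in> keys f" "x \<in> keys m" for m x
    using that f sg_range[OF i] unfolding polys_def by blast
  then show ?thesis unfolding swap_var_def
    by (intro polys_sum polys_mult polys_const polys_prod polys_power polys_Var)
qed

lemma finite_hset: "finite {m. keys m \<subseteq> {1..j} \<and> tdeg m = k}"
proof (rule finite_subset)
  show "{m. keys m \<subseteq> {1..j} \<and> tdeg m = k} \<subseteq> expo j ` ({1..j} \<rightarrow>\<^sub>E {..k})"
  proof
    fix m assume "m \<in> {m. keys m \<subseteq> {1..j} \<and> tdeg m = k}"
    then have m: "keys m \<subseteq> {1..j}" "tdeg m = k" by auto
    have le: "lookup m i \<le> k" if "i \<in> {1..j}" for i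
      using member_le_sum[of i "{1..j}" "lookup m"] that m by (simp add: tdeg_sum[OF m(1), symmetric])
    have "m = expo j (restrict (lookup m) {1..j})"
      using expo_lookup[OF m(1)] expo_cong[of j "restrict (lookup m) {1..j}" "lookup m"] by simp
    then show "m \<in> expo j ` ({1..j} \<rightarrow>\<^sub>E {..k})" using le by (intro image_eqI) auto
  qed
  show "finite (expo j ` ({1..j} \<rightarrow>\<^sub>E {..k}))" by (intro finite_imageI finite_PiE) auto
qed

lemma tdeg_add: "tdeg (a + b) = tdeg a + tdeg b"
proof -
  have s: "tdeg c = (\<Sum>x\<in>S. lookup c x)" if "finite S" "keys c \<subseteq> S" for c S
    unfolding tdeg_def by (rule sum.mono_neutral_left) (use that in \<open>auto simp: in_keys_iff\<close>)
  let ?S = "keys a \<union> keys b"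
  have "keys (a + b) \<subseteq> ?S" by (rule Poly_Mapping.keys_add)
  then show ?thesis by (simp add: s[of ?S] lookup_add sum.distrib)
qed

lemma tdeg_single [simp]: "tdeg (Poly_Mapping.single j p) = p"
  by (simp add: tdeg_def)

lemma tdeg_zero_iff: "tdeg m = 0 \<longleftrightarrow> m = 0"
proof
  assume "tdeg m = 0"
  then have "\<forall>x\<in>keys m. lookup m x = 0" by (simp add: tdeg_def)
  then show "m = 0" by (intro poly_mapping_eqI) (auto simp: in_keys_iff)
qed (simp add: tdeg_def)

lemma h_poly_0: "h_poly 0 j = 1"
proof -
  have "{m. keys m \<subseteq> {1..j} \<and> tdeg m = 0} = {0::nat \<Rightarrow>\<^sub>0 nat}" by (auto simp: tdeg_zero_iff)
  then show ?thesis by (simp add: h_poly_def)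
qed

text \<open>The monomials of degree k+1 are split according to whether the last variable divides
  them.\<close>

lemma h_poly_Suc: "h_poly (Suc k) (Suc j) = h_poly (Suc k) j + Var (Suc j) * (h_poly k (Suc j) :: 'a::comm_ring_1 mpoly)"
proof -
  let ?H = "\<lambda>k j. {m. keys m \<subseteq> {1..j} \<and> tdeg m = k}"
  let ?e = "Poly_Mapping.single (Suc j) (1::nat)"
  have eq: "?H (Suc k) (Suc j) = ?H (Suc k) j \<union> (\<lambda>m. m + ?e) ` ?H k (Suc j)"
  proof (intro equalityI subsetI)
    fix m assume m: "m \<in> ?H (Suc k) (Suc j)"
    show "m \<in> ?H (Suc k) j \<union> (\<lambda>m. m + ?e) ` ?H k (Suc j)"
    proof (cases "Suc j \<in> keys m")
      case False
      moreover have "{1..Suc j} = insert (Suc j) {1..j}" by auto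
      ultimately show ?thesis using m by auto
    next
      case True
      then have p: "lookup m (Suc j) \<noteq> 0" by (simp add: in_keys_iff)
      have me: "m = (m - ?e) + ?e"
        using p by (intro poly_mapping_eqI) (auto simp: lookup_add lookup_minus lookup_single when_def)
      have "keys (m - ?e) \<subseteq> keys m" by (auto simp: in_keys_iff lookup_minus)
      moreover have "tdeg m = tdeg (m - ?e) + 1" by (subst me) (simp add: tdeg_add)
      ultimately show ?thesis using m me by auto
    qed
  next
    fix m assume "m \<in> ?H (Suc k) j \<union> (\<lambda>m. m + ?e) ` ?H k (Suc j)"
    then show "m \<in> ?H (Suc k) (Suc j)"
    proof
      assume "m \<in> (\<lambda>m. m + ?e) ` ?H k (Suc j)"
      then obtain m' where m': "m = m' + ?e" "m' \<in> ?H k (Suc j)" by blast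
      have "keys m \<subseteq> keys m' \<union> {Suc j}" using Poly_Mapping.keys_add[of m' ?e] unfolding m'(1) by simp
      then show ?thesis using m' by (auto simp: tdeg_add)
    next
      assume "m \<in> ?H (Suc k) j"
      then show ?thesis by auto
    qed
  qed
  have disj: "?H (Suc k) j \<inter> (\<lambda>m. m + ?e) ` ?H k (Suc j) = {}"
  proof safe
    fix m assume "keys (m + ?e) \<subseteq> {1..j}"
    moreover have "Suc j \<in> keys (m + ?e)" by (simp add: in_keys_iff lookup_add)
    ultimately show "m + ?e \<in> {}" by auto
  qed
  have inj: "inj_on (\<lambda>m. m + ?e) (?H k (Suc j))" by (rule inj_onI) simp
  show ?thesis unfolding h_poly_def eq
    by (subst sum.union_disjoint[OF finite_hset finite_imageI[OF finite_hset] disj])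
       (simp add: sum.reindex[OF inj] sum_distrib_left Var_def mult_single add.commute)
qed

lemma h_poly_Suc_0: "h_poly (Suc k) 0 = 0"
proof -
  have "{m :: nat \<Rightarrow>\<^sub>0 nat. keys m \<subseteq> {1..0} \<and> tdeg m = Suc k} = {}" by (auto simp: tdeg_def)
  then show ?thesis unfolding h_poly_def by (simp only: sum.empty)
qed

lemma swap_h_poly_less: "j < i \<Longrightarrow> swap_var i (h_poly k j) = (h_poly k j :: 'a::comm_ring_1 mpoly)"
proof (induction j arbitrary: k)
  case 0
  show ?case by (cases k) (simp_all add: h_poly_0 h_poly_Suc_0 swap_one swap_var_eq)
next
  case (Suc j)
  show ?case
  proof (induction k)
    case (Suc k)
    then show ?case using Suc.prems Suc.IH \<open>Suc j < i\<close>
      by (simp add: h_poly_Suc swap_add swap_mult swap_Var sg_other \<open>\<And>k. j < i \<Longrightarrow> swap_var i (h_poly k j) = h_poly k j\<close>)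
  qed (simp add: h_poly_0 swap_one)
qed

lemma swap_h_poly_base: "1 \<le> i \<Longrightarrow> swap_var i (h_poly k (Suc i)) = (h_poly k (Suc i) :: 'a::comm_ring_1 mpoly)"
proof (induction k rule: less_induct)
  case (less k)
  obtain l where l: "i = Suc l" using less.prems by (cases i) auto
  consider "k = 0" | "k = 1" | m where "k = Suc (Suc m)" by (metis One_nat_def not0_implies_Suc)
  then show ?case
  proof cases
    case 1
    then show ?thesis by (simp add: h_poly_0 swap_one)
  next
    case 2
    have fl: "swap_var i (h_poly (Suc 0) l) = (h_poly (Suc 0) l :: 'a mpoly)" by (rule swap_h_poly_less) (simp add: l)
    show ?thesis unfolding 2 One_nat_def h_poly_Suc unfolding l h_poly_Suc unfolding h_poly_0
      using fl by (simp add: swap_add swap_mult swap_Var swap_one l add_ac)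
  next
    case (3 m)
    have fl: "swap_var i (h_poly k l) = (h_poly k l :: 'a mpoly)" by (rule swap_h_poly_less) (simp add: l)
    have e1: "h_poly k (Suc i) = h_poly k i + Var (Suc i) * (h_poly (Suc m) (Suc i) :: 'a mpoly)" unfolding 3 by (rule h_poly_Suc)
    have e2: "h_poly k i = h_poly k l + Var i * (h_poly (Suc m) i :: 'a mpoly)" unfolding 3 l by (rule h_poly_Suc)
    have e3: "h_poly (Suc m) i = h_poly (Suc m) (Suc i) - Var (Suc i) * (h_poly m (Suc i) :: 'a mpoly)"
      unfolding h_poly_Suc[of m i] by simp
    \<comment> \<open>The last two variables enter only through their sum and their product, and the
      degrees drop by one and two; this is why the induction hypothesis is needed for two smaller
      values of k.\<close>
    have e: "h_poly k (Suc i) = h_poly k l + (Var i + Var (Suc i)) * h_poly (Suc m) (Suc i)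
        - Var i * Var (Suc i) * (h_poly m (Suc i) :: 'a mpoly)"
      unfolding e1 e2 e3 by (simp add: algebra_simps)
    have IH: "swap_var i (h_poly (Suc m) (Suc i)) = (h_poly (Suc m) (Suc i) :: 'a mpoly)"
      "swap_var i (h_poly m (Suc i)) = (h_poly m (Suc i) :: 'a mpoly)"
      using less 3 by auto
    show ?thesis unfolding e
      by (simp add: swap_add swap_diff swap_mult swap_Var fl IH) (simp add: algebra_simps)
  qed
qed

lemma swap_h_poly_greater: "1 \<le> i \<Longrightarrow> swap_var i (h_poly k (Suc i + d)) = (h_poly k (Suc i + d) :: 'a::comm_ring_1 mpoly)"
proof (induction d arbitrary: k)
  case 0
  then show ?case using swap_h_poly_base by simp
next
  case (Suc d)
  note IHd = Suc.IH[OF Suc.prems]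
  show ?case
  proof (induction k)
    case (Suc k)
    then show ?case using IHd[of "Suc k"] by (simp add: h_poly_Suc swap_add swap_mult swap_Var sg_other)
  qed (simp add: h_poly_0 swap_one)
qed

lemma swap_h_poly: "1 \<le> i \<Longrightarrow> j \<noteq> i \<Longrightarrow> swap_var i (h_poly k j) = (h_poly k j :: 'a::comm_ring_1 mpoly)"
proof (cases "j < i")
  case False
  assume "1 \<le> i" "j \<noteq> i"
  then show ?thesis using False swap_h_poly_greater[of i k "j - Suc i", where ?'a = 'a] by simp
qed (simp add: swap_h_poly_less)

text \<open>The divided difference of a complete symmetric polynomial in x_1, ..., x_i is the one of
  degree one less in x_1, ..., x_{i+1}. It follows by applying s_i to the recursion for x_{i+1} and
  comparing with the recursion itself.\<close>

lemma swap_h_poly_diff: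
  assumes "1 \<le> i"
  shows "(Var i - Var (Suc i)) * h_poly k (Suc i) = h_poly (Suc k) i - swap_var i (h_poly (Suc k) i :: 'a::comm_ring_1 mpoly)"
proof -
  have "swap_var i (h_poly (Suc k) (Suc i)) = swap_var i (h_poly (Suc k) i) + Var i * (h_poly k (Suc i) :: 'a mpoly)"
    unfolding h_poly_Suc[of k i] by (simp add: swap_add swap_mult swap_Var swap_h_poly_base[OF assms])
  then have "h_poly (Suc k) (Suc i) = swap_var i (h_poly (Suc k) i) + Var i * (h_poly k (Suc i) :: 'a mpoly)"
    unfolding swap_h_poly_base[OF assms] .
  then have "h_poly (Suc k) i + Var (Suc i) * h_poly k (Suc i) = swap_var i (h_poly (Suc k) i) + Var i * (h_poly k (Suc i) :: 'a mpoly)"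
    by (simp only: h_poly_Suc[of k i])
  then show ?thesis by (simp add: algebra_simps)
qed

lemma swap_e_poly:
  assumes i: "i \<in> {1..<n}"
  shows "swap_var i (e_poly n j) = (e_poly n j :: 'a::comm_ring_1 mpoly)"
proof -
  let ?S = "{S. S \<subseteq> {1..n} \<and> card S = j}"
  have im: "sg i ` S \<in> ?S" if "S \<in> ?S" for S
    using that sg_range[OF i] by (auto simp: card_image simp del: atLeastAtMost_iff)
  have "swap_var i (e_poly n j) = (\<Sum>S\<in>?S. \<Prod>s\<in>S. Var (sg i s) :: 'a mpoly)"
    by (simp add: e_poly_def swap_sum swap_prod swap_Var)
  also have "\<dots> = (\<Sum>S\<in>?S. \<Prod>s\<in>S. Var s)"
  proof (rule sum.reindex_bij_witness[where i = "image (sg i)" and j = "image (sg i)"])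
    show "(\<Prod>s\<in>sg i ` S. Var s) = (\<Prod>s\<in>S. Var (sg i s) :: 'a mpoly)" for S
      by (simp add: prod.reindex)
  qed (use im in \<open>auto simp: image_image simp del: mem_Collect_eq\<close>)
  finally show ?thesis by (simp add: e_poly_def)
qed

lemma h_poly_polys: "j \<le> n \<Longrightarrow> h_poly k j \<in> (polys n :: 'a::field mpoly set)"
  unfolding h_poly_def by (intro polys_sum mo_polys) auto

lemma e_poly_polys: "e_poly n j \<in> (polys n :: 'a::field mpoly set)"
  unfolding e_poly_def by (intro polys_sum polys_prod polys_Var) auto

lemma finite_Jgens: "finite (Jgens n k :: 'a::comm_ring_1 mpoly set)"
proof -
  have "(Jgens n k :: 'a mpoly set) = h_poly k ` {1..n} \<union> e_poly n ` {Suc (n - k)..n}" unfolding Jgens_def by blast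
  then show ?thesis by simp
qed

lemma Jgens_polys: "g \<in> Jgens n k \<Longrightarrow> g \<in> (polys n :: 'a::field mpoly set)"
  unfolding Jgens_def using h_poly_polys e_poly_polys by auto

lemma J_I: "(\<And>g. g \<in> Jgens n k \<Longrightarrow> c g \<in> polys n) \<Longrightarrow> (\<Sum>g\<in>Jgens n k. c g * g) \<in> J n k"
  unfolding J_def by blast

lemma J_add: "f \<in> J n k \<Longrightarrow> g \<in> J n k \<Longrightarrow> f + g \<in> (J n k :: 'a::field mpoly set)"
proof -
  assume "f \<in> J n k" "g \<in> J n k"
  then obtain c d where cd: "\<forall>g\<in>Jgens n k. c g \<in> polys n" "\<forall>g\<in>Jgens n k. d g \<in> polys n"
    and e: "f = (\<Sum>g\<in>Jgens n k. c g * g)" "g = (\<Sum>g\<in>Jgens n k. d g * g)" unfolding J_def by blast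
  have "f + g = (\<Sum>g\<in>Jgens n k. (c g + d g) * g)" unfolding e by (simp add: distrib_right sum.distrib)
  then show ?thesis using J_I[of n k "\<lambda>g. c g + d g"] cd by (simp add: polys_add)
qed

lemma J_mult: "p \<in> polys n \<Longrightarrow> f \<in> J n k \<Longrightarrow> p * f \<in> (J n k :: 'a::field mpoly set)"
proof -
  assume p: "p \<in> polys n" and "f \<in> J n k"
  then obtain c where c: "\<forall>g\<in>Jgens n k. c g \<in> polys n" and e: "f = (\<Sum>g\<in>Jgens n k. c g * g)" unfolding J_def by blast
  have "p * f = (\<Sum>g\<in>Jgens n k. (p * c g) * g)" unfolding e by (simp add: sum_distrib_left mult_ac)
  then show ?thesis using J_I[of n k "\<lambda>g. p * c g"] c p by (simp add: polys_mult)
qed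

lemma J_subspace: "pm.subspace (J n k :: 'a::field mpoly set)"
  unfolding pm.subspace_def
proof safe
  show "(0 :: 'a mpoly) \<in> J n k" using J_I[of n k "\<lambda>_. 0 :: 'a mpoly"] by (simp add: polys_def)
next
  fix c and f :: "'a mpoly" assume "f \<in> J n k"
  then show "smul c f \<in> J n k" unfolding smul_const_poly by (intro J_mult polys_const)
qed (rule J_add)

lemma Jgens_J: "g \<in> Jgens n k \<Longrightarrow> g \<in> (J n k :: 'a::field mpoly set)"
proof -
  assume g: "g \<in> Jgens n k"
  have "(\<Sum>h\<in>Jgens n k. (if h = g then 1 else 0) * h) = g"
    using g finite_Jgens[of n k, where ?'a = 'a] by (simp add: if_distrib[of "\<lambda>c. c * _"] cong: if_cong)
  then show ?thesis using J_I[of n k "\<lambda>h. if h = g then 1 else 0"] polys_one[of n, where ?'a = 'a]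
      pm.subspace_0[OF polys_subspace[of n, where ?'a = 'a]] by (simp split: if_splits)
qed

lemma J_polys: "J n k \<subseteq> (polys n :: 'a::field mpoly set)"
proof
  fix f :: "'a mpoly" assume "f \<in> J n k"
  then obtain c where "\<forall>g\<in>Jgens n k. c g \<in> polys n" "f = (\<Sum>g\<in>Jgens n k. c g * g)" unfolding J_def by blast
  moreover have "g \<in> Jgens n k \<Longrightarrow> g \<in> polys n" for g :: "'a mpoly" by (rule Jgens_polys)
  ultimately show "f \<in> polys n" by (auto intro!: polys_sum polys_mult)
qed

text \<open>A generator that s_i fixes can be pulled out of pi_i. The generator that may move is
  h_k(x_1, ..., x_i), and applying pibar_i to it produces its difference with h_k(x_1, ...,
  x_{i+1}), which is again a generator since i < n.\<close>

lemma J_stable: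
  assumes k: "1 \<le> k" and i: "i \<in> {1..<n}" and f: "f \<in> J n k"
  shows "pi_poly i f \<in> (J n k :: 'a::field mpoly set)"
proof -
  obtain c where c: "\<forall>g\<in>Jgens n k. c g \<in> polys n" and e: "f = (\<Sum>g\<in>Jgens n k. c g * g)" using f unfolding J_def by blast
  have "pi_poly i (c g * g) \<in> J n k" if g: "g \<in> Jgens n k" for g
  proof (cases "swap_var i g = g")
    case True
    then show ?thesis unfolding pi_poly_symmetric_mult[OF True]
      by (intro J_mult pi_polys i Jgens_J g) (use c g in blast)
  next
    case False
    then obtain j where j: "g = h_poly k j" "j \<in> {1..n}" using g swap_e_poly[OF i, where ?'a = 'a] unfolding Jgens_def by auto
    then have ji: "j = i" using False swap_h_poly[of i j k, where ?'a = 'a] i by auto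
    have i1: "1 \<le> i" using i by simp
    obtain k' where k': "k = Suc k'" using k by (cases k) auto
    let ?c = "c g" and ?h = "h_poly k i :: 'a mpoly" and ?h' = "h_poly k (Suc i) :: 'a mpoly"
    have hh: "g = ?h" using j ji by simp
    have d: "(Var i - Var (Suc i)) * h_poly k' (Suc i) = ?h - swap_var i ?h" unfolding k' by (rule swap_h_poly_diff[OF i1])
    have hs: "?h' - ?h = Var (Suc i) * h_poly k' (Suc i)" unfolding k' h_poly_Suc by simp
    \<comment> \<open>Twisted product rule, combined with pibar_i ?h = x_{i+1} h_{k-1}(x_1, ...,
      x_{i+1}) = ?h' - ?h.\<close>
    have "pibar_poly i (?c * ?h) = pibar_poly i ?c * ?h + swap_var i ?c * (?h' - ?h)"
    proof (rule pibar_polyI)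
      have "(Var i - Var (Suc i)) * (pibar_poly i ?c * ?h + swap_var i ?c * (?h' - ?h))
          = ((Var i - Var (Suc i)) * pibar_poly i ?c) * ?h + swap_var i ?c * Var (Suc i) * ((Var i - Var (Suc i)) * h_poly k' (Suc i))"
        unfolding hs by (simp only: distrib_left mult_ac)
      also have "\<dots> = Var (Suc i) * (?c * ?h - swap_var i (?c * ?h))"
        unfolding d pibar_poly_eq by (simp add: swap_mult algebra_simps)
      finally show "(Var i - Var (Suc i)) * (pibar_poly i ?c * ?h + swap_var i ?c * (?h' - ?h)) = \<dots>" .
    qed
    then have eq: "pi_poly i (?c * ?h) = pi_poly i ?c * ?h + swap_var i ?c * (?h' - ?h)"
      unfolding pibar_poly_def by (simp add: algebra_simps)
    have cp: "?c \<in> polys n" using c g by blast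
    have "?h \<in> J n k" using Jgens_J g hh by simp
    moreover have "?h' \<in> J n k" by (rule Jgens_J) (use i in \<open>auto simp: Jgens_def\<close>)
    ultimately show ?thesis unfolding hh[symmetric] eq[folded hh]
      using pi_polys[OF i cp] swap_polys[OF i cp]
      by (intro J_add J_mult pm.subspace_diff[OF J_subspace]) (simp_all add: hh)
  qed
  then show ?thesis unfolding e lin_sum[OF pi_poly_lin] by (intro pm.subspace_sum J_subspace)
qed

subsection \<open>Straightening\<close>

context hecke_module
begin

text \<open>Each further letter is absorbed by pibar_v on the right: it either lengthens
  \<open>v\<close> or only changes the sign, so the length never drops.\<close>

lemma pbar_word_ge:
  assumes "x \<in> M" "is_word n us" "perm n v"
  shows "pbar v (foldr (\<lambda>i y. T i y - y) us x) \<in> pm.span {pbar u x | u. perm n u \<and> ninv n v \<le> ninv n u}"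
  using assms(2,3)
proof (induction us arbitrary: v)
  case Nil
  then show ?case by (auto intro!: pm.span_base)
next
  case (Cons i us)
  let ?y = "foldr (\<lambda>i y. T i y - y) us x"
  have i: "i \<in> {1..<n}" and us: "is_word n us" using Cons.prems by auto
  have "is_word n us \<Longrightarrow> foldr (\<lambda>i y. T i y - y) us x \<in> M" for us
    by (induction us) (auto intro!: assms pm.subspace_diff[OF sub_M] stable)
  then have y: "?y \<in> M" using us by blast
  show ?case
  proof (cases "i \<in> pDes n v")
    case True
    then show ?thesis using pbar_right_down[OF y Cons.prems(2) True] Cons.IH[OF us Cons.prems(2)]
      by (simp add: pm.span_neg)
  next
    case False
    have p: "perm n (v \<circ> sg i)" by (rule perm_comp_sg[OF Cons.prems(2) i])
    have "v i < v (Suc i)" using False i perm_neq[OF Cons.prems(2), of i] by (simp add: pDes_def)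
    then have "ninv n v \<le> ninv n (v \<circ> sg i)" using ninv_right_up[OF Cons.prems(2) i] by simp
    then have "pm.span {pbar u x | u. perm n u \<and> ninv n (v \<circ> sg i) \<le> ninv n u}
        \<subseteq> pm.span {pbar u x | u. perm n u \<and> ninv n v \<le> ninv n u}" by (intro pm.span_mono) auto
    moreover have "pbar (v \<circ> sg i) ?y \<in> pm.span {pbar u x | u. perm n u \<and> ninv n (v \<circ> sg i) \<le> ninv n u}"
      by (rule Cons.IH[OF us p])
    moreover have "pbar v (foldr (\<lambda>i y. T i y - y) (i # us) x) = pbar (v \<circ> sg i) ?y"
      using pbar_right_up[OF y Cons.prems(2) i False] by simp
    ultimately show ?thesis by (simp only: subsetD)
  qed
qed

text \<open>The first letter is not a descent of \<open>w\<close>, so it makes the permutation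
  strictly longer; the later letters cannot undo this. It is applied to rearrangements of an
  exponent vector.\<close>

lemma pbar_word_longer:
  assumes x: "x \<in> M" and us: "is_word n (i # us)" and w: "perm n w" and i: "i \<notin> pDes n w"
  shows "pbar w (foldr (\<lambda>i y. T i y - y) (i # us) x) \<in> plonger w x"
proof -
  let ?y = "foldr (\<lambda>i y. T i y - y) us x"
  have "is_word n us \<Longrightarrow> foldr (\<lambda>i y. T i y - y) us x \<in> M" for us
    by (induction us) (auto intro!: x pm.subspace_diff[OF sub_M] stable)
  then have y: "?y \<in> M" using us by simp
  have i': "i \<in> {1..<n}" using us by simp
  have "w i < w (Suc i)" using i i' perm_neq[OF w, of i] by (simp add: pDes_def)
  then have l: "ninv n w < ninv n (w \<circ> sg i)" using ninv_right_up[OF w i'] by simp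
  have "pbar w (foldr (\<lambda>i y. T i y - y) (i # us) x) = pbar (w \<circ> sg i) ?y"
    using pbar_right_up[OF y w i' i] by simp
  also have "\<dots> \<in> pm.span {pbar u x | u. perm n u \<and> ninv n (w \<circ> sg i) \<le> ninv n u}"
    by (rule pbar_word_ge[OF x _ perm_comp_sg[OF w i']]) (use us in simp)
  also have "\<dots> \<subseteq> plonger w x" unfolding plonger_def by (rule pm.span_mono) (use l in auto)
  finally show ?thesis .
qed

lemma pbar_id: "pbar id x = x"
proof -
  have "length (rw n id) = 0" using red_rw[OF permutes_id, of n] unfolding red_def by (simp only: ninv_id)
  then show ?thesis by (simp add: pbar_foldr)
qed

end

definition dec :: "nat \<Rightarrow> (nat \<Rightarrow>\<^sub>0 nat) \<Rightarrow> bool" where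
  "dec n l \<longleftrightarrow> keys l \<subseteq> {1..n} \<and> (\<forall>j\<in>{1..<n}. lookup l (Suc j) \<le> lookup l j)"

definition lDes :: "nat \<Rightarrow> (nat \<Rightarrow>\<^sub>0 nat) \<Rightarrow> nat set" where
  "lDes n l = {j \<in> {1..<n}. lookup l (Suc j) < lookup l j}"

text \<open>The pairs that no reduction removes. A descent of \<open>w\<close> at which
  \<open>l\<close> is constant gives zero; a first exponent of at least k makes the monomial
  divisible by x_1^k = h_k(x_1); a drop of \<open>l\<close> at j > n-k that exceeds 1 at a descent
  of \<open>w\<close>, or 0 elsewhere, is removed with e_j. At j = n the exponent of x_{n+1}, which
  is 0, is the term of comparison.\<close>

definition good :: "nat \<Rightarrow> nat \<Rightarrow> (nat \<Rightarrow> nat) \<Rightarrow> (nat \<Rightarrow>\<^sub>0 nat) \<Rightarrow> bool" where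
  "good n k w l \<longleftrightarrow> pDes n w \<subseteq> lDes n l \<and> lookup l 1 < k \<and>
     (\<forall>j\<in>{Suc (n - k)..n}. lookup l j \<le> lookup l (Suc j) + (if j \<in> pDes n w then 1 else 0))"

lemma pi_mo_fixed:
  assumes "dec n l" "j \<in> {1..<n}" "j \<notin> lDes n l"
  shows "pi_poly j (mo l) = (mo l :: 'a::field mpoly)"
proof -
  have k: "keys l \<subseteq> {1..n}" and "lookup l (Suc j) \<le> lookup l j" using assms(1,2) unfolding dec_def by blast+
  then have "lookup l (Suc j) = lookup l j" using assms(2,3) by (simp add: lDes_def)
  then have "pibar_poly j (mo (expo n (lookup l)) :: 'a mpoly) = 0" by (intro pibar_expo_eq assms)
  then show ?thesis using expo_lookup[OF k] by (simp add: pibar_poly_def)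
qed

lemma pbar_low: "perm n w \<Longrightarrow> y \<in> low n d q \<Longrightarrow> pol.pbar n w y \<in> low n d q"
  by (rule pol.pbar_in_stable) (auto intro: low_subspace pi_low)

lemma pbar_J: "1 \<le> k \<Longrightarrow> perm n w \<Longrightarrow> y \<in> J n k \<Longrightarrow> pol.pbar n w y \<in> J n k"
  by (rule pol.pbar_in_stable) (auto intro: J_subspace J_stable)

lemma initial_segment:
  fixes S :: "nat set"
  assumes S: "S \<subseteq> {1..n}" "S \<noteq> {1..card S}"
  obtains i where "1 \<le> i" "i \<notin> S" "Suc i \<in> S"
proof (rule ccontr)
  assume nt: "\<not> thesis"
  note ob = that
  have dn: "i \<in> S" if "1 \<le> i" "Suc i \<in> S" for i using ob[of i] nt that by blast
  have fin: "finite S" using S finite_subset by blast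
  have ne: "S \<noteq> {}" using S by auto
  have "1 \<le> i \<Longrightarrow> i + d \<in> S \<Longrightarrow> i \<in> S" for i d
  proof (induction d)
    case (Suc d)
    then show ?case using dn[of "i + d"] by simp
  qed simp
  then have "i \<in> S" if "1 \<le> i" "i \<le> Max S" for i
    using that Max_in[OF fin ne] by (metis le_add_diff_inverse)
  then have "S = {1..Max S}" using fin S by auto
  then show False using S(2) by (metis card_atLeastAtMost diff_Suc_1)
qed

lemma e_poly_mo:
  "e_poly n j * mo (expo n f) = (\<Sum>S\<in>{S. S \<subseteq> {1..n} \<and> card S = j}. mo (expo n (\<lambda>s. f s + (if s \<in> S then 1 else 0))) :: 'a::comm_ring_1 mpoly)"
  unfolding e_poly_def sum_distrib_right
proof (rule sum.cong[OF refl])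
  fix S assume "S \<in> {S. S \<subseteq> {1..n} \<and> card S = j}"
  then have S: "{1..n} \<inter> S = S" by auto
  have "(\<Prod>s\<in>S. Var s) = (\<Prod>s\<in>{1..n}. if s \<in> S then Var s else 1 :: 'a mpoly)"
    by (simp add: prod.If_cases S)
  then have "(\<Prod>s\<in>S. Var s) * mo (expo n f) = (\<Prod>s\<in>{1..n}. (if s \<in> S then Var s else 1) * Var s ^ f s :: 'a mpoly)"
    by (simp add: mo_expo prod.distrib)
  also have "\<dots> = (\<Prod>s\<in>{1..n}. Var s ^ (f s + (if s \<in> S then 1 else 0)))"
    by (rule prod.cong) (auto simp: power_add mult.commute)
  finally show "(\<Prod>s\<in>S. Var s) * mo (expo n f) = (mo (expo n (\<lambda>s. f s + (if s \<in> S then 1 else 0))) :: 'a mpoly)"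
    by (simp add: mo_expo)
qed

lemma h_poly_1: "h_poly k 1 = Var 1 ^ k"
  unfolding One_nat_def by (induction k) (simp_all add: h_poly_0 h_poly_Suc h_poly_Suc_0)

text \<open>Multiplying \<open>x^\<mu>\<close> by an elementary symmetric polynomial produces \<open>x^\<lambda>\<close>, monomials that are
  smaller for the sum of squares of the exponents, and rearrangements of \<open>\<lambda>\<close> reached from \<open>\<lambda>\<close> by
  swaps in the stabilizer of \<open>\<mu>\<close>.\<close>

lemma elementary_terms:
  fixes f :: "nat \<Rightarrow> nat"
  assumes f: "\<And>i. i \<in> {1..<n} \<Longrightarrow> f (Suc i) \<le> f i" and j: "1 \<le> j" "j \<le> n"
    and d: "d = (\<Sum>s\<in>{1..n}. f s) + j" and S: "S \<subseteq> {1..n}" "card S = j"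
    and q: "q = qn n (expo n (\<lambda>s. f s + (if s \<in> {1..j} then 1 else 0)))"
    and F: "F = (\<lambda>S s. f s + (if s \<in> S then 1 else 0))"
  shows "qn n (expo n (F S)) \<le> q \<and> (mo (expo n (F S)) \<in> (low n d q :: 'a::field mpoly set) \<or>
     (\<exists>us. is_word n us \<and> (\<forall>i\<in>set us. f (Suc i) = f i) \<and> (us = [] \<longrightarrow> S = {1..j}) \<and>
        mo (expo n (F S)) - foldr pibar_poly us (mo (expo n (F {1..j}))) \<in> (low n d q :: 'a mpoly set)))"
  using S
proof (induction "\<Sum>S" arbitrary: S rule: less_induct)
  case less
  have deg: "tdeg (expo n (F S)) = d" if "S \<subseteq> {1..n}" "card S = j" for S
  proof -
    have "{1..n} \<inter> S = S" using that by auto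
    then show ?thesis using that by (simp add: tdeg_expo F sum.distrib d sum.If_cases)
  qed
  show ?case
  proof (cases "S = {1..j}")
    case True
    then show ?thesis using pm.subspace_0[OF low_subspace]
      by (intro conjI disjI2 exI[of _ "[]"]) (auto simp: q F)
  next
    case False
    then obtain i where i: "1 \<le> i" "i \<notin> S" "Suc i \<in> S" using initial_segment[OF less.prems(1)] less.prems(2) by metis
    have i': "i \<in> {1..<n}" using i less.prems by auto
    have fin: "finite S" using less.prems finite_subset by blast
    \<comment> \<open>Moving the element i+1 of \<open>S\<close> down to i lowers the sum of the
      elements; the induction ends at the initial segment {1..j}, which yields x^\<lambda>
      itself.\<close>
    define S' where "S' = insert i (S - {Suc i})"
    have cS': "card S' = j" using fin i less.prems card_Suc_Diff1[of S "Suc i"] by (simp add: S'_def)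
    have S'n: "S' \<subseteq> {1..n}" using less.prems i' by (auto simp: S'_def)
    have "\<Sum>S = Suc i + \<Sum>(S - {Suc i})" using sum.remove[OF fin i(3), of "\<lambda>x. x"] .
    moreover have "\<Sum>S' = i + \<Sum>(S - {Suc i})" unfolding S'_def using fin i by simp
    ultimately have "\<Sum>S' < \<Sum>S" by simp
    note IH = less.hyps[OF this S'n cS']
    have F_other: "F S s = F S' s" if "s \<noteq> i" "s \<noteq> Suc i" for s using that by (auto simp: F S'_def)
    have Fi: "F S i = f i" "F S (Suc i) = Suc (f (Suc i))" "F S' i = Suc (f i)" "F S' (Suc i) = f (Suc i)"
      using i by (auto simp: F S'_def)
    show ?thesis
    proof (cases "f (Suc i) = f i")
      case True
      have sw: "F S' \<circ> sg i = F S"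
      proof
        fix s show "(F S' \<circ> sg i) s = F S s"
          using F_other[of s] Fi True by (cases "s = i"; cases "s = Suc i") (auto simp: sg_other)
      qed
      have qe: "qn n (expo n (F S)) = qn n (expo n (F S'))" using expo_sg(2)[OF i', of "F S'"] by (simp only: sw)
      have "F S' (Suc i) < F S' i" using Fi True by simp
      from pibar_expo_desc[OF i' this, where ?'a = 'a]
      have "pibar_poly i (mo (expo n (F S'))) - mo (expo n (F S)) \<in> (low n d (qn n (expo n (F S'))) :: 'a mpoly set)"
        by (simp only: sw deg[OF S'n cS'])
      then have st: "pibar_poly i (mo (expo n (F S'))) - mo (expo n (F S)) \<in> (low n d q :: 'a mpoly set)"
        using low_mono[of "qn n (expo n (F S'))" q n d, where ?'a = 'a] IH by blast
      have "mo (expo n (F S)) \<in> (low n d q :: 'a mpoly set) \<or>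
        (\<exists>us. is_word n us \<and> (\<forall>i\<in>set us. f (Suc i) = f i) \<and> (us = [] \<longrightarrow> S = {1..j}) \<and>
          mo (expo n (F S)) - foldr pibar_poly us (mo (expo n (F {1..j}))) \<in> (low n d q :: 'a mpoly set))"
      proof (cases "mo (expo n (F S')) \<in> (low n d q :: 'a mpoly set)")
        case l: True
        from pm.subspace_diff[OF low_subspace pibar_low[OF i' l] st] show ?thesis by simp
      next
        case False
        then obtain us where us: "is_word n us" "\<forall>i\<in>set us. f (Suc i) = f i"
          "mo (expo n (F S')) - foldr pibar_poly us (mo (expo n (F {1..j}))) \<in> (low n d q :: 'a mpoly set)"
          using IH by blast
        have "pibar_poly i (mo (expo n (F S'))) - pibar_poly i (foldr pibar_poly us (mo (expo n (F {1..j})))) \<in> (low n d q :: 'a mpoly set)"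
          using pibar_low[OF i' us(3)] by (simp add: lin_diff[OF pibar_poly_lin])
        from pm.subspace_diff[OF low_subspace this st]
        show ?thesis using us i' True by (intro disjI2 exI[of _ "i # us"]) auto
      qed
      then show ?thesis using qe IH by simp
    next
      case False
      \<comment> \<open>The additional factor sits on the smaller of two different exponents, which
        makes the sum of squares strictly smaller than with the factor on the larger one.\<close>
      then have lt: "f (Suc i) < f i" using f[OF i'] by simp
      have r: "(\<Sum>s\<in>{1..n} - {i, Suc i}. (F S s)\<^sup>2) = (\<Sum>s\<in>{1..n} - {i, Suc i}. (F S' s)\<^sup>2)"
        by (rule sum.cong) (auto simp: F_other)
      have "(f i)\<^sup>2 + (Suc (f (Suc i)))\<^sup>2 < (Suc (f i))\<^sup>2 + (f (Suc i))\<^sup>2"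
        using lt by (simp add: power2_eq_square)
      then have "qn n (expo n (F S)) < qn n (expo n (F S'))"
        unfolding qn_expo sum_two[OF i'] r Fi by simp
      then have "qn n (expo n (F S)) < q" using IH by simp
      moreover from this have "mo (expo n (F S)) \<in> (low n d q :: 'a mpoly set)"
        by (intro low_base keys_expo deg less.prems)
      ultimately show ?thesis by simp
    qed
  qed
qed

lemma straighten_decreasing:
  fixes U :: "'a::field mpoly set"
  assumes k: "1 \<le> k" "k \<le> n" and U: "pm.subspace U" "J n k \<subseteq> U" and low: "low n (tdeg l) (qn n l) \<subseteq> U"
    and H: "\<And>w. perm n w \<Longrightarrow> good n k w l \<Longrightarrow> pol.plonger n w (mo l) \<subseteq> U \<Longrightarrow> pol.pbar n w (mo l) \<in> U"
    and l: "dec n l" and w: "perm n w"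
  shows "pol.pbar n w (mo l) \<in> U"
  using U(1) _ w
proof (rule pol.pbar_descending_induct)
  fix w assume w: "perm n w" and longer: "\<And>v. perm n v \<Longrightarrow> ninv n w < ninv n v \<Longrightarrow> pol.pbar n v (mo l) \<in> U"
  have pl: "pol.plonger n w (mo l) \<subseteq> U" by (rule pol.plonger_subset[OF U(1) longer])
  have kl: "keys l \<subseteq> {1..n}" and lS: "\<And>j. j \<in> {1..<n} \<Longrightarrow> lookup l (Suc j) \<le> lookup l j" using l by (auto simp: dec_def)
  have mol: "mo l \<in> (polys n :: 'a mpoly set)" by (rule mo_polys[OF kl])
  have lz: "lookup l (Suc n) = 0" using kl by (auto simp: in_keys_iff)
  consider (nd) i where "i \<in> pDes n w" "i \<notin> lDes n l" | (good) "good n k w l" | (big) "k \<le> lookup l 1"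
    | (e) j where "pDes n w \<subseteq> lDes n l" "j \<in> {Suc (n - k)..n}" "lookup l (Suc j) + (if j \<in> pDes n w then 1 else 0) < lookup l j"
    unfolding good_def by (metis linorder_not_less subsetI)
  then show "pol.pbar n w (mo l) \<in> U"
  proof cases
    case nd
    then have "i \<in> {1..<n}" using pDes_sub by blast
    from pol.pbar_zero[OF mol w nd(1) pi_mo_fixed[OF l this nd(2)]] show ?thesis
      using pm.subspace_0[OF U(1)] by simp
  next
    case good
    then show ?thesis by (intro H w pl)
  next
    case big
    let ?l' = "l - Poly_Mapping.single 1 k"
    have "l = Poly_Mapping.single 1 k + ?l'"
      using big by (intro poly_mapping_eqI) (auto simp: lookup_add lookup_minus lookup_single when_def)
    then have "(mo l :: 'a mpoly) = mo (Poly_Mapping.single 1 k) * mo ?l'" by (metis mult_single mult_1)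
    moreover have "mo (Poly_Mapping.single 1 k) = (h_poly k 1 :: 'a mpoly)"
      unfolding h_poly_1 using mono_val_Var[of "Poly_Mapping.single 1 k", where ?'a = 'a] by simp
    moreover have "(h_poly k 1 :: 'a mpoly) \<in> J n k" by (rule Jgens_J) (use k in \<open>auto simp: Jgens_def\<close>)
    moreover have "keys ?l' \<subseteq> {1..n}" using kl by (auto simp: in_keys_iff lookup_minus)
    ultimately have "(mo l :: 'a mpoly) \<in> J n k" by (metis J_mult mo_polys mult.commute)
    from pbar_J[OF k(1) w this] U show ?thesis by blast
  next
    case (e j)
    have j: "1 \<le> j" "j \<le> n" using e by auto
    \<comment> \<open>The partition \<mu> with x^\<lambda> = x_1 ... x_j x^\<mu>. The truncated
      subtraction is honest on 1, ..., j, since \<open>l\<close> is decreasing and positive at j;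
      and the excessive drop of \<open>l\<close> at j keeps \<mu> decreasing.\<close>
    define f where "f = (\<lambda>s. lookup l s - (if s \<le> j then 1 else 0))"
    define F where "F = (\<lambda>S s. f s + (if s \<in> S then 1 else 0))"
    have lj: "0 < lookup l j" using e(3) by auto
    have mono: "lookup l j \<le> lookup l s" if "1 \<le> s" "s \<le> j" for s
      using that(2,1)
    proof (induction rule: inc_induct)
      case (step m)
      then show ?case using lS[of m] j by force
    qed simp
    have lpos: "0 < lookup l s" if "1 \<le> s" "s \<le> j" for s using mono[OF that] lj by simp
    have fdec: "f (Suc i) \<le> f i" if "i \<in> {1..<n}" for i
      using lS[OF that] e(3) by (cases "i = j") (auto simp: f_def)
    \<comment> \<open>For i other than j, equal parts of \<mu> are equal parts of \<lambda>, hence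
      no descent of \<open>w\<close>. At i = j, equal parts of \<mu> mean a drop of exactly 1 in
      \<lambda>, and the case at hand then says that j is not a descent.\<close>
    have fDes: "i \<notin> pDes n w" if "f (Suc i) = f i" for i
    proof
      assume i: "i \<in> pDes n w"
      then have "lookup l (Suc i) < lookup l i" "1 \<le> i" using e(1) by (auto simp: lDes_def)
      then show False using that e(3) i lpos[of "Suc i"] lpos[of i] by (cases i j rule: linorder_cases) (auto simp: f_def)
    qed
    have Fl: "expo n (F {1..j}) = l"
    proof -
      have "expo n (F {1..j}) = expo n (lookup l)"
      proof (rule expo_cong)
        show "F {1..j} s = lookup l s" if "s \<in> {1..n}" for s
          using lpos[of s] that by (auto simp: F_def f_def)
      qed
      then show ?thesis using expo_lookup[OF kl] by simp
    qed
    have d: "tdeg l = (\<Sum>s\<in>{1..n}. f s) + j"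
    proof -
      have "{1..n} \<inter> {s. s \<le> j} = {1..j}" using j by auto
      then show ?thesis unfolding Fl[symmetric] tdeg_expo F_def by (simp add: sum.distrib sum.If_cases)
    qed
    let ?SS = "{S. S \<subseteq> {1..n} \<and> card S = j}"
    have terms_U: "pol.pbar n w (mo (expo n (F S))) \<in> U" if S: "S \<in> ?SS" "S \<noteq> {1..j}" for S
    proof -
      have Sn: "S \<subseteq> {1..n}" "card S = j" using S by auto
      have "qn n (expo n (F {1..j})) = qn n l" by (simp only: Fl)
      then have qe: "qn n l = qn n (expo n (\<lambda>s. f s + (if s \<in> {1..j} then 1 else 0)))" by (simp only: F_def)
      from elementary_terms[OF fdec j d Sn qe F_def, where ?'a = 'a]
      consider "mo (expo n (F S)) \<in> (low n (tdeg l) (qn n l) :: 'a mpoly set)"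
        | us where "is_word n us" "\<forall>i\<in>set us. f (Suc i) = f i" "us \<noteq> []"
          "mo (expo n (F S)) - foldr pibar_poly us (mo l) \<in> (low n (tdeg l) (qn n l) :: 'a mpoly set)"
        using S(2) unfolding Fl by blast
      then show ?thesis
      proof cases
        case 1
        from pbar_low[OF w 1] low show ?thesis by blast
      next
        case 2
        then obtain i us' where us: "us = i # us'" by (cases us) auto
        have iw: "is_word n (i # us')" and iD: "i \<notin> pDes n w" using 2 us fDes by auto
        have "(pibar_poly :: nat \<Rightarrow> 'a mpoly \<Rightarrow> 'a mpoly) = (\<lambda>i y. pi_poly i y - y)" by (simp add: fun_eq_iff pibar_poly_def)
        then have "pol.pbar n w (foldr pibar_poly us (mo l)) \<in> pol.plonger n w (mo l :: 'a mpoly)"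
          using pol.pbar_word_longer[OF mol iw w iD] unfolding us by simp
        then have "pol.pbar n w (foldr pibar_poly us (mo l)) \<in> U" using pl by blast
        moreover have "pol.pbar n w (mo (expo n (F S)) - foldr pibar_poly us (mo l)) \<in> U"
          using pbar_low[OF w 2(4)] low by blast
        ultimately show ?thesis using pm.subspace_add[OF U(1)] by (fastforce simp: lin_diff[OF pol.lin_pbar])
      qed
    qed
    have fin: "finite ?SS" by simp
    have jS: "{1..j} \<in> ?SS" using j by auto
    have "e_poly n j * mo (expo n f) \<in> (J n k :: 'a mpoly set)"
    proof -
      have "(e_poly n j :: 'a mpoly) \<in> J n k" by (rule Jgens_J) (use e(2) in \<open>auto simp: Jgens_def\<close>)
      then show ?thesis by (subst mult.commute) (intro J_mult mo_polys keys_expo)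
    qed
    then have "pol.pbar n w (e_poly n j * mo (expo n f)) \<in> U" using pbar_J[OF k(1) w] U(2) by blast
    also have "e_poly n j * mo (expo n f) = mo l + (\<Sum>S\<in>?SS - {{1..j}}. mo (expo n (F S)) :: 'a mpoly)"
    proof -
      have "e_poly n j * mo (expo n f) = (\<Sum>S\<in>?SS. mo (expo n (F S)) :: 'a mpoly)" unfolding e_poly_mo F_def ..
      then show ?thesis using sum.remove[OF fin jS, of "\<lambda>S. mo (expo n (F S)) :: 'a mpoly"] unfolding Fl by (simp only:)
    qed
    finally have "pol.pbar n w (mo l) + (\<Sum>S\<in>?SS - {{1..j}}. pol.pbar n w (mo (expo n (F S)))) \<in> U"
      by (simp only: lin_add[OF pol.lin_pbar] lin_sum[OF pol.lin_pbar])
    moreover have "(\<Sum>S\<in>?SS - {{1..j}}. pol.pbar n w (mo (expo n (F S)))) \<in> U"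
      by (intro pm.subspace_sum U(1) terms_U) auto
    ultimately show ?thesis using pm.subspace_diff[OF U(1)] by fastforce
  qed
qed

text \<open>The target \<open>U\<close> is an arbitrary subspace above \<open>J n k\<close> and the
  surviving terms are only required modulo longer ones, so the same argument serves every family
  that agrees with the pibar_w(x^\<lambda>) up to longer terms.\<close>

theorem straighten:
  fixes U :: "'a::field mpoly set"
  assumes k: "1 \<le> k" "k \<le> n" and U: "pm.subspace U" "J n k \<subseteq> U"
    and H: "\<And>w l. perm n w \<Longrightarrow> dec n l \<Longrightarrow> tdeg l = d \<Longrightarrow> good n k w l \<Longrightarrow> pol.plonger n w (mo l) \<subseteq> U
      \<Longrightarrow> pol.pbar n w (mo l) \<in> U"
  shows "low n d q \<subseteq> U"
proof (induction q)
  case 0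
  show ?case using pm.subspace_0[OF U(1)] by (simp add: low_def)
next
  case (Suc q)
  let ?X = "{mo l | l. dec n l \<and> tdeg l = d \<and> qn n l = q} :: 'a mpoly set"
  \<comment> \<open>All that the partitions with sum of squares exactly q generate, modulo smaller
    sums. This space is stable under the pi_i, so it contains every monomial that can be reached
    from a sorted one.\<close>
  let ?V = "set_add (pm.span {pol.pbar n w x | w x. perm n w \<and> x \<in> ?X}) (low n d q)"
  have XM: "?X \<subseteq> polys n" by (auto simp: dec_def intro!: mo_polys)
  have V: "pm.subspace ?V" by (intro subspace_set_add low_subspace pm.subspace_span)
  have lowV: "y \<in> low n d q \<Longrightarrow> y \<in> ?V" for y by (intro set_add_right pm.subspace_span)
  have Vst: "pi_poly i y \<in> ?V" if i: "i \<in> {1..<n}" and y: "y \<in> ?V" for i y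
  proof -
    obtain a b where ab: "a \<in> pm.span {pol.pbar n w x | w x. perm n w \<and> x \<in> ?X}" "b \<in> low n d q" "y = a + b"
      using y unfolding set_add_eq by blast
    have "pi_poly i a \<in> ?V" by (intro set_add_left low_subspace pol.span_pbar_stable[OF XM i ab(1)])
    moreover have "pi_poly i b \<in> ?V" by (intro lowV pi_low i ab)
    ultimately show ?thesis unfolding ab(3) by (simp only: lin_add[OF pi_poly_lin] pm.subspace_add[OF V])
  qed
  \<comment> \<open>The weight of sum s * f(s) drops when a larger exponent moves to the left. If f
    ascends at i, its monomial is the leading term of pibar_i applied to the swapped monomial, to
    which the induction applies.\<close>
  have sorted: "mo (expo n f) \<in> ?V" if "tdeg (expo n f) = d" "qn n (expo n f) = q" for f
    using that
  proof (induction "\<Sum>s\<in>{1..n}. s * f s" arbitrary: f rule: less_induct)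
    case less
    show ?case
    proof (cases "\<exists>i\<in>{1..<n}. f i < f (Suc i)")
      case False
      then have "dec n (expo n f)" unfolding dec_def using keys_expo
        by (auto simp: lookup_expo not_less simp del: atLeastAtMost_iff) (auto simp: not_less)
      then have "mo (expo n f) \<in> ?X" using less.prems by blast
      then have "pol.pbar n id (mo (expo n f)) \<in> pm.span {pol.pbar n w x | w x. perm n w \<and> x \<in> ?X}"
        by (intro pm.span_base) (use permutes_id in blast)
      then show ?thesis unfolding pol.pbar_id by (intro set_add_left low_subspace)
    next
      case True
      then obtain i where i: "i \<in> {1..<n}" "f i < f (Suc i)" by blast
      define g where "g = f \<circ> sg i"
      have gf: "g \<circ> sg i = f" by (simp add: g_def fun_eq_iff)
      have r: "(\<Sum>s\<in>{1..n} - {i, Suc i}. s * g s) = (\<Sum>s\<in>{1..n} - {i, Suc i}. s * f s)"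
        by (rule sum.cong) (auto simp: g_def sg_other)
      have "(\<Sum>s\<in>{1..n}. s * g s) < (\<Sum>s\<in>{1..n}. s * f s)"
        unfolding sum_two[OF i(1)] r using i(2) by (simp add: g_def)
      moreover have dq: "tdeg (expo n g) = d" "qn n (expo n g) = q" using expo_sg[OF i(1), of f] less.prems by (simp_all only: g_def)
      ultimately have "mo (expo n g) \<in> ?V" by (rule less.hyps)
      then have "pibar_poly i (mo (expo n g)) \<in> ?V" unfolding pibar_poly_def
        by (intro pm.subspace_diff[OF V] Vst i)
      moreover have "pibar_poly i (mo (expo n g)) - mo (expo n f) \<in> ?V"
        using pibar_expo_desc[OF i(1), of g, where ?'a = 'a] i(2) unfolding gf dq by (intro lowV) (simp add: g_def)
      ultimately show ?thesis using pm.subspace_diff[OF V] by fastforce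
    qed
  qed
  have "?V \<subseteq> U"
  proof (intro set_add_minimal U pm.span_minimal Suc.IH subsetI)
    fix y assume "y \<in> {pol.pbar n w x | w x. perm n w \<and> x \<in> ?X}"
    then obtain w l where y: "y = pol.pbar n w (mo l)" "perm n w" "dec n l" "tdeg l = d" "qn n l = q" by blast
    show "y \<in> U" unfolding y(1)
    proof (rule straighten_decreasing[OF k U _ _ y(3,2)])
      show "low n (tdeg l) (qn n l) \<subseteq> U" using Suc.IH y by simp
    qed (use H y in blast)
  qed
  then have VU: "mo m \<in> U" if "keys m \<subseteq> {1..n}" "tdeg m = d" "qn n m = q" for m
    using sorted[of "lookup m"] that expo_lookup[OF that(1)] by auto
  show ?case unfolding low_def
  proof (intro pm.span_minimal U(1) subsetI)
    fix y :: "'a mpoly" assume "y \<in> {mo m | m. keys m \<subseteq> {1..n} \<and> tdeg m = d \<and> qn n m < Suc q}"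
    then obtain m where m: "y = mo m" "keys m \<subseteq> {1..n}" "tdeg m = d" "qn n m < Suc q" by blast
    then consider "qn n m < q" | "qn n m = q" by linarith
    then show "y \<in> U"
    proof cases
      case 1
      then show ?thesis using low_base[OF m(2,3) 1] Suc.IH m(1) by blast
    qed (use VU m in blast)
  qed
qed

section \<open>Indexing the basis\<close>

subsection \<open>Compositions and descent sets\<close>

lemma compDes_single [simp]: "compDes [a] = {}"
  by (auto simp: compDes_def)

lemma compDes_Cons:
  assumes "\<alpha> \<noteq> []"
  shows "compDes (a # \<alpha>) = insert a ((+) a ` compDes \<alpha>)"
proof (intro equalityI subsetI)
  fix x assume "x \<in> compDes (a # \<alpha>)"
  then obtain j where j: "x = sum_list (take j (a # \<alpha>))" "0 < j" "j < Suc (length \<alpha>)" by (auto simp: compDes_def)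
  then obtain i where i: "j = Suc i" by (cases j) auto
  show "x \<in> insert a ((+) a ` compDes \<alpha>)"
  proof (cases "i = 0")
    case False
    then have "sum_list (take i \<alpha>) \<in> compDes \<alpha>" using i j unfolding compDes_def by auto
    then show ?thesis using i j by simp
  qed (use i j in simp)
next
  fix x assume x: "x \<in> insert a ((+) a ` compDes \<alpha>)"
  show "x \<in> compDes (a # \<alpha>)"
  proof (cases "x = a")
    case True
    then show ?thesis using assms unfolding compDes_def by (auto intro!: exI[of _ "Suc 0"])
  next
    case False
    then obtain j where "x = a + sum_list (take j \<alpha>)" "0 < j" "j < length \<alpha>" using x by (auto simp: compDes_def)
    then show ?thesis unfolding compDes_def by (auto intro!: exI[of _ "Suc j"])
  qed
qed

lemma is_comp_Cons: "is_comp n (a # \<alpha>) \<longleftrightarrow> 0 < a \<and> a \<le> n \<and> is_comp (n - a) \<alpha>"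
  by (auto simp: is_comp_def)

lemma is_comp_nonempty: "is_comp n \<alpha> \<Longrightarrow> 1 \<le> n \<Longrightarrow> \<alpha> \<noteq> []"
  by (auto simp: is_comp_def)

lemma is_comp_0: "is_comp 0 \<alpha> \<Longrightarrow> \<alpha> = []"
  by (cases \<alpha>) (auto simp: is_comp_def)

lemma is_comp_tail: "is_comp n (a # \<alpha>) \<Longrightarrow> \<alpha> \<noteq> [] \<Longrightarrow> 1 \<le> n - a"
  using is_comp_0[of \<alpha>] by (auto simp: is_comp_Cons) (metis One_nat_def Suc_leI gr0I)

lemma compDes_subset: "is_comp n \<alpha> \<Longrightarrow> compDes \<alpha> \<subseteq> {1..<n}"
proof (induction \<alpha> arbitrary: n)
  case (Cons a \<alpha>)
  show ?case
  proof (cases "\<alpha> = []")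
    case False
    have "compDes \<alpha> \<subseteq> {1..<n - a}" using Cons by (simp add: is_comp_Cons)
    then have "x \<in> {1..<n - a}" if "x \<in> compDes \<alpha>" for x using that by blast
    then have "a + x \<in> {1..<n}" if "x \<in> compDes \<alpha>" for x using that Cons.prems by (fastforce simp: is_comp_Cons)
    moreover have "a \<in> {1..<n}" using is_comp_tail[OF Cons.prems False] Cons.prems by (auto simp: is_comp_Cons)
    ultimately show ?thesis unfolding compDes_Cons[OF False] by blast
  qed simp
qed (simp add: compDes_def)

lemma finite_compDes: "is_comp n \<alpha> \<Longrightarrow> finite (compDes \<alpha>)"
  using compDes_subset finite_subset by blast

lemma card_compDes: "is_comp n \<alpha> \<Longrightarrow> 1 \<le> n \<Longrightarrow> length \<alpha> = Suc (card (compDes \<alpha>))"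
proof (induction \<alpha> arbitrary: n)
  case (Cons a \<alpha>)
  show ?case
  proof (cases "\<alpha> = []")
    case False
    have c: "is_comp (n - a) \<alpha>" using Cons.prems by (simp add: is_comp_Cons)
    have "length \<alpha> = Suc (card (compDes \<alpha>))" using Cons.IH[OF c] is_comp_tail[OF Cons.prems(1) False] by simp
    moreover have "a \<notin> (+) a ` compDes \<alpha>" using compDes_subset[OF c] by auto
    ultimately show ?thesis using finite_compDes[OF c] unfolding compDes_Cons[OF False]
      by (simp add: card_image)
  qed simp
qed (simp add: is_comp_def)

lemma composition_exists: "D \<subseteq> {1..<n} \<Longrightarrow> 1 \<le> n \<Longrightarrow> \<exists>\<alpha>. is_comp n \<alpha> \<and> compDes \<alpha> = D"
proof (induction n arbitrary: D rule: less_induct)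
  case (less n)
  show ?case
  proof (cases "D = {}")
    case True
    then show ?thesis using less.prems by (intro exI[of _ "[n]"]) (auto simp: is_comp_def)
  next
    case False
    have fin: "finite D" using less.prems finite_subset by blast
    define a where "a = Min D"
    have a: "a \<in> D" "\<And>d. d \<in> D \<Longrightarrow> a \<le> d" using fin False by (auto simp: a_def)
    have an: "1 \<le> a" "a < n" using a(1) less.prems by auto
    define D' where "D' = (\<lambda>d. d - a) ` (D - {a})"
    have D'n: "D' \<subseteq> {1..<n - a}"
    proof
      fix x assume "x \<in> D'"
      then obtain d where d: "d \<in> D" "d \<noteq> a" "x = d - a" by (auto simp: D'_def)
      then show "x \<in> {1..<n - a}" using a(2)[OF d(1)] less.prems by auto
    qed
    obtain \<alpha> where \<alpha>: "is_comp (n - a) \<alpha>" "compDes \<alpha> = D'"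
    proof -
      have "n - a < n" "1 \<le> n - a" using an by auto
      from less.IH[OF this(1) D'n this(2)] that show ?thesis by blast
    qed
    have ne: "\<alpha> \<noteq> []" using is_comp_nonempty[OF \<alpha>(1)] an by simp
    have "(\<lambda>x. a + (x - a)) ` (D - {a}) = (\<lambda>x. x) ` (D - {a})"
      by (rule image_cong) (use a(2) in auto)
    then have "(+) a ` D' = D - {a}" unfolding D'_def image_image by simp
    then have "compDes (a # \<alpha>) = D" unfolding compDes_Cons[OF ne] \<alpha>(2) using a(1) by auto
    then show ?thesis using \<alpha> an by (intro exI[of _ "a # \<alpha>"]) (simp add: is_comp_Cons)
  qed
qed

lemma composition_unique: "is_comp n \<alpha> \<Longrightarrow> is_comp n \<beta> \<Longrightarrow> 1 \<le> n \<Longrightarrow> compDes \<alpha> = compDes \<beta> \<Longrightarrow> \<alpha> = \<beta>"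
proof (induction \<alpha> arbitrary: n \<beta>)
  case (Cons a \<alpha>)
  have "\<beta> \<noteq> []" by (rule is_comp_nonempty[OF Cons.prems(2,3)])
  then obtain b \<beta>' where b: "\<beta> = b # \<beta>'" by (cases \<beta>) auto
  show ?case
  proof (cases "\<alpha> = [] \<or> \<beta>' = []")
    case True
    then have "compDes (a # \<alpha>) = {}" "compDes (b # \<beta>') = {}" using Cons.prems(4) b by auto
    then have "\<alpha> = []" "\<beta>' = []" using compDes_Cons by (metis insert_not_empty)+
    then show ?thesis using Cons.prems b by (simp add: is_comp_def)
  next
    case False
    then have ne: "\<alpha> \<noteq> []" "\<beta>' \<noteq> []" by auto
    have c: "is_comp (n - a) \<alpha>" "is_comp (n - b) \<beta>'" using Cons.prems b by (auto simp: is_comp_Cons)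
    have e: "insert a ((+) a ` compDes \<alpha>) = insert b ((+) b ` compDes \<beta>')"
      using Cons.prems(4) unfolding b compDes_Cons[OF ne(1)] compDes_Cons[OF ne(2)] .
    have pos: "\<And>x. x \<in> compDes \<alpha> \<Longrightarrow> 0 < x" "\<And>x. x \<in> compDes \<beta>' \<Longrightarrow> 0 < x"
      using compDes_subset[OF c(1)] compDes_subset[OF c(2)] by force+
    have "a \<in> insert b ((+) b ` compDes \<beta>')" "b \<in> insert a ((+) a ` compDes \<alpha>)" using e by blast+
    then have ab: "a = b" using pos by force
    have "(+) a ` compDes \<alpha> = (+) a ` compDes \<beta>'"
    proof -
      have "a \<notin> (+) a ` compDes \<alpha>" "a \<notin> (+) a ` compDes \<beta>'" using pos by force+
      then show ?thesis by (rule insert_ident[THEN iffD1, OF _ _ e[folded ab]])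
    qed
    then have "compDes \<alpha> = compDes \<beta>'" by (simp add: inj_image_eq_iff)
    then show ?thesis using Cons.IH[OF c(1)] c(2) is_comp_tail[OF Cons.prems(1) ne(1)] ab b by simp
  qed
qed (use is_comp_nonempty in force)

lemma hd_compDes: "is_comp n \<alpha> \<Longrightarrow> 1 \<le> n \<Longrightarrow> m < n \<Longrightarrow> m < hd \<alpha> \<longleftrightarrow> (\<forall>d\<in>compDes \<alpha>. m < d)"
proof (cases \<alpha>)
  case (Cons a \<alpha>')
  assume c: "is_comp n \<alpha>" and m: "m < n"
  show ?thesis
  proof (cases "\<alpha>' = []")
    case True
    then show ?thesis using c m by (simp add: Cons is_comp_def)
  next
    case False
    then show ?thesis unfolding Cons compDes_Cons[OF False] by auto
  qed
qed (use is_comp_nonempty in force)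

definition comp_of :: "nat \<Rightarrow> nat set \<Rightarrow> nat list" where
  "comp_of n D = (SOME \<alpha>. is_comp n \<alpha> \<and> compDes \<alpha> = D)"

lemma comp_of:
  assumes "D \<subseteq> {1..<n}" "1 \<le> n"
  shows "is_comp n (comp_of n D)" "compDes (comp_of n D) = D"
  using someI_ex[OF composition_exists[OF assms]] by (auto simp: comp_of_def)

subsection \<open>Exponents of the monomials \<open>x_ai\<close>\<close>

text \<open>The exponent of x_j in \<open>x_ai\<close>: each descent d contributes the product x_1
  ... x_d, which contains x_j exactly when j <= d.\<close>

definition lam :: "nat \<Rightarrow> nat set \<Rightarrow> nat list \<Rightarrow> (nat \<Rightarrow>\<^sub>0 nat)" where
  "lam n D is = expo n (\<lambda>j. card {d \<in> D. j \<le> d} + is ! (j - 1))"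

lemma x_ai_eq:
  assumes D: "compDes \<alpha> \<subseteq> {1..<n}"
  shows "x_ai n \<alpha> is = (mo (lam n (compDes \<alpha>) is) :: 'a::comm_ring_1 mpoly)"
proof -
  let ?D = "compDes \<alpha>"
  have fin: "finite ?D" using D finite_subset by blast
  have "(\<Prod>t\<in>{1..d}. Var t) = (\<Prod>t\<in>{1..n}. if t \<le> d then Var t else 1 :: 'a mpoly)" if "d \<in> ?D" for d
  proof -
    have "{1..n} \<inter> {t. t \<le> d} = {1..d}" using that D by auto
    then show ?thesis by (simp add: prod.If_cases)
  qed
  then have "(\<Prod>d\<in>?D. \<Prod>t\<in>{1..d}. Var t) = (\<Prod>d\<in>?D. \<Prod>t\<in>{1..n}. if t \<le> d then Var t else 1 :: 'a mpoly)" by simp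
  also have "\<dots> = (\<Prod>t\<in>{1..n}. \<Prod>d\<in>?D. if t \<le> d then Var t else 1)" by (rule prod.swap)
  also have "\<dots> = (\<Prod>t\<in>{1..n}. Var t ^ card {d \<in> ?D. t \<le> d})"
  proof (rule prod.cong[OF refl])
    fix t
    have "?D \<inter> {d. t \<le> d} = {d \<in> ?D. t \<le> d}" by auto
    then show "(\<Prod>d\<in>?D. if t \<le> d then Var t else 1) = (Var t ^ card {d \<in> ?D. t \<le> d} :: 'a mpoly)"
      using fin by (simp add: prod.If_cases)
  qed
  finally show ?thesis unfolding x_ai_def lam_def mo_expo by (simp add: power_add prod.distrib)
qed

lemma A_D:
  assumes "(\<alpha>, is) \<in> A n k" "1 \<le> k" "k \<le> n"
  shows "is_comp n \<alpha>" "compDes \<alpha> \<subseteq> {Suc (n - k)..<n}" "length is = n" "Suc (card (compDes \<alpha>)) \<le> k"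
    "\<And>j. j \<in> {1..n - k} \<Longrightarrow> is ! (j - 1) \<le> k - Suc (card (compDes \<alpha>))"
    "\<And>j. j \<in> {1..<n} \<Longrightarrow> is ! j \<le> is ! (j - 1)" "\<And>j. j \<in> {Suc (n - k)..n} \<Longrightarrow> is ! (j - 1) = 0"
proof -
  note a = assms(1)[unfolded A_def, simplified]
  show c: "is_comp n \<alpha>" and "length is = n" using a by auto
  have n: "1 \<le> n" using assms by simp
  have "\<forall>d\<in>compDes \<alpha>. n - k < d" using hd_compDes[OF c n, of "n - k"] a assms by auto
  then show "compDes \<alpha> \<subseteq> {Suc (n - k)..<n}" using compDes_subset[OF c]
    by (meson Suc_leI atLeastLessThan_iff subset_iff)
  have l: "length \<alpha> = Suc (card (compDes \<alpha>))" by (rule card_compDes[OF c n])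
  show "Suc (card (compDes \<alpha>)) \<le> k" using l a by simp
  show "\<And>j. j \<in> {1..n - k} \<Longrightarrow> is ! (j - 1) \<le> k - Suc (card (compDes \<alpha>))" using l a by auto
  show z: "is ! (j - 1) = 0" if "j \<in> {Suc (n - k)..n}" for j using a that by auto
  show "is ! j \<le> is ! (j - 1)" if j: "j \<in> {1..<n}" for j
  proof (cases "j < n - k")
    case True
    then show ?thesis using a j by auto
  next
    case False
    then show ?thesis using z[of "Suc j"] j by auto
  qed
qed

lemma A_I:
  assumes k: "1 \<le> k" "k \<le> n" and D: "D \<subseteq> {Suc (n - k)..<n}" and l: "length is = n"
    and b: "\<And>j. j \<in> {1..n - k} \<Longrightarrow> is ! (j - 1) \<le> k - Suc (card D)"
    and dcr: "\<And>j. j \<in> {1..<n - k} \<Longrightarrow> is ! j \<le> is ! (j - 1)"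
    and z: "\<And>j. j \<in> {Suc (n - k)..n} \<Longrightarrow> is ! (j - 1) = 0"
  shows "(comp_of n D, is) \<in> A n k"
proof -
  have Dn: "D \<subseteq> {1..<n}" and n: "1 \<le> n" using D k by auto
  note c = comp_of[OF Dn n]
  have "card D \<le> card {Suc (n - k)..<n}" using D by (intro card_mono) auto
  then have cD: "Suc (card D) \<le> k" using k by simp
  have "length (comp_of n D) = Suc (card D)" using card_compDes[OF c(1) n] c(2) by simp
  moreover have "n - k < hd (comp_of n D)" using hd_compDes[OF c(1) n, of "n - k"] c(2) D k by auto
  ultimately show ?thesis unfolding A_def using c(1) cD l b dcr z by auto
qed

definition Ix :: "nat \<Rightarrow> nat \<Rightarrow> ((nat list \<times> nat list) \<times> (nat \<Rightarrow> nat)) set" where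
  "Ix n k = {((\<alpha>, is), w). (\<alpha>, is) \<in> A n k \<and> perm n w \<and> compDes \<alpha> \<subseteq> pDes n w \<and> pDes n w \<subseteq> compDes \<alpha> \<union> seqDes n is}"

lemma card_ge_Suc:
  assumes "finite D"
  shows "card {d \<in> D. j \<le> d} = card {d \<in> D. Suc j \<le> d} + (if j \<in> D then 1 else (0::nat))"
proof (cases "j \<in> D")
  case True
  then have "{d \<in> D. j \<le> d} = insert j {d \<in> D. Suc j \<le> d}" by auto
  then show ?thesis using True assms by simp
next
  case False
  then have "{d \<in> D. j \<le> d} = {d \<in> D. Suc j \<le> d}" using le_eq_less_or_eq by auto
  then show ?thesis using False by simp
qed

lemma lam_diff:
  assumes "finite D" "j \<in> {1..<n}"
  shows "lookup (lam n D is) j + is ! j = lookup (lam n D is) (Suc j) + is ! (j - 1) + (if j \<in> D then 1 else 0)"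
  using assms card_ge_Suc[OF assms(1), of j] by (simp add: lam_def lookup_expo)

lemma lam_dec_lDes:
  assumes a: "(\<alpha>, is) \<in> A n k" and k: "1 \<le> k" "k \<le> n"
  shows "dec n (lam n (compDes \<alpha>) is)" "lDes n (lam n (compDes \<alpha>) is) = compDes \<alpha> \<union> seqDes n is"
proof -
  note ad = A_D[OF a k]
  have fin: "finite (compDes \<alpha>)" using ad(2) finite_subset by blast
  show "dec n (lam n (compDes \<alpha>) is)" unfolding dec_def
  proof (intro conjI ballI)
    show "keys (lam n (compDes \<alpha>) is) \<subseteq> {1..n}" unfolding lam_def by (rule keys_expo)
    fix j assume j: "j \<in> {1..<n}"
    show "lookup (lam n (compDes \<alpha>) is) (Suc j) \<le> lookup (lam n (compDes \<alpha>) is) j"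
      using lam_diff[OF fin j, of "is"] ad(6)[OF j] by (auto split: if_splits)
  qed
  have Dn: "compDes \<alpha> \<subseteq> {1..<n}" using ad(2) by (rule subset_trans) auto
  have "lookup (lam n (compDes \<alpha>) is) (Suc j) < lookup (lam n (compDes \<alpha>) is) j \<longleftrightarrow> j \<in> compDes \<alpha> \<or> is ! j < is ! (j - 1)"
    if j: "j \<in> {1..<n}" for j
    using lam_diff[OF fin j, of "is"] ad(6)[OF j] by (auto split: if_splits)
  then show "lDes n (lam n (compDes \<alpha>) is) = compDes \<alpha> \<union> seqDes n is"
    unfolding lDes_def seqDes_def using Dn by blast
qed

text \<open>A good pair determines its index: \<alpha> has the descents of \<open>w\<close> that are
  larger than n-k, and i is what remains of the exponents after the contribution of these descents
  is removed. The bound on i_1 comes from the first exponent being less than k.\<close>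

lemma good_index:
  assumes k: "1 \<le> k" "k \<le> n" and w: "perm n w" and l: "dec n l" and g: "good n k w l"
  obtains \<alpha> "is" where "((\<alpha>, is), w) \<in> Ix n k" "l = lam n (compDes \<alpha>) is"
proof -
  define D where "D = pDes n w \<inter> {Suc (n - k)..<n}"
  have fin: "finite D" by (simp add: D_def)
  have Dn: "D \<subseteq> {1..<n}" and n: "1 \<le> n" using k by (auto simp: D_def)
  have kl: "keys l \<subseteq> {1..n}" using l by (simp add: dec_def)
  have l0: "lookup l j = 0" if "n < j" for j using kl that by (auto simp: in_keys_iff)
  \<comment> \<open>Beyond n-k goodness pins the exponents: \<open>l\<close> must drop at every
    descent of \<open>w\<close>, and by no more than 1 there and 0 elsewhere. Hence the remainder i
    vanishes on these positions.\<close>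
  have step: "lookup l j = lookup l (Suc j) + (if j \<in> D then 1 else 0)" if j: "j \<in> {Suc (n - k)..n}" for j
  proof (cases "j = n")
    case True
    then have "j \<notin> pDes n w" using pDes_sub[of n w] by auto
    moreover have "lookup l j \<le> lookup l (Suc j) + (if j \<in> pDes n w then 1 else 0)" using g j unfolding good_def by blast
    ultimately have "lookup l j \<le> lookup l (Suc j)" by simp
    then show ?thesis using l0[of "Suc j"] True by (simp add: D_def)
  next
    case False
    then have j': "j \<in> {1..<n}" using j by auto
    have le: "lookup l (Suc j) \<le> lookup l j" using l j' unfolding dec_def by blast
    have gj: "lookup l j \<le> lookup l (Suc j) + (if j \<in> pDes n w then 1 else 0)" using g j unfolding good_def by blast
    have "lookup l (Suc j) < lookup l j" if "j \<in> pDes n w" using g that unfolding good_def lDes_def by blast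
    then show ?thesis using le gj j j' by (auto simp: D_def split: if_splits)
  qed
  have upper: "lookup l j = card {d \<in> D. j \<le> d}" if "Suc (n - k) \<le> j" "j \<le> Suc n" for j
    using that(2,1)
  proof (induction rule: inc_induct)
    case base
    have "{d \<in> D. Suc n \<le> d} = {}" using Dn by auto
    then show ?case using l0[of "Suc n"] by (simp only: card.empty lessI)
  next
    case (step m)
    then show ?case using \<open>\<And>j. j \<in> {Suc (n - k)..n} \<Longrightarrow> _\<close>[of m] card_ge_Suc[OF fin, of m] by simp
  qed
  have D0: "card {d \<in> D. j \<le> d} = card D" if "j \<le> Suc (n - k)" for j
    using that by (intro arg_cong[of _ _ card]) (auto simp: D_def)
  have dl: "lookup l (Suc j) \<le> lookup l j" if "j \<in> {1..<n}" for j using l that unfolding dec_def by blast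
  have anti: "lookup l j \<le> lookup l i" if "1 \<le> i" "i \<le> j" "j \<le> n" for i j
    using that(2,3,1)
  proof (induction rule: dec_induct)
    case (step m)
    then show ?case using dl[of m] by force
  qed simp
  have ge: "card D \<le> lookup l j" if "j \<in> {1..Suc (n - k)}" for j
  proof -
    have "lookup l (Suc (n - k)) = card D" using upper[of "Suc (n - k)"] D0[of "Suc (n - k)"] k by simp
    then show ?thesis using anti[of j "Suc (n - k)"] that k by auto
  qed
  define "is" where "is = map (\<lambda>j. lookup l (Suc j) - card {d \<in> D. Suc j \<le> d}) [0..<n]"
  have isn: "is ! (j - 1) = lookup l j - card {d \<in> D. j \<le> d}" if "j \<in> {1..n}" for j
    using that by (cases j) (auto simp: is_def)
  have isn': "is ! j = lookup l (Suc j) - card {d \<in> D. Suc j \<le> d}" if "j < n" for j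
    using that by (simp add: is_def)
  have inA: "(comp_of n D, is) \<in> A n k"
  proof (rule A_I[OF k])
    show "D \<subseteq> {Suc (n - k)..<n}" by (auto simp: D_def)
    show "length is = n" by (simp add: is_def)
    show "is ! (j - 1) \<le> k - Suc (card D)" if j: "j \<in> {1..n - k}" for j
    proof -
      have "lookup l j \<le> lookup l 1" using anti[of 1 j] j by auto
      moreover have "lookup l 1 < k" using g by (simp add: good_def)
      ultimately show ?thesis using isn[of j] D0[of j] j by auto
    qed
    show "is ! j \<le> is ! (j - 1)" if j: "j \<in> {1..<n - k}" for j
    proof -
      have "j < n" "j \<le> n" using j by auto
      then show ?thesis using isn[of j] isn'[of j] D0[of j] D0[of "Suc j"] dl[of j] j by (auto intro: diff_le_mono)
    qed
    show "is ! (j - 1) = 0" if j: "j \<in> {Suc (n - k)..n}" for j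
      using isn[of j] upper[of j] j by auto
  qed
  have cD: "compDes (comp_of n D) = D" by (rule comp_of[OF Dn n])
  have leq: "l = lam n D is"
  proof -
    have "card {d \<in> D. j \<le> d} \<le> lookup l j" if "j \<in> {1..n}" for j
      using that ge[of j] D0[of j] upper[of j] by (cases "j \<le> Suc (n - k)") auto
    then have "expo n (lookup l) = lam n D is" unfolding lam_def by (intro expo_cong) (simp add: isn)
    then show ?thesis using expo_lookup[OF kl] by simp
  qed
  have "pDes n w \<subseteq> D \<union> seqDes n is"
    using g lam_dec_lDes(2)[OF inA k] leq cD by (simp add: good_def)
  then have "((comp_of n D, is), w) \<in> Ix n k" unfolding Ix_def using inA w cD by (auto simp: D_def)
  moreover have "l = lam n (compDes (comp_of n D)) is" using leq cD by simp
  ultimately show ?thesis by (rule that)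
qed

text \<open>Both bases of the quotient (the one of the theorem and the one adapted to the projective
  indecomposables) differ from \<open>pibar_w(x_ai)\<close> only by terms with longer \<open>w\<close>.\<close>

theorem index_spanning:
  fixes v :: "((nat list \<times> nat list) \<times> (nat \<Rightarrow> nat)) \<Rightarrow> 'a::field mpoly"
  assumes k: "1 \<le> k" "k \<le> n"
    and v: "\<And>\<alpha> is w. ((\<alpha>, is), w) \<in> Ix n k \<Longrightarrow>
      v ((\<alpha>, is), w) - pol.pbar n w (x_ai n \<alpha> is) \<in> pol.plonger n w (x_ai n \<alpha> is)"
    and m: "keys m \<subseteq> {1..n}"
  shows "mo m \<in> set_add (pm.span (v ` {p \<in> Ix n k. tdeg (lam n (compDes (fst (fst p))) (snd (fst p))) = tdeg m})) (J n k)"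
    (is "_ \<in> ?U")
proof -
  have U: "pm.subspace ?U" by (intro subspace_set_add J_subspace pm.subspace_span)
  have "low n (tdeg m) (Suc (qn n m)) \<subseteq> ?U"
  proof (rule straighten[OF k U])
    show "J n k \<subseteq> ?U" using set_add_right[OF pm.subspace_span] by blast
    fix w l assume w: "perm n w" and l: "dec n l" "tdeg l = tdeg m" "good n k w l" and pl: "pol.plonger n w (mo l) \<subseteq> ?U"
    obtain \<alpha> "is" where p: "((\<alpha>, is), w) \<in> Ix n k" and le: "l = lam n (compDes \<alpha>) is"
      by (rule good_index[OF k w l(1,3)])
    have c: "compDes \<alpha> \<subseteq> {1..<n}" using A_D(2)[of \<alpha> "is" n k] p k unfolding Ix_def by auto
    have x: "x_ai n \<alpha> is = (mo l :: 'a mpoly)" unfolding le by (rule x_ai_eq[OF c])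
    have "v ((\<alpha>, is), w) \<in> ?U"
      by (intro set_add_left J_subspace pm.span_base imageI) (use p l le in auto)
    moreover have "v ((\<alpha>, is), w) - pol.pbar n w (mo l) \<in> ?U" using v[OF p] pl unfolding x by blast
    ultimately show "pol.pbar n w (mo l) \<in> ?U" using pm.subspace_diff[OF U] by fastforce
  qed
  then show ?thesis using low_base[OF m refl, of "Suc (qn n m)"] by blast
qed

section \<open>Linear independence by point evaluation\<close>

definition homog :: "nat \<Rightarrow> 'a::comm_ring_1 mpoly \<Rightarrow> bool" where
  "homog d f \<longleftrightarrow> (\<forall>m\<in>keys f. tdeg m = d)"

lemma homog_mo: "homog (tdeg m) (mo m)"
  by (simp add: homog_def)

lemma homog_mult: "homog d f \<Longrightarrow> homog e g \<Longrightarrow> homog (d + e) (f * g)"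
  unfolding homog_def using keys_mult[of f g] by (fastforce simp: tdeg_add)

lemma homog_subspace: "pm.subspace {f. homog d f}"
  unfolding homog_def by (rule subspace_keys)

lemma homog_diff: "homog d f \<Longrightarrow> homog d g \<Longrightarrow> homog d (f - g :: 'a::field mpoly)"
  using pm.subspace_diff[OF homog_subspace, of f d g] by simp

lemma homog_sum: "(\<And>x. x \<in> S \<Longrightarrow> homog d (f x)) \<Longrightarrow> homog d (sum f S :: 'a::field mpoly)"
  using pm.subspace_sum[OF homog_subspace, of S f d] by simp

lemma homog_smul: "homog d f \<Longrightarrow> homog d (smul c f :: 'a::field mpoly)"
  using pm.subspace_scale[OF homog_subspace, of f d c] by simp

lemma homog_low: "f \<in> low n d q \<Longrightarrow> homog d (f :: 'a::field mpoly)"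
proof -
  assume f: "f \<in> low n d q"
  have "low n d q \<subseteq> {f :: 'a mpoly. homog d f}" unfolding low_def
    by (rule pm.span_minimal[OF _ homog_subspace]) (auto simp: homog_def)
  then show ?thesis using f by blast
qed

lemma homog_Var: "homog 1 (Var j)"
  by (simp add: homog_def Var_def)

lemma homog_h_poly: "homog k (h_poly k j :: 'a::field mpoly)"
  unfolding h_poly_def by (rule homog_sum) (auto simp: homog_def)

lemma homog_e_poly: "homog j (e_poly n j :: 'a::field mpoly)"
  unfolding e_poly_def
proof (rule homog_sum)
  fix S assume "S \<in> {S. S \<subseteq> {1..n} \<and> card S = j}"
  then have S: "finite S" "card S = j" using finite_subset by auto
  have "finite S \<Longrightarrow> homog (card S) (\<Prod>s\<in>S. Var s :: 'a mpoly)" for S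
  proof (induction S rule: finite_induct)
    case (insert x S)
    then show ?case using homog_mult[OF homog_Var[of x] insert.IH] by (simp add: plus_1_eq_Suc)
  qed (simp add: homog_def tdeg_def)
  then show "homog j (\<Prod>s\<in>S. Var s :: 'a mpoly)" using S by blast
qed

definition hcomp :: "nat \<Rightarrow> 'a::field mpoly \<Rightarrow> 'a mpoly" where
  "hcomp d = lext (\<lambda>m. if tdeg m = d then mo m else 0)"

lemma hcomp_lin: "lin (hcomp d)"
  unfolding hcomp_def by (rule lext_lin)

lemma homog_hcomp: "homog d (hcomp d f)"
proof -
  have "hcomp d f \<in> {f. homog d f}" unfolding hcomp_def
    by (rule lext_in_subspace[OF homog_subspace]) (auto simp: homog_def)
  then show ?thesis by simp
qed

lemma hcomp_polys: "f \<in> polys n \<Longrightarrow> hcomp d f \<in> polys n"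
  unfolding hcomp_def
proof (rule lext_in_subspace[OF polys_subspace])
  fix m assume f: "f \<in> polys n" and m: "m \<in> keys f"
  then have "keys m \<subseteq> {1..n}" by (auto simp: polys_def)
  then show "(if tdeg m = d then mo m else 0) \<in> (polys n :: 'a mpoly set)"
    using mo_polys[of m n, where ?'a = 'a] pm.subspace_0[OF polys_subspace[of n, where ?'a = 'a]] by simp
qed

lemma hcomp_homog: "homog e f \<Longrightarrow> hcomp d f = (if e = d then f else 0)"
proof -
  assume f: "homog e f"
  have "hcomp d f = lext (\<lambda>m. if e = d then mo m else 0) f"
    unfolding hcomp_def lext_def by (rule sum.cong) (use f in \<open>auto simp: homog_def\<close>)
  also have "\<dots> = (if e = d then f else 0)" by (auto simp: lext_ident) (simp add: lext_def)
  finally show ?thesis .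
qed

lemma lin_mult_right: "lin (\<lambda>f. f * g :: 'a::field mpoly)"
  by (rule linI) (simp_all add: distrib_right smul_mult_left)

lemma hcomp_mult:
  assumes g: "homog e g"
  shows "hcomp d (f * g) = (if e \<le> d then hcomp (d - e) f * g else 0)"
proof (rule lin_eqI[of "\<lambda>f. hcomp d (f * g)" "\<lambda>f. if e \<le> d then hcomp (d - e) f * g else 0"])
  show "lin (\<lambda>f. hcomp d (f * g))" by (rule lin_comp[OF hcomp_lin lin_mult_right])
  show "lin (\<lambda>f. if e \<le> d then hcomp (d - e) f * g else 0)"
    using lin_comp[OF lin_mult_right hcomp_lin] by (cases "e \<le> d") (auto simp: lin_def)
  fix m
  have "homog (tdeg m + e) (mo m * g)" by (rule homog_mult[OF homog_mo g])
  then show "hcomp d (mo m * g) = (if e \<le> d then hcomp (d - e) (mo m) * g else 0)"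
    by (auto simp: hcomp_homog hcomp_homog[OF homog_mo])
qed

text \<open>The generators are homogeneous, so a homogeneous component of an element of
  \<open>J\<close> is obtained by truncating the coefficients to the complementary degrees.\<close>

lemma J_homog:
  assumes f: "f \<in> J n k" and g: "\<And>g. g \<in> Jgens n k \<Longrightarrow> homog (dg g) g"
  shows "\<exists>c. hcomp d f = (\<Sum>g\<in>Jgens n k. c g * g) \<and> (\<forall>g\<in>Jgens n k. c g \<in> polys n \<and>
    (c g = 0 \<or> dg g \<le> d \<and> homog (d - dg g) (c g :: 'a::field mpoly)))"
proof -
  obtain b where b: "\<forall>g\<in>Jgens n k. b g \<in> polys n" "f = (\<Sum>g\<in>Jgens n k. b g * g)" using f unfolding J_def by blast
  define c where "c g = (if dg g \<le> d then hcomp (d - dg g) (b g) else 0)" for g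
  have "hcomp d (b g * g) = c g * g" if "g \<in> Jgens n k" for g
    unfolding hcomp_mult[OF g[OF that]] c_def by simp
  then have "hcomp d f = (\<Sum>g\<in>Jgens n k. c g * g)" unfolding b(2) lin_sum[OF hcomp_lin] by simp
  moreover have "c g \<in> polys n" if "g \<in> Jgens n k" for g
    unfolding c_def using b(1) that hcomp_polys pm.subspace_0[OF polys_subspace] by auto
  moreover have "c g = 0 \<or> dg g \<le> d \<and> homog (d - dg g) (c g)" for g
    unfolding c_def by (simp add: homog_hcomp)
  ultimately show ?thesis by blast
qed

lemma hcomp_J:
  assumes f: "f \<in> (J n k :: 'a::field mpoly set)" and g: "\<And>g. g \<in> Jgens n k \<Longrightarrow> homog (dg g) (g :: 'a mpoly)"
  shows "hcomp d f \<in> J n k"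
proof -
  obtain c where c: "hcomp d f = (\<Sum>g\<in>Jgens n k. c g * g)" "\<forall>g\<in>Jgens n k. c g \<in> polys n"
    using J_homog[of f n k dg d] f g by blast
  show ?thesis unfolding c(1) by (rule J_I) (use c(2) in blast)
qed

text \<open>The assumption \<open>gens\<close> says that on the points every generator agrees with
  polynomials of lower degree. The corrections are written as sums of \<kappa>_s G_s because the
  \<kappa>_s lie in the larger field, while the G_s stay over the original one and can again be
  multiplied by coefficients from there.\<close>

locale point_eval = coeff_hom e for e :: "'a::field \<Rightarrow> 'k::field" +
  fixes n k :: nat and X :: "'x set" and pt :: "'x \<Rightarrow> nat \<Rightarrow> 'k"
  assumes fin: "finite X"
    and distinct: "\<And>s t. s \<in> X \<Longrightarrow> t \<in> X \<Longrightarrow> s \<noteq> t \<Longrightarrow> \<exists>i\<in>{1..n}. pt s i \<noteq> pt t i"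
    and gens: "\<And>g. g \<in> Jgens n k \<Longrightarrow> \<exists>d. homog d g \<and> (\<exists>r \<kappa> G. (\<forall>s<(r::nat). \<exists>d'<d. homog d' (G s) \<and> G s \<in> polys n) \<and>
          (\<forall>x\<in>X. hom_ext (pt x) g = (\<Sum>s<r. \<kappa> s * hom_ext (pt x) (G s))))"
begin

definition EV :: "'a mpoly \<Rightarrow> ('x \<Rightarrow>\<^sub>0 'k)" where
  "EV f = (\<Sum>x\<in>X. Poly_Mapping.single x (hom_ext (pt x) f))"

lemma lookup_EV: "lookup (EV f) x = (if x \<in> X then hom_ext (pt x) f else 0)"
  using fin by (simp add: EV_def lookup_sum lookup_single when_def)

lemma hom_ext_smul: "hom_ext v (smul c f) = e c * hom_ext v f"
  by (simp add: smul_const_poly hom_ext_mult hom_ext_const)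

lemma EV_add: "EV (f + g) = EV f + EV g"
  by (rule poly_mapping_eqI) (simp add: lookup_EV lookup_add hom_ext_add)

lemma EV_smul: "EV (smul c f) = smul (e c) (EV f)"
  by (rule poly_mapping_eqI) (simp add: lookup_EV hom_ext_smul)

lemma EV_zero: "EV 0 = 0"
  by (rule poly_mapping_eqI) (simp add: lookup_EV)

lemma EV_sum: "EV (sum f S) = (\<Sum>x\<in>S. EV (f x))"
  by (induction S rule: infinite_finite_induct) (simp_all add: EV_add EV_zero)

definition Fil :: "nat \<Rightarrow> ('x \<Rightarrow>\<^sub>0 'k) set" where
  "Fil d = pm.span {EV (mo m) | m. keys m \<subseteq> {1..n} \<and> tdeg m < d}"

lemma EV_Fil:
  assumes "f \<in> polys n" "homog d' f" "d' < d"
  shows "EV f \<in> Fil d"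
proof -
  have "EV f = EV (\<Sum>m\<in>keys f. smul (lookup f m) (mo m))" by (simp add: sum_single_keys)
  also have "\<dots> = (\<Sum>m\<in>keys f. smul (e (lookup f m)) (EV (mo m)))" by (simp only: EV_sum EV_smul)
  also have "\<dots> \<in> Fil d" unfolding Fil_def
  proof (intro pm.span_sum pm.span_scale pm.span_base)
    fix m assume m: "m \<in> keys f"
    then have "keys m \<subseteq> {1..n}" "tdeg m < d" using assms by (auto simp: polys_def homog_def)
    then show "EV (mo m) \<in> {EV (mo m) | m. keys m \<subseteq> {1..n} \<and> tdeg m < d}" by blast
  qed
  finally show ?thesis .
qed

definition dgen :: "'a mpoly \<Rightarrow> nat" where
  "dgen g = (SOME d. homog d g \<and> (\<exists>r \<kappa> G. (\<forall>s<(r::nat). \<exists>d'<d. homog d' (G s) \<and> G s \<in> polys n) \<and>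
          (\<forall>x\<in>X. hom_ext (pt x) g = (\<Sum>s<r. \<kappa> s * hom_ext (pt x) (G s)))))"

lemma dgen:
  assumes "g \<in> Jgens n k"
  shows "homog (dgen g) g" "\<exists>r \<kappa> G. (\<forall>s<(r::nat). \<exists>d'<dgen g. homog d' (G s) \<and> G s \<in> polys n) \<and>
          (\<forall>x\<in>X. hom_ext (pt x) g = (\<Sum>s<r. \<kappa> s * hom_ext (pt x) (G s)))"
proof -
  note * = someI_ex[OF gens[OF assms], folded dgen_def]
  show "homog (dgen g) g" by (rule conjunct1[OF *])
  show "\<exists>r \<kappa> G. (\<forall>s<(r::nat). \<exists>d'<dgen g. homog d' (G s) \<and> G s \<in> polys n) \<and>
          (\<forall>x\<in>X. hom_ext (pt x) g = (\<Sum>s<r. \<kappa> s * hom_ext (pt x) (G s)))"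
    by (rule conjunct2[OF *])
qed

text \<open>Replacing each generator by its correction lowers the degree without changing the
  values, so a homogeneous element of \<open>J\<close> of degree d looks on the points like
  something of degree less than d.\<close>

lemma J_Fil:
  assumes f: "f \<in> J n k" "homog d f"
  shows "EV f \<in> Fil d"
proof -
  obtain c where c1: "hcomp d f = (\<Sum>g\<in>Jgens n k. c g * g)" and c': "\<forall>g\<in>Jgens n k. c g \<in> polys n \<and>
    (c g = 0 \<or> dgen g \<le> d \<and> homog (d - dgen g) (c g))"
    using J_homog[of f n k dgen d] f(1) dgen(1) by blast
  have c: "hcomp d f = (\<Sum>g\<in>Jgens n k. c g * g)" "\<And>g. g \<in> Jgens n k \<Longrightarrow> c g \<in> polys n"
    "\<And>g. g \<in> Jgens n k \<Longrightarrow> c g = 0 \<or> dgen g \<le> d \<and> homog (d - dgen g) (c g)"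
    using c1 c' by blast+
  have "EV (c g * g) \<in> Fil d" if g: "g \<in> Jgens n k" for g
  proof (cases "c g = 0")
    case True
    then show ?thesis by (simp add: EV_zero Fil_def pm.span_zero)
  next
    case False
    then have cg: "dgen g \<le> d" "homog (d - dgen g) (c g)" using c(3)[OF g] by auto
    obtain r \<kappa> G where G: "\<forall>s<(r::nat). \<exists>d'<dgen g. homog d' (G s) \<and> G s \<in> polys n"
      "\<forall>x\<in>X. hom_ext (pt x) g = (\<Sum>s<r. \<kappa> s * hom_ext (pt x) (G s))" using dgen(2)[OF g] by blast
    have "EV (c g * g) = (\<Sum>s<r. smul (\<kappa> s) (EV (c g * G s)))"
      by (rule poly_mapping_eqI) (use G(2) in \<open>simp add: lookup_EV lookup_sum hom_ext_mult sum_distrib_left mult_ac\<close>)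
    moreover have "EV (c g * G s) \<in> Fil d" if s: "s < r" for s
    proof -
      obtain d' where d': "d' < dgen g" "homog d' (G s)" "G s \<in> polys n" using G(1) s by blast
      show ?thesis by (rule EV_Fil[OF polys_mult[OF c(2)[OF g] d'(3)] homog_mult[OF cg(2) d'(2)]]) (use cg d' in simp)
    qed
    ultimately show ?thesis unfolding Fil_def by (auto intro!: pm.span_sum pm.span_scale)
  qed
  then have "EV (hcomp d f) \<in> Fil d" unfolding c(1) EV_sum Fil_def by (intro pm.span_sum) auto
  then show ?thesis using hcomp_homog[OF f(2), of d] by simp
qed

lemma interpolation:
  assumes x: "x \<in> X"
  shows "Poly_Mapping.single x 1 \<in> pm.span {EV (mo m) | m. keys m \<subseteq> {1..n}}"
proof -
  let ?F = "pm.span {EV (mo m) | m. keys m \<subseteq> {1..n}}"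
  \<comment> \<open>Pointwise multiplication by x_i - b. It preserves the space of values of
    polynomials and provides the factors of the Lagrange interpolation polynomials.\<close>
  define mul where "mul i b = lext (\<lambda>x. Poly_Mapping.single x (pt x i - b))" for i b
  have lmul: "lookup (mul i b v) x = (pt x i - b) * lookup v x" for i b v x
    unfolding mul_def lext_def lookup_sum
    by (simp add: lookup_single when_def in_keys_iff)
  have mulF: "mul i b v \<in> ?F" if i: "i \<in> {1..n}" and v: "v \<in> ?F" for i b v
  proof (rule lin_span_image[OF _ _ pm.subspace_span v])
    show "lin (mul i b)" unfolding mul_def by (rule lext_lin)
    fix y assume "y \<in> {EV (mo m) | m. keys m \<subseteq> {1..n}}"
    then obtain m where m: "y = EV (mo m)" "keys m \<subseteq> {1..n}" by blast
    have "mo (Poly_Mapping.single i 1 + m) = (Var i * mo m :: 'a mpoly)" by (simp add: Var_def mult_single)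
    then have "mul i b y = EV (mo (Poly_Mapping.single i 1 + m)) - smul b (EV (mo m))"
      by (intro poly_mapping_eqI) (simp add: lmul m(1) lookup_EV lookup_minus hom_ext_mult left_diff_distrib)
    moreover have "keys (Poly_Mapping.single i 1 + m) \<subseteq> {1..n}"
      using Poly_Mapping.keys_add[of "Poly_Mapping.single i (1::nat)" m] i m(2) by auto
    ultimately show "mul i b y \<in> ?F" using m(2)
      by (simp only:) (intro pm.span_diff pm.span_scale pm.span_base; blast)
  qed
  have "\<exists>v\<in>?F. lookup v x = 1 \<and> (\<forall>y\<in>Y. lookup v y = 0) \<and> keys v \<subseteq> X" if "finite Y" "Y \<subseteq> X - {x}" for Y
    using that
  proof (induction Y rule: finite_induct)
    case empty
    have "EV (mo 0) \<in> ?F" by (rule pm.span_base) (auto intro!: exI[of _ 0])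
    moreover have "lookup (EV (mo 0)) x = 1" using x by (simp add: lookup_EV)
    moreover have "keys (EV (mo 0)) \<subseteq> X" by (auto simp: in_keys_iff lookup_EV split: if_splits)
    ultimately show ?case by blast
  next
    case (insert y Y)
    then obtain v where v: "v \<in> ?F" "lookup v x = 1" "\<forall>y\<in>Y. lookup v y = 0" "keys v \<subseteq> X" by auto
    obtain i where i: "i \<in> {1..n}" "pt x i \<noteq> pt y i" using distinct[of x y] x insert.prems by auto
    let ?u = "smul (inverse (pt x i - pt y i)) (mul i (pt y i) v)"
    have "?u \<in> ?F" by (intro pm.span_scale mulF i v)
    moreover have "lookup ?u x = 1" using i v by (simp add: lmul)
    moreover have "\<forall>z\<in>insert y Y. lookup ?u z = 0" using v by (auto simp: lmul)
    moreover have "keys ?u \<subseteq> X" using v(4) by (auto simp: in_keys_iff lmul)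
    ultimately show ?case by blast
  qed
  from this[of "X - {x}"] obtain v where v: "v \<in> ?F" "lookup v x = 1" "\<forall>y\<in>X - {x}. lookup v y = 0" "keys v \<subseteq> X"
    using fin by auto
  have "v = Poly_Mapping.single x 1"
  proof (rule poly_mapping_eqI)
    show "lookup v y = lookup (Poly_Mapping.single x 1) y" for y
      using v by (cases "y \<in> X") (auto simp: lookup_single when_def in_keys_iff)
  qed
  then show ?thesis using v(1) by simp
qed

text \<open>By induction on d, the values of all polynomials of degree less than d are spanned by
  the values of family members of degree less than d. So the values of the family span all functions
  on \<open>X\<close> and are independent by its size, whereas a relation modulo \<open>J\<close> in
  degree d would put a combination in degree d into the span of lower degrees.\<close>

theorem independent_mod_J:
  fixes v :: "'i \<Rightarrow> 'a mpoly"
  assumes I: "finite I" "card I \<le> card X"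
    and hv: "\<And>p. p \<in> I \<Longrightarrow> homog (deg p) (v p)" "\<And>p. p \<in> I \<Longrightarrow> v p \<in> polys n"
    and sp: "\<And>m. keys m \<subseteq> {1..n} \<Longrightarrow> mo m \<in> set_add (pm.span (v ` {p \<in> I. deg p = tdeg m})) (J n k)"
    and z: "(\<Sum>p\<in>I. smul (c p) (v p)) \<in> J n k" and q: "q \<in> I"
  shows "c q = 0"
proof -
  define W where "W d = pm.span ((\<lambda>p. EV (v p)) ` {p \<in> I. deg p < d})" for d
  have Wmono: "W d \<subseteq> W d'" if "d \<le> d'" for d d' unfolding W_def by (rule pm.span_mono) (use that in auto)
  have FW: "Fil d \<subseteq> W d" for d
  proof (induction d)
    case 0
    show ?case by (simp add: Fil_def W_def)
  next
    case (Suc d)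
    show ?case unfolding Fil_def
    proof (rule pm.span_minimal)
      show "pm.subspace (W (Suc d))" by (simp add: W_def)
      show "{EV (mo m) | m. keys m \<subseteq> {1..n} \<and> tdeg m < Suc d} \<subseteq> W (Suc d)"
      proof
        fix y assume "y \<in> {EV (mo m) | m. keys m \<subseteq> {1..n} \<and> tdeg m < Suc d}"
        then obtain m where m: "y = EV (mo m)" "keys m \<subseteq> {1..n}" "tdeg m < Suc d" by blast
        show "y \<in> W (Suc d)"
        proof (cases "tdeg m < d")
          case True
          have "mo m \<in> (polys n :: 'a mpoly set)" by (rule mo_polys[OF m(2)])
          from EV_Fil[OF this homog_mo True] show ?thesis using Suc.IH Wmono[of d "Suc d"] m(1) by auto
        next
          case False
          then have d: "tdeg m = d" using m(3) by simp
          obtain s j where sj: "s \<in> pm.span (v ` {p \<in> I. deg p = d})" "j \<in> J n k" "mo m = s + j"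
            using sp[OF m(2)] unfolding set_add_eq d by blast
          obtain b where b: "s = (\<Sum>p\<in>{p \<in> I. deg p = d}. smul (b p) (v p))"
            using span_image_family[OF _ sj(1)] I(1) by auto
          \<comment> \<open>Only family members of degree d enter, so the remainder in
            \<open>J\<close> is homogeneous as well, which is what \<open>J_Fil\<close>
            requires.\<close>
          have "homog d s" unfolding b by (intro homog_sum homog_smul) (use hv in auto)
          moreover have "homog d (mo m :: 'a mpoly)" using homog_mo[of m] d by simp
          ultimately have "homog d (mo m - s)" by (intro homog_diff)
          then have "homog d j" using sj(3) by simp
          from J_Fil[OF sj(2) this] have 1: "EV j \<in> W (Suc d)" using Suc.IH Wmono[of d "Suc d"] by auto
          have "EV s = (\<Sum>p\<in>{p \<in> I. deg p = d}. smul (e (b p)) (EV (v p)))" unfolding b by (simp only: EV_sum EV_smul)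
          also have "\<dots> \<in> W (Suc d)" unfolding W_def by (intro pm.span_sum pm.span_scale pm.span_base) auto
          finally have "EV s \<in> W (Suc d)" .
          with 1 show ?thesis unfolding m(1) sj(3) EV_add W_def by (intro pm.span_add)
        qed
      qed
    qed
  qed
  have all: "W d \<subseteq> pm.span ((\<lambda>p. EV (v p)) ` I)" for d unfolding W_def by (rule pm.span_mono) auto
  have "pm.span {EV (mo m) | m. keys m \<subseteq> {1..n}} \<subseteq> pm.span ((\<lambda>p. EV (v p)) ` I)"
  proof (rule pm.span_minimal)
    show "{EV (mo m) | m. keys m \<subseteq> {1..n}} \<subseteq> pm.span ((\<lambda>p. EV (v p)) ` I)"
    proof
      fix y assume "y \<in> {EV (mo m) | m. keys m \<subseteq> {1..n}}"
      then obtain m where m: "y = EV (mo m)" "keys m \<subseteq> {1..n}" by blast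
      have "EV (mo m) \<in> Fil (Suc (tdeg m))" by (rule EV_Fil[OF mo_polys[OF m(2)] homog_mo]) simp
      then show "y \<in> pm.span ((\<lambda>p. EV (v p)) ` I)" using FW all m(1) by blast
    qed
  qed simp
  then have singles: "Poly_Mapping.single x 1 \<in> pm.span ((\<lambda>p. EV (v p)) ` I)" if "x \<in> X" for x
    using interpolation[OF that] by blast
  define d where "d = deg q"
  let ?Id = "{p \<in> I. deg p = d}" and ?Il = "{p \<in> I. deg p < d}"
  have "hcomp d (\<Sum>p\<in>I. smul (c p) (v p)) = (\<Sum>p\<in>I. if deg p = d then smul (c p) (v p) else 0)"
    unfolding lin_sum[OF hcomp_lin] lin_smul[OF hcomp_lin]
    by (rule sum.cong) (auto simp: hcomp_homog[OF hv(1)])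
  also have "\<dots> = (\<Sum>p\<in>?Id. smul (c p) (v p))" using I(1) by (simp add: sum.inter_filter)
  finally have hd: "hcomp d (\<Sum>p\<in>I. smul (c p) (v p)) = (\<Sum>p\<in>?Id. smul (c p) (v p))" .
  have Jd: "(\<Sum>p\<in>?Id. smul (c p) (v p)) \<in> J n k" using hcomp_J[OF z dgen(1)] hd by metis
  have "homog d (\<Sum>p\<in>?Id. smul (c p) (v p))" by (intro homog_sum homog_smul) (use hv in auto)
  from J_Fil[OF Jd this] FW have "EV (\<Sum>p\<in>?Id. smul (c p) (v p)) \<in> W d" by blast
  then obtain b where b: "EV (\<Sum>p\<in>?Id. smul (c p) (v p)) = (\<Sum>p\<in>?Il. smul (b p) (EV (v p)))"
    using span_image_family[of ?Il _ "\<lambda>p. EV (v p)"] I(1) unfolding W_def by auto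
  \<comment> \<open>One linear relation among the values: the given coefficients in degree d, moved
    to the larger field, against the expansion in lower degrees; higher degrees get 0.\<close>
  define a where "a p = (if deg p = d then e (c p) else if deg p < d then - b p else 0)" for p
  have "(\<Sum>p\<in>I. smul (a p) (EV (v p))) = (\<Sum>p\<in>?Id \<union> ?Il. smul (a p) (EV (v p)))"
    by (rule sum.mono_neutral_right) (use I(1) in \<open>auto simp: a_def\<close>)
  also have "\<dots> = (\<Sum>p\<in>?Id. smul (a p) (EV (v p))) + (\<Sum>p\<in>?Il. smul (a p) (EV (v p)))"
    by (rule sum.union_disjoint) (use I(1) in auto)
  also have "(\<Sum>p\<in>?Id. smul (a p) (EV (v p))) = EV (\<Sum>p\<in>?Id. smul (c p) (v p))"
    unfolding EV_sum EV_smul by (rule sum.cong) (auto simp: a_def)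
  also have "(\<Sum>p\<in>?Il. smul (a p) (EV (v p))) = - (\<Sum>p\<in>?Il. smul (b p) (EV (v p)))"
    unfolding sum_negf[symmetric] by (rule sum.cong) (auto simp: a_def pm.scale_minus_left)
  finally have "(\<Sum>p\<in>I. smul (a p) (EV (v p))) = 0" unfolding b by simp
  from spanning_family_independent[OF I(1) fin I(2) singles this q] have ec: "e (c q) = 0" by (simp add: a_def d_def)
  show "c q = 0"
  proof (rule ccontr)
    assume "c q \<noteq> 0"
    then have "e (c q) * e (inverse (c q)) = 1" by (simp add: e_mult[symmetric] e_one)
    then show False using ec by simp
  qed
qed

end

subsection \<open>A point set indexed by ordered set partitions\<close>

text \<open>Reading a surjection \<open>c\<close> from left to right, the slot \<open>c i\<close> is emptied at step \<open>i\<close> and refilled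
  with the fresh label \<open>k + i\<close>; \<open>slot k c i\<close> is the label that is removed at step \<open>i\<close>.\<close>

definition prev :: "(nat \<Rightarrow> nat) \<Rightarrow> nat \<Rightarrow> nat set" where
  "prev c i = {j \<in> {1..<i}. c j = c i}"

definition slot :: "nat \<Rightarrow> (nat \<Rightarrow> nat) \<Rightarrow> nat \<Rightarrow> nat" where
  "slot k c i = (if prev c i = {} then c i else k + Max (prev c i))"

lemma finite_prev [simp]: "finite (prev c i)"
  by (simp add: prev_def)

lemma slot_cases:
  assumes "c i < k"
  obtains (first) "prev c i = {}" "slot k c i = c i" "slot k c i < k"
    | (later) j where "j \<in> prev c i" "\<And>j'. j' \<in> prev c i \<Longrightarrow> j' \<le> j" "slot k c i = k + j" "1 \<le> j" "j < i" "c j = c i"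
proof (cases "prev c i = {}")
  case True
  then show ?thesis using first assms by (simp add: slot_def)
next
  case False
  let ?j = "Max (prev c i)"
  have j: "?j \<in> prev c i" by (rule Max_in[OF finite_prev False])
  moreover have "?j \<in> {1..<i} \<and> c ?j = c i" using j unfolding prev_def by blast
  moreover have "slot k c i = k + ?j" using False by (simp add: slot_def)
  ultimately show ?thesis by (intro later[of ?j]) auto
qed

text \<open>Each label is removed at most once: a label b < k at the first position of the letter b,
  and the label k+j at the next position after j that has the same letter.\<close>

lemma slot_inj_on:
  assumes c: "\<And>i. i \<in> {1..n} \<Longrightarrow> c i < k"
  shows "inj_on (slot k c) {1..n}"
proof -
  have "slot k c i \<noteq> slot k c i'" if i: "i \<in> {1..n}" "i' \<in> {1..n}" "i < i'" for i i'
  proof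
    assume e: "slot k c i = slot k c i'"
    show False
    proof (cases rule: slot_cases[of c i k, OF c[OF i(1)], case_names first later])
      case f: first
      show False
      proof (cases rule: slot_cases[of c i' k, OF c[OF i(2)], case_names first later])
        case first
        then have "i \<in> prev c i'" using f e i by (simp add: prev_def)
        then show False using first by simp
      qed (use f e in simp)
    next
      case l: (later j)
      show False
      proof (cases rule: slot_cases[of c i' k, OF c[OF i(2)], case_names first later])
        case (later j')
        then have "i \<in> prev c i'" using l e i by (simp add: prev_def)
        then show False using later l e by force
      qed (use l e in simp)
    qed
  qed
  then show ?thesis by (metis inj_onI linorder_neqE_nat)
qed

text \<open>At step i only labels k+j with 1 <= j < i have been added. Positions are counted from 1,
  so the label k itself never occurs; this saves the one label on which the degree count for h_k
  depends.\<close>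

lemma slot_bound: "c i < k \<Longrightarrow> slot k c i < k + i \<and> slot k c i \<noteq> k"
  by (cases rule: slot_cases[of c i k]) auto

lemma slot_surj:
  assumes c: "\<And>i. i \<in> {1..n} \<Longrightarrow> c i < k" and s: "b < k" "\<exists>i\<in>{1..n}. c i = b"
  shows "b \<in> slot k c ` {1..n}"
proof -
  define i where "i = (LEAST i. i \<in> {1..n} \<and> c i = b)"
  have ex: "\<exists>i. i \<in> {1..n} \<and> c i = b" using s(2) by blast
  have i: "i \<in> {1..n}" "c i = b" using LeastI_ex[OF ex] unfolding i_def by blast+
  have least: "i \<le> j" if "j \<in> {1..n} \<and> c j = b" for j unfolding i_def by (rule Least_le[of "\<lambda>i. i \<in> {1..n} \<and> c i = b", OF that])
  have "prev c i = {}"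
  proof (rule ccontr)
    assume "prev c i \<noteq> {}"
    then obtain j where "j \<in> {1..<i}" "c j = c i" by (auto simp: prev_def)
    then show False using least[of j] i by auto
  qed
  then have "slot k c i = b" using i by (simp add: slot_def)
  then show ?thesis using i by blast
qed

text \<open>Decoding from left to right: a label below k is the letter itself, and a label k+j says
  that the letter is the one at the earlier position j.\<close>

lemma slot_determines:
  assumes c: "\<And>i. i \<in> {1..n} \<Longrightarrow> c i < k" and d: "\<And>i. i \<in> {1..n} \<Longrightarrow> d i < k"
    and e: "\<And>i. i \<in> {1..n} \<Longrightarrow> slot k c i = slot k d i" and i: "i \<in> {1..n}"
  shows "c i = d i"
  using i
proof (induction i rule: less_induct)
  case (less i)
  note ci = c[OF less.prems] and di = d[OF less.prems]
  show ?case
  proof (cases rule: slot_cases[of c i k, OF ci, case_names first later])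
    case f: first
    show ?thesis by (cases rule: slot_cases[of d i k, OF di, case_names first later]) (use f e[OF less.prems] in auto)
  next
    case l: (later j)
    show ?thesis
    proof (cases rule: slot_cases[of d i k, OF di, case_names first later])
      case (later j')
      then have "j' = j" using l e[OF less.prems] by simp
      moreover have "c j = d j" using l less by auto
      ultimately show ?thesis using later l by simp
    qed (use l e[OF less.prems] in simp)
  qed
qed

lemma coeff_prod_linear:
  fixes a :: "'b \<Rightarrow> 'k::field"
  assumes "finite S"
  shows "coeff (\<Prod>s\<in>S. [:1, - a s:]) r = (-1) ^ r * (\<Sum>T\<in>{T. T \<subseteq> S \<and> card T = r}. \<Prod>s\<in>T. a s)"
proof -
  have m: "(\<Prod>s\<in>T. [:0, - a s:]) = monom ((-1) ^ card T * (\<Prod>s\<in>T. a s)) (card T)" if "finite T" for T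
    using that
  proof (induction T rule: finite_induct)
    case (insert x T)
    have "[:0, - a x:] = monom (- a x) 1" by (simp add: monom_Suc One_nat_def monom_0)
    then show ?case using insert by (simp add: mult_monom plus_1_eq_Suc)
  qed (simp add: monom_0 one_pCons)
  have "(\<Prod>s\<in>S. [:1, - a s:]) = (\<Prod>s\<in>S. [:0, - a s:] + 1)" by (simp add: one_pCons)
  also have "\<dots> = (\<Sum>T\<in>Pow S. (\<Prod>s\<in>T. [:0, - a s:]) * (\<Prod>s\<in>S - T. 1))" by (rule prod_add[OF assms])
  also have "\<dots> = (\<Sum>T\<in>Pow S. monom ((-1) ^ card T * (\<Prod>s\<in>T. a s)) (card T))"
    by (rule sum.cong) (use m finite_subset[OF _ assms] in auto)
  finally have "coeff (\<Prod>s\<in>S. [:1, - a s:]) r = (\<Sum>T\<in>Pow S. if card T = r then (-1) ^ r * (\<Prod>s\<in>T. a s) else 0)"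
    by (simp add: coeff_sum if_distrib cong: if_cong)
  also have "\<dots> = (\<Sum>T\<in>{T \<in> Pow S. card T = r}. (-1) ^ r * (\<Prod>s\<in>T. a s))"
    by (rule sum.inter_filter[symmetric]) (use assms in simp)
  also have "{T \<in> Pow S. card T = r} = {T. T \<subseteq> S \<and> card T = r}" by auto
  finally show ?thesis by (simp add: sum_distrib_left)
qed

context coeff_hom
begin

lemma hom_ext_e_poly: "hom_ext v (e_poly n r) = (\<Sum>T\<in>{T. T \<subseteq> {1..n} \<and> card T = r}. \<Prod>s\<in>T. v s)"
  by (simp add: e_poly_def hom_ext_sum hom_ext_prod)

end

locale labels = coeff_hom e for e :: "'a::field \<Rightarrow> 'k::field" +
  fixes a :: "nat \<Rightarrow> 'k" and n k :: nat
  assumes a_inj: "inj a" and k: "1 \<le> k" "k \<le> n"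
begin

definition lin_fac :: "'k \<Rightarrow> 'k poly" where "lin_fac x = [:1, - x:]"

lemma coeff_lin_fac_0: "coeff (\<Prod>s\<in>S. lin_fac (f s)) 0 = 1"
  by (simp add: lin_fac_def poly_0_coeff_0[symmetric] poly_prod)

lemma degree_lin_fac: "finite S \<Longrightarrow> Polynomial.degree (\<Prod>s\<in>S. lin_fac (f s)) \<le> card S"
proof (induction S rule: finite_induct)
  case (insert x S)
  have "Polynomial.degree (lin_fac (f x)) \<le> 1" by (simp add: lin_fac_def)
  then have "Polynomial.degree (lin_fac (f x) * (\<Prod>s\<in>S. lin_fac (f s))) \<le> 1 + card S"
    using insert.IH by (intro order_trans[OF degree_mult_le] add_mono)
  then show ?case using insert by simp
qed simp

text \<open>The generating function of the complete symmetric polynomials is the inverse of the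
  product of the factors 1 - x_i t.\<close>

lemma fps_h_poly: "Abs_fps (\<lambda>m. hom_ext v (h_poly m j)) * fps_of_poly (\<Prod>i\<in>{1..j}. lin_fac (v i)) = 1"
proof (induction j)
  case 0
  have "Abs_fps (\<lambda>m. hom_ext v (h_poly m 0)) = 1"
  proof (rule fps_ext)
    show "fps_nth (Abs_fps (\<lambda>m. hom_ext v (h_poly m 0))) m = fps_nth 1 m" for m
      by (cases m) (simp_all add: h_poly_0 h_poly_Suc_0)
  qed
  then show ?case by simp
next
  case (Suc j)
  let ?H = "\<lambda>j. Abs_fps (\<lambda>m. hom_ext v (h_poly m j))"
  have "?H (Suc j) * (1 - fps_const (v (Suc j)) * fps_X) = ?H j"
  proof (rule fps_ext)
    show "fps_nth (?H (Suc j) * (1 - fps_const (v (Suc j)) * fps_X)) m = fps_nth (?H j) m" for m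
      by (cases m) (simp_all add: h_poly_0 h_poly_Suc hom_ext_add hom_ext_mult right_diff_distrib mult.assoc[symmetric])
  qed
  moreover have "fps_of_poly (lin_fac (v (Suc j))) = 1 - fps_const (v (Suc j)) * fps_X"
    by (simp add: lin_fac_def fps_of_poly_pCons)
  moreover have "(\<Prod>i\<in>{1..Suc j}. lin_fac (v i)) = lin_fac (v (Suc j)) * (\<Prod>i\<in>{1..j}. lin_fac (v i))"
    by (simp add: atLeastAtMostSuc_conv)
  ultimately show ?case using Suc.IH by (simp only: fps_of_poly_mult mult.assoc[symmetric])
qed

definition pts :: "(nat \<Rightarrow> nat) \<Rightarrow> nat \<Rightarrow> 'k" where "pts c i = a (slot k c i)"

definition surj_word :: "(nat \<Rightarrow> nat) \<Rightarrow> bool" where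
  "surj_word c \<longleftrightarrow> (\<forall>i\<in>{1..n}. c i < k) \<and> (\<forall>b<k. \<exists>i\<in>{1..n}. c i = b)"

lemma prod_split_labels:
  assumes c: "surj_word c" and j: "j \<le> n" and S: "finite S" "slot k c ` {1..j} \<subseteq> S"
  shows "(\<Prod>s\<in>S. lin_fac (a s)) = (\<Prod>i\<in>{1..j}. lin_fac (pts c i)) * (\<Prod>s\<in>S - slot k c ` {1..j}. lin_fac (a s))"
    "card (S - slot k c ` {1..j}) = card S - j"
proof -
  have "inj_on (slot k c) {1..n}" by (rule slot_inj_on) (use c in \<open>simp add: surj_word_def\<close>)
  moreover have "{1..j} \<subseteq> {1..n}" using j by simp
  ultimately have inj: "inj_on (slot k c) {1..j}" by (rule inj_on_subset)
  have "(\<Prod>s\<in>slot k c ` {1..j}. lin_fac (a s)) = (\<Prod>i\<in>{1..j}. lin_fac (pts c i))"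
    unfolding prod.reindex[OF inj] by (simp add: pts_def)
  then show "(\<Prod>s\<in>S. lin_fac (a s)) = (\<Prod>i\<in>{1..j}. lin_fac (pts c i)) * (\<Prod>s\<in>S - slot k c ` {1..j}. lin_fac (a s))"
    using prod.subset_diff[OF S(2,1), of "\<lambda>s. lin_fac (a s)"] by (simp add: mult.commute)
  show "card (S - slot k c ` {1..j}) = card S - j"
    using S by (simp add: card_Diff_subset card_image[OF inj] finite_subset)
qed

text \<open>The first j coordinates are j distinct elements of a fixed set of k+j-1 labels.
  Multiplying the generating function of the h_m by the product over all these labels leaves a
  polynomial of degree at most k-1, so its coefficient at t^k vanishes. The multiplier does not
  depend on the point.\<close>

lemma h_poly_relation:
  assumes j: "j \<in> {1..n}"
  obtains p where "p 0 = 1" "\<And>c. surj_word c \<Longrightarrow> (\<Sum>r\<le>k. p r * hom_ext (pts c) (h_poly (k - r) j)) = 0"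
proof -
  \<comment> \<open>The k initial labels together with those that are added at the steps 1, ...,
    j-1.\<close>
  define S where "S = {..<k} \<union> {Suc k..<k + j}"
  define P where "P = (\<Prod>s\<in>S. lin_fac (a s))"
  have fin: "finite S" by (simp add: S_def)
  have cardS: "card S = k + j - 1" unfolding S_def using j by (subst card_Un_disjoint) auto
  have "(\<Sum>r\<le>k. coeff P r * hom_ext (pts c) (h_poly (k - r) j)) = 0" if c: "surj_word c" for c
  proof -
    have sub: "slot k c ` {1..j} \<subseteq> S"
    proof
      fix x assume "x \<in> slot k c ` {1..j}"
      then obtain i where i: "i \<in> {1..j}" "x = slot k c i" by blast
      have "c i < k" using c i j by (auto simp: surj_word_def)
      from slot_bound[of c i k, OF this] show "x \<in> S" using i by (auto simp: S_def)
    qed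
    have jn: "j \<le> n" using j by simp
    let ?R = "\<Prod>s\<in>S - slot k c ` {1..j}. lin_fac (a s)"
    note sp = prod_split_labels[OF c jn fin sub]
    have "fps_of_poly P * Abs_fps (\<lambda>m. hom_ext (pts c) (h_poly m j))
        = (Abs_fps (\<lambda>m. hom_ext (pts c) (h_poly m j)) * fps_of_poly (\<Prod>i\<in>{1..j}. lin_fac (pts c i))) * fps_of_poly ?R"
      unfolding P_def sp(1) fps_of_poly_mult by (simp only: mult_ac)
    then have "fps_of_poly P * Abs_fps (\<lambda>m. hom_ext (pts c) (h_poly m j)) = fps_of_poly ?R"
      unfolding fps_h_poly by simp
    then have "fps_nth (fps_of_poly P * Abs_fps (\<lambda>m. hom_ext (pts c) (h_poly m j))) k = coeff ?R k" by simp
    moreover have "Polynomial.degree ?R < k"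
      using degree_lin_fac[of "S - slot k c ` {1..j}" a] fin sp(2) cardS k j by (simp add: One_nat_def)
    ultimately show ?thesis by (simp add: fps_mult_nth coeff_eq_0 atLeast0AtMost)
  qed
  moreover have "coeff P 0 = 1" unfolding P_def by (rule coeff_lin_fac_0)
  ultimately show ?thesis using that by blast
qed

text \<open>By surjectivity every point uses all k initial labels, so the product of the factors 1 -
  x_i t is divisible by the fixed product \<open>P\<close> over these labels, with quotient of
  degree at most n-k. Dividing by \<open>P\<close> as a power series makes all coefficients beyond
  n-k vanish.\<close>

lemma e_poly_relation:
  assumes r: "n - k < r"
  obtains p where "p 0 = 1" "\<And>c. surj_word c \<Longrightarrow> (\<Sum>s\<le>r. p s * hom_ext (pts c) (e_poly n (r - s))) = 0"
proof -
  define P where "P = (\<Prod>s\<in>{..<k}. lin_fac (a s))"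
  have P0: "coeff P 0 = 1" unfolding P_def by (simp add: coeff_lin_fac_0)
  define u where "u = inverse (fps_of_poly P)"
  have uP: "u * fps_of_poly P = 1" unfolding u_def by (rule inverse_mult_eq_1) (simp add: P0)
  have u0: "fps_nth u 0 = 1" unfolding u_def by (simp add: P0)
  have "(\<Sum>s\<le>r. ((-1) ^ s * fps_nth u s) * hom_ext (pts c) (e_poly n (r - s))) = 0" if c: "surj_word c" for c
  proof -
    let ?S = "slot k c ` {1..n}"
    have sub: "{..<k} \<subseteq> ?S" using c slot_surj[of n c k] by (auto simp: surj_word_def)
    have inj: "inj_on (slot k c) {1..n}" by (rule slot_inj_on) (use c in \<open>simp add: surj_word_def\<close>)
    let ?Q = "\<Prod>i\<in>{1..n}. lin_fac (pts c i)" and ?R = "\<Prod>s\<in>?S - {..<k}. lin_fac (a s)"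
    have "?Q = (\<Prod>s\<in>?S. lin_fac (a s))" unfolding prod.reindex[OF inj] by (simp add: pts_def)
    also have "\<dots> = P * ?R" unfolding P_def using prod.subset_diff[OF sub, of "\<lambda>s. lin_fac (a s)"] by (simp add: mult.commute)
    finally have Q: "?Q = P * ?R" .
    have "u * fps_of_poly ?Q = (u * fps_of_poly P) * fps_of_poly ?R" unfolding Q fps_of_poly_mult by (simp only: mult.assoc)
    then have uQ: "u * fps_of_poly ?Q = fps_of_poly ?R" unfolding uP by simp
    have "Polynomial.degree ?R \<le> card (?S - {..<k})" by (rule degree_lin_fac) simp
    also have "\<dots> = n - k" using sub by (simp add: card_Diff_subset card_image[OF inj])
    finally have "fps_nth (u * fps_of_poly ?Q) r = 0" unfolding uQ using r by (simp add: coeff_eq_0)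
    then have "(\<Sum>s\<le>r. fps_nth u s * ((-1) ^ (r - s) * hom_ext (pts c) (e_poly n (r - s)))) = 0"
      by (simp add: fps_mult_nth atLeast0AtMost lin_fac_def coeff_prod_linear hom_ext_e_poly)
    \<comment> \<open>The coefficient of t^(r-s) is e_{r-s} up to the sign (-1)^(r-s). Multiplying
      by (-1)^r normalizes the coefficient of e_r to 1.\<close>
    then have "(-1) ^ r * (\<Sum>s\<le>r. fps_nth u s * ((-1) ^ (r - s) * hom_ext (pts c) (e_poly n (r - s)))) = 0" by simp
    also have "(-1) ^ r * (\<Sum>s\<le>r. fps_nth u s * ((-1) ^ (r - s) * hom_ext (pts c) (e_poly n (r - s))))
        = (\<Sum>s\<le>r. ((-1) ^ s * fps_nth u s) * hom_ext (pts c) (e_poly n (r - s)))"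
      unfolding sum_distrib_left
    proof (rule sum.cong[OF refl])
      fix s assume s: "s \<in> {..r}"
      then obtain d where "r = s + d" using le_Suc_ex by auto
      then have "(-1) ^ r * (-1) ^ (r - s) = ((-1) ^ s :: 'k)" by (simp add: power_add mult.assoc)
      have "(-1) ^ r * (fps_nth u s * ((-1) ^ (r - s) * hom_ext (pts c) (e_poly n (r - s))))
          = ((-1) ^ r * (-1) ^ (r - s)) * (fps_nth u s * hom_ext (pts c) (e_poly n (r - s)))" by (simp only: mult_ac)
      also note \<open>(-1) ^ r * (-1) ^ (r - s) = ((-1) ^ s :: 'k)\<close>
      finally show "(-1) ^ r * (fps_nth u s * ((-1) ^ (r - s) * hom_ext (pts c) (e_poly n (r - s))))
          = ((-1) ^ s * fps_nth u s) * hom_ext (pts c) (e_poly n (r - s))" by (simp only: mult.assoc)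
    qed
    finally show ?thesis .
  qed
  moreover have "(-1) ^ 0 * fps_nth u 0 = 1" by (simp add: u0)
  ultimately show ?thesis using that[of "\<lambda>s. (-1) ^ s * fps_nth u s"] by blast
qed

lemma solve_relation:
  fixes p :: "nat \<Rightarrow> 'k"
  assumes "p 0 = 1" "(\<Sum>s\<le>r. p s * x s) = 0" "1 \<le> r"
  shows "x 0 = (\<Sum>s<r. (- p (Suc s)) * x (Suc s))"
proof -
  have "(\<Sum>s\<le>r. p s * x s) = p 0 * x 0 + (\<Sum>s<r. p (Suc s) * x (Suc s))"
    using sum.lessThan_Suc_shift[of "\<lambda>s. p s * x s" r] by (simp add: lessThan_Suc_atMost)
  then show ?thesis using assms by (simp add: sum_negf eq_neg_iff_add_eq_0)
qed

lemma point_eval_labels: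
  fixes X :: "'x set" and b :: "'x \<Rightarrow> nat \<Rightarrow> nat"
  assumes X: "finite X" "\<And>x. x \<in> X \<Longrightarrow> surj_word (b x)"
    and inj: "\<And>x y. x \<in> X \<Longrightarrow> y \<in> X \<Longrightarrow> (\<And>i. i \<in> {1..n} \<Longrightarrow> b x i = b y i) \<Longrightarrow> x = y"
  shows "point_eval e n k X (\<lambda>x. pts (b x))"
proof (unfold_locales)
  show "finite X" by fact
next
  fix s t assume st: "s \<in> X" "t \<in> X" "s \<noteq> t"
  show "\<exists>i\<in>{1..n}. pts (b s) i \<noteq> pts (b t) i"
  proof (rule ccontr)
    assume "\<not> ?thesis"
    then have "slot k (b s) i = slot k (b t) i" if "i \<in> {1..n}" for i
      using that a_inj unfolding pts_def by (metis injD)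
    then have "b s i = b t i" if "i \<in> {1..n}" for i
      using slot_determines[of n "b s" k "b t" i] X(2)[OF st(1)] X(2)[OF st(2)] that by (auto simp: surj_word_def)
    then show False using inj[OF st(1,2)] st(3) by blast
  qed
next
  fix g :: "'a mpoly" assume "g \<in> Jgens n k"
  then consider (h) j where "j \<in> {1..n}" "g = h_poly k j" | (e) r where "r \<in> {Suc (n - k)..n}" "g = e_poly n r"
    unfolding Jgens_def by blast
  then show "\<exists>d. homog d g \<and> (\<exists>r \<kappa> G. (\<forall>s<(r::nat). \<exists>d'<d. homog d' (G s) \<and> G s \<in> polys n) \<and>
          (\<forall>x\<in>X. hom_ext (pts (b x)) g = (\<Sum>s<r. \<kappa> s * hom_ext (pts (b x)) (G s))))"
  proof cases
    case h
    obtain p where p: "p 0 = 1" "\<And>c. surj_word c \<Longrightarrow> (\<Sum>r\<le>k. p r * hom_ext (pts c) (h_poly (k - r) j)) = 0"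
      by (rule h_poly_relation[OF h(1)]) blast
    have "hom_ext (pts (b x)) g = (\<Sum>s<k. (- p (Suc s)) * hom_ext (pts (b x)) (h_poly (k - Suc s) j))" if "x \<in> X" for x
      using solve_relation[OF p(1) p(2)[OF X(2)[OF that]] k(1)] h(2) by simp
    moreover have "\<exists>d'<k. homog d' (h_poly (k - Suc s) j :: 'a mpoly) \<and> h_poly (k - Suc s) j \<in> (polys n :: 'a mpoly set)" if "s < k" for s
      using homog_h_poly h_poly_polys h(1) that by (intro exI[of _ "k - Suc s"]) auto
    ultimately show ?thesis using homog_h_poly[of k j] h(2)
      by (intro exI[of _ k] conjI exI[of _ "\<lambda>s. - p (Suc s)"] exI[of _ "\<lambda>s. h_poly (k - Suc s) j"]) auto
  next
    case e
    have r: "n - k < r" "1 \<le> r" using e by auto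
    obtain p where p: "p 0 = 1" "\<And>c. surj_word c \<Longrightarrow> (\<Sum>s\<le>r. p s * hom_ext (pts c) (e_poly n (r - s))) = 0"
      by (rule e_poly_relation[OF r(1)]) blast
    have "hom_ext (pts (b x)) g = (\<Sum>s<r. (- p (Suc s)) * hom_ext (pts (b x)) (e_poly n (r - Suc s)))" if "x \<in> X" for x
      using solve_relation[OF p(1) p(2)[OF X(2)[OF that]] r(2)] e(2) by simp
    moreover have "\<exists>d'<r. homog d' (e_poly n (r - Suc s) :: 'a mpoly) \<and> e_poly n (r - Suc s) \<in> (polys n :: 'a mpoly set)" if "s < r" for s
      using homog_e_poly e_poly_polys that by (intro exI[of _ "r - Suc s"]) auto
    ultimately show ?thesis using homog_e_poly[of r n] e(2)
      by (intro exI[of _ r] conjI exI[of _ "\<lambda>s. - p (Suc s)"] exI[of _ "\<lambda>s. e_poly n (r - Suc s)"]) auto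
  qed
qed

end

text \<open>The labels are taken in the field of rational functions, since the given field may be too small.\<close>

lemma labels_fract:
  assumes "1 \<le> k" "k \<le> n"
  shows "labels (\<lambda>c :: 'a::field. Fraction_Field.Fract [:c:] 1) (\<lambda>i. Fraction_Field.Fract (monom 1 i) 1) n k"
proof
  show "inj (\<lambda>i. Fraction_Field.Fract (monom (1 :: 'a) i) 1)"
    by (rule injI) (simp add: eq_fract monom_eq_iff')
qed (use assms in \<open>simp_all add: One_fract_def one_pCons mult.commute\<close>)

text \<open>\<open>b\<close> reads each element of \<open>X\<close> as a surjection from {1..n} onto
  the k blocks; auxiliary field and labels disappear from the statement.\<close>

lemma basis_mod_J:
  fixes v :: "'i \<Rightarrow> 'a::field mpoly" and X :: "'x set" and b :: "'x \<Rightarrow> nat \<Rightarrow> nat"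
  assumes k: "1 \<le> k" "k \<le> n" and X: "finite X" "\<And>x i. x \<in> X \<Longrightarrow> i \<in> {1..n} \<Longrightarrow> b x i < k"
      "\<And>x c. x \<in> X \<Longrightarrow> c < k \<Longrightarrow> \<exists>i\<in>{1..n}. b x i = c"
    and inj: "\<And>x y. x \<in> X \<Longrightarrow> y \<in> X \<Longrightarrow> (\<And>i. i \<in> {1..n} \<Longrightarrow> b x i = b y i) \<Longrightarrow> x = y"
    and I: "finite I" "card I \<le> card X"
    and hv: "\<And>p. p \<in> I \<Longrightarrow> homog (deg p) (v p)" "\<And>p. p \<in> I \<Longrightarrow> v p \<in> polys n"
    and sp: "\<And>m. keys m \<subseteq> {1..n} \<Longrightarrow> mo m \<in> set_add (pm.span (v ` {p \<in> I. deg p = tdeg m})) (J n k)"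
    and z: "(\<Sum>p\<in>I. smul (c p) (v p)) \<in> J n k" and q: "q \<in> I"
  shows "c q = 0"
proof -
  interpret labels "\<lambda>c :: 'a. Fraction_Field.Fract [:c:] 1" "\<lambda>i. Fraction_Field.Fract (monom 1 i) 1" n k by (rule labels_fract[OF k])
  have "surj_word (b x)" if "x \<in> X" for x unfolding surj_word_def using X(2,3) that by blast
  then interpret point_eval "\<lambda>c :: 'a. Fraction_Field.Fract [:c:] 1" n k X "\<lambda>x. pts (b x)"
    by (intro point_eval_labels X(1) inj)
  show ?thesis by (rule independent_mod_J[OF I hv sp z q])
qed

subsection \<open>Counting\<close>

text \<open>For a permutation with descent set D, the pairs (\<alpha>, i) with which it occurs in
  the basis.\<close>

definition QD :: "nat \<Rightarrow> nat \<Rightarrow> nat set \<Rightarrow> (nat list \<times> nat list) set" where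
  "QD n k D = {(\<alpha>, is) \<in> A n k. compDes \<alpha> \<subseteq> D \<and> D \<subseteq> compDes \<alpha> \<union> seqDes n is}"

text \<open>The counterpart of \<open>QD\<close> for ordered set partitions: an element g lists the
  cut positions of a sorted partition into k blocks.\<close>

definition GD :: "nat \<Rightarrow> nat \<Rightarrow> nat set \<Rightarrow> nat set set" where
  "GD n k D = {g. D \<subseteq> g \<and> g \<subseteq> {1..<n} \<and> card g = k - 1}"

lemma finite_GD [simp]: "finite (GD n k D)"
  by (rule finite_subset[of _ "Pow {1..<n}"]) (auto simp: GD_def)

lemma card_GD:
  assumes "1 \<le> k" "D \<subseteq> {1..<n}"
  shows "card (GD n k D) = (if card D < k then (n - 1 - card D) choose (k - 1 - card D) else 0)"
proof -
  have fD: "finite D" using assms finite_subset by blast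
  have le: "card D \<le> card g" if "g \<in> GD n k D" for g
    using that finite_subset[of g "{1..<n}"] by (intro card_mono) (auto simp: GD_def)
  show ?thesis
  proof (cases "card D < k")
    case True
    have "bij_betw (\<lambda>S. S \<union> D) {S. S \<subseteq> {1..<n} - D \<and> card S = k - 1 - card D} (GD n k D)"
    proof (rule bij_betw_byWitness[where f' = "\<lambda>g. g - D"])
      show "(\<lambda>S. S \<union> D) ` {S. S \<subseteq> {1..<n} - D \<and> card S = k - 1 - card D} \<subseteq> GD n k D"
      proof
        fix g assume "g \<in> (\<lambda>S. S \<union> D) ` {S. S \<subseteq> {1..<n} - D \<and> card S = k - 1 - card D}"
        then obtain S where S: "g = S \<union> D" "S \<subseteq> {1..<n} - D" "card S = k - 1 - card D" by blast
        have "finite S" "S \<inter> D = {}" using S(2) finite_subset by blast+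
        then have "card g = k - 1" using True fD S(3) unfolding S(1) by (simp add: card_Un_disjoint)
        then show "g \<in> GD n k D" using S assms by (auto simp: GD_def)
      qed
      show "(\<lambda>g. g - D) ` GD n k D \<subseteq> {S. S \<subseteq> {1..<n} - D \<and> card S = k - 1 - card D}"
        using fD by (auto simp: GD_def card_Diff_subset)
    qed (auto simp: GD_def)
    then have "card (GD n k D) = card {S. S \<subseteq> {1..<n} - D \<and> card S = k - 1 - card D}"
      by (rule bij_betw_same_card[symmetric])
    also have "\<dots> = card ({1..<n} - D) choose (k - 1 - card D)" by (rule n_subsets) simp
    also have "card ({1..<n} - D) = n - 1 - card D" using assms fD by (simp add: card_Diff_subset)
    finally show ?thesis using True by simp
  next
    case False
    then have "GD n k D = {}" using le assms(1) by (fastforce simp: GD_def)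
    then show ?thesis using False by simp
  qed
qed

context
  fixes n k :: nat and D :: "nat set"
  assumes k: "1 \<le> k" "k \<le> n" and D: "D \<subseteq> {1..<n}"
begin

definition "Dhi = D \<inter> {Suc (n - k)..<n}"
definition "Dlo = D \<inter> {1..n - k}"

text \<open>i is rebuilt from the slacks \<open>l\<close>. It must drop by at least 1 at every
  element of D up to n-k, and \<open>l ! t\<close> is the excess of the drop at t; the entry
  \<open>l ! 0\<close> is the distance of i_1 from its upper bound and does not enter the
  sums.\<close>

definition seq_of :: "nat list \<Rightarrow> nat list" where
  "seq_of l = map (\<lambda>i. \<Sum>t\<in>{Suc i..n - k}. l ! t + (if t \<in> D then 1 else 0)) [0..<n]"

lemma D_split: "D = Dhi \<union> Dlo" "Dhi \<inter> Dlo = {}" "finite Dhi" "finite Dlo" "card D = card Dhi + card Dlo"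
proof -
  show "D = Dhi \<union> Dlo" "Dhi \<inter> Dlo = {}" "finite Dhi" "finite Dlo" using D k by (auto simp: Dhi_def Dlo_def)
  then show "card D = card Dhi + card Dlo" by (metis card_Un_disjoint)
qed

lemma seq_of_nth: "j \<in> {1..n} \<Longrightarrow> seq_of l ! (j - 1) = (\<Sum>t\<in>{j..n - k}. l ! t + (if t \<in> D then 1 else 0))"
  by (cases j) (auto simp: seq_of_def)

lemma seq_of_nth': "j < n \<Longrightarrow> seq_of l ! j = (\<Sum>t\<in>{Suc j..n - k}. l ! t + (if t \<in> D then 1 else 0))"
  by (simp add: seq_of_def)

lemma seq_of_step: "j \<in> {1..n - k} \<Longrightarrow> seq_of l ! (j - 1) = seq_of l ! j + l ! j + (if j \<in> D then 1 else 0)"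
proof -
  assume j: "j \<in> {1..n - k}"
  then have j: "j \<in> {1..n}" "j < n" "j \<le> n - k" using k by auto
  show ?thesis unfolding seq_of_nth[OF j(1)] seq_of_nth'[OF j(2)] sum.atLeast_Suc_atMost[OF j(3)] by simp
qed

lemma sum_Dlo: "(\<Sum>t\<in>{1..n - k}. (if t \<in> D then 1 else 0)) = card Dlo"
  by (simp add: Dlo_def sum.If_cases Int_commute)

lemma hi_subset: "Dhi \<subseteq> {1..<n}" "Dhi \<subseteq> {Suc (n - k)..<n}"
  using D by (auto simp: Dhi_def)

lemma seq_of_first:
  assumes "length l = Suc (n - k)" "sum_list l + card D = k - 1" "card D < k"
  shows "seq_of l ! 0 + l ! 0 = k - Suc (card Dhi)"
proof -
  have "sum_list l = (\<Sum>t<Suc (n - k). l ! t)" by (simp add: sum_list_sum_nth assms(1) atLeast0LessThan)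
  also have "\<dots> = l ! 0 + (\<Sum>t\<in>{1..n - k}. l ! t)"
    by (subst sum.lessThan_Suc_shift) (simp add: sum.shift_bounds_Suc_ivl[symmetric] atLeast0LessThan[symmetric]
        atLeastLessThanSuc_atLeastAtMost One_nat_def)
  finally have "sum_list l = l ! 0 + (\<Sum>t\<in>{1..n - k}. l ! t)" .
  moreover have "seq_of l ! 0 = (\<Sum>t\<in>{1..n - k}. l ! t) + card Dlo"
    using seq_of_nth[of 1 l] k by (simp add: sum.distrib sum_Dlo)
  ultimately show ?thesis using assms(2,3) D_split(5) by simp
qed

lemma seq_of_in_QD:
  assumes l: "length l = Suc (n - k)" "sum_list l + card D = k - 1" "card D < k"
  shows "(comp_of n Dhi, seq_of l) \<in> QD n k D"
proof -
  have n: "1 \<le> n" using k by simp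
  note c = comp_of[OF hi_subset(1) n]
  have dcr: "seq_of l ! j \<le> seq_of l ! (j - 1)" if "j \<in> {1..n - k}" for j using seq_of_step[OF that, of l] by simp
  have bound: "seq_of l ! (j - 1) \<le> seq_of l ! 0" if "j \<in> {1..n - k}" for j
    using that
  proof (induction j)
    case (Suc j)
    then show ?case using dcr[of j] by (cases "j = 0") auto
  qed simp
  have inA: "(comp_of n Dhi, seq_of l) \<in> A n k"
  proof (rule A_I[OF k hi_subset(2)])
    show "length (seq_of l) = n" by (simp add: seq_of_def)
    show "seq_of l ! (j - 1) \<le> k - Suc (card Dhi)" if "j \<in> {1..n - k}" for j
      using bound[OF that] seq_of_first[OF l] by simp
    show "seq_of l ! j \<le> seq_of l ! (j - 1)" if "j \<in> {1..<n - k}" for j using dcr that by simp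
    show "seq_of l ! (j - 1) = 0" if "j \<in> {Suc (n - k)..n}" for j using seq_of_nth[of j l] that by simp
  qed
  have "Dlo \<subseteq> seqDes n (seq_of l)"
  proof
    fix j assume j: "j \<in> Dlo"
    then have "j \<in> {1..n - k}" "j \<in> D" by (auto simp: Dlo_def)
    then show "j \<in> seqDes n (seq_of l)" using seq_of_step[of j l] k by (auto simp: seqDes_def)
  qed
  then show ?thesis using inA c(2) D_split(1) by (auto simp: QD_def)
qed

lemma QD_seq:
  assumes q: "(\<alpha>, is) \<in> QD n k D"
  shows "\<alpha> = comp_of n Dhi" "card D < k"
    "\<exists>l. length l = Suc (n - k) \<and> sum_list l + card D = k - 1 \<and> is = seq_of l"
proof -
  have n: "1 \<le> n" using k by simp
  have a: "(\<alpha>, is) \<in> A n k" and sub: "compDes \<alpha> \<subseteq> D" "D \<subseteq> compDes \<alpha> \<union> seqDes n is" using q by (auto simp: QD_def)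
  note ad = A_D[OF a k]
  note c = comp_of[OF hi_subset(1) n]
  have z: "is ! j = 0" if "n - k \<le> j" "j < n" for j using ad(7)[of "Suc j"] that by simp
  have sd: "seqDes n is \<subseteq> {1..n - k}"
  proof
    fix j assume j: "j \<in> seqDes n is"
    then have "is ! (j - 1) \<noteq> 0" "1 \<le> j" "j < n" by (auto simp: seqDes_def)
    then show "j \<in> {1..n - k}" using ad(7)[of j] by (cases "j \<le> n - k") auto
  qed
  have cD: "compDes \<alpha> = Dhi" using ad(2) sub sd by (auto simp: Dhi_def)
  show \<alpha>: "\<alpha> = comp_of n Dhi" by (rule composition_unique[OF ad(1) c(1) n]) (simp add: c cD)
  have lo: "Dlo \<subseteq> seqDes n is" using sub(2) cD by (auto simp: Dlo_def Dhi_def)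
  have gap: "is ! t + (if t \<in> D then 1 else 0) \<le> is ! (t - 1)" if t: "t \<in> {1..n - k}" for t
  proof -
    have "t \<in> {1..<n}" using t k by auto
    moreover have "is ! t < is ! (t - 1)" if "t \<in> D"
    proof -
      have "t \<in> Dlo" using t that by (simp add: Dlo_def)
      then show ?thesis using lo by (auto simp: seqDes_def)
    qed
    ultimately show ?thesis using ad(6)[of t] by auto
  qed
  have i0: "is ! 0 \<le> k - Suc (card Dhi)"
  proof (cases "n - k = 0")
    case True
    then show ?thesis using z[of 0] k by simp
  next
    case False
    then show ?thesis using ad(5)[of 1] cD by auto
  qed
  \<comment> \<open>Inverse of \<open>seq_of\<close>: the distance of i_1 from its bound, followed
    by the excess of every drop over the forced one.\<close>
  define l where "l = (k - Suc (card Dhi) - is ! 0) # map (\<lambda>t. is ! (t - 1) - is ! t - (if t \<in> D then 1 else 0)) [1..<Suc (n - k)]"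
  have ll: "length l = Suc (n - k)" by (simp add: l_def del: upt_Suc)
  have l0: "l ! 0 = k - Suc (card Dhi) - is ! 0" by (simp add: l_def)
  have lt: "l ! t + (if t \<in> D then 1 else 0) + is ! t = is ! (t - 1)" if t: "t \<in> {1..n - k}" for t
  proof -
    obtain s where s: "t = Suc s" using t by (cases t) auto
    have "l ! t = is ! (t - 1) - is ! t - (if t \<in> D then 1 else 0)"
      using t unfolding s l_def by (simp add: One_nat_def del: upt_Suc)
    then show ?thesis using gap[OF t] by simp
  qed
  have tele: "(\<Sum>t\<in>{j..n - k}. l ! t + (if t \<in> D then 1 else 0)) = is ! (j - 1)" if "1 \<le> j" "j \<le> Suc (n - k)" for j
    using that(2,1)
  proof (induction rule: inc_induct)
    case base
    then show ?case using z[of "n - k"] k by simp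
  next
    case (step m)
    then show ?case using lt[of m] by (simp add: sum.atLeast_Suc_atMost)
  qed
  have seqe: "is = seq_of l"
  proof (rule nth_equalityI)
    show "length is = length (seq_of l)" using ad(3) by (simp add: seq_of_def)
    fix i assume i: "i < length is"
    then have i': "i < n" using ad(3) by simp
    show "is ! i = seq_of l ! i"
    proof (cases "Suc i \<le> Suc (n - k)")
      case True
      then show ?thesis using tele[of "Suc i"] seq_of_nth'[OF i', of l] by simp
    next
      case False
      then show ?thesis using z[OF _ i'] seq_of_nth'[OF i', of l] by simp
    qed
  qed
  have "is ! 0 = (\<Sum>t\<in>{1..n - k}. l ! t) + card Dlo"
    using tele[of 1] by (simp add: sum.distrib sum_Dlo)
  moreover have "sum_list l = l ! 0 + (\<Sum>t\<in>{1..n - k}. l ! t)"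
  proof -
    have "sum_list l = (\<Sum>t<Suc (n - k). l ! t)" by (simp add: sum_list_sum_nth ll atLeast0LessThan)
    also have "\<dots> = l ! 0 + (\<Sum>t\<in>{1..n - k}. l ! t)"
      by (subst sum.lessThan_Suc_shift) (simp add: sum.shift_bounds_Suc_ivl[symmetric] atLeast0LessThan[symmetric]
        atLeastLessThanSuc_atLeastAtMost One_nat_def)
    finally show ?thesis .
  qed
  moreover have "Suc (card Dhi) \<le> k" using ad(4) cD by simp
  ultimately have "sum_list l + card D = k - 1" "card D < k" using i0 l0 D_split(5) by simp_all
  then show "card D < k" "\<exists>l. length l = Suc (n - k) \<and> sum_list l + card D = k - 1 \<and> is = seq_of l"
    using ll seqe by auto
qed

text \<open>Stars and bars: k-1-|D| units of slack are distributed over n-k+1 places, and the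
  resulting binomial coefficient also counts the (k-1)-subsets of {1..n-1} that contain D.\<close>

lemma card_QD: "card (QD n k D) = card (GD n k D)"
proof (cases "card D < k")
  case True
  define N where "N = k - 1 - card D"
  let ?L = "{l :: nat list. length l = Suc (n - k) \<and> sum_list l = N}"
  have N: "sum_list l = N \<longleftrightarrow> sum_list l + card D = k - 1" for l :: "nat list" using True by (auto simp: N_def)
  have "bij_betw (\<lambda>l. (comp_of n Dhi, seq_of l)) ?L (QD n k D)"
    unfolding bij_betw_def
  proof (intro conjI inj_onI)
    fix l l' assume l: "l \<in> ?L" "l' \<in> ?L" and "(comp_of n Dhi, seq_of l) = (comp_of n Dhi, seq_of l')"
    then have e: "seq_of l = seq_of l'" by simp
    have lN: "length l = Suc (n - k)" "sum_list l + card D = k - 1" "length l' = Suc (n - k)" "sum_list l' + card D = k - 1"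
      using l N by auto
    show "l = l'"
    proof (rule nth_equalityI)
      show "length l = length l'" using l by simp
      fix i assume i: "i < length l"
      show "l ! i = l' ! i"
      proof (cases "i = 0")
        case True
        then show ?thesis using seq_of_first[OF lN(1,2) \<open>card D < k\<close>] seq_of_first[OF lN(3,4) \<open>card D < k\<close>] e by simp
      next
        case False
        then have "i \<in> {1..n - k}" using i l by auto
        then show ?thesis using seq_of_step[of i l] seq_of_step[of i l'] e by simp
      qed
    qed
  next
    show "(\<lambda>l. (comp_of n Dhi, seq_of l)) ` ?L = QD n k D"
    proof (intro equalityI subsetI)
      fix x assume "x \<in> (\<lambda>l. (comp_of n Dhi, seq_of l)) ` ?L"
      then show "x \<in> QD n k D" using seq_of_in_QD[OF _ _ True] N by auto
    next
      fix x assume x: "x \<in> QD n k D"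
      obtain \<alpha> "is" where xe: "x = (\<alpha>, is)" by (cases x)
      from QD_seq[OF x[unfolded xe]] show "x \<in> (\<lambda>l. (comp_of n Dhi, seq_of l)) ` ?L" using N xe by auto
    qed
  qed
  then have "card (QD n k D) = card ?L" by (rule bij_betw_same_card[symmetric])
  also have "\<dots> = (N + Suc (n - k) - 1) choose N" by (rule card_length_sum_list)
  also have "N + Suc (n - k) - 1 = n - 1 - card D" using True k by (simp add: N_def)
  finally show ?thesis using card_GD[OF k(1) D] True by (simp add: N_def)
next
  case False
  then have "QD n k D = {}" using QD_seq(2) by fastforce
  then show ?thesis using card_GD[OF k(1) D] False by simp
qed

lemma finite_QD: "finite (QD n k D)"
proof (cases "card D < k")
  case True
  have "QD n k D \<subseteq> (\<lambda>l. (comp_of n Dhi, seq_of l)) ` {l :: nat list. set l \<subseteq> {..k} \<and> length l = Suc (n - k)}"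
  proof
    fix x assume x: "x \<in> QD n k D"
    obtain \<alpha> "is" where xe: "x = (\<alpha>, is)" by (cases x)
    from QD_seq[OF x[unfolded xe]] obtain l where l: "x = (comp_of n Dhi, seq_of l)" "length l = Suc (n - k)" "sum_list l + card D = k - 1"
      using xe by auto
    have "set l \<subseteq> {..k}" using l(3) member_le_sum_list by fastforce
    then show "x \<in> (\<lambda>l. (comp_of n Dhi, seq_of l)) ` {l. set l \<subseteq> {..k} \<and> length l = Suc (n - k)}" using l by blast
  qed
  then show ?thesis by (rule finite_subset) (intro finite_imageI finite_lists_length_eq, simp)
next
  case False
  then have "QD n k D = {}" using QD_seq(2) by fastforce
  then show ?thesis by simp
qed

end

lemma mult_eq_card_GD:
  assumes "1 \<le> k" "k \<le> n" "is_comp n \<beta>"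
  shows "mult n k \<beta> = card (GD n k (compDes \<beta>))"
proof -
  have l: "length \<beta> = Suc (card (compDes \<beta>))" using card_compDes[OF assms(3)] assms by simp
  then have "length \<beta> \<le> k \<longleftrightarrow> card (compDes \<beta>) < k" by auto
  moreover have "n - length \<beta> = n - 1 - card (compDes \<beta>)" "k - length \<beta> = k - 1 - card (compDes \<beta>)" using l by simp_all
  ultimately show ?thesis using card_GD[OF assms(1) compDes_subset[OF assms(3)]] by (simp add: mult_def)
qed

definition Gx :: "nat \<Rightarrow> nat \<Rightarrow> (nat set \<times> (nat \<Rightarrow> nat)) set" where
  "Gx n k = {(g, w). perm n w \<and> g \<in> GD n k (pDes n w)}"

lemma Ix_Sigma: "Ix n k = (\<lambda>(w, p). (p, w)) ` (SIGMA w:{w. perm n w}. QD n k (pDes n w))"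
  by (force simp: Ix_def QD_def)

lemma Gx_Sigma: "Gx n k = (\<lambda>(w, p). (p, w)) ` (SIGMA w:{w. perm n w}. GD n k (pDes n w))"
  by (force simp: Gx_def)

lemma finite_Ix: "1 \<le> k \<Longrightarrow> k \<le> n \<Longrightarrow> finite (Ix n k)"
  unfolding Ix_Sigma by (intro finite_imageI finite_SigmaI finite_perms finite_QD pDes_sub)

lemma finite_Gx: "finite (Gx n k)"
  unfolding Gx_Sigma by (intro finite_imageI finite_SigmaI finite_perms finite_GD)

lemma card_Ix: "1 \<le> k \<Longrightarrow> k \<le> n \<Longrightarrow> card (Ix n k) = card (Gx n k)"
proof -
  assume k: "1 \<le> k" "k \<le> n"
  have inj: "inj_on (\<lambda>(w, p). (p, w)) S" for S :: "('b \<times> 'c) set" by (auto simp: inj_on_def)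
  show ?thesis unfolding Ix_Sigma Gx_Sigma card_image[OF inj]
    by (simp add: card_SigmaI finite_perms finite_QD[OF k pDes_sub] card_QD[OF k pDes_sub])
qed

section \<open>The module of ordered set partitions\<close>

abbreviation osps :: "nat \<Rightarrow> nat \<Rightarrow> nat set list set" where "osps n k \<equiv> {s. is_osp n k s}"

definition osp_of :: "nat \<Rightarrow> nat \<Rightarrow> (nat \<Rightarrow> nat) \<Rightarrow> nat set list" where
  "osp_of n k c = map (\<lambda>b. {x \<in> {1..n}. c x = b}) [0..<k]"

lemma osp_of_cong: "(\<And>x. x \<in> {1..n} \<Longrightarrow> c x = d x) \<Longrightarrow> osp_of n k c = osp_of n k d"
  by (auto simp: osp_of_def)

lemma blk_unique:
  assumes s: "is_osp n k s" and a: "a < k" "x \<in> s ! a"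
  shows "blk s x = a"
  unfolding blk_def
proof (rule the_equality)
  show "a < length s \<and> x \<in> s ! a" using s a by (simp add: is_osp_def)
  fix b assume "b < length s \<and> x \<in> s ! b"
  then show "b = a" using s a unfolding is_osp_def by (metis IntI empty_iff)
qed

lemma blk_props:
  assumes s: "is_osp n k s" and x: "x \<in> {1..n}"
  shows "blk s x < k" "x \<in> s ! blk s x"
proof -
  have "x \<in> \<Union>(set s)" using s x by (simp add: is_osp_def)
  then obtain a where a: "a < length s" "x \<in> s ! a" by (auto simp: in_set_conv_nth)
  then have "a < k" using s by (simp add: is_osp_def)
  then show "blk s x < k" "x \<in> s ! blk s x" using blk_unique[OF s _ a(2)] a by auto
qed

lemma blk_surj:
  assumes s: "is_osp n k s" and b: "b < k"
  shows "\<exists>x\<in>{1..n}. blk s x = b"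
proof -
  have "s ! b \<in> set s" using s b by (simp add: is_osp_def)
  then have "s ! b \<noteq> {}" "s ! b \<subseteq> {1..n}" using s by (auto simp: is_osp_def)
  then show ?thesis using blk_unique[OF s b] by blast
qed

lemma osp_of_blk:
  assumes s: "is_osp n k s"
  shows "osp_of n k (blk s) = s"
proof (rule nth_equalityI)
  show "length (osp_of n k (blk s)) = length s" using s by (simp add: osp_of_def is_osp_def)
  fix b assume "b < length (osp_of n k (blk s))"
  then have b: "b < k" by (simp add: osp_of_def)
  then have "s ! b \<in> set s" using s by (simp add: is_osp_def)
  then have "s ! b \<subseteq> {1..n}" using s by (auto simp: is_osp_def)
  then show "osp_of n k (blk s) ! b = s ! b"
    using b blk_unique[OF s b] blk_props(2)[OF s] by (auto simp: osp_of_def)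
qed

lemma osp_eqI:
  assumes "is_osp n k s" "is_osp n k t" "\<And>x. x \<in> {1..n} \<Longrightarrow> blk s x = blk t x"
  shows "s = t"
proof -
  have "osp_of n k (blk s) = osp_of n k (blk t)" by (rule osp_of_cong[OF assms(3)])
  then show ?thesis by (simp only: osp_of_blk[OF assms(1)] osp_of_blk[OF assms(2)])
qed

lemma is_osp_of:
  assumes "\<And>x. x \<in> {1..n} \<Longrightarrow> c x < k" "\<And>b. b < k \<Longrightarrow> \<exists>x\<in>{1..n}. c x = b"
  shows "is_osp n k (osp_of n k c)"
  unfolding is_osp_def
proof (intro conjI ballI allI impI)
  show "length (osp_of n k c) = k" by (simp add: osp_of_def)
  show "B \<noteq> {}" if B: "B \<in> set (osp_of n k c)" for B
  proof -
    obtain b where "b < k" "B = {x \<in> {1..n}. c x = b}" using B by (auto simp: osp_of_def)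
    then show ?thesis using assms(2)[of b] by blast
  qed
  have "\<Union>(set (osp_of n k c)) = (\<Union>b<k. {x \<in> {1..n}. c x = b})" by (simp add: osp_of_def atLeast0LessThan)
  also have "\<dots> = {1..n}" using assms(1) by blast
  finally show "\<Union>(set (osp_of n k c)) = {1..n}" .
  show "osp_of n k c ! a \<inter> osp_of n k c ! b = {}" if "a < k" "b < k" "a \<noteq> b" for a b
    using that by (auto simp: osp_of_def)
qed

lemma blk_osp_of:
  assumes "\<And>x. x \<in> {1..n} \<Longrightarrow> c x < k" "\<And>b. b < k \<Longrightarrow> \<exists>x\<in>{1..n}. c x = b" "x \<in> {1..n}"
  shows "blk (osp_of n k c) x = c x"
proof (rule blk_unique[OF is_osp_of[OF assms(1,2)]])
  show "c x < k" by (rule assms(1)[OF assms(3)])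
  then show "x \<in> osp_of n k c ! c x" using assms(3) by (simp add: osp_of_def)
qed

lemma finite_osps: "finite (osps n k)"
proof (rule finite_subset)
  show "osps n k \<subseteq> {s. set s \<subseteq> Pow {1..n} \<and> length s = k}" unfolding is_osp_def by blast
qed (rule finite_lists_length_eq, simp)

section \<open>The 0-Hecke relations on ordered set partitions\<close>

definition sw :: "nat \<Rightarrow> nat set list \<Rightarrow> nat set list" where "sw i = map ((`) (sg i))"

lemma osp_gen_sw: "osp_gen i s = (if blk s (Suc i) < blk s i then 0
    else if blk s i < blk s (Suc i) then Poly_Mapping.single s 1 + Poly_Mapping.single (sw i s) 1
    else Poly_Mapping.single s 1)"
  by (simp add: osp_gen_def sw_def)

lemma sw_eq:
  assumes s: "is_osp n k s" and i: "i \<in> {1..<n}"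
  shows "sw i s = osp_of n k (\<lambda>x. blk s (sg i x))"
proof -
  have "sg i ` {x \<in> {1..n}. blk s x = b} = {x \<in> {1..n}. blk s (sg i x) = b}" for b
  proof (intro equalityI subsetI)
    fix x assume "x \<in> {x \<in> {1..n}. blk s (sg i x) = b}"
    then have "x = sg i (sg i x)" "sg i x \<in> {x \<in> {1..n}. blk s x = b}" using sg_range[OF i] by auto
    then show "x \<in> sg i ` {x \<in> {1..n}. blk s x = b}" by (rule image_eqI)
  qed (use sg_range[OF i] in auto)
  then have "sw i (osp_of n k (blk s)) = osp_of n k (\<lambda>x. blk s (sg i x))" by (simp add: osp_of_def sw_def)
  then show ?thesis by (simp only: osp_of_blk[OF s])
qed

lemma
  assumes s: "is_osp n k s" and i: "i \<in> {1..<n}"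
  shows sw_osp: "is_osp n k (sw i s)"
    and blk_sw: "x \<in> {1..n} \<Longrightarrow> blk (sw i s) x = blk s (sg i x)"
proof -
  have 1: "blk s (sg i x) < k" if "x \<in> {1..n}" for x using blk_props(1)[OF s] sg_range[OF i] that by blast
  have 2: "\<exists>x\<in>{1..n}. blk s (sg i x) = b" if b: "b < k" for b
  proof -
    obtain x where x: "x \<in> {1..n}" "blk s x = b" using blk_surj[OF s b] by blast
    then have "sg i x \<in> {1..n}" "blk s (sg i (sg i x)) = b" using sg_range[OF i] by (blast, simp)
    then show ?thesis by blast
  qed
  show "is_osp n k (sw i s)" unfolding sw_eq[OF s i] by (rule is_osp_of[OF 1 2])
  show "x \<in> {1..n} \<Longrightarrow> blk (sw i s) x = blk s (sg i x)" unfolding sw_eq[OF s i] by (rule blk_osp_of[OF 1 2])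
qed

lemma sw_sw: "sw i (sw i s) = s"
  by (simp add: sw_def image_image comp_def)

lemma sw_far: "Suc i < j \<Longrightarrow> sw i (sw j s) = sw j (sw i s)"
proof -
  assume "Suc i < j"
  then have "sg i (sg j x) = sg j (sg i x)" for x by (auto simp: transpose_def)
  then show ?thesis by (simp add: sw_def image_image comp_def)
qed

lemma sw_braid: "sw i (sw (Suc i) (sw i s)) = sw (Suc i) (sw i (sw (Suc i) s))"
proof -
  have "sg i (sg (Suc i) (sg i x)) = sg (Suc i) (sg i (sg (Suc i) x))" for x by (auto simp: transpose_def)
  then show ?thesis by (simp add: sw_def image_image comp_def)
qed

lemma osp_act_lext: "osp_act i = lext (osp_gen i)"
  by (simp add: fun_eq_iff osp_act_def lext_def)

lemma osp_act_lin: "lin (osp_act i)"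
  unfolding osp_act_lext by (rule lext_lin)

lemma osp_act_single: "osp_act i (Poly_Mapping.single s 1) = (osp_gen i s :: nat set list \<Rightarrow>\<^sub>0 'a::field)"
  by (simp add: osp_act_lext)

lemma OPset_subspace: "pm.subspace (OPset n k :: (nat set list \<Rightarrow>\<^sub>0 'a::field) set)"
proof -
  have "(OPset n k :: (nat set list \<Rightarrow>\<^sub>0 'a) set) = {f. \<forall>s\<in>keys f. is_osp n k s}" by (auto simp: OPset_def)
  then show ?thesis using subspace_keys[of "is_osp n k"] by simp
qed

lemma single_OPset: "is_osp n k s \<Longrightarrow> Poly_Mapping.single s 1 \<in> OPset n k"
  by (simp add: OPset_def)

lemma lin_eq_on_OPset:
  assumes "lin F" "lin G" "\<And>s. is_osp n k s \<Longrightarrow> F (Poly_Mapping.single s 1) = G (Poly_Mapping.single s 1)" "f \<in> OPset n k"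
  shows "F f = G f"
proof -
  have f: "f = (\<Sum>s\<in>keys f. smul (lookup f s) (Poly_Mapping.single s 1))" by (simp add: sum_single_keys)
  have "F (\<Sum>s\<in>keys f. smul (lookup f s) (Poly_Mapping.single s 1)) = G (\<Sum>s\<in>keys f. smul (lookup f s) (Poly_Mapping.single s 1))"
    unfolding lin_sum[OF assms(1)] lin_sum[OF assms(2)] lin_smul[OF assms(1)] lin_smul[OF assms(2)]
    by (rule sum.cong) (use assms(3,4) in \<open>auto simp: OPset_def\<close>)
  then show ?thesis using f by simp
qed

lemma osp_act_idem: "is_osp n k s \<Longrightarrow> i \<in> {1..<n} \<Longrightarrow> osp_act i (osp_gen i s) = (osp_gen i s :: nat set list \<Rightarrow>\<^sub>0 'a::field)"
  by (auto simp: osp_gen_sw osp_act_single lin_add[OF osp_act_lin] lin_zero[OF osp_act_lin] blk_sw)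

lemma osp_act_far:
  assumes s: "is_osp n k s" and i: "i \<in> {1..<n}" and j: "j \<in> {1..<n}" and ij: "Suc i < j"
  shows "osp_act i (osp_gen j s) = (osp_act j (osp_gen i s) :: nat set list \<Rightarrow>\<^sub>0 'a::field)"
proof -
  have b: "blk (sw i s) j = blk s j" "blk (sw i s) (Suc j) = blk s (Suc j)"
    "blk (sw j s) i = blk s i" "blk (sw j s) (Suc i) = blk s (Suc i)"
    using i j ij by (simp_all add: blk_sw[OF s i] blk_sw[OF s j] sg_other)
  show ?thesis using b sw_far[OF ij, of s]
    by (simp add: osp_gen_sw osp_act_single lin_add[OF osp_act_lin] lin_zero[OF osp_act_lin])
qed

lemma osp_act_braid:
  assumes s: "is_osp n k s" and i: "i \<in> {1..<n}" and i2: "Suc i < n"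
  shows "osp_act i (osp_act (Suc i) (osp_gen i s))
    = (osp_act (Suc i) (osp_act i (osp_gen (Suc i) s)) :: nat set list \<Rightarrow>\<^sub>0 'a::field)"
proof -
  let ?j = "Suc i"
  have j: "?j \<in> {1..<n}" using i2 by simp
  have r: "i \<in> {1..n}" "?j \<in> {1..n}" "Suc ?j \<in> {1..n}" using i i2 by auto
  have o: "sg i (Suc ?j) = Suc ?j" "sg ?j i = i" by (simp_all add: sg_other)
  have A: "blk (sw i t) i = blk t ?j" "blk (sw i t) ?j = blk t i" "blk (sw i t) (Suc ?j) = blk t (Suc ?j)"
    "blk (sw ?j t) i = blk t i" "blk (sw ?j t) ?j = blk t (Suc ?j)" "blk (sw ?j t) (Suc ?j) = blk t ?j"
    if t: "is_osp n k t" for t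
    using r o by (simp_all add: blk_sw[OF t i] blk_sw[OF t j])
  note os = sw_osp[OF s i] sw_osp[OF s j]
  note os2 = sw_osp[OF os(1) j] sw_osp[OF os(2) i]
  note rules = A[OF s] A[OF os(1)] A[OF os(2)] A[OF os2(1)] A[OF os2(2)]
  note g = osp_gen_sw[of i s] osp_gen_sw[of ?j s] osp_gen_sw[of i "sw i s"] osp_gen_sw[of ?j "sw i s"]
    osp_gen_sw[of i "sw ?j s"] osp_gen_sw[of ?j "sw ?j s"]
    osp_gen_sw[of i "sw ?j (sw i s)"] osp_gen_sw[of ?j "sw ?j (sw i s)"]
    osp_gen_sw[of i "sw i (sw ?j s)"] osp_gen_sw[of ?j "sw i (sw ?j s)"]
  define p q r where "p = blk s i" and "q = blk s ?j" and "r = blk s (Suc ?j)"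
  note simps = g rules p_def[symmetric] q_def[symmetric] r_def[symmetric] osp_act_single
    lin_add[OF osp_act_lin] lin_zero[OF osp_act_lin] sw_sw sw_braid[of i s, symmetric]
  \<comment> \<open>Both sides depend only on the relative order of the blocks of i, i+1 and i+2, so
    the weak orders on three elements are checked one by one.\<close>
  consider "p < q" | "p = q" | "q < p" by linarith
  then show ?thesis
  proof cases
    case 1
    consider "q < r" | "q = r" | "r < q" "p < r" | "r < q" "p = r" | "r < q" "r < p" using 1 by linarith
    then show ?thesis by cases (use 1 in \<open>simp_all only: simps if_True if_False\<close>, auto simp: simps)
  next
    case 2
    consider "q < r" | "q = r" | "r < q" by linarith
    then show ?thesis by cases (use 2 in \<open>auto simp: simps\<close>)
  next
    case 3
    consider "q < r" "p < r" | "q < r" "p = r" | "q < r" "r < p" | "q = r" | "r < q" by linarith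
    then show ?thesis by cases (use 3 in \<open>auto simp: simps\<close>)
  qed
qed

interpretation op: hecke_module n osp_act "OPset n k :: (nat set list \<Rightarrow>\<^sub>0 'a::field) set" for n k
proof
  show "lin (osp_act i)" for i by (rule osp_act_lin)
  show "pm.subspace (OPset n k)" by (rule OPset_subspace)
  show "osp_act i f \<in> OPset n k" if "i \<in> {1..<n}" "f \<in> OPset n k" for i and f :: "nat set list \<Rightarrow>\<^sub>0 'a"
  proof -
    have "osp_gen i s \<in> (OPset n k :: (nat set list \<Rightarrow>\<^sub>0 'a) set)" if "s \<in> keys f" for s
    proof -
      have "is_osp n k s" using that \<open>f \<in> OPset n k\<close> by (auto simp: OPset_def)
      then show ?thesis unfolding osp_gen_sw
        using single_OPset[of n k s, where ?'a = 'a] single_OPset[OF sw_osp[OF _ \<open>i \<in> {1..<n}\<close>], of k s, where ?'a = 'a]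
          pm.subspace_add[OF OPset_subspace] pm.subspace_0[OF OPset_subspace] by auto
    qed
    then show ?thesis unfolding osp_act_lext by (intro lext_in_subspace OPset_subspace)
  qed
  show "osp_act i (osp_act i f) = osp_act i f" if "i \<in> {1..<n}" "f \<in> OPset n k" for i and f :: "nat set list \<Rightarrow>\<^sub>0 'a"
    by (rule lin_eq_on_OPset[OF lin_comp[OF osp_act_lin osp_act_lin] osp_act_lin _ that(2)])
       (simp add: osp_act_single osp_act_idem[OF _ that(1)])
  show "osp_act i (osp_act j f) = osp_act j (osp_act i f)" if "i \<in> {1..<n}" "j \<in> {1..<n}" "Suc i < j" "f \<in> OPset n k"
    for i j and f :: "nat set list \<Rightarrow>\<^sub>0 'a"
    by (rule lin_eq_on_OPset[OF lin_comp[OF osp_act_lin osp_act_lin] lin_comp[OF osp_act_lin osp_act_lin] _ that(4)])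
       (simp add: osp_act_single osp_act_far[OF _ that(1-3)])
  show "osp_act i (osp_act (Suc i) (osp_act i f)) = osp_act (Suc i) (osp_act i (osp_act (Suc i) f))"
    if "i \<in> {1..<n}" "Suc i < n" "f \<in> OPset n k" for i and f :: "nat set list \<Rightarrow>\<^sub>0 'a"
    by (rule lin_eq_on_OPset[OF lin_comp[OF osp_act_lin lin_comp[OF osp_act_lin osp_act_lin]]
              lin_comp[OF osp_act_lin lin_comp[OF osp_act_lin osp_act_lin]] _ that(3)])
       (simp add: osp_act_single osp_act_braid[OF _ that(1,2)])
qed

text \<open>With g as a set of cuts, each behind one of its elements, this is the number of the
  interval in which x lies, counted from 0. \<open>std\<close> is the corresponding sorted ordered
  set partition.\<close>

definition rank :: "nat set \<Rightarrow> nat \<Rightarrow> nat" where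
  "rank g x = card {d \<in> g. d < x}"

definition std :: "nat \<Rightarrow> nat \<Rightarrow> nat set \<Rightarrow> nat set list" where
  "std n k g = osp_of n k (rank g)"

lemma rank_Suc: "finite g \<Longrightarrow> rank g (Suc x) = rank g x + (if x \<in> g then 1 else 0)"
proof -
  assume fin: "finite g"
  show ?thesis
  proof (cases "x \<in> g")
    case True
    then have "{d \<in> g. d < Suc x} = insert x {d \<in> g. d < x}" by auto
    then show ?thesis using True fin by (simp add: rank_def)
  next
    case False
    then have "{d \<in> g. d < Suc x} = {d \<in> g. d < x}" using less_Suc_eq by auto
    then show ?thesis using False by (simp add: rank_def)
  qed
qed

lemma rank_1: "g \<subseteq> {1..<n} \<Longrightarrow> rank g 1 = 0"
proof -
  assume "g \<subseteq> {1..<n}"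
  then have "{d \<in> g. d < 1} = {}" by auto
  then show ?thesis unfolding rank_def by (simp only: card.empty)
qed

lemma rank_n: "g \<subseteq> {1..<n} \<Longrightarrow> rank g n = card g"
proof -
  assume "g \<subseteq> {1..<n}"
  then have "{d \<in> g. d < n} = g" by auto
  then show ?thesis by (simp add: rank_def)
qed

lemma rank_mono: "finite g \<Longrightarrow> x \<le> y \<Longrightarrow> rank g x \<le> rank g y"
  unfolding rank_def by (intro card_mono) auto

lemma
  assumes k: "1 \<le> k" "k \<le> n" and g: "g \<subseteq> {1..<n}" "card g = k - 1"
  shows rank_less: "x \<in> {1..n} \<Longrightarrow> rank g x < k"
    and rank_surj: "b < k \<Longrightarrow> \<exists>x\<in>{1..n}. rank g x = b"
proof -
  have fin: "finite g" using g finite_subset by blast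
  show "rank g x < k" if "x \<in> {1..n}"
    using rank_mono[OF fin, of x n] rank_n[OF g(1)] g(2) that k by auto
  show "\<exists>x\<in>{1..n}. rank g x = b" if b: "b < k"
  proof -
    have ex: "\<exists>x. 1 \<le> x \<and> b \<le> rank g x" using rank_n[OF g(1)] g(2) b k by (intro exI[of _ n]) auto
    define x where "x = (LEAST x. 1 \<le> x \<and> b \<le> rank g x)"
    have x: "1 \<le> x" "b \<le> rank g x" using LeastI_ex[OF ex] unfolding x_def by blast+
    have least: "x \<le> y" if "1 \<le> y \<and> b \<le> rank g y" for y unfolding x_def
      by (rule Least_le[of "\<lambda>x. 1 \<le> x \<and> b \<le> rank g x", OF that])
    have xn: "x \<le> n" using least[of n] rank_n[OF g(1)] g(2) b k by auto
    have "rank g x \<le> b"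
    proof (cases "x = 1")
      case True
      then show ?thesis using rank_1[OF g(1)] by simp
    next
      case False
      then obtain y where y: "x = Suc y" "1 \<le> y" using x(1) by (cases x) auto
      have "rank g y < b" using least[of y] y by force
      then show ?thesis using rank_Suc[OF fin, of y] y by simp
    qed
    then show ?thesis using x xn by (intro bexI[of _ x]) auto
  qed
qed

lemma
  assumes k: "1 \<le> k" "k \<le> n" and g: "g \<subseteq> {1..<n}" "card g = k - 1"
  shows std_osp: "is_osp n k (std n k g)"
    and blk_std: "x \<in> {1..n} \<Longrightarrow> blk (std n k g) x = rank g x"
  unfolding std_def
  using is_osp_of[of n "rank g" k] blk_osp_of[of n "rank g" k x] rank_less[OF k g] rank_surj[OF k g] by blast+

abbreviation ss :: "nat set list \<Rightarrow> (nat set list \<Rightarrow>\<^sub>0 'a::field)" where "ss s \<equiv> Poly_Mapping.single s 1"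

lemma osp_act_std_fixed:
  assumes k: "1 \<le> k" "k \<le> n" and g: "g \<subseteq> {1..<n}" "card g = k - 1" and j: "j \<in> {1..<n}" "j \<notin> g"
  shows "osp_act j (ss (std n k g)) = ss (std n k g)"
proof -
  have "finite g" using g finite_subset by blast
  then have "rank g (Suc j) = rank g j" using rank_Suc j by simp
  then have "blk (std n k g) (Suc j) = blk (std n k g) j" using blk_std[OF k g] j by auto
  then show ?thesis by (simp add: osp_act_single osp_gen_sw)
qed

lemma sorted_osp:
  assumes k: "1 \<le> k" "k \<le> n" and s: "is_osp n k s" and mono: "\<And>i. i \<in> {1..<n} \<Longrightarrow> blk s i \<le> blk s (Suc i)"
  shows "\<exists>g. g \<subseteq> {1..<n} \<and> card g = k - 1 \<and> s = std n k g"
proof -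
  define g where "g = {d \<in> {1..<n}. blk s d < blk s (Suc d)}"
  have g: "g \<subseteq> {1..<n}" "finite g" by (auto simp: g_def)
  have mon: "blk s x \<le> blk s y" if "x \<le> y" "1 \<le> x" "y \<le> n" for x y
    using that
  proof (induction rule: dec_induct)
    case (step m)
    then show ?case using mono[of m] by force
  qed simp
  have b1: "blk s 1 = 0"
  proof -
    obtain y where "y \<in> {1..n}" "blk s y = 0" using blk_surj[OF s, of 0] k by auto
    then show ?thesis using mon[of 1 y] by auto
  qed
  have bn: "blk s n = k - 1"
  proof -
    obtain y where y: "y \<in> {1..n}" "blk s y = k - 1" using blk_surj[OF s, of "k - 1"] k by auto
    have "blk s n < k" using blk_props(1)[OF s, of n] k by simp
    then show ?thesis using mon[of y n] y k by auto
  qed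
  have jump: "blk s (Suc x) = blk s x + (if x \<in> g then 1 else 0)" if x: "x \<in> {1..<n}" for x
  proof -
    \<comment> \<open>A larger jump would skip a block, which would then be empty because the block
      numbers increase weakly.\<close>
    have "blk s (Suc x) \<le> Suc (blk s x)"
    proof (rule ccontr)
      assume gap: "\<not> ?thesis"
      have "Suc (blk s x) < k" using gap blk_props(1)[OF s, of "Suc x"] x by auto
      then obtain y where y: "y \<in> {1..n}" "blk s y = Suc (blk s x)" using blk_surj[OF s] by blast
      show False
      proof (cases "y \<le> x")
        case True
        then show ?thesis using mon[of y x] x y by auto
      next
        case False
        then show ?thesis using mon[of "Suc x" y] gap x y by auto
      qed
    qed
    then show ?thesis using mono[OF x] x by (auto simp: g_def)
  qed
  have r: "blk s x = rank g x" if "1 \<le> x" "x \<le> n" for x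
    using that
  proof (induction rule: dec_induct)
    case base
    show ?case using b1 rank_1[OF g(1)] by simp
  next
    case (step m)
    then show ?case using jump[of m] rank_Suc[OF g(2), of m] by simp
  qed
  have cg: "card g = k - 1" using r[of n] bn rank_n[OF g(1)] k by simp
  have "s = std n k g"
    by (rule osp_eqI[OF s std_osp[OF k g(1) cg]]) (simp add: blk_std[OF k g(1) cg] r)
  then show ?thesis using g cg by blast
qed

text \<open>If i+1 stands in a block to the left of i, then \<open>s\<close> is the new term of pi_i
  applied to s_i(s). The weight gives small letters the large factors, so undoing this swap lowers
  it, and the process stops at the sorted partitions.\<close>

lemma osp_cyclic:
  assumes k: "1 \<le> k" "k \<le> n" and s: "is_osp n k s"
  shows "(ss s :: nat set list \<Rightarrow>\<^sub>0 'a::field) \<in> pm.span {op.pbar n w x | w x. perm n w \<and> x \<in> {ss (std n k g) | g. g \<subseteq> {1..<n} \<and> card g = k - 1}}"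
    (is "_ \<in> pm.span {op.pbar n w x | w x. perm n w \<and> x \<in> ?X}")
  using s
proof (induction "\<Sum>x\<in>{1..n}. (n - x) * blk s x" arbitrary: s rule: less_induct)
  case less
  note s = less.prems
  have XM: "?X \<subseteq> OPset n k" using single_OPset std_osp[OF k] by blast
  show ?case
  proof (cases "\<exists>i\<in>{1..<n}. blk s (Suc i) < blk s i")
    case False
    then obtain g where g: "g \<subseteq> {1..<n}" "card g = k - 1" "s = std n k g"
      using sorted_osp[OF k s] by (meson not_less)
    have "op.pbar n id (ss s) \<in> {op.pbar n w x | w x. perm n w \<and> x \<in> ?X}" using g permutes_id by blast
    then show ?thesis unfolding op.pbar_id by (rule pm.span_base)
  next
    case True
    then obtain i where i: "i \<in> {1..<n}" "blk s (Suc i) < blk s i" by blast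
    define t where "t = sw i s"
    have t: "is_osp n k t" unfolding t_def by (rule sw_osp[OF s i(1)])
    have bt: "blk t x = blk s (sg i x)" if "x \<in> {1..n}" for x unfolding t_def by (rule blk_sw[OF s i(1) that])
    have r: "(\<Sum>x\<in>{1..n} - {i, Suc i}. (n - x) * blk t x) = (\<Sum>x\<in>{1..n} - {i, Suc i}. (n - x) * blk s x)"
      by (rule sum.cong) (auto simp: bt sg_other)
    have "i \<in> {1..n}" "Suc i \<in> {1..n}" using i by auto
    then have b: "blk t i = blk s (Suc i)" "blk t (Suc i) = blk s i" using bt by simp_all
    obtain d where d: "n = Suc (i + d)" using i(1) less_imp_Suc_add by auto
    have "(\<Sum>x\<in>{1..n}. (n - x) * blk t x) < (\<Sum>x\<in>{1..n}. (n - x) * blk s x)"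
      unfolding sum_two[OF i(1)] r b using i(2) by (simp add: d)
    from less.hyps[OF this t] have IH: "ss t \<in> pm.span {op.pbar n w x | w x. perm n w \<and> x \<in> ?X}" .
    have "osp_act i (ss t) = (ss t + ss s :: nat set list \<Rightarrow>\<^sub>0 'a)" using i(2) by (simp add: osp_act_single osp_gen_sw b) (simp add: t_def sw_sw)
    moreover have "osp_act i (ss t) \<in> pm.span {op.pbar n w x | w x. perm n w \<and> x \<in> ?X}"
      by (rule op.span_pbar_stable[OF XM i(1) IH])
    ultimately show ?thesis using pm.span_diff[OF _ IH, of "ss t + ss s"] by simp
  qed
qed

text \<open>pi_j fixes the sorted partition with cuts g unless j is in g, so only the
  \<open>w\<close> with Des(w) inside g contribute; the longer terms are treated by descending
  induction.\<close>

lemma op_spanning: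
  fixes v :: "nat set \<times> (nat \<Rightarrow> nat) \<Rightarrow> (nat set list \<Rightarrow>\<^sub>0 'a::field)"
  assumes k: "1 \<le> k" "k \<le> n"
    and v: "\<And>g w. (g, w) \<in> Gx n k \<Longrightarrow> v (g, w) - op.pbar n w (ss (std n k g)) \<in> op.plonger n w (ss (std n k g))"
    and s: "is_osp n k s"
  shows "ss s \<in> pm.span (v ` Gx n k)"
proof -
  let ?U = "pm.span (v ` Gx n k)"
  have "op.pbar n w (ss (std n k g)) \<in> ?U" if w: "perm n w" and g: "g \<subseteq> {1..<n}" "card g = k - 1" for w g
    using pm.subspace_span _ w
  proof (rule op.pbar_descending_induct)
    fix w assume w: "perm n w" and longer: "\<And>v. perm n v \<Longrightarrow> ninv n w < ninv n v \<Longrightarrow> op.pbar n v (ss (std n k g)) \<in> ?U"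
    show "op.pbar n w (ss (std n k g)) \<in> ?U"
    proof (cases "pDes n w \<subseteq> g")
      case True
      then have "(g, w) \<in> Gx n k" using w g by (auto simp: Gx_def GD_def)
      moreover have "op.plonger n w (ss (std n k g)) \<subseteq> ?U" by (rule op.plonger_subset[OF pm.subspace_span longer])
      ultimately have "v (g, w) \<in> ?U" "v (g, w) - op.pbar n w (ss (std n k g)) \<in> ?U" using v by (auto intro: pm.span_base)
      from pm.span_diff[OF this] show ?thesis by simp
    next
      case False
      then obtain j where j: "j \<in> pDes n w" "j \<notin> g" by blast
      have "j \<in> {1..<n}" using j pDes_sub by blast
      then have "op.pbar n w (ss (std n k g) :: nat set list \<Rightarrow>\<^sub>0 'a) = 0"
        using op.pbar_zero[OF single_OPset[OF std_osp[OF k g]] w j(1)] osp_act_std_fixed[OF k g _ j(2)] by blast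
      then show ?thesis by (simp add: pm.span_zero)
    qed
  qed
  then have "pm.span {op.pbar n w x | w x. perm n w \<and> x \<in> {ss (std n k g) | g. g \<subseteq> {1..<n} \<and> card g = k - 1}} \<subseteq> ?U"
    by (intro pm.span_minimal) auto
  then show ?thesis using osp_cyclic[OF k s] by blast
qed

lemma increasing_on_run:
  assumes "\<And>d. p \<le> d \<Longrightarrow> d < q \<Longrightarrow> w d < (w (Suc d) :: nat)" "p < q"
  shows "w p < w q"
  using assms(2,1)
proof (induction q)
  case (Suc q)
  then have "w q < w (Suc q)" by simp
  moreover have "w p \<le> w q" using Suc by (cases "p = q") auto
  ultimately show ?case by simp
qed simp

text \<open>\<open>(g, w)\<close> is recovered from \<open>w(std g)\<close>: \<open>w\<close> lists the letters in the order of their blocks, and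
  increasingly inside each block.\<close>

lemma card_Gx_le:
  assumes k: "1 \<le> k" "k \<le> n"
  shows "card (Gx n k) \<le> card (osps n k)"
proof (rule card_inj_on_le[where f = "\<lambda>(g, w). osp_of n k (\<lambda>x. rank g (inv w x))"])
  have c: "rank g (inv w x) < k" "b < k \<Longrightarrow> \<exists>x\<in>{1..n}. rank g (inv w x) = b"
    if "(g, w) \<in> Gx n k" "x \<in> {1..n}" for g w x b
  proof -
    have w: "perm n w" and g: "g \<subseteq> {1..<n}" "card g = k - 1" using that by (auto simp: Gx_def GD_def)
    have iw: "perm n (inv w)" by (rule permutes_inv[OF w])
    show "rank g (inv w x) < k" using rank_less[OF k g] permutes_in_image[OF iw] that by blast
    assume "b < k"
    then obtain y where y: "y \<in> {1..n}" "rank g y = b" using rank_surj[OF k g] by blast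
    then have "w y \<in> {1..n}" "rank g (inv w (w y)) = b"
      using permutes_in_image[OF w] permutes_inverses[OF w] by (blast, simp)
    then show "\<exists>x\<in>{1..n}. rank g (inv w x) = b" by blast
  qed
  have n: "n \<in> {1..n}" using k by simp
  show "(\<lambda>(g, w). osp_of n k (\<lambda>x. rank g (inv w x))) ` Gx n k \<subseteq> osps n k"
    using is_osp_of[of n _ k] c n by fast
  show "finite (osps n k)" by (rule finite_osps)
  show "inj_on (\<lambda>(g, w). osp_of n k (\<lambda>x. rank g (inv w x))) (Gx n k)"
  proof (rule inj_onI, clarify)
    fix g w g' w'
    assume gw: "(g, w) \<in> Gx n k" and gw': "(g', w') \<in> Gx n k"
      and e: "osp_of n k (\<lambda>x. rank g (inv w x)) = osp_of n k (\<lambda>x. rank g' (inv w' x))"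
    have w: "perm n w" and g: "g \<subseteq> {1..<n}" "card g = k - 1" "pDes n w \<subseteq> g" using gw by (auto simp: Gx_def GD_def)
    have w': "perm n w'" and g': "g' \<subseteq> {1..<n}" "card g' = k - 1" "pDes n w' \<subseteq> g'" using gw' by (auto simp: Gx_def GD_def)
    define c where "c x = rank g (inv w x)" for x
    have cc: "c x = rank g' (inv w' x)" if "x \<in> {1..n}" for x
      unfolding c_def using blk_osp_of[of n "\<lambda>x. rank g (inv w x)" k x] blk_osp_of[of n "\<lambda>x. rank g' (inv w' x)" k x]
        c[OF gw] c[OF gw'] e that by metis
    \<comment> \<open>The total order of letters by block and then by size. Both \<open>w\<close>
      and \<open>w'\<close> list the letters in this order, hence they agree.\<close>
    define R where "R x y \<longleftrightarrow> c x < c y \<or> c x = c y \<and> x < y" for x y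
    have ord: "R (v p) (v q)"
      if v: "perm n v" and h: "h \<subseteq> {1..<n}" "pDes n v \<subseteq> h" and ch: "\<And>x. x \<in> {1..n} \<Longrightarrow> c x = rank h (inv v x)"
        and pq: "p \<in> {1..n}" "q \<in> {1..n}" "p < q" for v h p q
    proof -
      have fin: "finite h" using h finite_subset by blast
      have cv: "c (v x) = rank h x" if "x \<in> {1..n}" for x
        using ch[of "v x"] permutes_in_image[OF v, of x] permutes_inverses[OF v] that by simp
      have le: "rank h p \<le> rank h q" using rank_mono[OF fin, of p q] pq by simp
      show ?thesis
      proof (cases "rank h p = rank h q")
        case True
        have "v d < v (Suc d)" if d: "p \<le> d" "d < q" for d
        proof -
          have "rank h p \<le> rank h d" "rank h (Suc d) \<le> rank h q" using rank_mono[OF fin] d by auto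
          then have "d \<notin> h" using rank_Suc[OF fin, of d] True by auto
          then have "d \<notin> pDes n v" using h by blast
          then show ?thesis using d pq perm_neq[OF v, of d] by (auto simp: pDes_def)
        qed
        from increasing_on_run[of p q v, OF this pq(3)] show ?thesis using True cv pq by (simp add: R_def)
      qed (use le cv pq in \<open>simp add: R_def\<close>)
    qed
    \<comment> \<open>Agreement of two increasing listings, phrased as: the permutation of positions
      between them is increasing, so it is the identity.\<close>
    define u where "u = inv w' \<circ> w"
    have u: "perm n u" unfolding u_def by (intro permutes_compose permutes_inv w w')
    have wu: "w' (u x) = w x" for x unfolding u_def using permutes_inverses[OF w'] by simp
    have "u = id"
    proof (rule strict_mono_perm_id[OF u])
      fix i assume i: "i \<in> {1..<n}"
      then have in1: "i \<in> {1..n}" "Suc i \<in> {1..n}" by auto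
      have in2: "u i \<in> {1..n}" "u (Suc i) \<in> {1..n}" using permutes_in_image[OF u] in1 by blast+
      show "u i < u (Suc i)"
      proof (rule ccontr)
        assume "\<not> ?thesis"
        then have "u (Suc i) < u i" using perm_neq[OF u, of i] by linarith
        from ord[OF w' g'(1,3) cc in2(2,1) this] have "R (w (Suc i)) (w i)" by (simp only: wu)
        moreover have "R (w i) (w (Suc i))" by (rule ord[OF w g(1,3) _ in1]) (simp_all add: c_def)
        ultimately show False by (auto simp: R_def)
      qed
    qed
    then have ww: "w = w'" using wu by (auto simp: fun_eq_iff)
    have rr: "rank g x = rank g' x" if x: "x \<in> {1..n}" for x
    proof -
      have "w x \<in> {1..n}" using permutes_in_image[OF w] x by blast
      from cc[OF this] show ?thesis using permutes_inverses[OF w] by (simp add: c_def ww[symmetric])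
    qed
    have "d \<in> g \<longleftrightarrow> d \<in> g'" for d
    proof (cases "d \<in> {1..<n}")
      case True
      have "finite g" "finite g'" using g g' finite_subset by blast+
      then show ?thesis using rr[of d] rr[of "Suc d"] True by (auto simp: rank_Suc split: if_splits)
    qed (use g g' in blast)
    then show "g = g' \<and> w = w'" using ww by blast
  qed
qed

lemma op_independent:
  fixes v :: "nat set \<times> (nat \<Rightarrow> nat) \<Rightarrow> (nat set list \<Rightarrow>\<^sub>0 'a::field)"
  assumes k: "1 \<le> k" "k \<le> n"
    and v: "\<And>g w. (g, w) \<in> Gx n k \<Longrightarrow> v (g, w) - op.pbar n w (ss (std n k g)) \<in> op.plonger n w (ss (std n k g))"
    and z: "(\<Sum>p\<in>Gx n k. smul (c p) (v p)) = 0" and q: "q \<in> Gx n k"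
  shows "c q = 0"
  by (rule spanning_family_independent[OF finite_Gx finite_osps card_Gx_le[OF k] _ z q])
     (use op_spanning[OF k v] in auto)

section \<open>Direct sums of projective modules\<close>

lemma embed_lext: "embed c = lext (\<lambda>u. Poly_Mapping.single (c, u) (1::'a::field))"
  by (simp add: fun_eq_iff embed_def lext_def)

lemma embed_lin: "lin (embed c :: 'a::field fa \<Rightarrow> _)"
  unfolding embed_lext by (rule lext_lin)

lemma ds_act_lext: "ds_act i = lext (\<lambda>cu. Poly_Mapping.single (fst cu, i # snd cu) (1::'a::field))"
  by (simp add: fun_eq_iff ds_act_def lext_def)

lemma ds_act_lin: "lin (ds_act i :: (('c \<times> nat list) \<Rightarrow>\<^sub>0 'a::field) \<Rightarrow> _)"
  unfolding ds_act_lext by (rule lext_lin)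

lemma ds_act_embed: "ds_act i (embed c y) = embed c (fa_act i y :: 'a::field fa)"
  by (rule lin_eqI[OF lin_comp[OF ds_act_lin embed_lin] lin_comp[OF embed_lin fa_act_lin]])
     (simp add: embed_lext ds_act_lext fa_act_def fa_gen_def fa_word_def fa_mult_lext)

text \<open>Evaluation of a direct sum: the summand with label c is evaluated at its own generator
  \<open>x c\<close>.\<close>

definition ds_eval :: "(nat \<Rightarrow> ('x \<Rightarrow>\<^sub>0 'a::field) \<Rightarrow> ('x \<Rightarrow>\<^sub>0 'a)) \<Rightarrow> ('c \<Rightarrow> ('x \<Rightarrow>\<^sub>0 'a)) \<Rightarrow> (('c \<times> nat list) \<Rightarrow>\<^sub>0 'a) \<Rightarrow> ('x \<Rightarrow>\<^sub>0 'a)" where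
  "ds_eval T x = lext (\<lambda>cu. foldr T (snd cu) (x (fst cu)))"

lemma ds_eval_lin: "lin (ds_eval T x)"
  unfolding ds_eval_def by (rule lext_lin)

lemma ds_eval_embed: "ds_eval T x (embed c y) = act T (x c) y"
  by (rule lin_eqI[OF lin_comp[OF ds_eval_lin embed_lin] act_lin])
     (simp add: embed_lext ds_eval_def act_def)

lemma ds_eval_act: "(\<And>i. lin (T i)) \<Longrightarrow> ds_eval T x (ds_act i f) = T i (ds_eval T x f)"
  by (rule lin_eqI[OF lin_comp[OF ds_eval_lin ds_act_lin] lin_comp[OF _ ds_eval_lin]])
     (simp_all add: ds_act_lext ds_eval_def)

lemma DSset_span: "DSset n k = pm.span {embed (\<beta>, j) (y :: 'a::field fa) | \<beta> j y. is_comp n \<beta> \<and> j < mult n k \<beta> \<and>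
    y \<in> Pset n (compDes \<beta>) (compDes \<beta>)}"
  unfolding DSset_def span_pm_eq ..

lemma DSzero_span: "DSzero n k = pm.span {embed (\<beta>, j) (y :: 'a::field fa) | \<beta> j y. is_comp n \<beta> \<and> j < mult n k \<beta> \<and> y \<in> Irel n}"
  unfolding DSzero_def span_pm_eq ..

lemma embed_DSset:
  "is_comp n \<beta> \<Longrightarrow> j < mult n k \<beta> \<Longrightarrow> y \<in> Pset n (compDes \<beta>) (compDes \<beta>) \<Longrightarrow> embed (\<beta>, j) (y :: 'a::field fa) \<in> DSset n k"
  unfolding DSset_span by (rule pm.span_base, rule CollectI, rule exI[of _ \<beta>], rule exI[of _ j], rule exI[of _ y], simp)

lemma embed_DSzero:
  "is_comp n \<beta> \<Longrightarrow> j < mult n k \<beta> \<Longrightarrow> y \<in> Irel n \<Longrightarrow> embed (\<beta>, j) (y :: 'a::field fa) \<in> DSzero n k"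
  unfolding DSzero_span by (rule pm.span_base, rule CollectI, rule exI[of _ \<beta>], rule exI[of _ j], rule exI[of _ y], simp)

lemma DSset_subspace: "pm.subspace (DSset n k :: (_ \<Rightarrow>\<^sub>0 'a::field) set)"
  unfolding DSset_span by simp

lemma DSzero_subspace: "pm.subspace (DSzero n k :: (_ \<Rightarrow>\<^sub>0 'a::field) set)"
  unfolding DSzero_span by simp

lemma ds_act_DSset:
  assumes i: "i \<in> {1..<n}" and f: "f \<in> DSset n k"
  shows "ds_act i f \<in> (DSset n k :: (_ \<Rightarrow>\<^sub>0 'a::field) set)"
proof (rule lin_span_image[OF ds_act_lin _ DSset_subspace f[unfolded DSset_span]])
  fix g :: "_ \<Rightarrow>\<^sub>0 'a"
  assume "g \<in> {embed (\<beta>, j) y | \<beta> j y. is_comp n \<beta> \<and> j < mult n k \<beta> \<and> y \<in> Pset n (compDes \<beta>) (compDes \<beta>)}"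
  then obtain \<beta> j and y :: "'a fa" where g: "g = embed (\<beta>, j) y" "is_comp n \<beta>" "j < mult n k \<beta>"
    "y \<in> Pset n (compDes \<beta>) (compDes \<beta>)" by blast
  show "ds_act i g \<in> DSset n k" unfolding g(1) ds_act_embed by (intro embed_DSset g fa_act_Pset i)
qed

lemma ds_act_DSzero:
  assumes i: "i \<in> {1..<n}" and f: "f \<in> DSzero n k"
  shows "ds_act i f \<in> (DSzero n k :: (_ \<Rightarrow>\<^sub>0 'a::field) set)"
proof (rule lin_span_image[OF ds_act_lin _ DSzero_subspace f[unfolded DSzero_span]])
  fix g :: "_ \<Rightarrow>\<^sub>0 'a"
  assume "g \<in> {embed (\<beta>, j) y | \<beta> j y. is_comp n \<beta> \<and> j < mult n k \<beta> \<and> y \<in> Irel n}"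
  then obtain \<beta> j and y :: "'a fa" where g: "g = embed (\<beta>, j) y" "is_comp n \<beta>" "j < mult n k \<beta>"
    "y \<in> Irel n" by blast
  show "ds_act i g \<in> DSzero n k" unfolding g(1) ds_act_embed by (intro embed_DSzero g fa_act_Irel i)
qed

text \<open>For P_\<beta> the lower and upper bounds on the descent set coincide, so a permutation
  occurs in exactly the summands with Des(\<beta>) = Des(w).\<close>

definition BI :: "nat \<Rightarrow> nat \<Rightarrow> ((nat list \<times> nat) \<times> (nat \<Rightarrow> nat)) set" where
  "BI n k = {((\<beta>, j), w). is_comp n \<beta> \<and> j < mult n k \<beta> \<and> perm n w \<and> pDes n w = compDes \<beta>}"

definition pbasis :: "nat \<Rightarrow> (nat \<Rightarrow> nat) \<Rightarrow> 'a::field fa" where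
  "pbasis n w = fa_mult (pb n w) (piw0 n ({1..<n} - pDes n w))"

lemma finite_BI:
  assumes n: "1 \<le> n"
  shows "finite (BI n k)"
proof (rule finite_subset)
  show "BI n k \<subseteq> (\<lambda>(w, j). ((comp_of n (pDes n w), j), w)) ` (SIGMA w:{w. perm n w}. {..<mult n k (comp_of n (pDes n w))})"
  proof
    fix p assume "p \<in> BI n k"
    then obtain \<beta> j w where p: "p = ((\<beta>, j), w)" "is_comp n \<beta>" "j < mult n k \<beta>" "perm n w" "pDes n w = compDes \<beta>"
      by (auto simp: BI_def)
    have "\<beta> = comp_of n (pDes n w)"
      by (rule composition_unique[OF p(2) comp_of(1)[OF pDes_sub n] n]) (simp only: comp_of(2)[OF pDes_sub n] p(5)[symmetric])
    then show "p \<in> (\<lambda>(w, j). ((comp_of n (pDes n w), j), w)) ` (SIGMA w:{w. perm n w}. {..<mult n k (comp_of n (pDes n w))})"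
      using p(1,3,4) by (intro image_eqI[of _ _ "(w, j)"] SigmaI) simp_all
  qed
qed (intro finite_imageI finite_SigmaI finite_perms finite_lessThan)

lemma (in hecke_module) act_Pset:
  assumes x: "x \<in> M" and y: "y \<in> Pset n D1 D2" and D1: "D1 \<subseteq> {1..<n}"
  shows "act T x y \<in> M"
proof -
  let ?P = "fa_mult (pb n (w0set n D1)) (piw0 n ({1..<n} - D2)) :: 'a fa"
  have P: "?P \<in> fa_words n" by (intro fa_mult_words pb_words w0set_perm D1 piw0_words) auto
  obtain s r where s: "s \<in> pm.span {fa_mult (fa_word u) ?P | u. is_word n u}" and r: "r \<in> Irel n" and y: "y = s + r"
    using y unfolding Pset_span set_add_eq by blast
  have "act T x s \<in> M"
    by (rule lin_span_image[OF act_lin _ sub_M s]) (use P in \<open>auto intro!: act_M x fa_mult_words fa_word_in_words\<close>)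
  then show ?thesis unfolding y by (simp add: lin_add[OF act_lin] act_Irel[OF x r])
qed

lemma DSset_spanned:
  assumes n: "1 \<le> n" and y: "y \<in> (DSset n k :: (_ \<Rightarrow>\<^sub>0 'a::field) set)"
  shows "y \<in> set_add (pm.span ((\<lambda>p. embed (fst p) (pbasis n (snd p))) ` BI n k)) (DSzero n k)"
    (is "_ \<in> ?S")
proof -
  have S: "pm.subspace ?S" by (intro subspace_set_add DSzero_subspace pm.subspace_span)
  have "DSset n k \<subseteq> ?S" unfolding DSset_span
  proof (rule pm.span_minimal[OF _ S], rule subsetI)
    fix f :: "_ \<Rightarrow>\<^sub>0 'a" assume "f \<in> {embed (\<beta>, j) y | \<beta> j y. is_comp n \<beta> \<and> j < mult n k \<beta> \<and> y \<in> Pset n (compDes \<beta>) (compDes \<beta>)}"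
    then obtain \<beta> j and y :: "'a fa" where f: "f = embed (\<beta>, j) y" and \<beta>: "is_comp n \<beta>" "j < mult n k \<beta>"
      and y: "y \<in> Pset n (compDes \<beta>) (compDes \<beta>)" by blast
    let ?W = "{w. perm n w \<and> compDes \<beta> \<subseteq> pDes n w \<and> pDes n w \<subseteq> compDes \<beta>}"
    obtain s r where s: "s \<in> pm.span ((\<lambda>w. fa_mult (pb n w) (piw0 n ({1..<n} - compDes \<beta>))) ` ?W)"
      and r: "r \<in> Irel n" and ysr: "y = s + r"
      using subsetD[OF Pset_spanned[OF order_refl compDes_subset[OF \<beta>(1)]] y] unfolding set_add_eq by blast
    have "embed (\<beta>, j) s \<in> ?S"
    proof (rule lin_span_image[OF embed_lin _ S s])
      fix x :: "'a fa" assume "x \<in> (\<lambda>w. fa_mult (pb n w) (piw0 n ({1..<n} - compDes \<beta>))) ` ?W"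
      then obtain w where w: "perm n w" "pDes n w = compDes \<beta>" "x = fa_mult (pb n w) (piw0 n ({1..<n} - compDes \<beta>))" by blast
      have "((\<beta>, j), w) \<in> BI n k" using \<beta> w by (simp add: BI_def)
      moreover have "embed (\<beta>, j) x = embed (fst ((\<beta>, j), w)) (pbasis n (snd ((\<beta>, j), w)))" using w by (simp add: pbasis_def)
      ultimately show "embed (\<beta>, j) x \<in> ?S" by (intro set_add_left DSzero_subspace pm.span_base) blast
    qed
    moreover have "embed (\<beta>, j) r \<in> ?S" by (intro set_add_right pm.subspace_span embed_DSzero \<beta> r)
    ultimately show "f \<in> ?S" unfolding f ysr by (simp add: lin_add[OF embed_lin] pm.subspace_add[OF S])
  qed
  then show ?thesis using y by blast
qed

text \<open>The elements of F(D) are generators, equal in number to the multiplicity of the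
  composition with descent set D. The copies of P_\<beta> are sent to these generators, and the same
  generator may serve several D. If the images of the adapted bases form a basis modulo
  \<open>Z\<close>, the evaluation is an isomorphism, whatever the module looks like
  otherwise.\<close>

theorem (in hecke_module) ds_iso:
  fixes F :: "nat set \<Rightarrow> 'q set" and x :: "'q \<Rightarrow> ('x \<Rightarrow>\<^sub>0 'a)"
  assumes k: "1 \<le> k" "k \<le> n" and Z: "pm.subspace Z" "Z \<subseteq> M" "\<And>i z. i \<in> {1..<n} \<Longrightarrow> z \<in> Z \<Longrightarrow> T i z \<in> Z"
    and F: "\<And>D. D \<subseteq> {1..<n} \<Longrightarrow> finite (F D) \<and> card (F D) = card (GD n k D)"
    and x: "\<And>q D. D \<subseteq> {1..<n} \<Longrightarrow> q \<in> F D \<Longrightarrow> x q \<in> M"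
    and I: "I = {(q, w). perm n w \<and> q \<in> F (pDes n w)}" "finite I"
    and span: "\<And>m. m \<in> M \<Longrightarrow> \<exists>c. m - (\<Sum>(q, w)\<in>I. smul (c (q, w)) (act T (x q) (pbasis n w))) \<in> Z"
    and ind: "\<And>c p. (\<Sum>(q, w)\<in>I. smul (c (q, w)) (act T (x q) (pbasis n w))) \<in> Z \<Longrightarrow> p \<in> I \<Longrightarrow> c p = 0"
  shows "\<exists>\<phi>. hmod_iso n T M Z ds_act (DSset n k) (DSzero n k) \<phi>"
    and "\<exists>\<psi>. hmod_iso n ds_act (DSset n k) (DSzero n k) T M Z \<psi>"
proof -
  have n: "1 \<le> n" using k by simp
  have "\<exists>h. bij_betw h {..<mult n k \<beta>} (F (compDes \<beta>))" if \<beta>: "is_comp n \<beta>" for \<beta>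
    using ex_bij_betw_nat_finite[of "F (compDes \<beta>)"] F[OF compDes_subset[OF \<beta>]] mult_eq_card_GD[OF k \<beta>]
    by (simp add: atLeast0LessThan)
  then obtain h where h: "\<And>\<beta>. is_comp n \<beta> \<Longrightarrow> bij_betw (h \<beta>) {..<mult n k \<beta>} (F (compDes \<beta>))" by metis
  \<comment> \<open>Translates the numbering of copies by (\<beta>, j) into the generators
    themselves; the composition is recovered from the descent set of w.\<close>
  define \<theta> where "\<theta> = (\<lambda>((\<beta>, j), w). (h \<beta> j, w :: nat \<Rightarrow> nat))"
  have bij: "bij_betw \<theta> (BI n k) I"
    unfolding bij_betw_def
  proof (intro conjI inj_onI)
    fix p p' assume p: "p \<in> BI n k" "p' \<in> BI n k" "\<theta> p = \<theta> p'"
    obtain \<beta> j w where pe: "p = ((\<beta>, j), w)" by (metis surj_pair)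
    obtain \<beta>' j' w' where pe': "p' = ((\<beta>', j'), w')" by (metis surj_pair)
    have c: "is_comp n \<beta>" "is_comp n \<beta>'" "j < mult n k \<beta>" "j' < mult n k \<beta>'" "w = w'" "compDes \<beta> = compDes \<beta>'" "h \<beta> j = h \<beta>' j'"
      using p unfolding pe pe' BI_def \<theta>_def by auto
    have \<beta>: "\<beta> = \<beta>'" by (rule composition_unique[OF c(1,2) n c(6)])
    then have "j = j'" using h[OF c(1)] c by (auto simp: bij_betw_def inj_on_def)
    then show "p = p'" using \<beta> c pe pe' by simp
  next
    show "\<theta> ` BI n k = I"
    proof (intro equalityI subsetI)
      fix y assume "y \<in> \<theta> ` BI n k"
      then obtain \<beta> j w where y: "y = (h \<beta> j, w)" "is_comp n \<beta>" "j < mult n k \<beta>" "perm n w" "pDes n w = compDes \<beta>"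
        by (auto simp: BI_def \<theta>_def)
      then show "y \<in> I" using h[OF y(2)] by (auto simp: I bij_betw_def)
    next
      fix y assume "y \<in> I"
      then obtain q w where y: "y = (q, w)" "perm n w" "q \<in> F (pDes n w)" by (auto simp: I)
      define \<beta> where "\<beta> = comp_of n (pDes n w)"
      have \<beta>: "is_comp n \<beta>" "compDes \<beta> = pDes n w" unfolding \<beta>_def by (rule comp_of[OF pDes_sub n])+
      have "q \<in> h \<beta> ` {..<mult n k \<beta>}" using y(3) bij_betw_imp_surj_on[OF h[OF \<beta>(1)]] unfolding \<beta>(2) by simp
      then obtain j where j: "j < mult n k \<beta>" "h \<beta> j = q" by (elim imageE) simp
      have "((\<beta>, j), w) \<in> BI n k" unfolding BI_def using \<beta> y(2) j(1) by simp
      then show "y \<in> \<theta> ` BI n k" by (rule rev_image_eqI) (simp add: \<theta>_def j(2) y(1))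
    qed
  qed
  define E where "E = ds_eval T (\<lambda>(\<beta>, j). x (h \<beta> j))"
  define b2 where "b2 p = embed (fst p) (pbasis n (snd p) :: 'a fa)" for p :: "(nat list \<times> nat) \<times> (nat \<Rightarrow> nat)"
  define v where "v p = act T (x (fst p)) (pbasis n (snd p))" for p
  have hx: "x (h \<beta> j) \<in> M" if "is_comp n \<beta>" "j < mult n k \<beta>" for \<beta> j
  proof (rule x[OF compDes_subset[OF that(1)]])
    show "h \<beta> j \<in> F (compDes \<beta>)" using h[OF that(1)] that(2) by (auto simp: bij_betw_def)
  qed
  have Ee: "E (embed (\<beta>, j) y) = act T (x (h \<beta> j)) y" for \<beta> j y unfolding E_def by (simp add: ds_eval_embed)
  have reidx: "(\<Sum>p\<in>BI n k. smul (c p) (v (\<theta> p))) = (\<Sum>p\<in>I. smul (c (inv_into (BI n k) \<theta> p)) (v p))" for c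
  proof -
    have "(\<Sum>p\<in>I. smul (c (inv_into (BI n k) \<theta> p)) (v p)) = (\<Sum>p\<in>BI n k. smul (c (inv_into (BI n k) \<theta> (\<theta> p))) (v (\<theta> p)))"
      by (rule sum.reindex_bij_betw[OF bij, symmetric])
    also have "\<dots> = (\<Sum>p\<in>BI n k. smul (c p) (v (\<theta> p)))"
      by (rule sum.cong) (use bij in \<open>auto simp: bij_betw_def inv_into_f_f\<close>)
    finally show ?thesis by simp
  qed
  have vI: "(\<Sum>(q, w)\<in>I. smul (c (q, w)) (act T (x q) (pbasis n w))) = (\<Sum>p\<in>I. smul (c p) (v p))" for c
    by (rule sum.cong) (auto simp: v_def)
  have DZ: "E ` DSzero n k \<subseteq> Z"
  proof
    fix y assume "y \<in> E ` DSzero n k"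
    then obtain f where f: "f \<in> DSzero n k" "y = E f" by blast
    show "y \<in> Z" unfolding f(2)
    proof (rule lin_span_image[OF _ _ Z(1) f(1)[unfolded DSzero_span]])
      show "lin E" unfolding E_def by (rule ds_eval_lin)
      fix g assume "g \<in> {embed (\<beta>, j) (y :: 'a fa) | \<beta> j y. is_comp n \<beta> \<and> j < mult n k \<beta> \<and> y \<in> Irel n}"
      then obtain \<beta> j and y :: "'a fa" where g: "g = embed (\<beta>, j) y" "is_comp n \<beta>" "j < mult n k \<beta>" "y \<in> Irel n" by blast
      have "act T (x (h \<beta> j)) y = 0" by (rule act_Irel[OF hx[OF g(2,3)] g(4)])
      then show "E g \<in> Z" unfolding g(1) Ee using pm.subspace_0[OF Z(1)] by simp
    qed
  qed
  have DM: "E ` DSset n k \<subseteq> M"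
  proof
    fix y assume "y \<in> E ` DSset n k"
    then obtain f where f: "f \<in> DSset n k" "y = E f" by blast
    show "y \<in> M" unfolding f(2)
    proof (rule lin_span_image[OF _ _ sub_M f(1)[unfolded DSset_span]])
      show "lin E" unfolding E_def by (rule ds_eval_lin)
      fix g assume "g \<in> {embed (\<beta>, j) (y :: 'a fa) | \<beta> j y. is_comp n \<beta> \<and> j < mult n k \<beta> \<and> y \<in> Pset n (compDes \<beta>) (compDes \<beta>)}"
      then obtain \<beta> j and y :: "'a fa" where g: "g = embed (\<beta>, j) y" "is_comp n \<beta>" "j < mult n k \<beta>"
        "y \<in> Pset n (compDes \<beta>) (compDes \<beta>)" by blast
      show "E g \<in> M" unfolding g(1) Ee by (rule act_Pset[OF hx[OF g(2,3)] g(4) compDes_subset[OF g(2)]])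
    qed
  qed
  have b2M: "b2 p \<in> DSset n k" if "p \<in> BI n k" for p
  proof -
    obtain \<beta> j w where p: "p = ((\<beta>, j), w)" "is_comp n \<beta>" "j < mult n k \<beta>" "perm n w" "pDes n w = compDes \<beta>"
      using \<open>p \<in> BI n k\<close> by (auto simp: BI_def)
    have "pbasis n w \<in> Pset n (compDes \<beta>) (compDes \<beta>)"
      unfolding pbasis_def p(5) by (rule pb_in_Pset[OF p(4)]) (simp add: p(5))
    then show ?thesis unfolding b2_def p(1) fst_conv snd_conv by (intro embed_DSset p)
  qed
  have b2s: "\<exists>c. y - (\<Sum>p\<in>BI n k. smul (c p) (b2 p)) \<in> DSzero n k" if y: "y \<in> DSset n k" for y
  proof -
    obtain s r where s: "s \<in> pm.span (b2 ` BI n k)" "r \<in> DSzero n k" "y = s + r"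
      using DSset_spanned[OF n y] unfolding set_add_eq b2_def by blast
    obtain c where "s = (\<Sum>p\<in>BI n k. smul (c p) (b2 p))" by (rule span_image_family[OF finite_BI[OF n] s(1)])
    then show ?thesis using s by (intro exI[of _ c]) simp
  qed
  have Eb: "E (b2 p) = v (\<theta> p)" if "p \<in> BI n k" for p
  proof -
    obtain \<beta> j w where p: "p = ((\<beta>, j), w)" by (metis surj_pair)
    show ?thesis unfolding b2_def p fst_conv snd_conv Ee by (simp add: v_def \<theta>_def)
  qed
  have b1s: "\<exists>c. m - (\<Sum>p\<in>BI n k. smul (c p) (v (\<theta> p))) \<in> Z" if m: "m \<in> M" for m
  proof -
    obtain c where "m - (\<Sum>p\<in>I. smul (c p) (v p)) \<in> Z" using span[OF m] unfolding vI by blast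
    also have "(\<Sum>p\<in>I. smul (c p) (v p)) = (\<Sum>p\<in>BI n k. smul (c (\<theta> p)) (v (\<theta> p)))"
      by (rule sum.reindex_bij_betw[OF bij, symmetric])
    finally show ?thesis by (intro exI[of _ "\<lambda>p. c (\<theta> p)"])
  qed
  have b1i: "c p = 0" if z: "(\<Sum>p\<in>BI n k. smul (c p) (v (\<theta> p))) \<in> Z" and p: "p \<in> BI n k" for c p
  proof -
    have "\<theta> p \<in> I" using bij p by (auto simp: bij_betw_def)
    then have "c (inv_into (BI n k) \<theta> (\<theta> p)) = 0"
      using ind[of "\<lambda>p. c (inv_into (BI n k) \<theta> p)", unfolded vI[of "\<lambda>p. c (inv_into (BI n k) \<theta> p)"]]
        z[unfolded reidx] by blast
    then show ?thesis using bij p by (simp add: bij_betw_def inv_into_f_f)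
  qed
  have com: "E (ds_act i y) - T i (E y) \<in> Z" if "i \<in> {1..<n}" "y \<in> DSset n k" for i y
    unfolding E_def ds_eval_act[OF lin_T] using pm.subspace_0[OF Z(1)] by simp
  have linE: "lin E" unfolding E_def by (rule ds_eval_lin)
  note iso = hmod_iso_from_basis[where n = n and B = "BI n k" and ?T1.0 = T and ?M1.0 = M and ?Z1.0 = Z and ?T2.0 = ds_act
    and ?M2.0 = "DSset n k" and ?Z2.0 = "DSzero n k" and E = E and ?b1.0 = "\<lambda>p. v (\<theta> p)" and ?b2.0 = b2, OF finite_BI[OF n] sub_M Z(1) DSset_subspace DSzero_subspace Z(2) linE DM DZ
    lin_T Z(3) stable ds_act_lin ds_act_DSzero ds_act_DSset com b2M b2s Eb b1s]
  show "\<exists>\<phi>. hmod_iso n T M Z ds_act (DSset n k) (DSzero n k) \<phi>" by (rule ex_forward[OF iso(2)]) (assumption | erule (1) b1i | erule conjunct1)+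
  show "\<exists>\<psi>. hmod_iso n ds_act (DSset n k) (DSzero n k) T M Z \<psi>" by (rule exI, rule iso(1)) (assumption | erule (1) b1i)+
qed

section \<open>The modules \<open>N\<close> and the decomposition of the quotient\<close>

lemma act_in_stable:
  assumes "pm.subspace U" "\<And>i y. i \<in> {1..<n} \<Longrightarrow> y \<in> U \<Longrightarrow> T i y \<in> U" "x \<in> U" "a \<in> fa_words n"
  shows "act T x a \<in> U"
  unfolding act_def
proof (rule lext_in_subspace[OF assms(1)])
  fix u assume "u \<in> keys a"
  then have "is_word n u" using assms(4) by (simp add: fa_words_def)
  then show "foldr T u x \<in> U" by (induction u) (auto simp: assms(2,3))
qed

definition Wset :: "nat \<Rightarrow> nat list \<times> nat list \<Rightarrow> (nat \<Rightarrow> nat) set" where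
  "Wset n p = {w. perm n w \<and> compDes (fst p) \<subseteq> pDes n w \<and> pDes n w \<subseteq> compDes (fst p) \<union> seqDes n (snd p)}"

context
  fixes n k :: nat
  assumes k: "1 \<le> k" "k \<le> n"
begin

lemma A_Des:
  assumes "(\<alpha>, is) \<in> A n k"
  shows "is_comp n \<alpha>" "compDes \<alpha> \<subseteq> {1..<n}" "compDes \<alpha> \<union> seqDes n is \<subseteq> {1..<n}"
  using A_D(1)[OF assms k] compDes_subset[of n \<alpha>] by (auto simp: seqDes_def)

lemma x_ai_low:
  assumes a: "(\<alpha>, is) \<in> A n k"
  shows "(x_ai n \<alpha> is :: 'a::field mpoly) \<in> low n (tdeg (lam n (compDes \<alpha>) is)) (Suc (qn n (lam n (compDes \<alpha>) is)))"
  unfolding x_ai_eq[OF A_Des(2)[OF a]] using lam_dec_lDes(1)[OF a k] by (intro low_base) (auto simp: dec_def)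

lemma x_ai_polys: "(\<alpha>, is) \<in> A n k \<Longrightarrow> (x_ai n \<alpha> is :: 'a::field mpoly) \<in> polys n"
  using x_ai_low low_polys by blast

lemma x_ai_fixed:
  assumes a: "(\<alpha>, is) \<in> A n k" and j: "j \<in> {1..<n} - (compDes \<alpha> \<union> seqDes n is)"
  shows "pi_poly j (x_ai n \<alpha> is :: 'a::field mpoly) = x_ai n \<alpha> is"
  unfolding x_ai_eq[OF A_Des(2)[OF a]]
  by (rule pi_mo_fixed[OF lam_dec_lDes(1)[OF a k]]) (use j lam_dec_lDes(2)[OF a k] in auto)

text \<open>\<open>y\<close> is either pibar_w or its product with pi_v. Both families agree with
  pibar_w(x_ai) up to longer terms, and acting on a monomial keeps degree and membership in
  \<open>low\<close>, hence the homogeneity that the point evaluation asks for.\<close>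

lemma index_basis:
  fixes y :: "(nat list \<times> nat list) \<times> (nat \<Rightarrow> nat) \<Rightarrow> 'a::field fa" and v :: "_ \<Rightarrow> 'a mpoly"
  assumes yw: "\<And>p. p \<in> Ix n k \<Longrightarrow> y p \<in> fa_words n"
    and v: "\<And>\<alpha> is w. v ((\<alpha>, is), w) = act pi_poly (x_ai n \<alpha> is) (y ((\<alpha>, is), w))"
    and dv: "\<And>\<alpha> is w. ((\<alpha>, is), w) \<in> Ix n k \<Longrightarrow>
      act pi_poly (x_ai n \<alpha> is) (y ((\<alpha>, is), w)) - pol.pbar n w (x_ai n \<alpha> is) \<in> pol.plonger n w (x_ai n \<alpha> is)"
  shows "f \<in> polys n \<Longrightarrow> \<exists>c. f - (\<Sum>p\<in>Ix n k. smul (c p) (v p)) \<in> J n k"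
    and "(\<Sum>p\<in>Ix n k. smul (c p) (v p)) \<in> J n k \<Longrightarrow> q \<in> Ix n k \<Longrightarrow> c q = 0"
proof -
  let ?deg = "\<lambda>p :: (nat list \<times> nat list) \<times> (nat \<Rightarrow> nat). tdeg (lam n (compDes (fst (fst p))) (snd (fst p)))"
  have sp: "mo m \<in> set_add (pm.span (v ` {p \<in> Ix n k. ?deg p = tdeg m})) (J n k)" if "keys m \<subseteq> {1..n}" for m
    by (rule index_spanning[OF k _ that]) (use v dv in simp)
  have vlow: "v p \<in> low n (?deg p) (Suc (qn n (lam n (compDes (fst (fst p))) (snd (fst p)))))" if p: "p \<in> Ix n k" for p
  proof -
    obtain \<alpha> "is" w where pe: "p = ((\<alpha>, is), w)" by (metis surj_pair)
    have a: "(\<alpha>, is) \<in> A n k" using p pe by (simp add: Ix_def)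
    show ?thesis unfolding pe v fst_conv snd_conv
      by (rule act_in_stable[OF low_subspace pi_low x_ai_low[OF a] yw[OF p[unfolded pe]]])
  qed
  show "\<exists>c. f - (\<Sum>p\<in>Ix n k. smul (c p) (v p)) \<in> J n k" if f: "f \<in> polys n"
  proof -
    let ?S = "set_add (pm.span (v ` Ix n k)) (J n k)"
    have S: "pm.subspace ?S" by (intro subspace_set_add J_subspace pm.subspace_span)
    have "mo m \<in> ?S" if m: "m \<in> keys f" for m
    proof -
      have "keys m \<subseteq> {1..n}" using f m by (simp add: polys_def)
      then have "mo m \<in> set_add (pm.span (v ` {p \<in> Ix n k. ?deg p = tdeg m})) (J n k)" by (rule sp)
      moreover have "pm.span (v ` {p \<in> Ix n k. ?deg p = tdeg m}) \<subseteq> pm.span (v ` Ix n k)" by (rule pm.span_mono) blast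
      ultimately show ?thesis unfolding set_add_eq by blast
    qed
    then have "lext mo f \<in> ?S" by (rule lext_in_subspace[OF S])
    then obtain s r where s: "s \<in> pm.span (v ` Ix n k)" "r \<in> J n k" "f = s + r"
      unfolding set_add_eq mpoly_eq_lext[symmetric] by blast
    obtain c where "s = (\<Sum>p\<in>Ix n k. smul (c p) (v p))" by (rule span_image_family[OF finite_Ix[OF k] s(1)])
    then show ?thesis using s by (intro exI[of _ c]) simp
  qed
  show "c q = 0" if z: "(\<Sum>p\<in>Ix n k. smul (c p) (v p)) \<in> J n k" and q: "q \<in> Ix n k"
  proof (rule basis_mod_J[where X = "osps n k" and b = blk and deg = ?deg, OF k finite_osps _ _ _ finite_Ix[OF k] _ _ _ sp z q])
    show "card (Ix n k) \<le> card (osps n k)" unfolding card_Ix[OF k] by (rule card_Gx_le[OF k])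
    show "blk x i < k" if "x \<in> osps n k" "i \<in> {1..n}" for x i using blk_props(1)[of n k x i] that by simp
    show "\<exists>i\<in>{1..n}. blk x i = c" if "x \<in> osps n k" "c < k" for x c using blk_surj[of n k x c] that by simp
    show "x = y" if "x \<in> osps n k" "y \<in> osps n k" "\<And>i. i \<in> {1..n} \<Longrightarrow> blk x i = blk y i" for x y
      using osp_eqI[of n k x y] that by simp
    show "homog (?deg p) (v p)" if "p \<in> Ix n k" for p by (rule homog_low[OF vlow[OF that]])
    show "v p \<in> polys n" if "p \<in> Ix n k" for p using vlow[OF that] low_polys by blast
  qed
qed

abbreviation (input) bN :: "nat list \<times> nat list \<Rightarrow> (nat \<Rightarrow> nat) \<Rightarrow> 'a::field mpoly" where
  "bN p w \<equiv> pibar_w_poly n w (x_ai n (fst p) (snd p))"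

lemma Ix_eq: "Ix n k = Sigma (A n k) (Wset n)"
  by (auto simp: Ix_def Wset_def)

lemma finite_Wset: "finite (Wset n p)"
  by (rule finite_subset[OF _ finite_perms[of n]]) (auto simp: Wset_def)

lemma finite_A: "finite (A n k)"
proof (rule finite_subset)
  show "A n k \<subseteq> fst ` Ix n k"
  proof
    fix p assume "p \<in> A n k"
    moreover obtain \<alpha> "is" where p: "p = (\<alpha>, is)" by (metis surj_pair)
    ultimately have a: "(\<alpha>, is) \<in> A n k" by simp
    have "w0set n (compDes \<alpha>) \<in> Wset n (\<alpha>, is)"
      using w0set_perm[OF A_Des(2)[OF a]] pDes_w0set[OF A_Des(2)[OF a]] by (simp add: Wset_def)
    then have "((\<alpha>, is), w0set n (compDes \<alpha>)) \<in> Ix n k" using a by (simp add: Ix_eq)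
    then show "p \<in> fst ` Ix n k" unfolding p by (rule rev_image_eqI) simp
  qed
qed (rule finite_imageI[OF finite_Ix[OF k]])

lemma sum_Ix: "(\<Sum>p\<in>Ix n k. h p) = (\<Sum>p\<in>A n k. \<Sum>w\<in>Wset n p. (h (p, w) :: 'b::comm_monoid_add))"
  unfolding Ix_eq using finite_A finite_Wset by (simp add: sum.Sigma)

lemma bN_basis:
  fixes f :: "'a::field mpoly"
  shows "f \<in> polys n \<Longrightarrow> \<exists>c. f - (\<Sum>p\<in>A n k. \<Sum>w\<in>Wset n p. smul (c p w) (bN p w)) \<in> J n k"
    and "(\<Sum>p\<in>A n k. \<Sum>w\<in>Wset n p. smul (c p w) (bN p w :: 'a mpoly)) \<in> J n k \<Longrightarrow> p \<in> A n k \<Longrightarrow> w \<in> Wset n p \<Longrightarrow> c p w = 0"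
proof -
  let ?y = "\<lambda>p :: (nat list \<times> nat list) \<times> (nat \<Rightarrow> nat). pb n (snd p) :: 'a fa"
  let ?v = "\<lambda>p. bN (fst p) (snd p) :: 'a mpoly"
  have y: "?y p \<in> fa_words n" if "p \<in> Ix n k" for p using that by (intro pb_words) (auto simp: Ix_def)
  have v: "?v ((\<alpha>, is), w) = act pi_poly (x_ai n \<alpha> is) (?y ((\<alpha>, is), w))" for \<alpha> "is" w
    by (simp add: pibar_w_poly_eq pol.pbar_def)
  have dv: "act pi_poly (x_ai n \<alpha> is) (?y ((\<alpha>, is), w)) - pol.pbar n w (x_ai n \<alpha> is) \<in> pol.plonger n w (x_ai n \<alpha> is)"
    for \<alpha> "is" w by (simp add: pol.pbar_def pm.subspace_0[OF pol.plonger_subspace])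
  note basis = index_basis[of ?y ?v, OF y v dv, unfolded sum_Ix]
  show "\<exists>c. f - (\<Sum>p\<in>A n k. \<Sum>w\<in>Wset n p. smul (c p w) (bN p w)) \<in> J n k" if f: "f \<in> polys n"
  proof -
    obtain c where "f - (\<Sum>p\<in>A n k. \<Sum>w\<in>Wset n p. smul (c (p, w)) (bN p w)) \<in> J n k"
      using basis(1)[OF _ f] by auto
    then show ?thesis by (intro exI[of _ "\<lambda>p w. c (p, w)"])
  qed
  show "c p w = 0" if z: "(\<Sum>p\<in>A n k. \<Sum>w\<in>Wset n p. smul (c p w) (bN p w :: 'a mpoly)) \<in> J n k"
    and p: "p \<in> A n k" "w \<in> Wset n p"
    using basis(2)[of "\<lambda>q. c (fst q) (snd q)" "(p, w)"] z p by (simp add: Ix_eq)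
qed

context
  fixes \<alpha> "is" :: "nat list"
  assumes a: "(\<alpha>, is) \<in> A n k"
begin

abbreviation (input) "Dai \<equiv> compDes \<alpha> \<union> seqDes n is"

text \<open>A relation for one pair is extended by zero to a relation for all pairs.\<close>

lemma bN_independent:
  assumes z: "(\<Sum>w\<in>Wset n (\<alpha>, is). smul (c w) (bN (\<alpha>, is) w :: 'a::field mpoly)) \<in> J n k" and w: "w \<in> Wset n (\<alpha>, is)"
  shows "c w = 0"
proof -
  define c' where "c' p w = (if p = (\<alpha>, is) then c w else 0)" for p w
  have "(\<Sum>p\<in>A n k. \<Sum>w\<in>Wset n p. smul (c' p w) (bN p w :: 'a mpoly))
      = (\<Sum>p\<in>A n k. if p = (\<alpha>, is) then (\<Sum>w\<in>Wset n (\<alpha>, is). smul (c w) (bN (\<alpha>, is) w)) else 0)"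
    by (rule sum.cong) (auto simp: c'_def)
  also have "\<dots> = (\<Sum>w\<in>Wset n (\<alpha>, is). smul (c w) (bN (\<alpha>, is) w))" using a finite_A by simp
  finally have "c' (\<alpha>, is) w = 0" using z by (intro bN_basis(2)[OF _ a w]) simp
  then show ?thesis by (simp add: c'_def)
qed

lemma Nset_span: "(Nset n k \<alpha> is :: 'a::field mpoly set) = set_add
    (pm.span {word_act_poly u (bN (\<alpha>, is) (w0set n (compDes \<alpha>))) | u. is_word n u}) (J n k)"
  unfolding Nset_def span_pm_eq by simp

lemma Nset_subspace: "pm.subspace (Nset n k \<alpha> is :: 'a::field mpoly set)"
  unfolding Nset_span by (intro subspace_set_add J_subspace pm.subspace_span)

lemma J_Nset: "f \<in> J n k \<Longrightarrow> f \<in> (Nset n k \<alpha> is :: 'a::field mpoly set)"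
  unfolding Nset_span by (intro set_add_right pm.subspace_span)

lemma Nset_generator:
  "is_word n u \<Longrightarrow> word_act_poly u (bN (\<alpha>, is) (w0set n (compDes \<alpha>))) \<in> (Nset n k \<alpha> is :: 'a::field mpoly set)"
  unfolding Nset_span by (intro set_add_left J_subspace pm.span_base) blast

lemma Nset_minimal:
  assumes "pm.subspace U" "\<And>u. is_word n u \<Longrightarrow> word_act_poly u (bN (\<alpha>, is) (w0set n (compDes \<alpha>))) \<in> U" "J n k \<subseteq> U"
  shows "(Nset n k \<alpha> is :: 'a::field mpoly set) \<subseteq> U"
  unfolding Nset_span by (intro set_add_minimal pm.span_minimal assms) (use assms(2) in blast)

lemma Nset_polys: "(Nset n k \<alpha> is :: 'a::field mpoly set) \<subseteq> polys n"
proof (rule Nset_minimal[OF polys_subspace _ J_polys])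
  fix u assume u: "is_word n u"
  have "(bN (\<alpha>, is) (w0set n (compDes \<alpha>)) :: 'a mpoly) \<in> polys n" unfolding pibar_w_poly_eq
    by (rule pol.pbar_M[OF w0set_perm[OF A_Des(2)[OF a]]]) (simp add: x_ai_polys[OF a])
  then show "word_act_poly u (bN (\<alpha>, is) (w0set n (compDes \<alpha>)) :: 'a mpoly) \<in> polys n"
    unfolding word_act_poly_def by (rule pol.foldr_M[OF u])
qed

lemma Nset_stable:
  assumes i: "i \<in> {1..<n}" and f: "f \<in> Nset n k \<alpha> is"
  shows "pi_poly i f \<in> (Nset n k \<alpha> is :: 'a::field mpoly set)"
proof -
  have "(Nset n k \<alpha> is :: 'a mpoly set) \<subseteq> {f. pi_poly i f \<in> Nset n k \<alpha> is}"
  proof (rule Nset_minimal[OF lin_subspace_vimage[OF pi_poly_lin Nset_subspace]])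
    fix u assume "is_word n u"
    then have "is_word n (i # u)" using i by (simp add: is_word_def)
    from Nset_generator[OF this, where ?'a = 'a]
    show "word_act_poly u (bN (\<alpha>, is) (w0set n (compDes \<alpha>))) \<in> {f :: 'a mpoly. pi_poly i f \<in> Nset n k \<alpha> is}"
      by (simp add: word_act_poly_def)
  qed (auto intro: J_Nset J_stable[OF k(1) i])
  then show ?thesis using f by blast
qed

text \<open>The exponents of \<open>x_ai\<close> at j and j+1 agree for every j outside
  \<open>Dai\<close>, so the factor pi_{w_0} on the right acts as the identity. This turns the
  generators of P into those of N.\<close>

lemma act_P_basis:
  fixes y :: "'a::field fa"
  shows "act pi_poly (x_ai n \<alpha> is) (fa_mult y (piw0 n ({1..<n} - Dai))) = act pi_poly (x_ai n \<alpha> is) y"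
  by (rule pol.act_piw0_fixed[OF x_ai_polys[OF a]]) (auto intro: x_ai_fixed[OF a, unfolded Un_iff])

lemma act_P_generator:
  "act pi_poly (x_ai n \<alpha> is) (fa_mult (fa_word u) (fa_mult (pb n (w0set n (compDes \<alpha>))) (piw0 n ({1..<n} - Dai))))
    = word_act_poly u (bN (\<alpha>, is) (w0set n (compDes \<alpha>)) :: 'a::field mpoly)"
  by (simp only: act_mult[OF pi_poly_lin, where a = "fa_word u"] act_P_basis act_word word_act_poly_def pibar_w_poly_eq
    pol.pbar_def fst_conv snd_conv)

lemma act_P_Nset:
  assumes y: "y \<in> Pset n (compDes \<alpha>) Dai"
  shows "act pi_poly (x_ai n \<alpha> is) y \<in> (Nset n k \<alpha> is :: 'a::field mpoly set)"
proof -
  have "Pset n (compDes \<alpha>) Dai \<subseteq> {y. act pi_poly (x_ai n \<alpha> is) y \<in> (Nset n k \<alpha> is :: 'a mpoly set)}"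
    unfolding Pset_span
  proof (intro set_add_minimal pm.span_minimal lin_subspace_vimage act_lin Nset_subspace subsetI)
    fix y :: "'a fa"
    assume "y \<in> {fa_mult (fa_word u) (fa_mult (pb n (w0set n (compDes \<alpha>))) (piw0 n ({1..<n} - Dai))) | u. is_word n u}"
    then show "y \<in> {y. act pi_poly (x_ai n \<alpha> is) y \<in> Nset n k \<alpha> is}"
      using Nset_generator by (auto simp: act_P_generator)
  next
    fix y :: "'a fa" assume "y \<in> Irel n"
    then show "y \<in> {y. act pi_poly (x_ai n \<alpha> is) y \<in> Nset n k \<alpha> is}"
      by (simp add: pol.act_Irel[OF x_ai_polys[OF a]] pm.subspace_0[OF Nset_subspace])
  qed
  then show ?thesis using y by blast
qed

lemma bN_Nset:
  assumes w: "w \<in> Wset n (\<alpha>, is)"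
  shows "bN (\<alpha>, is) w \<in> (Nset n k \<alpha> is :: 'a::field mpoly set)"
proof -
  have w': "perm n w" "compDes \<alpha> \<subseteq> pDes n w" using w by (auto simp: Wset_def)
  show ?thesis using act_P_Nset[OF pb_in_Pset[OF w', of Dai, where ?'a = 'a]]
    by (simp add: act_P_basis pibar_w_poly_eq pol.pbar_def)
qed

lemma P_spanned:
  assumes "y \<in> (Pset n (compDes \<alpha>) Dai :: 'a::field fa set)"
  shows "\<exists>c. y - (\<Sum>w\<in>Wset n (\<alpha>, is). smul (c w) (fa_mult (pb n w) (piw0 n ({1..<n} - Dai)))) \<in> Irel n"
proof -
  have W: "{w. perm n w \<and> compDes \<alpha> \<subseteq> pDes n w \<and> pDes n w \<subseteq> Dai} = Wset n (\<alpha>, is)" by (simp add: Wset_def)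
  obtain s r where s: "s \<in> pm.span ((\<lambda>w. fa_mult (pb n w) (piw0 n ({1..<n} - Dai))) ` Wset n (\<alpha>, is))"
    "r \<in> Irel n" "y = s + r"
    using subsetD[OF Pset_spanned[OF Un_upper1 A_Des(3)[OF a]] assms] unfolding W set_add_eq by blast
  obtain c where "s = (\<Sum>w\<in>Wset n (\<alpha>, is). smul (c w) (fa_mult (pb n w) (piw0 n ({1..<n} - Dai))))"
    by (rule span_image_family[OF finite_Wset s(1)])
  then show ?thesis using s by (intro exI[of _ c]) simp
qed

text \<open>Spanning is transported from the left ideal by evaluation at \<open>x_ai\<close>, which
  maps the generators of P onto those of N.\<close>

lemma Nset_spanned: "(Nset n k \<alpha> is :: 'a::field mpoly set) \<subseteq> set_add (pm.span (bN (\<alpha>, is) ` Wset n (\<alpha>, is))) (J n k)"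
    (is "_ \<subseteq> ?S")
proof (rule Nset_minimal)
  show S: "pm.subspace ?S" by (intro subspace_set_add J_subspace pm.subspace_span)
  show "J n k \<subseteq> ?S" by (intro subsetI set_add_right pm.subspace_span)
  fix u assume u: "is_word n u"
  let ?y = "fa_mult (fa_word u) (fa_mult (pb n (w0set n (compDes \<alpha>))) (piw0 n ({1..<n} - Dai))) :: 'a fa"
  let ?s = "\<lambda>c. \<Sum>w\<in>Wset n (\<alpha>, is). smul (c w) (fa_mult (pb n w) (piw0 n ({1..<n} - Dai)) :: 'a fa)"
  have "?y \<in> Pset n (compDes \<alpha>) Dai" unfolding Pset_span by (intro set_add_left Irel_subspace pm.span_base) (use u in blast)
  then obtain c where c: "?y - ?s c \<in> Irel n" using P_spanned by blast
  have "act pi_poly (x_ai n \<alpha> is) ?y = act pi_poly (x_ai n \<alpha> is) (?s c)"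
    using pol.act_Irel[OF x_ai_polys[OF a] c] by (simp add: lin_diff[OF act_lin])
  also have "\<dots> = (\<Sum>w\<in>Wset n (\<alpha>, is). smul (c w) (bN (\<alpha>, is) w))"
    by (simp add: lin_sum[OF act_lin] lin_smul[OF act_lin] act_P_basis pibar_w_poly_eq pol.pbar_def)
  also have "\<dots> \<in> ?S" by (intro set_add_left J_subspace pm.subspace_sum pm.subspace_span pm.subspace_scale pm.span_base) blast
  finally show "word_act_poly u (bN (\<alpha>, is) (w0set n (compDes \<alpha>))) \<in> ?S" unfolding act_P_generator .
qed

lemma Nset_spanned_sum:
  assumes "f \<in> (Nset n k \<alpha> is :: 'a::field mpoly set)"
  shows "\<exists>c. f - (\<Sum>w\<in>Wset n (\<alpha>, is). smul (c w) (bN (\<alpha>, is) w)) \<in> J n k"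
proof -
  obtain s r where s: "s \<in> pm.span (bN (\<alpha>, is) ` Wset n (\<alpha>, is))" "r \<in> J n k" "f = s + r"
    using subsetD[OF Nset_spanned assms] unfolding set_add_eq by blast
  obtain c where "s = (\<Sum>w\<in>Wset n (\<alpha>, is). smul (c w) (bN (\<alpha>, is) w))" by (rule span_image_family[OF finite_Wset s(1)])
  then show ?thesis using s by (intro exI[of _ c]) simp
qed

text \<open>Evaluation at \<open>x_ai\<close> maps the spanning products of P to elements that are
  independent modulo \<open>J\<close>, so both are bases and the inverse is the map of the
  theorem.\<close>

lemma Nset_iso:
  "\<exists>\<phi>. hmod_iso n pi_poly (Nset n k \<alpha> is) (J n k :: 'a::field mpoly set) fa_act (Pset n (compDes \<alpha>) Dai) (Irel n) \<phi> \<and>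
    (\<forall>w\<in>Wset n (\<alpha>, is). \<phi> (bN (\<alpha>, is) w) - fa_mult (pb n w) (piw0 n ({1..<n} - Dai)) \<in> Irel n)"
proof (rule hmod_iso_from_basis(2)[where E = "act pi_poly (x_ai n \<alpha> is)", OF finite_Wset])
  show "J n k \<subseteq> (Nset n k \<alpha> is :: 'a mpoly set)" using J_Nset by blast
  show "act pi_poly (x_ai n \<alpha> is) ` Pset n (compDes \<alpha>) Dai \<subseteq> (Nset n k \<alpha> is :: 'a mpoly set)" using act_P_Nset by blast
  show "act pi_poly (x_ai n \<alpha> is) ` Irel n \<subseteq> (J n k :: 'a mpoly set)"
  proof (rule image_subsetI)
    fix y :: "'a fa" assume "y \<in> Irel n"
    then have "act pi_poly (x_ai n \<alpha> is) y = 0" by (rule pol.act_Irel[OF x_ai_polys[OF a]])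
    then show "act pi_poly (x_ai n \<alpha> is) y \<in> (J n k :: 'a mpoly set)" using pm.subspace_0[OF J_subspace] by simp
  qed
  show "act pi_poly (x_ai n \<alpha> is) (fa_act i y) - pi_poly i (act pi_poly (x_ai n \<alpha> is) y) \<in> (J n k :: 'a mpoly set)" for i y
    by (simp add: fa_act_def fa_gen_def act_mult[OF pi_poly_lin] pm.subspace_0[OF J_subspace])
  show "act pi_poly (x_ai n \<alpha> is) (fa_mult (pb n w) (piw0 n ({1..<n} - Dai))) = (bN (\<alpha>, is) w :: 'a mpoly)" for w
    by (simp add: act_P_basis pibar_w_poly_eq pol.pbar_def)
  show "fa_mult (pb n w) (piw0 n ({1..<n} - Dai)) \<in> (Pset n (compDes \<alpha>) Dai :: 'a fa set)" if "w \<in> Wset n (\<alpha>, is)" for w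
    using that by (intro pb_in_Pset) (auto simp: Wset_def)
qed (fact act_lin Nset_subspace J_subspace Pset_subspace Irel_subspace pi_poly_lin fa_act_lin
  | erule (1) J_stable[OF k(1)] Nset_stable fa_act_Irel fa_act_Pset P_spanned Nset_spanned_sum bN_independent
  | erule P_spanned Nset_spanned_sum)+

end

lemma pbasis_words: "perm n w \<Longrightarrow> pbasis n w \<in> fa_words n"
  unfolding pbasis_def by (intro fa_mult_words pb_words piw0_words) auto

text \<open>The generators are the monomials \<open>x_ai\<close> themselves. The element pibar_w
  pi_v of the indecomposable for Des(w) is applied to every monomial whose interval contains Des(w),
  and by unitriangularity this is again a basis of the quotient.\<close>

lemma quotient_iso_DS: "\<exists>\<phi>. hmod_iso n pi_poly (polys n) (J n k :: 'a::field mpoly set) ds_act (DSset n k) (DSzero n k) \<phi>"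
proof -
  let ?y = "\<lambda>p :: (nat list \<times> nat list) \<times> (nat \<Rightarrow> nat). pbasis n (snd p) :: 'a fa"
  let ?x = "\<lambda>q. x_ai n (fst q) (snd q) :: 'a mpoly"
  let ?v = "\<lambda>p. act pi_poly (?x (fst p)) (?y p)"
  have y: "?y p \<in> fa_words n" if "p \<in> Ix n k" for p using that by (intro pbasis_words) (auto simp: Ix_def)
  have dv: "act pi_poly (x_ai n \<alpha> is) (?y ((\<alpha>, is), w)) - pol.pbar n w (x_ai n \<alpha> is) \<in> pol.plonger n w (x_ai n \<alpha> is)"
    if "((\<alpha>, is), w) \<in> Ix n k" for \<alpha> "is" w
    unfolding snd_conv pbasis_def
    by (rule pol.act_pb_piw0[OF x_ai_polys]) (use that in \<open>auto simp: Ix_def\<close>)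
  note basis = index_basis[of ?y ?v, OF y _ dv]
  have I: "Ix n k = {(q, w). perm n w \<and> q \<in> QD n k (pDes n w)}" by (auto simp: Ix_def QD_def)
  have s: "(\<Sum>(q, w)\<in>Ix n k. smul (c (q, w)) (act pi_poly (?x q) (pbasis n w))) = (\<Sum>p\<in>Ix n k. smul (c p) (?v p))" for c
    by (rule sum.cong) auto
  show ?thesis
  proof (rule pol.ds_iso(1)[OF k J_subspace J_polys J_stable[OF k(1)] _ _ I finite_Ix[OF k], where x = ?x])
    show "\<exists>c. m - (\<Sum>(q, w)\<in>Ix n k. smul (c (q, w)) (act pi_poly (?x q) (pbasis n w))) \<in> J n k" if "m \<in> polys n" for m
      unfolding s by (rule basis(1)[OF _ _ _ that]) auto
    show "c p = 0" if "(\<Sum>(q, w)\<in>Ix n k. smul (c (q, w)) (act pi_poly (?x q) (pbasis n w))) \<in> J n k" "p \<in> Ix n k" for c p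
      by (rule basis(2)[OF _ _ _ that[unfolded s]]) auto
    show "finite (QD n k D) \<and> card (QD n k D) = card (GD n k D)" if "D \<subseteq> {1..<n}" for D
      using finite_QD[OF k that] card_QD[OF k that] by simp
    show "?x q \<in> polys n" if "q \<in> QD n k D" for q D using that by (auto simp: QD_def intro: x_ai_polys)
  qed
qed

text \<open>The same comparison with the sorted ordered set partitions as generators: the one with
  cuts g serves every descent set contained in g.\<close>

lemma DS_iso_OP: "\<exists>\<psi>. hmod_iso n ds_act (DSset n k :: (((nat list \<times> nat) \<times> nat list) \<Rightarrow>\<^sub>0 'a::field) set) (DSzero n k)
    osp_act (OPset n k) {0} \<psi>"
proof -
  let ?x = "\<lambda>g. ss (std n k g) :: nat set list \<Rightarrow>\<^sub>0 'a"
  let ?v = "\<lambda>p. act osp_act (?x (fst p)) (pbasis n (snd p))"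
  have x: "?x g \<in> OPset n k" if "g \<in> GD n k D" for g D
    using that by (intro single_OPset std_osp[OF k]) (auto simp: GD_def)
  have v: "?v (g, w) - op.pbar n w (?x g) \<in> op.plonger n w (?x g)" if "(g, w) \<in> Gx n k" for g w
    unfolding fst_conv snd_conv pbasis_def
    by (rule op.act_pb_piw0[of _ n k]) (use that x in \<open>auto simp: Gx_def\<close>)
  have s: "(\<Sum>(q, w)\<in>Gx n k. smul (c (q, w)) (act osp_act (?x q) (pbasis n w))) = (\<Sum>p\<in>Gx n k. smul (c p) (?v p))" for c
    by (rule sum.cong) auto
  show ?thesis
  proof (rule op.ds_iso(2)[OF k pm.subspace_single_0 _ _ _ _ Gx_def finite_Gx, where x = ?x])
    show "\<exists>c. m - (\<Sum>(q, w)\<in>Gx n k. smul (c (q, w)) (act osp_act (?x q) (pbasis n w))) \<in> {0}" if m: "m \<in> OPset n k" for m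
    proof -
      have "lext ss m \<in> pm.span (?v ` Gx n k)"
        by (rule lext_in_subspace[OF pm.subspace_span op_spanning[OF k v]]) (use m in \<open>auto simp: OPset_def\<close>)
      then have "m \<in> pm.span (?v ` Gx n k)" by (simp add: lext_ident)
      then obtain c where "m = (\<Sum>p\<in>Gx n k. smul (c p) (?v p))" by (rule span_image_family[OF finite_Gx])
      then show ?thesis unfolding s by (intro exI[of _ c]) simp
    qed
    show "c p = 0" if "(\<Sum>(q, w)\<in>Gx n k. smul (c (q, w)) (act osp_act (?x q) (pbasis n w))) \<in> {0}" "p \<in> Gx n k" for c p
      by (rule op_independent[OF k v _ that(2)]) (use that(1)[unfolded s] in simp_all)
    show "{0} \<subseteq> (OPset n k :: (nat set list \<Rightarrow>\<^sub>0 'a) set)" using pm.subspace_0[OF OPset_subspace] by simp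
    show "osp_act i z \<in> {0}" if "z \<in> {0}" for i and z :: "nat set list \<Rightarrow>\<^sub>0 'a" using that lin_zero[OF op.lin_T] by simp
    show "finite (GD n k D) \<and> card (GD n k D) = card (GD n k D)" for D by simp
    show "?x q \<in> OPset n k" if "q \<in> GD n k D" for q D using that by (rule x)
  qed
qed

end

theorem mainTheorem16:
  fixes n k :: nat
  assumes "1 \<le> k" and "k \<le> n"
  shows
   "(\<forall>(\<alpha>, is) \<in> A n k.
       (let W = {w. w permutes {1..n} \<and> compDes \<alpha> \<subseteq> pDes n w \<and> pDes n w \<subseteq> compDes \<alpha> \<union> seqDes n is};
            b = (\<lambda>w. pibar_w_poly n w (x_ai n \<alpha> is) :: 'a::field mpoly);
            Dai = compDes \<alpha> \<union> seqDes n is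
        in (\<forall>w\<in>W. b w \<in> Nset n k \<alpha> is) \<and>
           (\<forall>c. (\<Sum>w\<in>W. smul (c w) (b w)) \<in> J n k \<longrightarrow> (\<forall>w\<in>W. c w = 0)) \<and>
           Nset n k \<alpha> is \<subseteq> set_add (span_pm (b ` W)) (J n k) \<and>
           (\<exists>\<phi>. hmod_iso n pi_poly (Nset n k \<alpha> is) (J n k) fa_act (Pset n (compDes \<alpha>) Dai) (Irel n) \<phi> \<and>
                 (\<forall>w\<in>W. \<phi> (b w) - fa_mult (fa_pibar_w n w) (fa_pi_w n (w0set n ({1..<n} - Dai))) \<in> Irel n))))
    \<and> (\<forall>p\<in>A n k. Nset n k (fst p) (snd p) \<subseteq> (polys n :: 'a mpoly set))
    \<and> (\<forall>f\<in>polys n. \<exists>g. (\<forall>p\<in>A n k. g p \<in> Nset n k (fst p) (snd p)) \<and> f - (\<Sum>p\<in>A n k. g p) \<in> (J n k :: 'a mpoly set))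
    \<and> (\<forall>g. (\<forall>p\<in>A n k. g p \<in> Nset n k (fst p) (snd p)) \<and> (\<Sum>p\<in>A n k. g p) \<in> (J n k :: 'a mpoly set)
           \<longrightarrow> (\<forall>p\<in>A n k. g p \<in> J n k))
    \<and> (\<exists>\<phi>. hmod_iso n pi_poly (polys n) (J n k :: 'a mpoly set) ds_act (DSset n k) (DSzero n k) \<phi>)
    \<and> (\<exists>\<psi>. hmod_iso n ds_act (DSset n k :: (((nat list \<times> nat) \<times> nat list) \<Rightarrow>\<^sub>0 'a) set) (DSzero n k)
                       osp_act (OPset n k) {0} \<psi>)"
proof (intro conjI ballI allI impI)
  note k = assms
  let ?b = "\<lambda>p w. pibar_w_poly n w (x_ai n (fst p) (snd p)) :: 'a mpoly"
  fix p assume p: "p \<in> A n k"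
  obtain \<alpha> "is" where pe: "p = (\<alpha>, is)" by (metis surj_pair)
  have a: "(\<alpha>, is) \<in> A n k" using p pe by simp
  have W: "{w. perm n w \<and> compDes \<alpha> \<subseteq> pDes n w \<and> pDes n w \<subseteq> compDes \<alpha> \<union> seqDes n is} = Wset n (\<alpha>, is)"
    by (simp add: Wset_def)
  show "case p of (\<alpha>, is) \<Rightarrow>
       (let W = {w. w permutes {1..n} \<and> compDes \<alpha> \<subseteq> pDes n w \<and> pDes n w \<subseteq> compDes \<alpha> \<union> seqDes n is};
            b = (\<lambda>w. pibar_w_poly n w (x_ai n \<alpha> is) :: 'a mpoly);
            Dai = compDes \<alpha> \<union> seqDes n is
        in (\<forall>w\<in>W. b w \<in> Nset n k \<alpha> is) \<and>
           (\<forall>c. (\<Sum>w\<in>W. smul (c w) (b w)) \<in> J n k \<longrightarrow> (\<forall>w\<in>W. c w = 0)) \<and>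
           Nset n k \<alpha> is \<subseteq> set_add (span_pm (b ` W)) (J n k) \<and>
           (\<exists>\<phi>. hmod_iso n pi_poly (Nset n k \<alpha> is) (J n k) fa_act (Pset n (compDes \<alpha>) Dai) (Irel n) \<phi> \<and>
                 (\<forall>w\<in>W. \<phi> (b w) - fa_mult (fa_pibar_w n w) (fa_pi_w n (w0set n ({1..<n} - Dai))) \<in> Irel n)))"
    unfolding pe prod.case Let_def W span_pm_eq
    using bN_Nset[OF k a, where ?'a = 'a] bN_independent[OF k a, where ?'a = 'a]
      Nset_spanned[OF k a, where ?'a = 'a] Nset_iso[OF k a, where ?'a = 'a]
    unfolding fst_conv snd_conv by blast
  show "Nset n k (fst p) (snd p) \<subseteq> (polys n :: 'a mpoly set)" unfolding pe fst_conv snd_conv by (rule Nset_polys[OF k a])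
next
  note k = assms
  fix f :: "'a mpoly" assume "f \<in> polys n"
  then obtain c where c: "f - (\<Sum>p\<in>A n k. \<Sum>w\<in>Wset n p. smul (c p w) (pibar_w_poly n w (x_ai n (fst p) (snd p)))) \<in> J n k"
    using bN_basis(1)[OF k] by blast
  show "\<exists>g. (\<forall>p\<in>A n k. g p \<in> Nset n k (fst p) (snd p)) \<and> f - (\<Sum>p\<in>A n k. g p) \<in> J n k"
  proof (rule exI, rule conjI[OF _ c], rule ballI)
    fix p assume p: "p \<in> A n k"
    obtain \<alpha> "is" where pe: "p = (\<alpha>, is)" by (metis surj_pair)
    have a: "(\<alpha>, is) \<in> A n k" using p pe by simp
    show "(\<Sum>w\<in>Wset n p. smul (c p w) (pibar_w_poly n w (x_ai n (fst p) (snd p)))) \<in> Nset n k (fst p) (snd p)"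
      unfolding pe fst_conv snd_conv
      by (intro pm.subspace_sum pm.subspace_scale Nset_subspace[OF k a] bN_Nset[OF k a, simplified])
  qed
next
  note k = assms
  fix g :: "nat list \<times> nat list \<Rightarrow> 'a mpoly" and p
  assume g: "(\<forall>p\<in>A n k. g p \<in> Nset n k (fst p) (snd p)) \<and> (\<Sum>p\<in>A n k. g p) \<in> J n k" and p: "p \<in> A n k"
  let ?s = "\<lambda>c p. \<Sum>w\<in>Wset n p. smul (c w) (pibar_w_poly n w (x_ai n (fst p) (snd p))) :: 'a mpoly"
  \<comment> \<open>Each summand is replaced by its expansion in the basis of its N. The total lies
    in \<open>J\<close>, so the joint independence over all pairs makes every coefficient
    zero.\<close>
  have "\<exists>c. g q - ?s c q \<in> J n k" if "q \<in> A n k" for q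
    using Nset_spanned_sum[OF k, of "fst q" "snd q" "g q"] that g by simp
  then obtain c where c: "\<And>q. q \<in> A n k \<Longrightarrow> g q - ?s (c q) q \<in> J n k" by metis
  have "(\<Sum>q\<in>A n k. g q - ?s (c q) q) \<in> J n k" by (rule pm.subspace_sum[OF J_subspace c])
  then have "(\<Sum>q\<in>A n k. g q) - (\<Sum>q\<in>A n k. g q - ?s (c q) q) \<in> J n k" using g by (intro pm.subspace_diff[OF J_subspace]) auto
  then have "(\<Sum>q\<in>A n k. ?s (c q) q) \<in> J n k" by (simp add: sum_subtractf)
  then have "c p w = 0" if "w \<in> Wset n p" for w by (rule bN_basis(2)[OF k _ p that])
  then have "?s (c p) p = 0" by (intro sum.neutral) simp
  then show "g p \<in> J n k" using c[OF p] by simp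
qed (rule quotient_iso_DS[OF assms] DS_iso_OP[OF assms])+

end
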